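(* Let $k\ge 1$, $l_0,l_1,\dots,l_k$ and $m_1,\dots,m_k$ be non-negative integers with $l_0>0$, $l_i\ge m_i$ for all $1\le i\le k$, and $l'>m'>0$, where $l'=\sum_{i=1}^k l_i$ and $m'=\sum_{i=1}^k m_i$. For a meromorphic function $f$ put $$P[f]=f^{l_0}(f^{l_1})^{(m_1)}(f^{l_2})^{(m_2)}\cdots (f^{l_k})^{(m_k)}.$$ Let $f$ be a transcendental meromorphic function on $\mathbb{C}$. Then for any small function $\omega\not\equiv 0,\infty$ of $f$, the function $P[f]-\omega$ has infinitely many zeros.
   Context: A meromorphic function $\omega$ is a small function of $f$ if $T(r,\omega)=o(T(r,f))$ as $r\to\infty$, possibly outside a set of $r$ of finite linear measure, where $T$ is the Nevanlinna characteristic. *)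

theory Defs
  imports "HOL-Complex_Analysis.Complex_Analysis" "HOL-Computational_Algebra.Polynomial"
begin

text \<open>Basic Nevanlinna theory for a meromorphic function f on the whole plane
  (represented as a total function; values at poles are irrelevant).\<close>

definition logplus :: "real \<Rightarrow> real" where
  "logplus x = (if x \<le> 1 then 0 else ln x)"

definition npoles :: "(complex \<Rightarrow> complex) \<Rightarrow> real \<Rightarrow> real" where
  "npoles f t = real (\<Sum>z\<in>{z. cmod z \<le> t \<and> is_pole f z}. nat (- zorder f z))"

definition Ncount :: "(complex \<Rightarrow> complex) \<Rightarrow> real \<Rightarrow> real" where
  "Ncount f r = integral {0..r} (\<lambda>t. (npoles f t - npoles f 0) / t) + npoles f 0 * ln r"

definition proxim :: "(complex \<Rightarrow> complex) \<Rightarrow> real \<Rightarrow> real" where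
  "proxim f r = (1 / (2 * pi)) *
     integral {0..2*pi} (\<lambda>\<theta>. logplus (cmod (f (complex_of_real r * cis \<theta>))))"

definition nev_T :: "(complex \<Rightarrow> complex) \<Rightarrow> real \<Rightarrow> real" where
  "nev_T f r = proxim f r + Ncount f r"

definition rational_fun :: "(complex \<Rightarrow> complex) \<Rightarrow> bool" where
  "rational_fun f \<longleftrightarrow> (\<exists>p q :: complex poly. q \<noteq> 0 \<and>
      (\<forall>z. \<forall>\<^sub>F w in at z. f w = poly p w / poly q w))"

definition transcendental_mero :: "(complex \<Rightarrow> complex) \<Rightarrow> bool" where
  "transcendental_mero f \<longleftrightarrow> f meromorphic_on UNIV \<and> \<not> rational_fun f"

definition small_function :: "(complex \<Rightarrow> complex) \<Rightarrow> (complex \<Rightarrow> complex) \<Rightarrow> bool" where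
  "small_function \<omega> f \<longleftrightarrow> \<omega> meromorphic_on UNIV \<and>
     (\<exists>E :: real set. E \<in> sets lebesgue \<and> emeasure lebesgue E < \<infinity> \<and>
        (\<forall>\<epsilon>>0. \<exists>R. \<forall>r\<ge>R. r \<notin> E \<longrightarrow> \<bar>nev_T \<omega> r\<bar> \<le> \<epsilon> * nev_T f r))"

definition diff_monomial ::
  "nat \<Rightarrow> (nat \<Rightarrow> nat) \<Rightarrow> (nat \<Rightarrow> nat) \<Rightarrow> (complex \<Rightarrow> complex) \<Rightarrow> complex \<Rightarrow> complex" where
  "diff_monomial k l m f z =
     f z ^ l 0 * (\<Prod>i=1..k. (deriv ^^ m i) (\<lambda>w. f w ^ l i) z)"

end

theory Submission
  imports "HOL-Algebra.Algebraic_Closure_Type" Defs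
begin

text \<open>
  Suppose that \<open>P[f] - \<omega>\<close> has finitely many zeros. Write \<open>M = m'\<close>, \<open>n = M + 1\<close>, \<open>L = l\<^sub>0 + l'\<close>,
  \<open>G = P[f]/\<omega>\<close> and \<open>W = G'/(G - 1)\<close>. The identity \<open>1/G = 1 - (G'/G)(1/W)\<close>, the lemma on the logarithmic
  derivative and Jensen's formula for \<open>W\<close> give
  \<open>n m(r,1/f) + m(r,f) + (L - M - 2) T(r,f) = o(T(r,f))\<close>. Hence \<open>L = M + 2\<close>, so \<open>l\<^sub>0 = 1\<close> and \<open>l' = n\<close>;
  both proximity functions of \<open>f\<close> are small, and so is \<open>\<phi> = W/f\<close>. Comparing the two leading
  coefficients at the simple poles of \<open>f\<close> yields a Riccati equation \<open>f' = A f\<^sup>2 + B f + R\<close> with small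
  coefficients and \<open>A = \<phi>/(2 n)\<close>.

  The rest is algebra over the differential field of small functions, over which \<open>f\<close> is
  transcendental. By the Riccati equation \<open>G - 1 = Q(f)\<close> for a polynomial \<open>Q\<close> of degree \<open>2 n\<close>, and
  \<open>G' = 2 n A f (G - 1)\<close> becomes a differential equation for \<open>Q\<close> under which the Hessian \<open>H\<close> and the
  Jacobian \<open>J\<close> of \<open>Q\<close> (as a binary form of degree \<open>2 n\<close>) are semi-invariants, so \<open>J\<^sup>2 = c H\<^sup>3\<close> with a
  constant \<open>c\<close>. This forces \<open>Q\<close> to have exactly two distinct roots. Comparing the coefficients of
  degree \<open>0\<close>, \<open>1\<close>, \<open>2\<close> and \<open>2 n\<close> of \<open>Q\<close> then leads to an impossible identity between integers.
\<close>

text \<open>For \<open>L > M + 2\<close> the growth estimate alone is absurd, because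
  \<open>T(r,f)\<close> is not \<open>o(T(r,f))\<close>. The borderline \<open>L = M + 2\<close> is
  the real obstacle: there the estimate only says that both proximity functions are small, so an
  algebraic obstruction has to be found. The Riccati equation supplies it by making differentiation
  act on polynomials in \<open>f\<close> like an infinitesimal projective change of the variable.
  The equation for \<open>G - 1\<close> says that this motion merely rescales the binary form
  \<open>Q\<close>, hence also every covariant of \<open>Q\<close>. Since \<open>J ^ 2\<close> and
  \<open>H ^ 3\<close> are rescaled by the same factor, their quotient has derivative zero and is a
  complex number. If the two roots \<open>p\<close>, \<open>q\<close> have multiplicities
  \<open>a\<close>, \<open>b\<close>, the low coefficients of \<open>Q\<close> determine
  \<open>p / q\<close> and \<open>p * q\<close>, and the leading coefficient adds one more relation.
  With \<open>b \<le> a\<close> and \<open>t = a - n\<close> these combine to: a product of falling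
  factorials times \<open>b ^ t\<close> equals \<open>n\<close> times the matching product of rising
  factorials times \<open>a ^ t\<close>. The second side is strictly larger.\<close>

hide_const (open) Coset.order UnivPoly.coeff Divisibility.prime

subsection \<open>Circle means and the Poisson formula\<close>

definition cavg :: "real \<Rightarrow> (complex \<Rightarrow> real) \<Rightarrow> real" where
  "cavg r u = (1 / (2 * pi)) * integral {0..2*pi} (\<lambda>\<theta>. u (complex_of_real r * cis \<theta>))"

lemma proxim_cavg: "proxim f r = cavg r (\<lambda>z. logplus (cmod (f z)))"
  by (simp add: proxim_def cavg_def)

lemma circle_continuous:
  fixes u :: "complex \<Rightarrow> 'a :: topological_space"
  assumes "continuous_on (sphere 0 r) u" "r \<ge> 0"
  shows "continuous_on A (\<lambda>t. u (complex_of_real r * cis t))"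
  by (rule continuous_on_compose2[OF assms(1)]) (auto intro!: continuous_intros simp: norm_mult assms)

lemma circle_integrable:
  fixes u :: "complex \<Rightarrow> 'a :: banach"
  assumes "continuous_on (sphere 0 r) u" "r \<ge> 0"
  shows "(\<lambda>t. u (complex_of_real r * cis t)) integrable_on {0..2*pi}"
  by (rule integrable_continuous_real[OF circle_continuous[OF assms]])

lemma cavg_cong: "r \<ge> 0 \<Longrightarrow> (\<And>z. cmod z = r \<Longrightarrow> u z = v z) \<Longrightarrow> cavg r u = cavg r v"
  unfolding cavg_def by (intro arg_cong2[where f = "(*)"] refl integral_cong) (simp add: norm_mult)

lemma cavg_mono:
  assumes "continuous_on (sphere 0 r) u" "continuous_on (sphere 0 r) v" "r \<ge> 0"
    "\<And>z. cmod z = r \<Longrightarrow> u z \<le> v z"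
  shows "cavg r u \<le> cavg r v"
  unfolding cavg_def
  by (intro mult_left_mono integral_le circle_integrable assms) (auto simp: norm_mult assms)

lemma cavg_add:
  assumes "continuous_on (sphere 0 r) u" "continuous_on (sphere 0 r) v" "r \<ge> 0"
  shows "cavg r (\<lambda>z. u z + v z) = cavg r u + cavg r v"
  unfolding cavg_def using assms by (subst integral_add) (simp_all add: circle_integrable ring_distribs)

lemma cavg_diff:
  assumes "continuous_on (sphere 0 r) u" "continuous_on (sphere 0 r) v" "r \<ge> 0"
  shows "cavg r (\<lambda>z. u z - v z) = cavg r u - cavg r v"
  unfolding cavg_def using assms by (subst integral_diff) (simp_all add: circle_integrable ring_distribs)

lemma cavg_cmult: "cavg r (\<lambda>z. c * u z) = c * cavg r u"
  unfolding cavg_def by simp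

lemma cavg_const [simp]: "cavg r (\<lambda>z. c) = c"
  unfolding cavg_def by simp

lemma cavg_sum:
  assumes "finite I" "\<And>i. i \<in> I \<Longrightarrow> continuous_on (sphere 0 r) (u i)" "r \<ge> 0"
  shows "cavg r (\<lambda>z. \<Sum>i\<in>I. u i z) = (\<Sum>i\<in>I. cavg r (u i))"
  using assms
  by (induction I) (auto simp: cavg_add continuous_on_sum)

lemma cavg_nonneg:
  assumes "\<And>z. cmod z = r \<Longrightarrow> u z \<ge> 0" "r \<ge> 0"
  shows "cavg r u \<ge> 0"
proof -
  have "integral {0..2*pi} (\<lambda>\<theta>. u (complex_of_real r * cis \<theta>)) \<ge> 0"
    using assms by (cases "(\<lambda>\<theta>. u (complex_of_real r * cis \<theta>)) integrable_on {0..2*pi}")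
      (auto intro!: integral_nonneg simp: norm_mult not_integrable_integral)
  then show ?thesis by (simp add: cavg_def)
qed

lemma circlepath_has_integral:
  assumes "(f has_contour_integral I) (circlepath 0 r)"
  shows "((\<lambda>t. f (complex_of_real r * cis t) * (complex_of_real r * cis t)) has_integral (I / \<i>)) {0..2*pi}"
proof -
  have "((\<lambda>t. f (complex_of_real r * cis t) * of_real r * \<i> * cis t) has_integral I) {0..2*pi}"
    using assms unfolding circlepath_def by (simp add: has_contour_integral_part_circlepath_iff)
  then have "((\<lambda>t. (f (complex_of_real r * cis t) * of_real r * \<i> * cis t) / \<i>) has_integral I / \<i>) {0..2*pi}"
    by (rule has_integral_divide)
  then show ?thesis by (simp add: mult_ac)
qed

lemma cauchy_circle:
  fixes f :: "complex \<Rightarrow> complex"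
  assumes "f holomorphic_on A" "open A" "cball 0 r \<subseteq> A" "cmod w < r"
  shows "((\<lambda>t. f (complex_of_real r * cis t) * (complex_of_real r * cis t / (complex_of_real r * cis t - w)))
           has_integral (2 * pi * f w)) {0..2*pi}"
proof -
  have "((\<lambda>u. f u / (u - w)) has_contour_integral (2 * of_real pi * \<i> * f w)) (circlepath 0 r)"
    by (rule Cauchy_integral_circlepath_simple) (use assms in \<open>auto intro: holomorphic_on_subset\<close>)
  from circlepath_has_integral[OF this] show ?thesis by (simp add: mult_ac)
qed

lemma cauchy_circle_deriv:
  fixes f :: "complex \<Rightarrow> complex"
  assumes "f holomorphic_on A" "open A" "cball 0 r \<subseteq> A" "cmod w < r"
  shows "((\<lambda>t. f (complex_of_real r * cis t) * (complex_of_real r * cis t / (complex_of_real r * cis t - w) ^ 2))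
           has_integral (2 * pi * deriv f w)) {0..2*pi}"
proof -
  have "((\<lambda>u. f u / (u - w) ^ Suc 1) has_contour_integral (2 * pi * \<i> / fact 1 * (deriv ^^ 1) f w)) (circlepath 0 r)"
    by (rule Cauchy_has_contour_integral_higher_derivative_circlepath)
       (use assms in \<open>auto intro: holomorphic_on_subset holomorphic_on_imp_continuous_on
         intro!: holomorphic_on_subset[OF assms(1)]\<close>)
  from circlepath_has_integral[OF this] show ?thesis by (simp add: mult_ac power2_eq_square)
qed

lemma circle_mean:
  fixes f :: "complex \<Rightarrow> complex"
  assumes "f holomorphic_on A" "open A" "cball 0 r \<subseteq> A" "r > 0"
  shows "((\<lambda>t. f (complex_of_real r * cis t)) has_integral (2 * pi * f 0)) {0..2*pi}"
  using cauchy_circle[OF assms(1-3), of 0] assms(4) by (simp add: has_integral_eq_rhs)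

lemma cavg_Re_mean:
  assumes "h holomorphic_on A" "open A" "cball 0 r \<subseteq> A" "r > 0"
  shows "cavg r (\<lambda>z. Re (h z)) = Re (h 0)"
proof -
  have "((\<lambda>t. Re (h (complex_of_real r * cis t))) has_integral (Re (2 * pi * h 0))) {0..2*pi}"
    using has_integral_linear[OF circle_mean[OF assms] bounded_linear_Re] by (simp add: o_def)
  then show ?thesis by (simp add: cavg_def integral_unique)
qed

definition pkernel :: "real \<Rightarrow> complex \<Rightarrow> complex \<Rightarrow> real" where
  "pkernel r z \<zeta> = (r ^ 2 - cmod z ^ 2) / cmod (\<zeta> - z) ^ 2"

text \<open>The only possible zero in \<open>z\<close> is the mirror image of \<open>w\<close> in
  the circle of radius \<open>r\<close>, which lies outside the closed disc.\<close>

lemma cnj_denominator_nz: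
  assumes "cmod w < r" "cmod z \<le> r"
  shows "of_real (r ^ 2) - cnj w * z \<noteq> 0"
proof
  assume "of_real (r ^ 2) - cnj w * z = 0"
  then have "complex_of_real (r ^ 2) = cnj w * z" by simp
  then have "cmod (of_real (r ^ 2)) = cmod w * cmod z" by (metis norm_mult complex_mod_cnj)
  then have "r ^ 2 = cmod w * cmod z" by (simp add: norm_power)
  moreover have "cmod w * cmod z \<le> cmod w * r" using assms by (intro mult_left_mono) auto
  moreover have "cmod w * r < r * r" using assms by (intro mult_strict_right_mono) (auto intro: le_less_trans[of 0 "cmod w"])
  ultimately show False by (simp add: power2_eq_square)
qed

lemma cnj_denominator_nz_open:
  assumes "cmod w < r"
  obtains B where "open B" "cball 0 r \<subseteq> B" "\<And>z. z \<in> B \<Longrightarrow> of_real (r ^ 2) - cnj w * z \<noteq> 0"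
proof -
  have "open {z. of_real (r ^ 2) - cnj w * z \<noteq> 0}"
    by (intro open_Collect_neq continuous_intros)
  moreover have "cball 0 r \<subseteq> {z. of_real (r ^ 2) - cnj w * z \<noteq> 0}"
    by (intro subsetI CollectI cnj_denominator_nz assms) simp
  ultimately show ?thesis using that by blast
qed

text \<open>The first summand is the Cauchy kernel. The second is holomorphic in
  \<open>\<zeta>\<close> near the closed disc and vanishes at 0, so it contributes nothing to the
  mean when multiplied by a holomorphic function. This reduces the Poisson formula to
  Cauchy's.\<close>

lemma poisson_kernel_eq:
  assumes "cmod \<zeta> = r" "cmod z < r"
  shows "complex_of_real (pkernel r z \<zeta>) = \<zeta> / (\<zeta> - z) + cnj z * \<zeta> / (of_real (r ^ 2) - cnj z * \<zeta>)"
proof -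
  have ne: "\<zeta> - z \<noteq> 0" "\<zeta> \<noteq> 0" using assms by auto
  have r2: "complex_of_real (r ^ 2) = \<zeta> * cnj \<zeta>" using assms(1) by (metis complex_norm_square)
  have z2: "complex_of_real (cmod z ^ 2) = z * cnj z" by (metis complex_norm_square)
  have d: "complex_of_real (cmod (\<zeta> - z) ^ 2) = (\<zeta> - z) * cnj (\<zeta> - z)" by (metis complex_norm_square)
  have ne': "cnj \<zeta> - cnj z \<noteq> 0" using ne by (metis complex_cnj_diff complex_cnj_zero_iff)
  have "complex_of_real (pkernel r z \<zeta>) = (\<zeta> * cnj \<zeta> - z * cnj z) / ((\<zeta> - z) * (cnj \<zeta> - cnj z))"
    unfolding pkernel_def of_real_divide of_real_diff r2 z2 d by simp
  also have "\<dots> = \<zeta> / (\<zeta> - z) + cnj z / (cnj \<zeta> - cnj z)"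
    using ne ne' by (simp add: field_simps)
  also have "cnj z / (cnj \<zeta> - cnj z) = cnj z * \<zeta> / (of_real (r ^ 2) - cnj z * \<zeta>)"
    unfolding r2 using ne ne' by (simp add: field_simps)
  finally show ?thesis .
qed

lemma pkernel_bounds:
  assumes "cmod \<zeta> = r" "cmod z < r"
  shows "pkernel r z \<zeta> \<ge> 0" "pkernel r z \<zeta> \<le> (r + cmod z) / (r - cmod z)"
proof -
  have sq: "cmod z ^ 2 < r ^ 2" using assms by (intro power_strict_mono) auto
  then show "pkernel r z \<zeta> \<ge> 0" by (simp add: pkernel_def)
  have "r - cmod z \<le> cmod (\<zeta> - z)" using norm_triangle_ineq2[of \<zeta> z] assms by simp
  then have "(r - cmod z) ^ 2 \<le> cmod (\<zeta> - z) ^ 2" using assms by (intro power_mono) auto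
  then have "pkernel r z \<zeta> \<le> (r ^ 2 - cmod z ^ 2) / (r - cmod z) ^ 2"
    unfolding pkernel_def using assms sq by (intro divide_left_mono mult_pos_pos) auto
  also have "\<dots> = (r + cmod z) / (r - cmod z)"
  proof -
    have "r ^ 2 - cmod z ^ 2 = (r + cmod z) * (r - cmod z)" by (simp add: power2_eq_square algebra_simps)
    then show ?thesis using assms by (simp add: power2_eq_square)
  qed
  finally show "pkernel r z \<zeta> \<le> (r + cmod z) / (r - cmod z)" .
qed

lemma poisson_formula:
  assumes h: "h holomorphic_on A" "open A" "cball 0 r \<subseteq> A" and z: "cmod z < r"
  shows "cavg r (\<lambda>\<zeta>. pkernel r z \<zeta> * Re (h \<zeta>)) = Re (h z)"
proof -
  have r: "r > 0" using z by (auto intro: le_less_trans[of 0 "cmod z"])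
  obtain B where B: "open B" "cball 0 r \<subseteq> B" "\<And>x. x \<in> B \<Longrightarrow> of_real (r ^ 2) - cnj z * x \<noteq> 0"
    using cnj_denominator_nz_open[OF z] by blast
  define k where "k \<zeta> = h \<zeta> * (cnj z * \<zeta> / (of_real (r ^ 2) - cnj z * \<zeta>))" for \<zeta>
  have "((\<lambda>t. k (complex_of_real r * cis t)) has_integral (2 * pi * k 0)) {0..2*pi}"
  proof (rule circle_mean)
    show "k holomorphic_on A \<inter> B" unfolding k_def using B h(1)
      by (intro holomorphic_intros) (auto intro: holomorphic_on_subset)
  qed (use B h r in auto)
  from has_integral_add[OF cauchy_circle[OF h z] this]
  have "((\<lambda>t. h (of_real r * cis t) * of_real (pkernel r z (of_real r * cis t))) has_integral (2 * pi * h z)) {0..2*pi}"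
    by (rule has_integral_eq_rhs[OF has_integral_eq, rotated])
       (use r in \<open>auto simp: k_def poisson_kernel_eq[OF _ z] norm_mult algebra_simps\<close>)
  from has_integral_linear[OF this bounded_linear_Re]
  have "((\<lambda>t. pkernel r z (of_real r * cis t) * Re (h (of_real r * cis t))) has_integral (2 * pi * Re (h z))) {0..2*pi}"
    by (simp add: o_def mult_ac)
  then show ?thesis by (simp add: cavg_def integral_unique)
qed

text \<open>Cauchy's formula for \<open>deriv h z\<close> contains \<open>h\<close>, not its real
  part. The auxiliary function \<open>k\<close> has mean zero, and on the circle its conjugate is
  \<open>cnj (h \<zeta>)\<close> times the same Cauchy kernel; adding that conjugate turns
  \<open>h\<close> into \<open>2 * Re h\<close>.\<close>

lemma deriv_bound_by_Re:
  assumes h: "h holomorphic_on A" "open A" "cball 0 r \<subseteq> A" and z: "cmod z < r"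
  shows "cmod (deriv h z) \<le> 2 * r * cavg r (\<lambda>\<zeta>. \<bar>Re (h \<zeta>)\<bar>) / (r - cmod z) ^ 2"
proof -
  have r: "r > 0" using z by (auto intro: le_less_trans[of 0 "cmod z"])
  obtain B where B: "open B" "cball 0 r \<subseteq> B" "\<And>x. x \<in> B \<Longrightarrow> of_real (r ^ 2) - cnj z * x \<noteq> 0"
    using cnj_denominator_nz_open[OF z] by blast
  define k where "k \<zeta> = h \<zeta> * (of_real (r ^ 2) * \<zeta> / (of_real (r ^ 2) - cnj z * \<zeta>) ^ 2)" for \<zeta>
  have "((\<lambda>t. k (complex_of_real r * cis t)) has_integral (2 * pi * k 0)) {0..2*pi}"
  proof (rule circle_mean)
    show "k holomorphic_on A \<inter> B" unfolding k_def using B h(1)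
      by (intro holomorphic_intros) (auto intro: holomorphic_on_subset)
  qed (use B h r in auto)
  then have "((\<lambda>t. k (complex_of_real r * cis t)) has_integral 0) {0..2*pi}" by (simp add: k_def)
  from has_integral_linear[OF this bounded_linear_cnj]
  have "((\<lambda>t. cnj (k (complex_of_real r * cis t))) has_integral 0) {0..2*pi}" by (simp add: o_def)
  from has_integral_add[OF cauchy_circle_deriv[OF h z] this]
  have I: "((\<lambda>t. of_real (2 * Re (h (of_real r * cis t))) * (of_real r * cis t / (of_real r * cis t - z) ^ 2))
      has_integral (2 * pi * deriv h z)) {0..2*pi}"
  proof (rule has_integral_eq_rhs[OF has_integral_eq, rotated])
    fix t :: real
    define \<zeta> where "\<zeta> = complex_of_real r * cis t"
    have nz: "cmod \<zeta> = r" using r by (simp add: \<zeta>_def norm_mult)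
    then have ne: "\<zeta> - z \<noteq> 0" "\<zeta> \<noteq> 0" using r z by auto
    have r2: "complex_of_real (r ^ 2) = \<zeta> * cnj \<zeta>" using nz by (metis complex_norm_square)
    have "cnj (k \<zeta>) = cnj (h \<zeta>) * (\<zeta> * cnj \<zeta> * cnj \<zeta> / (\<zeta> * cnj \<zeta> - z * cnj \<zeta>) ^ 2)"
      unfolding k_def r2 by (simp add: mult_ac)
    also have "\<zeta> * cnj \<zeta> - z * cnj \<zeta> = (\<zeta> - z) * cnj \<zeta>" by (simp add: algebra_simps)
    also have "\<zeta> * cnj \<zeta> * cnj \<zeta> / ((\<zeta> - z) * cnj \<zeta>) ^ 2 = \<zeta> / (\<zeta> - z) ^ 2"
      using ne by (simp add: power2_eq_square)
    finally have "h \<zeta> * (\<zeta> / (\<zeta> - z) ^ 2) + cnj (k \<zeta>) = (h \<zeta> + cnj (h \<zeta>)) * (\<zeta> / (\<zeta> - z) ^ 2)"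
      by (simp add: algebra_simps add_divide_distrib)
    then show "h (of_real r * cis t) * (of_real r * cis t / (of_real r * cis t - z) ^ 2) + cnj (k (of_real r * cis t))
       = of_real (2 * Re (h (of_real r * cis t))) * (of_real r * cis t / (of_real r * cis t - z) ^ 2)"
      unfolding complex_add_cnj \<zeta>_def by simp
  qed simp
  have cont: "continuous_on (sphere 0 r) h"
    using h by (meson holomorphic_on_imp_continuous_on continuous_on_subset sphere_cball order_trans)
  have "norm (integral {0..2*pi} (\<lambda>t. of_real (2 * Re (h (of_real r * cis t))) * (of_real r * cis t / (of_real r * cis t - z) ^ 2)))
     \<le> integral {0..2*pi} (\<lambda>t. (2 * r / (r - cmod z) ^ 2) * \<bar>Re (h (of_real r * cis t))\<bar>)"
  proof (rule integral_norm_bound_integral)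
    show "(\<lambda>t. (2 * r / (r - cmod z) ^ 2) * \<bar>Re (h (of_real r * cis t))\<bar>) integrable_on {0..2*pi}"
      using r cont by (intro circle_integrable[where u = "\<lambda>\<zeta>. 2 * r / (r - cmod z) ^ 2 * \<bar>Re (h \<zeta>)\<bar>"] continuous_intros) auto
    fix t :: real
    define \<zeta> where "\<zeta> = complex_of_real r * cis t"
    have nz: "cmod \<zeta> = r" using r by (simp add: \<zeta>_def norm_mult)
    have "r - cmod z \<le> cmod (\<zeta> - z)" using norm_triangle_ineq2[of \<zeta> z] nz by simp
    then have "(r - cmod z) ^ 2 \<le> cmod (\<zeta> - z) ^ 2" using z by (intro power_mono) auto
    then have "r / cmod (\<zeta> - z) ^ 2 \<le> r / (r - cmod z) ^ 2"
      using r z by (intro divide_left_mono mult_pos_pos) (auto intro: less_le_trans[rotated])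
    then have "2 * \<bar>Re (h \<zeta>)\<bar> * (r / cmod (\<zeta> - z) ^ 2) \<le> 2 * \<bar>Re (h \<zeta>)\<bar> * (r / (r - cmod z) ^ 2)"
      by (intro mult_left_mono) auto
    then show "norm (of_real (2 * Re (h (of_real r * cis t))) * (of_real r * cis t / (of_real r * cis t - z) ^ 2))
       \<le> (2 * r / (r - cmod z) ^ 2) * \<bar>Re (h (of_real r * cis t))\<bar>"
      unfolding \<zeta>_def[symmetric] by (simp add: norm_mult norm_divide norm_power nz mult_ac abs_mult)
  qed (use I in \<open>auto simp: has_integral_integrable\<close>)
  then have "norm (2 * pi * deriv h z) \<le> (2 * r / (r - cmod z) ^ 2) * (2 * pi * cavg r (\<lambda>\<zeta>. \<bar>Re (h \<zeta>)\<bar>))"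
    unfolding integral_unique[OF I] by (simp add: cavg_def)
  then have "(2 * pi) * cmod (deriv h z) \<le> (2 * pi) * (2 * r * cavg r (\<lambda>\<zeta>. \<bar>Re (h \<zeta>)\<bar>) / (r - cmod z) ^ 2)"
    by (simp add: norm_mult mult_ac)
  then show ?thesis by (rule mult_left_le_imp_le) simp
qed

text \<open>A Poisson integral is harmonic inside the circle, so its mean over a smaller concentric
  circle is its value at the centre, that is, the mean of the boundary values. Exchanging the two
  integrals proves this for merely continuous boundary values.\<close>

lemma cavg_poisson:
  assumes u: "continuous_on (sphere 0 r) u" and s: "0 \<le> s" "s < r"
  shows "cavg s (\<lambda>z. cavg r (\<lambda>\<zeta>. pkernel r z \<zeta> * u \<zeta>)) = cavg r u"
    and "continuous_on (sphere 0 s) (\<lambda>z. cavg r (\<lambda>\<zeta>. pkernel r z \<zeta> * u \<zeta>))"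
proof -
  have ne: "cmod (of_real r * cis y - of_real s * cis x) \<noteq> 0" for x y
  proof
    assume "cmod (of_real r * cis y - of_real s * cis x) = 0"
    then have "of_real r * cis y = of_real s * cis x" by simp
    then have "cmod (of_real r * cis y) = cmod (of_real s * cis x)" by simp
    then show False using s by (simp add: norm_mult)
  qed
  define g where "g x y = pkernel r (of_real s * cis x) (of_real r * cis y) * u (of_real r * cis y)" for x y
  have cu: "continuous_on UNIV (\<lambda>y. u (of_real r * cis y))"
    by (rule circle_continuous[OF u]) (use s in auto)
  have cont: "continuous_on (cbox (0, 0) (2*pi, 2*pi)) (\<lambda>(x, y). g x y)"
  proof -
    have "continuous_on UNIV (\<lambda>p::real \<times> real. u (of_real r * cis (snd p)))"
      by (rule continuous_on_compose2[OF cu]) (auto intro: continuous_intros)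
    then have "continuous_on UNIV (\<lambda>p. g (fst p) (snd p))"
      unfolding g_def pkernel_def by (intro continuous_intros) (use ne in auto)
    then show ?thesis by (auto simp: case_prod_unfold intro: continuous_on_subset)
  qed
  have kern: "integral {0..2*pi} (\<lambda>x. pkernel r (of_real s * cis x) (of_real r * cis y)) = 2 * pi" for y
  proof -
    \<comment> \<open>The kernel depends only on the distance of the two angles, so the angles may
      be swapped. The integral over the inner angle becomes a Poisson integral of the constant
      1.\<close>
    have eq: "pkernel r (of_real s * cis x) (of_real r * cis y) = pkernel r (of_real s * cis y) (of_real r * cis x)" for x
    proof -
      have "cnj (of_real r * cis y - of_real s * cis x) * cis (x + y) = of_real r * cis x - of_real s * cis y"
        by (simp add: algebra_simps cis_mult cis_cnj)
      then have "cmod (cnj (of_real r * cis y - of_real s * cis x) * cis (x + y)) = cmod (of_real r * cis x - of_real s * cis y)"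
        by simp
      then have "cmod (of_real r * cis y - of_real s * cis x) = cmod (of_real r * cis x - of_real s * cis y)"
        by (simp only: norm_mult complex_mod_cnj norm_cis mult_1_right)
      then show ?thesis by (simp add: pkernel_def norm_mult)
    qed
    have "cavg r (\<lambda>\<zeta>. pkernel r (of_real s * cis y) \<zeta> * Re ((\<lambda>_. 1) \<zeta>)) = Re 1"
      using s by (intro poisson_formula[where A = UNIV]) (auto simp: norm_mult)
    then show ?thesis by (simp add: cavg_def eq)
  qed
  have "integral {0..2*pi} (\<lambda>x. integral {0..2*pi} (g x)) = integral {0..2*pi} (\<lambda>y. integral {0..2*pi} (\<lambda>x. g x y))"
    using integral_swap_continuous[OF cont] by simp
  also have "\<dots> = integral {0..2*pi} (\<lambda>y. 2 * pi * u (of_real r * cis y))"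
    unfolding g_def using kern by simp
  finally have "integral {0..2*pi} (\<lambda>x. integral {0..2*pi} (g x)) = 2 * pi * integral {0..2*pi} (\<lambda>y. u (of_real r * cis y))"
    by simp
  then show "cavg s (\<lambda>z. cavg r (\<lambda>\<zeta>. pkernel r z \<zeta> * u \<zeta>)) = cavg r u"
    by (simp add: cavg_def g_def[abs_def])
  have "continuous_on (sphere 0 s) (\<lambda>z. integral (cbox 0 (2*pi)) (\<lambda>t. pkernel r z (of_real r * cis t) * u (of_real r * cis t)))"
  proof (rule integral_continuous_on_param)
    have "continuous_on (sphere 0 s \<times> cbox 0 (2*pi)) (\<lambda>p. u (of_real r * cis (snd p)))"
      by (rule continuous_on_compose2[OF cu]) (auto intro: continuous_intros)
    moreover have "cmod (of_real r * cis y - z) \<noteq> 0" if "cmod z = s" for y z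
    proof
      assume "cmod (of_real r * cis y - z) = 0"
      then have "of_real r * cis y = z" by simp
      then have "cmod (of_real r * cis y) = cmod z" by simp
      then show False using s that by (simp add: norm_mult)
    qed
    ultimately show "continuous_on (sphere 0 s \<times> cbox 0 (2*pi)) (\<lambda>(z, t). pkernel r z (of_real r * cis t) * u (of_real r * cis t))"
      unfolding pkernel_def case_prod_unfold by (intro continuous_intros) auto
  qed
  then show "continuous_on (sphere 0 s) (\<lambda>z. cavg r (\<lambda>\<zeta>. pkernel r z \<zeta> * u \<zeta>))"
    unfolding cavg_def by (intro continuous_intros) simp
qed

text \<open>On the disc \<open>1 - d * z / c\<close> stays in the right half-plane, where the
  principal logarithm is holomorphic; its real part then has the mean value property.\<close>

lemma cavg_log_affine:
  assumes "cmod d * r < cmod c" "r > 0"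
  shows "cavg r (\<lambda>z. ln (cmod (c - d * z))) = ln (cmod c)"
proof -
  have "0 \<le> cmod d * r" using assms(2) by simp
  then have "cmod c > 0" using assms(1) by linarith
  then have c0: "c \<noteq> 0" by simp
  define A where "A = {z. cmod (d * z / c) < 1}"
  have "open A" unfolding A_def by (intro open_Collect_less continuous_intros) (use c0 in auto)
  have sub: "cball 0 r \<subseteq> A"
  proof
    fix z :: complex assume "z \<in> cball 0 r"
    then have "cmod d * cmod z \<le> cmod d * r" by (intro mult_left_mono) auto
    then show "z \<in> A" using assms c0 by (simp add: A_def norm_mult norm_divide divide_simps)
  qed
  have pos: "Re (1 - d * z / c) > 0" if "z \<in> A" for z
    using complex_Re_le_cmod[of "d * z / c"] that by (simp add: A_def)
  have nn: "1 - d * z / c \<notin> \<real>\<^sub>\<le>\<^sub>0" if "z \<in> A" for z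
    using pos[OF that] by (auto simp: complex_nonpos_Reals_iff)
  define h :: "complex \<Rightarrow> complex" where "h z = of_real (ln (cmod c)) + Ln (1 - d * z / c)" for z
  have "cavg r (\<lambda>z. Re (h z)) = Re (h 0)"
  proof (rule cavg_Re_mean)
    show "h holomorphic_on A" unfolding h_def using c0 nn by (intro holomorphic_intros) auto
  qed (use sub \<open>open A\<close> assms in auto)
  moreover have "Re (h z) = ln (cmod (c - d * z))" if "cmod z = r" for z
  proof -
    have "z \<in> A" using sub that by auto
    then have ne: "1 - d * z / c \<noteq> 0" using pos by fastforce
    then have "c - d * z \<noteq> 0" using c0 by (auto simp: field_simps)
    have "Re (h z) = ln (cmod c) + ln (cmod (1 - d * z / c))" using ne by (simp add: h_def)
    also have "\<dots> = ln (cmod c * cmod (1 - d * z / c))" using ne c0 by (simp add: ln_mult)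
    also have "cmod c * cmod (1 - d * z / c) = cmod (c - d * z)"
      using c0 by (simp add: norm_mult[symmetric] algebra_simps)
    finally show ?thesis .
  qed
  ultimately show ?thesis using assms cavg_cong[of r "\<lambda>z. Re (h z)" "\<lambda>z. ln (cmod (c - d * z))"]
    by (simp add: h_def)
qed

lemma cavg_log_linear:
  assumes "cmod a \<noteq> r" "r > 0"
  shows "cavg r (\<lambda>z. ln (cmod (z - a))) = ln (max r (cmod a))"
proof (cases "cmod a < r")
  case True
  \<comment> \<open>Reflection in the circle moves the zero \<open>a\<close> out of the disc without
    changing the modulus on the circle, which puts the preceding lemma within reach.\<close>
  have "cmod (z - a) = cmod (of_real r - cnj a / of_real r * z)" if "cmod z = r" for z
  proof -
    have "cmod (z - a) * r = cmod (cnj (z - a) * z)" using that by (simp only: norm_mult complex_mod_cnj)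
    also have "cnj (z - a) * z = of_real (r ^ 2) - cnj a * z"
      using complex_norm_square[of z] that by (simp add: algebra_simps)
    also have "\<dots> = of_real r * (of_real r - cnj a / of_real r * z)"
      using assms by (simp add: power2_eq_square algebra_simps)
    finally show ?thesis using assms by (simp add: norm_mult)
  qed
  then have "cavg r (\<lambda>z. ln (cmod (z - a))) = cavg r (\<lambda>z. ln (cmod (of_real r - cnj a / of_real r * z)))"
    using assms by (intro cavg_cong) auto
  also have "\<dots> = ln (cmod (of_real r))"
    using True assms by (intro cavg_log_affine) (auto simp: norm_divide)
  finally show ?thesis using True assms by simp
next
  case False
  have "cavg r (\<lambda>z. ln (cmod (z - a))) = cavg r (\<lambda>z. ln (cmod (a - 1 * z)))"
    by (simp add: norm_minus_commute)
  also have "\<dots> = ln (cmod a)" using False assms by (intro cavg_log_affine) auto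
  finally show ?thesis using False by simp
qed

subsection \<open>Orders of meromorphic functions\<close>

text \<open>Being nonzero in the field of meromorphic functions. Values at isolated points, in
  particular at poles, are arbitrary for a total function, so nonvanishing is demanded only off a
  sparse set.\<close>

definition mnz :: "(complex \<Rightarrow> complex) \<Rightarrow> bool" where
  "mnz f \<longleftrightarrow> f meromorphic_on UNIV \<and> eventually (\<lambda>z. f z \<noteq> 0) (cosparse UNIV)"

text \<open>Reading the order off the Laurent series makes its rules consequences of field
  arithmetic on series and ignores the value of \<open>f\<close> at the point. The default for the
  zero series is 0.\<close>

definition ordm :: "(complex \<Rightarrow> complex) \<Rightarrow> complex \<Rightarrow> int" where
  "ordm f z = fls_subdegree (laurent_expansion f z)"

lemma mnz_mero: "mnz f \<Longrightarrow> f meromorphic_on UNIV" by (simp add: mnz_def)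

lemma le_mero:
  "f meromorphic_on UNIV \<Longrightarrow> (\<lambda>w. f (z + w)) has_laurent_expansion laurent_expansion f z"
  by (rule meromorphic_on_imp_has_laurent_expansion) auto

lemma mero_cases:
  assumes "f meromorphic_on UNIV"
  shows "mnz f \<or> eventually (\<lambda>z. f z = 0) (cosparse UNIV)"
  using meromorphic_imp_constant_or_avoid[of f UNIV 0] assms by (auto simp: mnz_def)

lemma le_nonzero: "mnz f \<Longrightarrow> laurent_expansion f z \<noteq> 0"
proof -
  assume f: "mnz f"
  then have "eventually (\<lambda>w. f w \<noteq> 0) (at z)"
    unfolding mnz_def using eventually_cosparse_imp_eventually_at by blast
  then show ?thesis
    using has_laurent_expansion_eventually_nonzero_iff[OF le_mero[OF mnz_mero[OF f], of z]] by simp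
qed

lemma le_cong_cosparse:
  assumes "eventually (\<lambda>z. f z = g z) (cosparse UNIV)"
  shows "laurent_expansion f z = laurent_expansion g z"
  by (rule laurent_expansion_cong[OF eventually_cosparse_imp_eventually_at[OF assms]]) auto

lemma le_const [simp]: "laurent_expansion (\<lambda>_. c) z = fls_const c"
  by (rule laurent_expansion_eqI) (rule laurent_expansion_intros)

text \<open>By the identity theorem a single germ decides. Identities between germs at one point
  thereby spread to all points.\<close>

lemma mnz_iff:
  assumes "f meromorphic_on UNIV"
  shows "mnz f \<longleftrightarrow> laurent_expansion f z \<noteq> 0"
  using mero_cases[OF assms] le_nonzero[of f z] le_cong_cosparse[of f "\<lambda>_. 0" z] by auto

lemma le_add:
  assumes "f meromorphic_on UNIV" "g meromorphic_on UNIV"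
  shows "laurent_expansion (\<lambda>w. f w + g w) z = laurent_expansion f z + laurent_expansion g z"
  by (rule laurent_expansion_eqI) (intro laurent_expansion_intros le_mero assms)

lemma le_diff:
  assumes "f meromorphic_on UNIV" "g meromorphic_on UNIV"
  shows "laurent_expansion (\<lambda>w. f w - g w) z = laurent_expansion f z - laurent_expansion g z"
  by (rule laurent_expansion_eqI) (intro laurent_expansion_intros le_mero assms)

lemma le_mult:
  assumes "f meromorphic_on UNIV" "g meromorphic_on UNIV"
  shows "laurent_expansion (\<lambda>w. f w * g w) z = laurent_expansion f z * laurent_expansion g z"
  by (rule laurent_expansion_eqI) (intro laurent_expansion_intros le_mero assms)

lemma le_inverse:
  assumes "f meromorphic_on UNIV"
  shows "laurent_expansion (\<lambda>w. inverse (f w)) z = inverse (laurent_expansion f z)"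
  by (rule laurent_expansion_eqI) (intro laurent_expansion_intros le_mero assms)

lemma le_divide:
  assumes "f meromorphic_on UNIV" "g meromorphic_on UNIV"
  shows "laurent_expansion (\<lambda>w. f w / g w) z = laurent_expansion f z / laurent_expansion g z"
  by (rule laurent_expansion_eqI) (intro laurent_expansion_intros le_mero assms)

lemma le_power:
  assumes "f meromorphic_on UNIV"
  shows "laurent_expansion (\<lambda>w. f w ^ n) z = laurent_expansion f z ^ n"
  by (rule laurent_expansion_eqI) (intro laurent_expansion_intros le_mero assms)

lemma le_power_int:
  assumes "f meromorphic_on UNIV"
  shows "laurent_expansion (\<lambda>w. f w powi n) z = laurent_expansion f z powi n"
  by (rule laurent_expansion_eqI) (intro laurent_expansion_intros le_mero assms)

lemma le_prod:
  assumes "\<And>i. i \<in> I \<Longrightarrow> f i meromorphic_on UNIV"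
  shows "laurent_expansion (\<lambda>w. \<Prod>i\<in>I. f i w) z = (\<Prod>i\<in>I. laurent_expansion (f i) z)"
  by (rule laurent_expansion_eqI) (intro laurent_expansion_intros le_mero assms)

lemma le_deriv:
  assumes "f meromorphic_on UNIV"
  shows "laurent_expansion (deriv f) z = fls_deriv (laurent_expansion f z)"
proof -
  have "deriv (\<lambda>w. f (z + w)) has_laurent_expansion fls_deriv (laurent_expansion f z)"
    by (intro laurent_expansion_intros le_mero assms)
  moreover have "deriv (\<lambda>w. f (z + w)) = (\<lambda>w. deriv f (z + w))"
  proof
    fix w show "deriv (\<lambda>w. f (z + w)) w = deriv f (z + w)"
      unfolding deriv_def using DERIV_shift[of f _ w z] by (simp add: add.commute)
  qed
  ultimately show ?thesis by (intro laurent_expansion_eqI) simp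
qed

lemma le_ident: "laurent_expansion (\<lambda>w. w - a) z = fls_const (z - a) + fls_X"
proof (rule laurent_expansion_eqI)
  have "(\<lambda>w. (z - a) + w) has_laurent_expansion fls_const (z - a) + fls_X"
    by (intro laurent_expansion_intros)
  then show "(\<lambda>w. z + w - a) has_laurent_expansion fls_const (z - a) + fls_X"
    by (simp add: algebra_simps)
qed

lemma ordm_mult: "mnz f \<Longrightarrow> mnz g \<Longrightarrow> ordm (\<lambda>w. f w * g w) z = ordm f z + ordm g z"
  by (simp add: ordm_def le_mult mnz_mero le_nonzero)

lemma ordm_inverse: "mnz f \<Longrightarrow> ordm (\<lambda>w. inverse (f w)) z = - ordm f z"
  by (simp add: ordm_def le_inverse mnz_mero le_nonzero fls_inverse_subdegree)

lemma ordm_divide: "mnz f \<Longrightarrow> mnz g \<Longrightarrow> ordm (\<lambda>w. f w / g w) z = ordm f z - ordm g z"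
  by (simp add: ordm_def le_divide mnz_mero le_nonzero fls_divide_subdegree)

lemma mnz_mult: "mnz f \<Longrightarrow> mnz g \<Longrightarrow> mnz (\<lambda>w. f w * g w)"
  by (simp add: mnz_iff[of _ 0] le_mult mnz_mero meromorphic_intros le_nonzero)

lemma mnz_inverse: "mnz f \<Longrightarrow> mnz (\<lambda>w. inverse (f w))"
  by (simp add: mnz_iff[of _ 0] le_inverse mnz_mero meromorphic_intros le_nonzero)

lemma mnz_divide: "mnz f \<Longrightarrow> mnz g \<Longrightarrow> mnz (\<lambda>w. f w / g w)"
  by (simp add: mnz_iff[of _ 0] le_divide mnz_mero meromorphic_intros le_nonzero)

lemma mnz_power: "mnz f \<Longrightarrow> mnz (\<lambda>w. f w ^ n)"
  by (simp add: mnz_iff[of _ 0] le_power mnz_mero meromorphic_intros le_nonzero)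

lemma mnz_const: "c \<noteq> 0 \<Longrightarrow> mnz (\<lambda>_. c)"
  by (simp add: mnz_iff[of _ 0] meromorphic_intros)

lemma analytic_ordm:
  assumes "f analytic_on {z}" "f meromorphic_on UNIV"
  shows "ordm f z \<ge> 0" "f z \<noteq> 0 \<Longrightarrow> ordm f z = 0"
proof -
  have L: "(\<lambda>w. f (z + w)) has_laurent_expansion laurent_expansion f z" by (rule le_mero[OF assms(2)])
  have "\<not> is_pole f z" using assms(1) analytic_at_imp_no_pole by blast
  then show ge: "ordm f z \<ge> 0" using is_pole_fls_subdegree_iff[OF L] by (simp add: ordm_def)
  assume nz: "f z \<noteq> 0"
  have "f \<midarrow>z\<rightarrow> fls_nth (laurent_expansion f z) 0"
    by (rule has_laurent_expansion_imp_tendsto[OF L]) (use ge in \<open>simp add: ordm_def\<close>)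
  moreover have "f \<midarrow>z\<rightarrow> f z" using assms(1) by (simp add: analytic_at_imp_isCont isContD)
  ultimately have "fls_nth (laurent_expansion f z) 0 = f z" using LIM_unique by blast
  then have "fls_nth (laurent_expansion f z) 0 \<noteq> 0" using nz by simp
  then have "fls_subdegree (laurent_expansion f z) \<le> 0" by (rule fls_subdegree_leI)
  then show "ordm f z = 0" using ge by (simp add: ordm_def)
qed

lemma remove_sings_ordm_0:
  assumes "f meromorphic_on UNIV" "laurent_expansion f z \<noteq> 0" "ordm f z = 0"
  shows "remove_sings f analytic_on {z}" "remove_sings f z \<noteq> 0"
proof -
  have L: "(\<lambda>w. f (z + w)) has_laurent_expansion laurent_expansion f z" by (rule le_mero[OF assms(1)])
  have lim: "f \<midarrow>z\<rightarrow> fls_nth (laurent_expansion f z) 0"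
    by (rule has_laurent_expansion_imp_tendsto[OF L]) (use assms in \<open>simp add: ordm_def\<close>)
  show "remove_sings f analytic_on {z}"
    by (rule remove_sings_analytic_at[OF meromorphic_on_isolated_singularity lim])
       (use assms(1) in \<open>auto intro: meromorphic_on_subset\<close>)
  have "remove_sings f z = fls_nth (laurent_expansion f z) 0" using lim by (rule remove_sings_eqI)
  moreover have "fls_nth (laurent_expansion f z) (ordm f z) \<noteq> 0"
    unfolding ordm_def using assms(2) by simp
  ultimately show "remove_sings f z \<noteq> 0" using assms(3) by simp
qed

definition goodpt :: "(complex \<Rightarrow> complex) \<Rightarrow> complex \<Rightarrow> bool" where
  "goodpt f z \<longleftrightarrow> f analytic_on {z} \<and> f z \<noteq> 0"

text \<open>On such circles all integrands below are continuous. Only countably many radii fail, so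
  restricting to them costs nothing.\<close>

definition goodrad :: "(complex \<Rightarrow> complex) \<Rightarrow> real \<Rightarrow> bool" where
  "goodrad f r \<longleftrightarrow> r > 0 \<and> (\<forall>z. cmod z = r \<longrightarrow> goodpt f z)"

definition anrad :: "(complex \<Rightarrow> complex) \<Rightarrow> real \<Rightarrow> bool" where
  "anrad f r \<longleftrightarrow> r > 0 \<and> (\<forall>z. cmod z = r \<longrightarrow> f analytic_on {z})"

lemma goodrad_anrad: "goodrad f r \<Longrightarrow> anrad f r" by (simp add: goodrad_def anrad_def goodpt_def)

lemma goodpt_cosparse: "mnz f \<Longrightarrow> eventually (goodpt f) (cosparse UNIV)"
  unfolding mnz_def goodpt_def using meromorphic_on_imp_analytic_cosparse eventually_conj by blast

lemma cosparse_finite_cball: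
  assumes "eventually P (cosparse UNIV)"
  shows "finite {z. cmod z \<le> r \<and> \<not> P z}"
proof -
  have "{z. \<not> P z} sparse_in UNIV" using assms by (simp add: eventually_cosparse)
  then have "finite (cball 0 r \<inter> {z. \<not> P z})"
    by (intro sparse_in_compact_finite) (auto intro: sparse_in_subset)
  then show ?thesis by (rule finite_subset[rotated]) auto
qed

lemma ordm_goodpt: "mnz f \<Longrightarrow> goodpt f z \<Longrightarrow> ordm f z = 0"
  using analytic_ordm(2) by (auto simp: goodpt_def mnz_mero)

lemma finite_ordm: "mnz f \<Longrightarrow> finite {z. cmod z \<le> r \<and> ordm f z \<noteq> 0}"
  by (rule finite_subset[OF _ cosparse_finite_cball[OF goodpt_cosparse]]) (auto dest: ordm_goodpt)

lemma finite_poles: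
  assumes "f meromorphic_on UNIV"
  shows "finite {z. cmod z \<le> r \<and> ordm f z < 0}"
proof -
  have "finite {z. cmod z \<le> r \<and> \<not> f analytic_on {z}}"
    by (rule cosparse_finite_cball[OF meromorphic_on_imp_analytic_cosparse[OF assms]])
  then show ?thesis
    by (rule finite_subset[rotated]) (use analytic_ordm(1)[OF _ assms] in force)
qed

lemma open_goodpt: "mnz f \<Longrightarrow> open {z. goodpt f z}"
proof -
  assume "mnz f"
  then have "closed {z. \<not> goodpt f z}"
    using goodpt_cosparse sparse_in_UNIV_imp_closed by (auto simp: eventually_cosparse)
  then show ?thesis by (simp add: closed_def Compl_eq)
qed

lemma anrad_continuous: "anrad f r \<Longrightarrow> continuous_on (sphere 0 r) f"
  unfolding anrad_def by (intro continuous_at_imp_continuous_on) (auto intro: analytic_at_imp_isCont)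

subsection \<open>Factorisation on a disc\<close>

definition blaschke :: "real \<Rightarrow> complex \<Rightarrow> complex \<Rightarrow> complex" where
  "blaschke r a z = of_real r * (z - a) / (of_real (r ^ 2) - cnj a * z)"

lemma blaschke_mero: "blaschke r a meromorphic_on UNIV"
  unfolding blaschke_def by (intro meromorphic_intros)

lemma blaschke_analytic:
  assumes "of_real (r ^ 2) - cnj a * z \<noteq> 0"
  shows "blaschke r a analytic_on {z}"
  unfolding blaschke_def by (intro analytic_intros) (use assms in auto)

lemma blaschke_ordm:
  assumes "cmod a < r" "of_real (r ^ 2) - cnj a * z \<noteq> 0"
  shows "ordm (blaschke r a) z = (if z = a then 1 else 0)" "laurent_expansion (blaschke r a) z \<noteq> 0"
proof -
  have r: "r > 0" using assms by (auto intro: le_less_trans[of 0 "cmod a"])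
  define k where "k w = of_real r / (of_real (r ^ 2) - cnj a * w)" for w
  have k: "k meromorphic_on UNIV" unfolding k_def by (intro meromorphic_intros)
  have "k analytic_on {z}" unfolding k_def using assms by (intro analytic_intros) auto
  moreover have kz: "k z \<noteq> 0" using r assms by (simp add: k_def)
  ultimately have ok: "ordm k z = 0" using analytic_ordm(2) k by blast
  have kn: "laurent_expansion k z \<noteq> 0"
  proof
    assume "laurent_expansion k z = 0"
    have "k \<midarrow>z\<rightarrow> fls_nth (laurent_expansion k z) 0"
      by (rule has_laurent_expansion_imp_tendsto[OF le_mero[OF k]]) (use ok in \<open>simp add: ordm_def\<close>)
    moreover have "k \<midarrow>z\<rightarrow> k z" using \<open>k analytic_on {z}\<close> by (simp add: analytic_at_imp_isCont isContD)
    ultimately have "fls_nth (laurent_expansion k z) 0 = k z" using LIM_unique by blast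
    then show False using kz \<open>laurent_expansion k z = 0\<close> by simp
  qed
  have eq: "blaschke r a = (\<lambda>w. k w * (w - a))" by (auto simp: blaschke_def k_def)
  have id: "(\<lambda>w. w - a) meromorphic_on UNIV" by (intro meromorphic_intros)
  have xn: "laurent_expansion (\<lambda>w. w - a) z \<noteq> 0"
  proof
    assume "laurent_expansion (\<lambda>w. w - a) z = 0"
    then have "fls_nth (fls_const (z - a) + fls_X) 1 = 0" by (simp add: le_ident)
    then show False by simp
  qed
  have ox: "ordm (\<lambda>w. w - a) z = (if z = a then 1 else 0)"
  proof (cases "z = a")
    case False
    have "ordm (\<lambda>w. w - a) z = 0"
      by (rule analytic_ordm(2)) (use False id in \<open>auto intro!: analytic_intros\<close>)
    then show ?thesis using False by simp
  qed (simp add: ordm_def le_ident)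
  have L: "laurent_expansion (blaschke r a) z = laurent_expansion k z * laurent_expansion (\<lambda>w. w - a) z"
    unfolding eq by (rule le_mult[OF k id])
  then show "laurent_expansion (blaschke r a) z \<noteq> 0" using kn xn by simp
  show "ordm (blaschke r a) z = (if z = a then 1 else 0)"
    using kn xn ok ox by (simp add: ordm_def L)
qed

lemma blaschke_nz:
  assumes "cmod a < r" "cmod z \<le> r" "z \<noteq> a"
  shows "blaschke r a z \<noteq> 0"
  using cnj_denominator_nz[OF assms(1,2)] assms by (auto simp: blaschke_def)

lemma blaschke_norm_1:
  assumes "cmod a < r" "cmod z = r"
  shows "cmod (blaschke r a z) = 1"
proof -
  have r: "r > 0" using assms by (auto intro: le_less_trans[of 0 "cmod a"])
  have ne: "z \<noteq> a" using assms by auto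
  have "of_real (r ^ 2) - cnj a * z = z * cnj (z - a)"
    using complex_norm_square[of z] assms by (simp add: algebra_simps)
  then have "cmod (of_real (r ^ 2) - cnj a * z) = r * cmod (z - a)"
    using assms by (simp only: norm_mult complex_mod_cnj)
  then show ?thesis using ne r by (simp add: blaschke_def norm_divide norm_mult)
qed

text \<open>Blaschke factors carry all zeros and poles in the disc and have modulus 1 on the circle.
  What remains extends to a zero-free holomorphic function on a larger disc and therefore is an
  exponential. The equation is asserted only where \<open>f\<close> is analytic, because a total
  function may have stray values at isolated points.\<close>

lemma factorization:
  assumes f: "mnz f" and r: "goodrad f r"
  defines "S \<equiv> {a. cmod a < r \<and> ordm f a \<noteq> 0}"
  shows "finite S" "\<exists>h A. open A \<and> cball 0 r \<subseteq> A \<and> h holomorphic_on A \<and>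
    (\<forall>z. cmod z \<le> r \<longrightarrow> f analytic_on {z} \<longrightarrow> z \<notin> S \<longrightarrow>
       f z = exp (h z) * (\<Prod>a\<in>S. blaschke r a z powi ordm f a))"
proof -
  have r0: "r > 0" using r by (simp add: goodrad_def)
  have fm: "f meromorphic_on UNIV" using f by (rule mnz_mero)
  have finS: "finite S" unfolding S_def by (rule finite_subset[OF _ finite_ordm[OF f, of r]]) auto
  \<comment> \<open>An open neighbourhood of the closed disc: beyond the open disc zeros and poles
    of \<open>f\<close> are excluded, and no Blaschke denominator vanishes anywhere in it.\<close>
  define V where "V = ({z. goodpt f z} \<union> ball 0 r) \<inter> (\<Inter>a\<in>S. {z. of_real (r ^ 2) - cnj a * z \<noteq> 0})"
  have "open V" unfolding V_def
    by (intro open_Int open_Un open_goodpt[OF f] open_ball open_INT finS ballI open_Collect_neq continuous_intros)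
  moreover have "cball 0 r \<subseteq> V"
  proof
    fix z :: complex assume z: "z \<in> cball 0 r"
    have "goodpt f z" if "z \<notin> ball 0 r" using z that r by (auto simp: goodrad_def)
    moreover have "of_real (r ^ 2) - cnj a * z \<noteq> 0" if "a \<in> S" for a
      by (rule cnj_denominator_nz) (use that z in \<open>auto simp: S_def\<close>)
    ultimately show "z \<in> V" unfolding V_def by blast
  qed
  ultimately obtain e where e: "e > 0" "(\<Union>x\<in>cball 0 r. ball x e) \<subseteq> V"
    using compact_subset_open_imp_ball_epsilon_subset[of "cball (0::complex) r" V] by (metis compact_cball)
  \<comment> \<open>The neighbourhood is shrunk to a disc, because the holomorphic logarithm is
    taken on a convex set.\<close>
  define A where "A = ball (0::complex) (r + e)"
  have AV: "A \<subseteq> V"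
  proof
    fix z :: complex assume z: "z \<in> A"
    show "z \<in> V"
    proof (cases "cmod z \<le> r")
      case True then show ?thesis using e by (force simp: mem_ball)
    next
      case False
      \<comment> \<open>The radial projection of \<open>z\<close> to the circle; its distance from
        \<open>z\<close> is \<open>cmod z - r\<close>.\<close>
      define y where "y = of_real (r / cmod z) * z"
      have zn: "z \<noteq> 0" using False r0 by auto
      then have "cmod y = r" using r0 by (simp add: y_def norm_mult norm_divide)
      moreover have "z - y = of_real (1 - r / cmod z) * z" by (simp add: y_def algebra_simps)
      then have "cmod (z - y) = \<bar>1 - r / cmod z\<bar> * cmod z" by (simp only: norm_mult norm_of_real)
      then have "cmod (z - y) = cmod z - r" using False zn by (simp add: abs_if field_simps)
      then have "dist y z < e" using z False by (simp add: A_def dist_norm norm_minus_commute)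
      ultimately show ?thesis using e by (force simp: mem_ball)
    qed
  qed
  define g where "g z = f z * (\<Prod>a\<in>S. blaschke r a z powi (- ordm f a))" for z
  have gm: "g meromorphic_on UNIV" unfolding g_def by (intro meromorphic_intros fm blaschke_mero)
  have LE: "laurent_expansion g z = laurent_expansion f z * (\<Prod>a\<in>S. laurent_expansion (blaschke r a) z powi (- ordm f a))" for z
    unfolding g_def
    by (subst le_mult, rule fm, intro meromorphic_intros blaschke_mero,
        subst le_prod, intro meromorphic_intros blaschke_mero, subst le_power_int, rule blaschke_mero, rule refl)
  have key: "laurent_expansion g z \<noteq> 0 \<and> ordm g z = 0" if z: "z \<in> A" for z
  proof -
    have "z \<in> V" using AV z by auto
    then have zV: "goodpt f z \<or> cmod z < r" and d: "\<And>a. a \<in> S \<Longrightarrow> of_real (r ^ 2) - cnj a * z \<noteq> 0"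
      unfolding V_def by auto
    have b: "ordm (blaschke r a) z = (if z = a then 1 else 0)" "laurent_expansion (blaschke r a) z \<noteq> 0" if "a \<in> S" for a
      using blaschke_ordm[of a r z] d[OF that] that by (auto simp: S_def)
    have ne: "laurent_expansion g z \<noteq> 0"
      unfolding LE using le_nonzero[OF f] b(2) finS by (auto simp: power_int_eq_0_iff)
    have sub: "fls_subdegree (\<Prod>a\<in>W. laurent_expansion (blaschke r a) z powi (- ordm f a)) = (\<Sum>a\<in>W. - ordm f a * ordm (blaschke r a) z)"
      if "finite W" "W \<subseteq> S" for W
      using that
    proof (induction W)
      case (insert a W)
      have "(\<Prod>a\<in>W. laurent_expansion (blaschke r a) z powi (- ordm f a)) \<noteq> 0"
        using insert b(2) by (auto simp: power_int_eq_0_iff)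
      moreover have "laurent_expansion (blaschke r a) z powi (- ordm f a) \<noteq> 0"
        using insert b(2)[of a] by (auto simp: power_int_eq_0_iff)
      ultimately show ?case using insert by (simp add: ordm_def fls_subdegree_power_int)
    qed simp
    have "ordm g z = ordm f z + (\<Sum>a\<in>S. - ordm f a * ordm (blaschke r a) z)"
      using ne sub[OF finS] unfolding ordm_def[of g] LE by (subst fls_subdegree_mult) (auto simp: ordm_def)
    also have "(\<Sum>a\<in>S. - ordm f a * ordm (blaschke r a) z) = (\<Sum>a\<in>S. if z = a then - ordm f z else 0)"
      by (intro sum.cong) (auto simp: b)
    also have "\<dots> = (if z \<in> S then - ordm f z else 0)" using finS by simp
    also have "ordm f z + \<dots> = 0"
      using zV ordm_goodpt[OF f] by (auto simp: S_def)
    finally show ?thesis using ne by blast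
  qed
  define G where "G = remove_sings g"
  have Gh: "G holomorphic_on A" "\<And>z. z \<in> A \<Longrightarrow> G z \<noteq> 0"
  proof -
    have "G analytic_on A"
      using remove_sings_ordm_0(1)[OF gm] key by (subst analytic_on_analytic_at) (auto simp: G_def)
    then show "G holomorphic_on A" by (rule analytic_imp_holomorphic)
    show "G z \<noteq> 0" if "z \<in> A" for z using remove_sings_ordm_0(2)[OF gm] key that by (auto simp: G_def)
  qed
  obtain h where h: "h holomorphic_on A" "\<And>x. x \<in> A \<Longrightarrow> exp (h x) = G x"
    using holomorphic_logarithm_exists[of A G 0] Gh r0 e unfolding A_def
    by (metis centre_in_ball add_pos_pos convex_ball open_ball)
  show "finite S" by fact
  show "\<exists>h A. open A \<and> cball 0 r \<subseteq> A \<and> h holomorphic_on A \<and>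
    (\<forall>z. cmod z \<le> r \<longrightarrow> f analytic_on {z} \<longrightarrow> z \<notin> S \<longrightarrow>
       f z = exp (h z) * (\<Prod>a\<in>S. blaschke r a z powi ordm f a))"
  proof (intro exI[of _ h] exI[of _ A] conjI allI impI)
    show "open A" "cball 0 r \<subseteq> A" using e by (auto simp: A_def)
    show "h holomorphic_on A" by fact
    fix z assume z: "cmod z \<le> r" "f analytic_on {z}" "z \<notin> S"
    have bn: "blaschke r a z \<noteq> 0" if "a \<in> S" for a
      using that z by (intro blaschke_nz) (auto simp: S_def)
    have "g analytic_on {z}" unfolding g_def
    proof (intro analytic_intros z)
      fix a assume a: "a \<in> S"
      show "blaschke r a analytic_on {z}"
        by (intro blaschke_analytic cnj_denominator_nz) (use a z in \<open>auto simp: S_def\<close>)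
    qed (use bn in auto)
    then have "G z = g z" by (simp add: G_def)
    moreover have "z \<in> A" using z e by (simp add: A_def)
    ultimately have "exp (h z) = g z" using h(2) by simp
    then have "exp (h z) * (\<Prod>a\<in>S. blaschke r a z powi ordm f a)
        = f z * ((\<Prod>a\<in>S. blaschke r a z powi (- ordm f a)) * (\<Prod>a\<in>S. blaschke r a z powi ordm f a))"
      by (simp add: g_def)
    also have "(\<Prod>a\<in>S. blaschke r a z powi (- ordm f a)) * (\<Prod>a\<in>S. blaschke r a z powi ordm f a) = 1"
      unfolding prod.distrib[symmetric] using bn by (intro prod.neutral) (auto simp: power_int_minus)
    finally show "f z = exp (h z) * (\<Prod>a\<in>S. blaschke r a z powi ordm f a)" by simp
  qed
qed

subsection \<open>Counting functions and Jensen's formula\<close>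

definition locfin :: "(complex \<Rightarrow> real) \<Rightarrow> bool" where
  "locfin D \<longleftrightarrow> (\<forall>r. finite {z. cmod z \<le> r \<and> D z \<noteq> 0})"

text \<open>The integrated counting function of a divisor \<open>D\<close> with the integral over
  the radius already evaluated. In this form it is visibly linear in \<open>D\<close>, and
  inequalities between divisors can be checked point by point.\<close>

definition cnt :: "(complex \<Rightarrow> real) \<Rightarrow> real \<Rightarrow> real" where
  "cnt D r = (\<Sum>z | 0 < cmod z \<and> cmod z \<le> r \<and> D z \<noteq> 0. D z * ln (r / cmod z)) + D 0 * ln r"

lemma locfin_finite: "locfin D \<Longrightarrow> finite {z. 0 < cmod z \<and> cmod z \<le> r \<and> D z \<noteq> 0}"
  unfolding locfin_def by (rule finite_subset[of _ "{z. cmod z \<le> r \<and> D z \<noteq> 0}"]) auto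

lemma cnt_superset:
  assumes "finite W" "\<And>z. 0 < cmod z \<Longrightarrow> cmod z \<le> r \<Longrightarrow> D z \<noteq> 0 \<Longrightarrow> z \<in> W"
    "\<And>z. z \<in> W \<Longrightarrow> 0 < cmod z \<and> cmod z \<le> r"
  shows "cnt D r = (\<Sum>z\<in>W. D z * ln (r / cmod z)) + D 0 * ln r"
  unfolding cnt_def using assms by (intro arg_cong2[where f = "(+)"] sum.mono_neutral_left refl) auto

lemma locfin_add: "locfin D \<Longrightarrow> locfin E \<Longrightarrow> locfin (\<lambda>z. D z + E z)"
  unfolding locfin_def
proof (intro allI)
  fix r assume "\<forall>r. finite {z. cmod z \<le> r \<and> D z \<noteq> 0}" "\<forall>r. finite {z. cmod z \<le> r \<and> E z \<noteq> 0}"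
  then have "finite ({z. cmod z \<le> r \<and> D z \<noteq> 0} \<union> {z. cmod z \<le> r \<and> E z \<noteq> 0})" by simp
  then show "finite {z. cmod z \<le> r \<and> D z + E z \<noteq> 0}" by (rule finite_subset[rotated]) auto
qed

lemma locfin_cmult: "locfin D \<Longrightarrow> locfin (\<lambda>z. c * D z)"
  unfolding locfin_def by (auto intro: finite_subset[rotated])

lemma locfin_mono: "locfin E \<Longrightarrow> (\<And>z. E z = 0 \<Longrightarrow> D z = 0) \<Longrightarrow> locfin D"
  unfolding locfin_def
proof (intro allI)
  fix r assume "\<forall>r. finite {z. cmod z \<le> r \<and> E z \<noteq> 0}" "\<And>z. E z = 0 \<Longrightarrow> D z = 0"
  then show "finite {z. cmod z \<le> r \<and> D z \<noteq> 0}"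
    by (intro finite_subset[of "{z. cmod z \<le> r \<and> D z \<noteq> 0}" "{z. cmod z \<le> r \<and> E z \<noteq> 0}"]) auto
qed

lemma cnt_add:
  assumes "locfin D" "locfin E"
  shows "cnt (\<lambda>z. D z + E z) r = cnt D r + cnt E r"
proof -
  define W where "W = {z. 0 < cmod z \<and> cmod z \<le> r \<and> D z \<noteq> 0} \<union> {z. 0 < cmod z \<and> cmod z \<le> r \<and> E z \<noteq> 0}"
  have W: "finite W" using assms unfolding W_def by (intro finite_UnI locfin_finite)
  show ?thesis
    by (subst (1 2 3) cnt_superset[OF W]) (auto simp: W_def sum.distrib algebra_simps)
qed

lemma cnt_cmult: "cnt (\<lambda>z. c * D z) r = c * cnt D r"
  by (cases "c = 0") (simp_all add: cnt_def sum_distrib_left algebra_simps)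

lemma cnt_diff:
  assumes "locfin D" "locfin E"
  shows "cnt (\<lambda>z. D z - E z) r = cnt D r - cnt E r"
  using cnt_add[OF assms(1) locfin_cmult[OF assms(2), of "-1"]] cnt_cmult[of "-1" E r] by simp

lemma cnt_nonneg:
  assumes "\<And>z. D z \<ge> 0" "r \<ge> 1"
  shows "cnt D r \<ge> 0"
  unfolding cnt_def using assms
  by (intro add_nonneg_nonneg sum_nonneg mult_nonneg_nonneg) (auto simp: ln_ge_zero_iff divide_simps)

lemma cnt_mono:
  assumes "locfin D" "locfin E" "\<And>z. D z \<le> E z" "r \<ge> 1"
  shows "cnt D r \<le> cnt E r"
  using cnt_nonneg[of "\<lambda>z. E z - D z" r] cnt_diff[OF assms(2,1), of r] assms by simp

definition polem :: "(complex \<Rightarrow> complex) \<Rightarrow> complex \<Rightarrow> real" where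
  "polem f z = real (nat (- ordm f z))"

definition zerom :: "(complex \<Rightarrow> complex) \<Rightarrow> complex \<Rightarrow> real" where
  "zerom f z = real (nat (ordm f z))"

lemma polem_nonneg [simp]: "polem f z \<ge> 0" by (simp add: polem_def)

lemma zerom_nonneg [simp]: "zerom f z \<ge> 0" by (simp add: zerom_def)

lemma locfin_polem: "f meromorphic_on UNIV \<Longrightarrow> locfin (polem f)"
  unfolding locfin_def polem_def using finite_poles by (auto simp: not_le)

lemma locfin_ordm: "mnz f \<Longrightarrow> locfin (\<lambda>z. real_of_int (ordm f z))"
  unfolding locfin_def using finite_ordm by auto

lemma locfin_zerom: "mnz f \<Longrightarrow> locfin (zerom f)"
  by (rule locfin_mono[OF locfin_ordm]) (auto simp: zerom_def)

lemma ordm_split: "real_of_int (ordm f z) = zerom f z - polem f z"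
  by (simp add: zerom_def polem_def)

lemma npoles_eq:
  assumes f: "f meromorphic_on UNIV"
  shows "npoles f t = (\<Sum>z | cmod z \<le> t \<and> ordm f z < 0. polem f z)"
proof -
  have p: "is_pole f z \<longleftrightarrow> ordm f z < 0" for z
    unfolding ordm_def by (rule is_pole_fls_subdegree_iff[OF le_mero[OF f]])
  have "nat (- zorder f z) = nat (- ordm f z)" if "ordm f z < 0" for z
  proof -
    have "laurent_expansion f z \<noteq> 0" using that by (auto simp: ordm_def)
    then show ?thesis using has_laurent_expansion_zorder[OF le_mero[OF f]] by (simp add: ordm_def)
  qed
  then have "(\<Sum>z | cmod z \<le> t \<and> ordm f z < 0. real (nat (- zorder f z))) = (\<Sum>z | cmod z \<le> t \<and> ordm f z < 0. polem f z)"
    by (intro sum.cong) (auto simp: polem_def)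
  then show ?thesis by (simp add: npoles_def p)
qed

lemma has_integral_step_inverse:
  fixes c r :: real
  assumes "0 < c" "c \<le> r"
  shows "((\<lambda>t. if c \<le> t then 1 / t else 0) has_integral ln (r / c)) {0..r}"
proof -
  have "((\<lambda>t. 1 / t) has_integral (ln r - ln c)) {c..r}"
    using assms by (intro fundamental_theorem_of_calculus[of c r ln "\<lambda>t. 1 / t"])
      (auto intro!: derivative_eq_intros simp: has_real_derivative_iff_has_vector_derivative[symmetric])
  then have "((\<lambda>t. if t \<in> {c..r} then 1 / t else 0) has_integral (ln r - ln c)) {0..r}"
    using assms by (subst has_integral_restrict) auto
  then have "((\<lambda>t. if c \<le> t then 1 / t else 0) has_integral (ln r - ln c)) {0..r}"
    by (rule has_integral_eq[rotated]) auto
  then show ?thesis using assms by (simp add: ln_div)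
qed

lemma Ncount_eq_cnt:
  assumes f: "f meromorphic_on UNIV" and r: "r > 0"
  shows "Ncount f r = cnt (polem f) r"
proof -
  define W where "W = {z. 0 < cmod z \<and> cmod z \<le> r \<and> polem f z \<noteq> 0}"
  have finW: "finite W" unfolding W_def by (rule locfin_finite[OF locfin_polem[OF f]])
  have np0: "npoles f 0 = polem f 0"
  proof -
    have "npoles f 0 = (\<Sum>z\<in>{z. cmod z \<le> 0 \<and> ordm f z < 0}. polem f z)" by (rule npoles_eq[OF f])
    also have "\<dots> = (\<Sum>z\<in>{0}. polem f z)" by (rule sum.mono_neutral_left) (auto simp: polem_def)
    finally show ?thesis by simp
  qed
  have eq: "(npoles f t - npoles f 0) / t = (\<Sum>a\<in>W. polem f a * (if cmod a \<le> t then 1 / t else 0))"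
    if t: "t \<in> {0..r}" for t
  proof (cases "t = 0")
    case False
    have fin: "finite {z. cmod z \<le> t \<and> ordm f z < 0}" by (rule finite_poles[OF f])
    have "npoles f t = (\<Sum>z\<in>insert 0 {z. cmod z \<le> t \<and> ordm f z < 0}. polem f z)"
      unfolding npoles_eq[OF f] using fin t by (intro sum.mono_neutral_left) (auto simp: polem_def)
    also have "\<dots> = polem f 0 + (\<Sum>z\<in>{z. cmod z \<le> t \<and> ordm f z < 0} - {0}. polem f z)"
      using fin by (subst sum.insert_remove) auto
    also have "(\<Sum>z\<in>{z. cmod z \<le> t \<and> ordm f z < 0} - {0}. polem f z)
       = (\<Sum>z\<in>{z\<in>W. cmod z \<le> t}. polem f z)"
      using t by (intro sum.cong) (auto simp: W_def polem_def)
    also have "\<dots> = (\<Sum>z\<in>W. if cmod z \<le> t then polem f z else 0)"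
      using finW by (simp add: sum.If_cases Collect_conj_eq[symmetric] sum.inter_filter)
    finally have "npoles f t - npoles f 0 = (\<Sum>z\<in>W. if cmod z \<le> t then polem f z else 0)"
      by (simp add: np0)
    then show ?thesis by (simp add: sum_divide_distrib if_distrib[of "\<lambda>x. x / t"] if_distrib[of "\<lambda>x. _ * x"] cong: if_cong)
  qed (auto simp: W_def intro!: sum.neutral)
  have "((\<lambda>t. \<Sum>a\<in>W. polem f a * (if cmod a \<le> t then 1 / t else 0)) has_integral
      (\<Sum>a\<in>W. polem f a * ln (r / cmod a))) {0..r}"
    using finW by (intro has_integral_sum has_integral_mult_right has_integral_step_inverse) (auto simp: W_def)
  then have "((\<lambda>t. (npoles f t - npoles f 0) / t) has_integral (\<Sum>a\<in>W. polem f a * ln (r / cmod a))) {0..r}"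
    by (rule has_integral_eq[rotated]) (use eq in auto)
  then show ?thesis
    by (simp add: Ncount_def integral_unique np0 cnt_def W_def)
qed

lemma nev_T_eq:
  assumes "f meromorphic_on UNIV" "r > 0"
  shows "nev_T f r = proxim f r + cnt (polem f) r"
  using Ncount_eq_cnt[OF assms] by (simp add: nev_T_def)

definition lcoef :: "(complex \<Rightarrow> complex) \<Rightarrow> complex" where
  "lcoef f = fls_nth (laurent_expansion f 0) (ordm f 0)"

lemma blaschke_norm_le_1:
  assumes "cmod a < r" "cmod z \<le> r"
  shows "cmod (blaschke r a z) \<le> 1"
proof -
  have r: "r > 0" using assms by (auto intro: le_less_trans[of 0 "cmod a"])
  have d: "of_real (r ^ 2) - cnj a * z \<noteq> 0" by (rule cnj_denominator_nz[OF assms])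
  have "(of_real (r ^ 2) - cnj a * z) * cnj (of_real (r ^ 2) - cnj a * z) - of_real (r ^ 2) * ((z - a) * cnj (z - a))
     = (of_real (r ^ 2) - a * cnj a) * (of_real (r ^ 2) - z * cnj z)"
    by (simp add: algebra_simps)
  then have "complex_of_real (cmod (of_real (r ^ 2) - cnj a * z) ^ 2 - r ^ 2 * cmod (z - a) ^ 2)
     = of_real ((r ^ 2 - cmod a ^ 2) * (r ^ 2 - cmod z ^ 2))"
    unfolding of_real_diff of_real_mult complex_norm_square by simp
  then have "cmod (of_real (r ^ 2) - cnj a * z) ^ 2 - r ^ 2 * cmod (z - a) ^ 2
     = (r ^ 2 - cmod a ^ 2) * (r ^ 2 - cmod z ^ 2)" by (simp only: of_real_eq_iff)
  moreover have "(r ^ 2 - cmod a ^ 2) * (r ^ 2 - cmod z ^ 2) \<ge> 0"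
    using assms by (intro mult_nonneg_nonneg) (auto intro!: power_mono)
  ultimately have "(r * cmod (z - a)) ^ 2 \<le> cmod (of_real (r ^ 2) - cnj a * z) ^ 2"
    by (simp add: power_mult_distrib)
  then have "r * cmod (z - a) \<le> cmod (of_real (r ^ 2) - cnj a * z)" by (rule power2_le_imp_le) simp
  then show ?thesis using d r by (simp add: blaschke_def norm_divide norm_mult)
qed

lemma goodrad_not_S: "mnz f \<Longrightarrow> goodrad f r \<Longrightarrow> cmod z = r \<Longrightarrow> ordm f z = 0"
  by (auto simp: goodrad_def intro: ordm_goodpt)

lemma factor_norm_sphere:
  assumes S: "S = {a. cmod a < r \<and> ordm f a \<noteq> 0}" and z: "cmod z = r"
    and eq: "f z = exp (h z) * (\<Prod>a\<in>S. blaschke r a z powi ordm f a)"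
  shows "cmod (f z) = exp (Re (h z))"
proof -
  have "cmod (\<Prod>a\<in>S. blaschke r a z powi ordm f a) = (\<Prod>a\<in>S. cmod (blaschke r a z) powi ordm f a)"
    by (simp add: prod_norm[symmetric] norm_power_int)
  also have "\<dots> = 1" using blaschke_norm_1[OF _ z] by (intro prod.neutral) (auto simp: S)
  finally show ?thesis by (simp add: eq norm_mult)
qed

lemma ln_powi: "x > 0 \<Longrightarrow> ln (x powi n) = real_of_int n * ln (x :: real)"
  by (cases "n \<ge> 0") (auto simp: power_int_def ln_realpow ln_inverse power_inverse)

lemma jensen:
  assumes f: "mnz f" and r: "goodrad f r"
  shows "cavg r (\<lambda>z. ln (cmod (f z))) = ln (cmod (lcoef f)) + cnt (\<lambda>z. real_of_int (ordm f z)) r"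
proof -
  have r0: "r > 0" using r by (simp add: goodrad_def)
  define S where "S = {a. cmod a < r \<and> ordm f a \<noteq> 0}"
  obtain h A where A: "open A" "cball 0 r \<subseteq> A" "h holomorphic_on A" and
      eq0: "\<forall>z. cmod z \<le> r \<longrightarrow> f analytic_on {z} \<longrightarrow> z \<notin> S \<longrightarrow>
         f z = exp (h z) * (\<Prod>a\<in>S. blaschke r a z powi ordm f a)"
    using factorization(2)[OF f r, folded S_def] by blast
  note eq = eq0[rule_format]
  have finS: "finite S" unfolding S_def by (rule factorization(1)[OF f r])
  have "cavg r (\<lambda>z. ln (cmod (f z))) = cavg r (\<lambda>z. Re (h z))"
  proof (rule cavg_cong)
    fix z assume z: "cmod z = r"
    then have "goodpt f z" using r by (simp add: goodrad_def)
    then have "f z = exp (h z) * (\<Prod>a\<in>S. blaschke r a z powi ordm f a)"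
      using z by (intro eq) (auto simp: goodpt_def S_def)
    from factor_norm_sphere[where h = h, OF S_def z this] show "ln (cmod (f z)) = Re (h z)" by simp
  qed (use r0 in simp)
  also have "\<dots> = Re (h 0)" by (rule cavg_Re_mean) (use A r0 in auto)
  finally have mean: "cavg r (\<lambda>z. ln (cmod (f z))) = Re (h 0)" .
  define n where "n = ordm f 0"
  have lc0: "lcoef f \<noteq> 0" using le_nonzero[OF f, of 0] by (simp add: lcoef_def ordm_def)
  have asy: "f \<sim>[at 0] (\<lambda>w. lcoef f * w powi n)"
    using has_laurent_expansion_imp_asymp_equiv[OF le_mero[OF mnz_mero[OF f], of 0]]
    by (simp add: lcoef_def n_def ordm_def)
  have ev0: "\<forall>\<^sub>F w in at 0. w \<noteq> (0::complex)" by (simp add: eventually_at_filter)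
  have lim1: "(\<lambda>w. f w / (w powi n)) \<midarrow>0\<rightarrow> lcoef f"
  proof -
    have "((\<lambda>w. f w / (lcoef f * w powi n)) \<longlongrightarrow> 1) (at 0)"
      by (rule asymp_equivD_strong[OF asy]) (rule eventually_mono[OF ev0], use lc0 in auto)
    then have "((\<lambda>w. lcoef f * (f w / (lcoef f * w powi n))) \<longlongrightarrow> lcoef f * 1) (at 0)"
      by (intro tendsto_intros)
    then show ?thesis using lc0 by simp
  qed
  \<comment> \<open>The factorisation divided by \<open>w powi n\<close>: the Blaschke factor of the
    origin is \<open>w / of_real r\<close>, so its power cancels up to
    \<open>of_real r powi (- n)\<close>. The result is continuous at 0, and its value there must be
    \<open>lcoef f\<close>.\<close>
  define G where "G w = exp (h w) * (\<Prod>a\<in>S - {0}. blaschke r a w powi ordm f a) * of_real r powi (- n)" for w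
  have evG: "\<forall>\<^sub>F w in at 0. f w / (w powi n) = G w"
  proof -
    have "\<forall>\<^sub>F w in at 0. goodpt f w"
      using goodpt_cosparse[OF f] eventually_cosparse_imp_eventually_at by blast
    moreover have "\<forall>\<^sub>F w in at (0::complex). cmod w < r"
      using eventually_at_in_open'[of "ball (0::complex) r" 0] r0 by simp
    ultimately show ?thesis using ev0
    proof eventually_elim
      case (elim w)
      have "w \<notin> S" using ordm_goodpt[OF f] elim by (auto simp: S_def)
      then have fw: "f w = exp (h w) * (\<Prod>a\<in>S. blaschke r a w powi ordm f a)"
        using elim by (intro eq) (auto simp: goodpt_def)
      have b0: "blaschke r 0 w = w / of_real r" using r0 by (simp add: blaschke_def power2_eq_square)
      have "(\<Prod>a\<in>S. blaschke r a w powi ordm f a) = (\<Prod>a\<in>S - {0}. blaschke r a w powi ordm f a) * (w / of_real r) powi n"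
      proof (cases "0 \<in> S")
        case True
        then show ?thesis using finS by (subst prod.remove[of _ 0]) (auto simp: b0 n_def)
      next
        case False
        then have "n = 0" using r0 by (simp add: S_def n_def)
        then show ?thesis using False by simp
      qed
      then show ?case using elim r0 unfolding fw G_def
        by (simp add: power_int_divide_distrib power_int_minus field_simps)
    qed
  qed
  have "continuous (at 0) h"
    using A r0 by (meson centre_in_cball continuous_on_eq_continuous_at holomorphic_on_imp_continuous_on less_imp_le subsetD)
  moreover have "continuous (at 0) (blaschke r a)" if "a \<in> S - {0}" for a
    unfolding blaschke_def by (intro continuous_intros) (use r0 in auto)
  moreover have "blaschke r a 0 \<noteq> 0" if "a \<in> S - {0}" for a
    using that r0 by (auto simp: blaschke_def)
  ultimately have "continuous (at 0) G"
    unfolding G_def by (intro continuous_intros) auto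
  then have lim2: "G \<midarrow>0\<rightarrow> G 0" by (simp add: isCont_def)
  have "lcoef f = G 0"
    using lim1 lim2 tendsto_cong[OF evG] LIM_unique by blast
  then have "cmod (lcoef f) = exp (Re (h 0)) * (\<Prod>a\<in>S - {0}. (cmod a / r) powi ordm f a) * r powi (- n)"
    using r0 by (simp add: G_def norm_mult prod_norm[symmetric] norm_power_int blaschke_def norm_divide power2_eq_square)
  then have "ln (cmod (lcoef f)) = ln (exp (Re (h 0)) * (\<Prod>a\<in>S - {0}. (cmod a / r) powi ordm f a) * r powi (- n))"
    by simp
  also have "\<dots> = Re (h 0) + ln (\<Prod>a\<in>S - {0}. (cmod a / r) powi ordm f a) + ln (r powi (- n))"
    using r0 finS by (subst ln_mult) (auto simp: ln_mult intro!: prod_pos mult_pos_pos)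
  also have "ln (\<Prod>a\<in>S - {0}. (cmod a / r) powi ordm f a) = (\<Sum>a\<in>S - {0}. ln ((cmod a / r) powi ordm f a))"
    using r0 finS by (subst ln_prod) auto
  also have "\<dots> = - (\<Sum>a\<in>S - {0}. real_of_int (ordm f a) * ln (r / cmod a))"
    unfolding sum_negf[symmetric] using r0 by (intro sum.cong refl) (auto simp: ln_powi ln_div algebra_simps)
  also have "ln (r powi (- n)) = - real_of_int n * ln r" using r0 by (simp add: ln_powi)
  finally have e: "ln (cmod (lcoef f)) = Re (h 0) - (\<Sum>a\<in>S - {0}. real_of_int (ordm f a) * ln (r / cmod a)) - real_of_int n * ln r"
    by simp
  have "cnt (\<lambda>z. real_of_int (ordm f z)) r = (\<Sum>a\<in>S - {0}. real_of_int (ordm f a) * ln (r / cmod a)) + real_of_int n * ln r"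
    unfolding n_def
  proof (rule cnt_superset)
    fix z assume z: "0 < cmod z" "cmod z \<le> r" "real_of_int (ordm f z) \<noteq> 0"
    then have "cmod z \<noteq> r" using goodrad_not_S[OF f r] by auto
    then show "z \<in> S - {0}" using z by (auto simp: S_def)
  qed (use finS in \<open>auto simp: S_def\<close>)
  then show ?thesis using e mean by simp
qed

subsection \<open>The Poisson-Jensen inequality and monotonicity of the characteristic\<close>

lemma logplus_nonneg [simp]: "logplus x \<ge> 0" by (simp add: logplus_def)

lemma ln_le_logplus: "x > 0 \<Longrightarrow> ln x \<le> logplus x" by (simp add: logplus_def)

lemma logplus_alt: "x > 0 \<Longrightarrow> logplus x = max 0 (ln x)"
  by (auto simp: logplus_def max_def ln_le_zero_iff not_le)

lemma logplus_max: "x \<ge> 0 \<Longrightarrow> logplus x = ln (max 1 x)"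
  by (auto simp: logplus_def max_def)

lemma continuous_on_logplus [continuous_intros]:
  assumes "continuous_on A u" "\<And>x. x \<in> A \<Longrightarrow> u x \<ge> (0::real)"
  shows "continuous_on A (\<lambda>x. logplus (u x))"
proof -
  have "continuous_on A (\<lambda>x. ln (max 1 (u x)))"
    using assms by (intro continuous_intros) (auto simp: max_def)
  then show ?thesis using assms(2) by (subst continuous_on_cong[OF refl logplus_max]) auto
qed

lemma anrad_logplus: "anrad f r \<Longrightarrow> continuous_on (sphere 0 r) (\<lambda>z. logplus (cmod (f z)))"
  by (intro continuous_intros anrad_continuous) auto

lemma continuous_pkernel:
  assumes "cmod z < r"
  shows "continuous_on (sphere 0 r) (pkernel r z)"
  unfolding pkernel_def using assms by (intro continuous_intros) auto

text \<open>By the factorisation, \<open>ln (cmod (f z))\<close> is the Poisson integral of the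
  boundary values plus one logarithm per zero and pole. Blaschke factors are at most 1 in modulus,
  so the zeros contribute negatively and are dropped; passing to \<open>logplus\<close> on the
  boundary only increases the bound.\<close>

lemma poisson_jensen_ineq:
  assumes f: "mnz f" and r: "goodrad f r" and z: "cmod z < r" "f analytic_on {z}"
  shows "logplus (cmod (f z)) \<le> cavg r (\<lambda>\<zeta>. pkernel r z \<zeta> * logplus (cmod (f \<zeta>)))
     + (\<Sum>a | cmod a < r \<and> ordm f a < 0. polem f a * - ln (cmod (blaschke r a z)))"
    (is "_ \<le> ?I + ?P")
proof -
  have r0: "r > 0" using r by (simp add: goodrad_def)
  have I0: "?I \<ge> 0" using pkernel_bounds(1)[OF _ z(1)] r0 by (intro cavg_nonneg mult_nonneg_nonneg) auto
  have nz_le: "- ln (cmod (blaschke r a z)) \<ge> 0" if "cmod a < r" for a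
  proof (cases "blaschke r a z = 0")
    case False
    then show ?thesis using blaschke_norm_le_1[of a r z] that z by (simp add: ln_le_zero_iff)
  qed simp
  have P0: "?P \<ge> 0" using nz_le by (intro sum_nonneg mult_nonneg_nonneg) auto
  show ?thesis
  proof (cases "cmod (f z) \<le> 1")
    case True
    then show ?thesis using I0 P0 by (simp add: logplus_def)
  next
    case False
    define S where "S = {a. cmod a < r \<and> ordm f a \<noteq> 0}"
    obtain h A where A: "open A" "cball 0 r \<subseteq> A" "h holomorphic_on A" and
      eq0: "\<forall>z. cmod z \<le> r \<longrightarrow> f analytic_on {z} \<longrightarrow> z \<notin> S \<longrightarrow>
         f z = exp (h z) * (\<Prod>a\<in>S. blaschke r a z powi ordm f a)"
    using factorization(2)[OF f r, folded S_def] by blast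
  note eq = eq0[rule_format]
  have finS: "finite S" unfolding S_def by (rule factorization(1)[OF f r])
    have fz: "f z \<noteq> 0" using False by auto
    then have zS: "z \<notin> S" using z ordm_goodpt[OF f, of z] by (auto simp: S_def goodpt_def)
    have bn: "blaschke r a z \<noteq> 0" if "a \<in> S" for a
      using that z zS by (intro blaschke_nz) (auto simp: S_def)
    have "f z = exp (h z) * (\<Prod>a\<in>S. blaschke r a z powi ordm f a)" using z zS by (intro eq) auto
    then have "cmod (f z) = exp (Re (h z)) * (\<Prod>a\<in>S. cmod (blaschke r a z) powi ordm f a)"
      by (simp add: norm_mult prod_norm[symmetric] norm_power_int)
    then have "ln (cmod (f z)) = ln (exp (Re (h z)) * (\<Prod>a\<in>S. cmod (blaschke r a z) powi ordm f a))" by simp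
    also have "\<dots> = Re (h z) + ln (\<Prod>a\<in>S. cmod (blaschke r a z) powi ordm f a)"
      using bn finS by (subst ln_mult) (auto intro!: prod_pos)
    also have "ln (\<Prod>a\<in>S. cmod (blaschke r a z) powi ordm f a) = (\<Sum>a\<in>S. real_of_int (ordm f a) * ln (cmod (blaschke r a z)))"
      using bn finS by (subst ln_prod) (auto simp: ln_powi)
    also have "\<dots> \<le> (\<Sum>a\<in>S. polem f a * - ln (cmod (blaschke r a z)))"
    proof (rule sum_mono)
      fix a assume "a \<in> S"
      then have "zerom f a * - ln (cmod (blaschke r a z)) \<ge> 0" using nz_le by (intro mult_nonneg_nonneg) (auto simp: S_def)
      then show "real_of_int (ordm f a) * ln (cmod (blaschke r a z)) \<le> polem f a * - ln (cmod (blaschke r a z))"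
        by (simp add: ordm_split algebra_simps)
    qed
    also have "\<dots> = ?P"
      using finS by (intro sum.mono_neutral_right) (auto simp: S_def polem_def)
    also have "Re (h z) = cavg r (\<lambda>\<zeta>. pkernel r z \<zeta> * Re (h \<zeta>))"
      by (rule poisson_formula[symmetric]) (use A z in auto)
    also have "\<dots> \<le> ?I"
    proof (rule cavg_mono)
      have "continuous_on (sphere 0 r) h"
        using A by (meson holomorphic_on_imp_continuous_on continuous_on_subset sphere_cball order_trans)
      then show "continuous_on (sphere 0 r) (\<lambda>\<zeta>. pkernel r z \<zeta> * Re (h \<zeta>))"
        by (intro continuous_intros continuous_pkernel z)
      show "continuous_on (sphere 0 r) (\<lambda>\<zeta>. pkernel r z \<zeta> * logplus (cmod (f \<zeta>)))"
        by (intro continuous_intros continuous_pkernel z anrad_continuous goodrad_anrad r) auto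
      fix \<zeta> assume \<zeta>: "cmod \<zeta> = r"
      then have "goodpt f \<zeta>" using r by (simp add: goodrad_def)
      then have "f \<zeta> = exp (h \<zeta>) * (\<Prod>a\<in>S. blaschke r a \<zeta> powi ordm f a)"
        using \<zeta> by (intro eq) (auto simp: goodpt_def S_def)
      from factor_norm_sphere[where h = h, OF S_def \<zeta> this] have "Re (h \<zeta>) = ln (cmod (f \<zeta>))" by simp
      also have "\<dots> \<le> logplus (cmod (f \<zeta>))" using \<open>goodpt f \<zeta>\<close> by (intro ln_le_logplus) (simp add: goodpt_def)
      finally show "pkernel r z \<zeta> * Re (h \<zeta>) \<le> pkernel r z \<zeta> * logplus (cmod (f \<zeta>))"
        by (intro mult_left_mono pkernel_bounds \<zeta> z)
    qed (use r0 in simp)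
    finally have "ln (cmod (f z)) \<le> ?I + ?P" by simp
    then show ?thesis using False by (simp add: logplus_def)
  qed
qed

text \<open>The Poisson-Jensen inequality is averaged over the smaller circle. The Poisson integrals
  average to \<open>proxim f r\<close>, and the means of the Blaschke terms add up to exactly the
  increase of the counting function from \<open>s\<close> to \<open>r\<close>.\<close>

lemma nev_T_mono:
  assumes f: "mnz f" and s: "goodrad f s" and r: "goodrad f r" and sr: "s < r"
  shows "nev_T f s \<le> nev_T f r"
proof -
  have fm: "f meromorphic_on UNIV" using f by (rule mnz_mero)
  have s0: "s > 0" and r0: "r > 0" using r s by (simp_all add: goodrad_def)
  define W where "W = {a. cmod a < r \<and> ordm f a < 0}"
  have finW: "finite W" unfolding W_def by (rule finite_subset[OF _ finite_poles[OF fm, of r]]) auto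
  have Ws: "cmod a \<noteq> s" if "a \<in> W" for a using that goodrad_not_S[OF f s] by (force simp: W_def)
  have lnb: "- ln (cmod (blaschke r a z)) = (ln (cmod (of_real (r ^ 2) - cnj a * z)) - ln r) - ln (cmod (z - a))"
    if "a \<in> W" "cmod z = s" for a z
  proof -
    have "z \<noteq> a" using Ws that by auto
    moreover have "of_real (r ^ 2) - cnj a * z \<noteq> 0"
      by (rule cnj_denominator_nz) (use that sr in \<open>auto simp: W_def\<close>)
    ultimately show ?thesis using r0 unfolding blaschke_def norm_mult norm_divide
      by (subst ln_div) (auto simp: ln_mult)
  qed
  have cont1: "continuous_on (sphere 0 s) (\<lambda>z. ln (cmod (of_real (r ^ 2) - cnj a * z)))" if "a \<in> W" for a
  proof -
    have "of_real (r ^ 2) - cnj a * z \<noteq> 0" if "z \<in> sphere 0 s" for z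
      by (rule cnj_denominator_nz) (use that \<open>a \<in> W\<close> sr in \<open>auto simp: W_def\<close>)
    then show ?thesis by (intro continuous_intros) (auto simp del: right_minus_eq)
  qed
  have cont2: "continuous_on (sphere 0 s) (\<lambda>z. ln (cmod (z - a)))" if "a \<in> W" for a
    using Ws[OF that] by (intro continuous_intros) auto
  have cont: "continuous_on (sphere 0 s) (\<lambda>z. - ln (cmod (blaschke r a z)))" if "a \<in> W" for a
  proof -
    have "continuous_on (sphere 0 s) (\<lambda>z. (ln (cmod (of_real (r ^ 2) - cnj a * z)) - ln r) - ln (cmod (z - a)))"
      by (intro continuous_intros cont1 cont2 that)
    then show ?thesis by (rule continuous_on_eq) (use lnb[OF that] in auto)
  qed
  have avg: "cavg s (\<lambda>z. - ln (cmod (blaschke r a z))) = ln r - ln (max s (cmod a))" if a: "a \<in> W" for a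
  proof -
    have "cavg s (\<lambda>z. - ln (cmod (blaschke r a z))) = cavg s (\<lambda>z. (ln (cmod (of_real (r ^ 2) - cnj a * z)) - ln r) - ln (cmod (z - a)))"
      using lnb[OF a] s0 by (intro cavg_cong) auto
    also have "\<dots> = cavg s (\<lambda>z. ln (cmod (of_real (r ^ 2) - cnj a * z))) - ln r - cavg s (\<lambda>z. ln (cmod (z - a)))"
      using cavg_diff[OF _ cont2[OF a], of "\<lambda>z. ln (cmod (of_real (r ^ 2) - cnj a * z)) - ln r"]
        cavg_diff[OF cont1[OF a], of "\<lambda>_. ln r"] cont1[OF a] s0
      by (simp add: continuous_on_diff)
    also have "cavg s (\<lambda>z. ln (cmod (of_real (r ^ 2) - cnj a * z))) = ln (cmod (of_real (r ^ 2)))"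
    proof (rule cavg_log_affine)
      have "cmod a * s < r * r" using a sr s0 by (intro mult_strict_mono) (auto simp: W_def)
      then show "cmod (cnj a) * s < cmod (of_real (r ^ 2))" by (simp only: norm_of_real complex_mod_cnj) (simp add: power2_eq_square)
    qed fact
    also have "\<dots> = 2 * ln r" using r0 by (simp add: norm_power ln_realpow)
    also have "cavg s (\<lambda>z. ln (cmod (z - a))) = ln (max s (cmod a))"
      using Ws[OF a] s0 by (rule cavg_log_linear)
    finally show ?thesis by simp
  qed
  define u where "u z = cavg r (\<lambda>\<zeta>. pkernel r z \<zeta> * logplus (cmod (f \<zeta>)))" for z
  have cl: "continuous_on (sphere 0 r) (\<lambda>z. logplus (cmod (f z)))" by (intro anrad_logplus goodrad_anrad r)
  have cu: "continuous_on (sphere 0 s) u" unfolding u_def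
    by (rule cavg_poisson(2)[OF cl]) (use s0 sr in auto)
  have "proxim f s \<le> cavg s (\<lambda>z. u z + (\<Sum>a\<in>W. polem f a * - ln (cmod (blaschke r a z))))"
    unfolding proxim_cavg
  proof (rule cavg_mono)
    show "continuous_on (sphere 0 s) (\<lambda>z. logplus (cmod (f z)))" by (intro anrad_logplus goodrad_anrad s)
    show "continuous_on (sphere 0 s) (\<lambda>z. u z + (\<Sum>a\<in>W. polem f a * - ln (cmod (blaschke r a z))))"
      by (intro continuous_intros cu cont)
    fix z assume "cmod z = s"
    then show "logplus (cmod (f z)) \<le> u z + (\<Sum>a\<in>W. polem f a * - ln (cmod (blaschke r a z)))"
      unfolding u_def W_def using sr s by (intro poisson_jensen_ineq[OF f r]) (auto simp: goodrad_def goodpt_def)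
  qed (use s0 in simp)
  also have "\<dots> = cavg s u + (\<Sum>a\<in>W. polem f a * (ln r - ln (max s (cmod a))))"
  proof -
    have c: "continuous_on (sphere 0 s) (\<lambda>z. polem f a * - ln (cmod (blaschke r a z)))" if "a \<in> W" for a
      by (intro continuous_intros cont that)
    have "cavg s (\<lambda>z. u z + (\<Sum>a\<in>W. polem f a * - ln (cmod (blaschke r a z))))
       = cavg s u + cavg s (\<lambda>z. \<Sum>a\<in>W. polem f a * - ln (cmod (blaschke r a z)))"
      using s0 by (intro cavg_add cu continuous_on_sum c) auto
    also have "cavg s (\<lambda>z. \<Sum>a\<in>W. polem f a * - ln (cmod (blaschke r a z)))
       = (\<Sum>a\<in>W. cavg s (\<lambda>z. polem f a * - ln (cmod (blaschke r a z))))"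
      using s0 by (intro cavg_sum finW c) auto
    also have "\<dots> = (\<Sum>a\<in>W. polem f a * (ln r - ln (max s (cmod a))))"
      by (intro sum.cong refl) (simp only: cavg_cmult avg)
    finally show ?thesis .
  qed
  also have "cavg s u = proxim f r" unfolding u_def proxim_cavg
    by (rule cavg_poisson(1)[OF cl]) (use s0 sr in auto)
  finally have m: "proxim f s \<le> proxim f r + (\<Sum>a\<in>W. polem f a * (ln r - ln (max s (cmod a))))" .
  have cr: "cnt (polem f) r = (\<Sum>a\<in>W - {0}. polem f a * ln (r / cmod a)) + polem f 0 * ln r"
  proof (rule cnt_superset)
    fix z assume z: "0 < cmod z" "cmod z \<le> r" "polem f z \<noteq> 0"
    then have "cmod z \<noteq> r" using goodrad_not_S[OF f r] by (auto simp: polem_def)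
    then show "z \<in> W - {0}" using z by (auto simp: W_def polem_def)
  qed (use finW in \<open>auto simp: W_def\<close>)
  have cs: "cnt (polem f) s = (\<Sum>a\<in>(W - {0}) \<inter> {a. cmod a < s}. polem f a * ln (s / cmod a)) + polem f 0 * ln s"
  proof (rule cnt_superset)
    fix z assume z: "0 < cmod z" "cmod z \<le> s" "polem f z \<noteq> 0"
    then have "cmod z \<noteq> s" using goodrad_not_S[OF f s] by (auto simp: polem_def)
    then show "z \<in> (W - {0}) \<inter> {a. cmod a < s}" using z sr by (auto simp: W_def polem_def)
  qed (use finW in \<open>auto simp: W_def\<close>)
  also have "(\<Sum>a\<in>(W - {0}) \<inter> {a. cmod a < s}. polem f a * ln (s / cmod a)) = (\<Sum>a\<in>W - {0}. polem f a * ln (max s (cmod a) / cmod a))"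
    using finW by (intro sum.mono_neutral_cong_left) (auto simp: max_def)
  finally have cs': "cnt (polem f) s = (\<Sum>a\<in>W - {0}. polem f a * ln (max s (cmod a) / cmod a)) + polem f 0 * ln s" .
  have "(\<Sum>a\<in>W. polem f a * (ln r - ln (max s (cmod a))))
      = polem f 0 * (ln r - ln s) + (\<Sum>a\<in>W - {0}. polem f a * (ln r - ln (max s (cmod a))))"
  proof (cases "0 \<in> W")
    case True then show ?thesis using finW s0 by (subst sum.remove[of _ 0]) auto
  next
    case False
    then have "polem f 0 = 0" using r0 by (auto simp: W_def polem_def)
    then show ?thesis using False by simp
  qed
  also have "(\<Sum>a\<in>W - {0}. polem f a * (ln r - ln (max s (cmod a))))
     = (\<Sum>a\<in>W - {0}. polem f a * ln (r / cmod a) - polem f a * ln (max s (cmod a) / cmod a))"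
    using r0 s0 by (intro sum.cong refl) (auto simp: ln_div algebra_simps max_def)
  finally have "(\<Sum>a\<in>W. polem f a * (ln r - ln (max s (cmod a)))) = cnt (polem f) r - cnt (polem f) s"
    by (simp add: cr cs' sum_subtractf algebra_simps)
  then show ?thesis using m r0 s0 by (simp add: nev_T_eq[OF fm])
qed

subsection \<open>The filter of radii outside sets of finite measure\<close>

text \<open>Truth for all large radii outside some set of finite measure. As a filter it merges
  finitely many exceptional sets silently, so none of them has to be carried through the
  estimates.\<close>

definition nevF :: "real filter" where
  "nevF = Abs_filter (\<lambda>P. \<exists>E\<in>lmeasurable. \<exists>R. \<forall>r\<ge>R. r \<notin> E \<longrightarrow> P r)"

lemma eventually_nevF:
  "eventually P nevF \<longleftrightarrow> (\<exists>E\<in>lmeasurable. \<exists>R. \<forall>r\<ge>R. r \<notin> E \<longrightarrow> P r)"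
  unfolding nevF_def
proof (rule eventually_Abs_filter, unfold_locales)
  show "\<exists>E\<in>lmeasurable. \<exists>R. \<forall>r\<ge>R. r \<notin> E \<longrightarrow> True" by (intro bexI[of _ "{}"]) auto
next
  fix P Q :: "real \<Rightarrow> bool"
  assume "\<exists>E\<in>lmeasurable. \<exists>R. \<forall>r\<ge>R. r \<notin> E \<longrightarrow> P r" "\<exists>E\<in>lmeasurable. \<exists>R. \<forall>r\<ge>R. r \<notin> E \<longrightarrow> Q r"
  then obtain E R E' R' where "E \<in> lmeasurable" "\<forall>r\<ge>R. r \<notin> E \<longrightarrow> P r" "E' \<in> lmeasurable" "\<forall>r\<ge>R'. r \<notin> E' \<longrightarrow> Q r"
    by blast
  then show "\<exists>E\<in>lmeasurable. \<exists>R. \<forall>r\<ge>R. r \<notin> E \<longrightarrow> P r \<and> Q r"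
    by (intro bexI[of _ "E \<union> E'"] exI[of _ "max R R'"]) (auto intro: fmeasurable.Un)
next
  fix P Q :: "real \<Rightarrow> bool"
  assume "\<forall>x. P x \<longrightarrow> Q x" "\<exists>E\<in>lmeasurable. \<exists>R. \<forall>r\<ge>R. r \<notin> E \<longrightarrow> P r"
  then show "\<exists>E\<in>lmeasurable. \<exists>R. \<forall>r\<ge>R. r \<notin> E \<longrightarrow> Q r" by blast
qed

lemma nevF_ge: "eventually (\<lambda>r. r \<ge> R) nevF"
  unfolding eventually_nevF by (intro bexI[of _ "{}"]) auto

lemma nevF_avoid: "E \<in> lmeasurable \<Longrightarrow> eventually (\<lambda>r. r \<notin> E) nevF"
  unfolding eventually_nevF by blast

text \<open>A set of finite measure cannot contain a half-line. This is what turns an estimate that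
  is eventually absurd into a contradiction.\<close>

lemma nevF_neq_bot: "nevF \<noteq> bot"
proof
  assume "nevF = bot"
  then have "eventually (\<lambda>_. False) nevF" by simp
  then obtain E :: "real set" and R where E: "E \<in> lmeasurable" "\<forall>r\<ge>R. r \<notin> E \<longrightarrow> False"
    unfolding eventually_nevF by blast
  define n where "n = measure lebesgue E + 1"
  have n: "n \<ge> 0" by (simp add: n_def)
  have "measure lebesgue {R..R + n} \<le> measure lebesgue E"
    by (rule measure_mono_fmeasurable) (use E in auto)
  moreover have "measure lebesgue {R..R + n} = n" using n by simp
  ultimately show False by (simp add: n_def)
qed

lemma nevF_countable: "countable B \<Longrightarrow> eventually (\<lambda>r. r \<notin> B) nevF"
proof -
  assume "countable B"
  then have "B \<in> null_sets lebesgue" by (intro null_sets_completionI countable_imp_null_set_lborel)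
  then have "B \<in> lmeasurable" by (rule fmeasurableI_null_sets)
  then show ?thesis by (rule nevF_avoid)
qed

lemma countable_bad_radii:
  assumes "eventually P (cosparse (UNIV :: complex set))"
  shows "countable (cmod ` {z. \<not> P z})"
proof -
  have "{z. \<not> P z} sparse_in UNIV" using assms by (simp add: eventually_cosparse)
  then have "countable {z. \<not> P z}" using sparse_imp_countable[of UNIV "{z. \<not> P z}"] by simp
  then show ?thesis by simp
qed

lemma nevF_cosparse:
  assumes "eventually P (cosparse (UNIV :: complex set))"
  shows "eventually (\<lambda>r. \<forall>z. cmod z = r \<longrightarrow> P z) nevF"
  using nevF_countable[OF countable_bad_radii[OF assms]] by (rule eventually_mono) blast

lemma nevF_goodrad: "mnz f \<Longrightarrow> eventually (goodrad f) nevF"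
  using eventually_conj[OF nevF_cosparse[OF goodpt_cosparse] nevF_ge[of 1]]
  by (rule eventually_mono) (auto simp: goodrad_def)

lemma nevF_anrad: "f meromorphic_on UNIV \<Longrightarrow> eventually (anrad f) nevF"
  using eventually_conj[OF nevF_cosparse[OF meromorphic_on_imp_analytic_cosparse] nevF_ge[of 1]]
  by (rule eventually_mono) (auto simp: anrad_def)

lemma goodrad_between:
  assumes "mnz f" "0 \<le> a" "a < b"
  obtains r where "goodrad f r" "a < r" "r < b"
proof -
  have "uncountable ({a<..<b} - cmod ` {z. \<not> goodpt f z})"
    using countable_bad_radii[OF goodpt_cosparse[OF assms(1)]] assms(3)
    by (intro uncountable_minus_countable) (auto simp: uncountable_open_interval)
  then have "{a<..<b} - cmod ` {z. \<not> goodpt f z} \<noteq> {}" using countable_empty by metis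
  then obtain r where "r \<in> {a<..<b}" "r \<notin> cmod ` {z. \<not> goodpt f z}" by blast
  then show ?thesis using that[of r] assms by (auto simp: goodrad_def)
qed

subsection \<open>First main theorem\<close>

lemma zerom_inverse: "mnz f \<Longrightarrow> polem (\<lambda>z. inverse (f z)) = zerom f"
  by (rule ext) (simp add: polem_def zerom_def ordm_inverse)

lemma goodrad_inverse: "goodrad f r \<Longrightarrow> goodrad (\<lambda>z. inverse (f z)) r"
  unfolding goodrad_def goodpt_def by (auto intro!: analytic_on_inverse)

lemma proxim_ln:
  assumes "goodrad f r"
  shows "cavg r (\<lambda>z. ln (cmod (f z))) = proxim f r - proxim (\<lambda>z. inverse (f z)) r"
    and "cavg r (\<lambda>z. \<bar>ln (cmod (f z))\<bar>) = proxim f r + proxim (\<lambda>z. inverse (f z)) r"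
proof -
  have r: "r > 0" using assms by (simp add: goodrad_def)
  have c: "continuous_on (sphere 0 r) (\<lambda>z. logplus (cmod (f z)))"
    "continuous_on (sphere 0 r) (\<lambda>z. logplus (cmod (inverse (f z))))"
    using anrad_logplus goodrad_anrad assms goodrad_inverse by blast+
  have p: "cmod (f z) > 0" if "cmod z = r" for z using assms that by (auto simp: goodrad_def goodpt_def)
  have "ln (cmod (f z)) = logplus (cmod (f z)) - logplus (cmod (inverse (f z)))"
    "\<bar>ln (cmod (f z))\<bar> = logplus (cmod (f z)) + logplus (cmod (inverse (f z)))" if "cmod z = r" for z
    using p[OF that] by (auto simp: logplus_alt norm_inverse ln_inverse max_def)
  then have "cavg r (\<lambda>z. ln (cmod (f z))) = cavg r (\<lambda>z. logplus (cmod (f z)) - logplus (cmod (inverse (f z))))"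
    "cavg r (\<lambda>z. \<bar>ln (cmod (f z))\<bar>) = cavg r (\<lambda>z. logplus (cmod (f z)) + logplus (cmod (inverse (f z))))"
    using r by (auto intro!: cavg_cong)
  then show "cavg r (\<lambda>z. ln (cmod (f z))) = proxim f r - proxim (\<lambda>z. inverse (f z)) r"
    "cavg r (\<lambda>z. \<bar>ln (cmod (f z))\<bar>) = proxim f r + proxim (\<lambda>z. inverse (f z)) r"
    using c r by (simp_all add: cavg_diff cavg_add proxim_cavg)
qed

lemma first_main_theorem:
  assumes "mnz f" "goodrad f r"
  shows "nev_T (\<lambda>z. inverse (f z)) r = nev_T f r - ln (cmod (lcoef f))"
proof -
  have r: "r > 0" using assms by (simp add: goodrad_def)
  have "cnt (\<lambda>z. real_of_int (ordm f z)) r = cnt (zerom f) r - cnt (polem f) r"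
    unfolding ordm_split using assms by (intro cnt_diff locfin_zerom locfin_polem mnz_mero)
  then show ?thesis
    using jensen[OF assms] proxim_ln(1)[OF assms(2)] r assms(1)
    by (simp add: nev_T_eq mnz_mero mnz_inverse zerom_inverse)
qed

lemma proxim_nonneg: "r \<ge> 0 \<Longrightarrow> proxim f r \<ge> 0"
  unfolding proxim_cavg by (intro cavg_nonneg) auto

lemma cnt_polem_le_T: "f meromorphic_on UNIV \<Longrightarrow> r \<ge> 1 \<Longrightarrow> cnt (polem f) r \<le> nev_T f r"
  using proxim_nonneg[of r f] by (simp add: nev_T_eq)

lemma proxim_le_T: "f meromorphic_on UNIV \<Longrightarrow> r \<ge> 1 \<Longrightarrow> proxim f r \<le> nev_T f r"
  using cnt_nonneg[of "polem f" r] by (simp add: nev_T_eq)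

lemma nev_T_nonneg: "f meromorphic_on UNIV \<Longrightarrow> r \<ge> 1 \<Longrightarrow> nev_T f r \<ge> 0"
  using proxim_le_T[of f r] proxim_nonneg[of r f] by simp

subsection \<open>The lemma on the logarithmic derivative\<close>

lemma blaschke_powi_deriv:
  assumes "finite W" "\<And>a. a \<in> W \<Longrightarrow> cmod a < r \<and> a \<noteq> z" "cmod z < r"
  shows "((\<lambda>w. \<Prod>a\<in>W. blaschke r a w powi n a) has_field_derivative
    (\<Prod>a\<in>W. blaschke r a z powi n a) * (\<Sum>a\<in>W. of_int (n a) * (1 / (z - a) + cnj a / (of_real (r ^ 2) - cnj a * z)))) (at z)"
  using assms
proof (induction W)
  case (insert b W)
  have d: "of_real (r ^ 2) - cnj b * z \<noteq> 0" by (rule cnj_denominator_nz) (use insert in auto)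
  have zb: "z - b \<noteq> 0" using insert by auto
  have r: "r > 0" using insert.prems(2) by (auto intro: le_less_trans[of 0 "cmod z"])
  have nz: "blaschke r b z \<noteq> 0" using insert by (intro blaschke_nz) auto
  have "(blaschke r b has_field_derivative
     (of_real r * (of_real (r ^ 2) - cnj b * z) - of_real r * (z - b) * (- cnj b)) / (of_real (r ^ 2) - cnj b * z) ^ 2) (at z)"
    unfolding blaschke_def using d by (auto intro!: derivative_eq_intros simp: power2_eq_square)
  also have "(of_real r * (of_real (r ^ 2) - cnj b * z) - of_real r * (z - b) * (- cnj b)) / (of_real (r ^ 2) - cnj b * z) ^ 2
     = blaschke r b z * (1 / (z - b) + cnj b / (of_real (r ^ 2) - cnj b * z))"
  proof -
    have "(of_real r * D - of_real r * u * (- c)) / D ^ 2 = of_real r * u / D * (1 / u + c / D)"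
      if "D \<noteq> 0" "u \<noteq> 0" for D u c :: complex
      using that by (simp add: add_divide_distrib ring_distribs power2_eq_square)
    from this[OF d zb] show ?thesis unfolding blaschke_def .
  qed
  finally have D1: "(blaschke r b has_field_derivative blaschke r b z * (1 / (z - b) + cnj b / (of_real (r ^ 2) - cnj b * z))) (at z)" .
  have "((\<lambda>w. blaschke r b w powi n b) has_field_derivative
     of_int (n b) * blaschke r b z powi (n b - 1) * (blaschke r b z * (1 / (z - b) + cnj b / (of_real (r ^ 2) - cnj b * z)))) (at z)"
    by (rule derivative_eq_intros D1 nz | simp add: nz)+
  then have D2: "((\<lambda>w. blaschke r b w powi n b) has_field_derivative
     blaschke r b z powi n b * (of_int (n b) * (1 / (z - b) + cnj b / (of_real (r ^ 2) - cnj b * z)))) (at z)"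
    using nz by (simp add: power_int_diff mult_ac)
  have IH: "((\<lambda>w. \<Prod>a\<in>W. blaschke r a w powi n a) has_field_derivative
    (\<Prod>a\<in>W. blaschke r a z powi n a) * (\<Sum>a\<in>W. of_int (n a) * (1 / (z - a) + cnj a / (of_real (r ^ 2) - cnj a * z)))) (at z)"
    using insert by auto
  from DERIV_mult[OF D2 IH] show ?case using insert by (simp add: algebra_simps)
qed simp

text \<open>The factorisation is differentiated logarithmically. The zero-free part is controlled by
  the boundary mean of its real part, which equals \<open>ln (cmod f)\<close> on the circle; each
  Blaschke factor contributes a pole at its zero and one at the mirror image.\<close>

lemma log_derivative_bound:
  assumes f: "mnz f" and R: "goodrad f R" and z: "cmod z < R" "goodpt f z"
  defines "S \<equiv> {a. cmod a < R \<and> ordm f a \<noteq> 0}"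
  shows "cmod (deriv f z / f z) \<le> 2 * R * cavg R (\<lambda>\<zeta>. \<bar>ln (cmod (f \<zeta>))\<bar>) / (R - cmod z) ^ 2
     + (\<Sum>a\<in>S. \<bar>real_of_int (ordm f a)\<bar> * (1 / cmod (z - a) + 1 / (R - cmod z)))"
proof -
  have R0: "R > 0" using R by (simp add: goodrad_def)
  obtain h A where A: "open A" "cball 0 R \<subseteq> A" "h holomorphic_on A" and
      eq0: "\<forall>z. cmod z \<le> R \<longrightarrow> f analytic_on {z} \<longrightarrow> z \<notin> S \<longrightarrow>
         f z = exp (h z) * (\<Prod>a\<in>S. blaschke R a z powi ordm f a)"
    using factorization(2)[OF f R, folded S_def] by blast
  have finS: "finite S" unfolding S_def by (rule factorization(1)[OF f R])
  have zS: "z \<notin> S" using ordm_goodpt[OF f z(2)] by (simp add: S_def)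
  define F where "F w = exp (h w) * (\<Prod>a\<in>S. blaschke R a w powi ordm f a)" for w
  have "\<forall>\<^sub>F w in nhds z. w \<in> {w. goodpt f w} \<inter> ball 0 R"
    using z by (intro eventually_nhds_in_open open_Int open_goodpt[OF f]) auto
  then have ev: "\<forall>\<^sub>F w in nhds z. f w = F w"
  proof (rule eventually_mono)
    fix w assume w: "w \<in> {w. goodpt f w} \<inter> ball 0 R"
    then have "w \<notin> S" using ordm_goodpt[OF f] by (auto simp: S_def)
    then show "f w = F w" using eq0 w by (auto simp: F_def goodpt_def)
  qed
  then have fz: "f z = F z" by (rule eventually_nhds_x_imp_x)
  define L where "L = (\<Sum>a\<in>S. of_int (ordm f a) * (1 / (z - a) + cnj a / (of_real (R ^ 2) - cnj a * z)))"
  have zA: "z \<in> A" using A z by auto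
  have "((\<lambda>w. exp (h w)) has_field_derivative exp (h z) * deriv h z) (at z)"
    by (rule DERIV_fun_exp) (use A zA holomorphic_derivI in blast)
  from DERIV_mult[OF this blaschke_powi_deriv[OF finS, of R z "ordm f"]]
  have "(F has_field_derivative F z * (deriv h z + L)) (at z)"
    using zS z by (auto simp: F_def[abs_def] L_def S_def algebra_simps)
  then have "deriv F z = F z * (deriv h z + L)" by (rule DERIV_imp_deriv)
  moreover have "deriv f z = deriv F z" by (rule deriv_cong_ev[OF ev refl])
  moreover have "F z \<noteq> 0" using z fz by (simp add: goodpt_def)
  ultimately have "deriv f z / f z = deriv h z + L" by (simp add: fz)
  then have "cmod (deriv f z / f z) \<le> cmod (deriv h z) + cmod L" by (simp add: norm_triangle_ineq)
  also have "cmod (deriv h z) \<le> 2 * R * cavg R (\<lambda>\<zeta>. \<bar>Re (h \<zeta>)\<bar>) / (R - cmod z) ^ 2"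
    by (rule deriv_bound_by_Re) (use A z in auto)
  also have "cavg R (\<lambda>\<zeta>. \<bar>Re (h \<zeta>)\<bar>) = cavg R (\<lambda>\<zeta>. \<bar>ln (cmod (f \<zeta>))\<bar>)"
  proof (rule cavg_cong)
    fix \<zeta> assume \<zeta>: "cmod \<zeta> = R"
    then have "goodpt f \<zeta>" using R by (simp add: goodrad_def)
    then have "f \<zeta> = exp (h \<zeta>) * (\<Prod>a\<in>S. blaschke R a \<zeta> powi ordm f a)"
      using \<zeta> eq0 by (auto simp: goodpt_def S_def)
    from factor_norm_sphere[where h = h, OF S_def[THEN meta_eq_to_obj_eq] \<zeta> this]
    show "\<bar>Re (h \<zeta>)\<bar> = \<bar>ln (cmod (f \<zeta>))\<bar>" by simp
  qed (use R0 in simp)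
  also have "cmod L \<le> (\<Sum>a\<in>S. \<bar>real_of_int (ordm f a)\<bar> * (1 / cmod (z - a) + 1 / (R - cmod z)))"
    unfolding L_def
  proof (rule sum_norm_le)
    fix a assume a: "a \<in> S"
    have d: "of_real (R ^ 2) - cnj a * z \<noteq> 0" by (rule cnj_denominator_nz) (use a z in \<open>auto simp: S_def\<close>)
    have "cmod (cnj a / (of_real (R ^ 2) - cnj a * z)) \<le> 1 / (R - cmod z)"
    proof -
      have "cmod a * (R - cmod z) \<le> R * R - cmod a * cmod z"
        using a z R0 mult_right_mono[of "cmod a" R R] by (simp add: S_def algebra_simps)
      also have "\<dots> \<le> cmod (of_real (R ^ 2) - cnj a * z)"
        using norm_triangle_ineq2[of "of_real (R ^ 2)" "cnj a * z"]
        by (simp add: norm_mult norm_power power2_eq_square)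
      finally show ?thesis using d z by (simp add: norm_divide divide_simps mult.commute)
    qed
    then have "cmod (1 / (z - a) + cnj a / (of_real (R ^ 2) - cnj a * z)) \<le> 1 / cmod (z - a) + 1 / (R - cmod z)"
      using norm_triangle_ineq[of "1 / (z - a)" "cnj a / (of_real (R ^ 2) - cnj a * z)"] by (simp add: norm_divide)
    then show "cmod (of_int (ordm f a) * (1 / (z - a) + cnj a / (of_real (R ^ 2) - cnj a * z)))
       \<le> \<bar>real_of_int (ordm f a)\<bar> * (1 / cmod (z - a) + 1 / (R - cmod z))"
      unfolding norm_mult by (simp add: mult_left_mono)
  qed
  finally show ?thesis by simp
qed

lemma interval_union_lmeasurable:
  fixes x d :: "nat \<Rightarrow> real"
  assumes "summable d" "\<And>k. d k \<ge> 0"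
  shows "(\<Union>k. {x k - d k..x k + d k}) \<in> lmeasurable"
proof (rule fmeasurableI)
  show "(\<Union>k. {x k - d k..x k + d k}) \<in> sets lebesgue" by auto
  have "emeasure lebesgue (\<Union>k. {x k - d k..x k + d k}) \<le> (\<Sum>k. emeasure lebesgue {x k - d k..x k + d k})"
    by (rule emeasure_subadditive_countably) auto
  also have "\<dots> = (\<Sum>k. ennreal (2 * d k))" using assms by (intro suminf_cong) auto
  also have "\<dots> = ennreal (\<Sum>k. 2 * d k)" using assms by (intro suminf_ennreal2) (auto intro: summable_mult)
  also have "\<dots> < \<infinity>" by simp
  finally show "emeasure lebesgue (\<Union>k. {x k - d k..x k + d k}) < \<infinity>" .
qed

text \<open>Two exceptional radii at which \<open>\<phi>\<close> takes values in the same dyadic interval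
  \<open>[2^k, 2^(k+1))\<close> differ by less than \<open>2^(-k)\<close>; no continuity is needed.\<close>
lemma borel_growth:
  fixes \<phi> :: "real \<Rightarrow> real"
  assumes mono: "\<And>x y. 1 \<le> x \<Longrightarrow> x \<le> y \<Longrightarrow> \<phi> x \<le> \<phi> y" and ge1: "\<And>x. 1 \<le> x \<Longrightarrow> \<phi> x \<ge> 1"
  shows "eventually (\<lambda>r. \<phi> (r + 1 / \<phi> r) \<le> 2 * \<phi> r) nevF"
proof -
  define B where "B k = {r. r \<ge> 1 \<and> \<phi> (r + 1 / \<phi> r) > 2 * \<phi> r \<and> 2 ^ k \<le> \<phi> r \<and> \<phi> r < 2 ^ Suc k}" for k :: nat
  define x where "x k = (SOME y. y \<in> B k)" for k
  have close: "\<bar>r - s\<bar> \<le> (1/2) ^ k" if "r \<in> B k" "s \<in> B k" for r s k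
  proof -
    have aux: "t \<le> u + (1/2) ^ k" if t: "t \<in> B k" and u: "u \<in> B k" for t u
    proof (rule ccontr)
      assume "\<not> t \<le> u + (1/2) ^ k"
      have pu: "\<phi> u \<ge> 2 ^ k" "u \<ge> 1" using u by (auto simp: B_def)
      have pos: "\<phi> u > 0" using pu by (auto intro: less_le_trans[of 0 "2 ^ k"])
      have "1 / \<phi> u \<le> 1 / 2 ^ k" using pu pos by (intro divide_left_mono) auto
      also have "\<dots> = (1/2) ^ k" by (simp add: power_divide)
      finally have "u + 1 / \<phi> u \<le> t" using \<open>\<not> t \<le> u + (1/2) ^ k\<close> by linarith
      then have "\<phi> (u + 1 / \<phi> u) \<le> \<phi> t" using pu pos by (intro mono) (auto intro: order.trans[of 1 u])
      then have "2 * \<phi> u < \<phi> t" using u by (auto simp: B_def)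
      then show False using t pu by (auto simp: B_def)
    qed
    show ?thesis using aux[OF that] aux[OF that(2) that(1)] by linarith
  qed
  have "(\<Union>k. {x k - (1/2) ^ k..x k + (1/2) ^ k}) \<in> lmeasurable"
    by (intro interval_union_lmeasurable) (auto intro: summable_geometric)
  then show ?thesis unfolding eventually_nevF
  proof (intro bexI exI[of _ 1] allI impI)
    fix r :: real assume r: "r \<ge> 1" "r \<notin> (\<Union>k. {x k - (1/2) ^ k..x k + (1/2) ^ k})"
    show "\<phi> (r + 1 / \<phi> r) \<le> 2 * \<phi> r"
    proof (rule ccontr)
      assume nle: "\<not> \<phi> (r + 1 / \<phi> r) \<le> 2 * \<phi> r"
      define k where "k = nat \<lfloor>log 2 (\<phi> r)\<rfloor>"
      have p1: "\<phi> r \<ge> 1" using ge1 r by simp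
      then have l0: "log 2 (\<phi> r) \<ge> 0" by simp
      then have fl: "real k \<le> log 2 (\<phi> r)" "log 2 (\<phi> r) < real (Suc k)"
        unfolding k_def by linarith+
      have "2 powr real k \<le> \<phi> r" using fl p1 by (subst (asm) le_log_iff) auto
      moreover have "\<phi> r < 2 powr real (Suc k)" using fl p1 by (subst (asm) log_less_iff) auto
      ultimately have "r \<in> B k" using r nle unfolding B_def
        by (simp add: powr_realpow[symmetric] powr_add)
      moreover from this have "x k \<in> B k" unfolding x_def by (rule someI)
      ultimately have "\<bar>r - x k\<bar> \<le> (1/2) ^ k" by (rule close)
      then have "r \<in> {x k - (1/2) ^ k..x k + (1/2) ^ k}" by (auto simp: abs_le_iff algebra_simps)
      then show False using r by blast
    qed
  qed
qed

lemma nevF_far_from_divisor: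
  assumes f: "mnz f"
  shows "eventually (\<lambda>r. \<forall>a. ordm f a \<noteq> 0 \<longrightarrow>
     1 / real (card {b. cmod b \<le> cmod a \<and> ordm f b \<noteq> 0}) ^ 2 \<le> \<bar>r - cmod a\<bar>) nevF"
proof -
  define N where "N t = card {b. cmod b \<le> t \<and> ordm f b \<noteq> 0}" for t
  define B where "B i = {t. \<exists>a. t = cmod a \<and> ordm f a \<noteq> 0 \<and> N t = i}" for i
  define x where "x i = (SOME t. t \<in> B i)" for i
  have N_strict: "N s < N t" if "s < t" "t = cmod a" "ordm f a \<noteq> 0" for s t a
    unfolding N_def
  proof (rule psubset_card_mono)
    have "a \<in> {b. cmod b \<le> t \<and> ordm f b \<noteq> 0}" "a \<notin> {b. cmod b \<le> s \<and> ordm f b \<noteq> 0}"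
      using that by auto
    then show "{b. cmod b \<le> s \<and> ordm f b \<noteq> 0} \<subset> {b. cmod b \<le> t \<and> ordm f b \<noteq> 0}"
      using that by force
  qed (rule finite_ordm[OF f])
  have Beq: "s = t" if st: "s \<in> B i" "t \<in> B i" for s t i
  proof -
    obtain a b where "s = cmod a" "ordm f a \<noteq> 0" "N s = i" "t = cmod b" "ordm f b \<noteq> 0" "N t = i"
      using st unfolding B_def by blast
    then show ?thesis using N_strict[of s t b] N_strict[of t s a] by (cases s t rule: linorder_cases) auto
  qed
  define d where "d i = 1 / real i ^ 2" for i
  have "summable d" unfolding d_def using inverse_power_summable[of 2] by (simp add: field_simps)
  then have "(\<Union>i. {x i - d i..x i + d i}) \<in> lmeasurable"
    by (rule interval_union_lmeasurable) (simp add: d_def)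
  from nevF_avoid[OF this] show ?thesis
  proof (rule eventually_mono, intro allI impI)
    fix r a assume r: "r \<notin> (\<Union>i. {x i - d i..x i + d i})" and a: "ordm f a \<noteq> 0"
    define i where "i = N (cmod a)"
    have aB: "cmod a \<in> B i" using a by (auto simp: B_def i_def)
    then have "x i \<in> B i" unfolding x_def by (rule someI)
    then have "x i = cmod a" using Beq aB by blast
    moreover have "r \<notin> {x i - d i..x i + d i}" using r by blast
    ultimately have "\<not> \<bar>r - cmod a\<bar> \<le> d i" by (auto simp: abs_le_iff algebra_simps)
    then show "1 / real (card {b. cmod b \<le> cmod a \<and> ordm f b \<noteq> 0}) ^ 2 \<le> \<bar>r - cmod a\<bar>"
      by (simp add: d_def i_def N_def)
  qed
qed

text \<open>In the counting function at \<open>R'\<close> every zero or pole of modulus below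
  \<open>R\<close> has weight at least \<open>ln (R' / R)\<close>, which is at least
  \<open>(R' - R) / R'\<close>.\<close>

lemma divisor_count_bound:
  assumes f: "mnz f" and R': "goodrad f R'" and R: "1 \<le> R" "R < R'"
  shows "(\<Sum>a | cmod a < R \<and> ordm f a \<noteq> 0. \<bar>real_of_int (ordm f a)\<bar>) * ((R' - R) / R')
     \<le> 2 * nev_T f R' + \<bar>ln (cmod (lcoef f))\<bar>"
proof -
  define D where "D z = zerom f z + polem f z" for z
  have D: "D z = \<bar>real_of_int (ordm f z)\<bar>" for z by (simp add: D_def zerom_def polem_def)
  have fm: "f meromorphic_on UNIV" using f by (rule mnz_mero)
  have "cnt D R' = cnt (zerom f) R' + cnt (polem f) R'"
    unfolding D_def by (intro cnt_add locfin_zerom locfin_polem f fm)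
  also have "\<dots> \<le> nev_T (\<lambda>z. inverse (f z)) R' + nev_T f R'"
    using cnt_polem_le_T[of "\<lambda>z. inverse (f z)" R'] cnt_polem_le_T[OF fm, of R'] R f fm
    by (simp add: zerom_inverse mnz_mero mnz_inverse)
  also have "\<dots> \<le> 2 * nev_T f R' + \<bar>ln (cmod (lcoef f))\<bar>" using first_main_theorem[OF f R'] by simp
  finally have up: "cnt D R' \<le> 2 * nev_T f R' + \<bar>ln (cmod (lcoef f))\<bar>" .
  define q where "q = (R' - R) / R'"
  have q: "q \<le> ln (R' / R)"
  proof -
    have "ln (R / R') \<le> R / R' - 1" using R by (intro ln_le_minus_one) auto
    then show ?thesis using R by (simp add: q_def ln_div diff_divide_distrib)
  qed
  define V where "V = {a. cmod a < R \<and> ordm f a \<noteq> 0}"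
  define W where "W = {z. 0 < cmod z \<and> cmod z \<le> R' \<and> D z \<noteq> 0}"
  have finW: "finite W" unfolding W_def D_def by (intro locfin_finite locfin_add locfin_zerom locfin_polem f fm)
  have finV: "finite V" unfolding V_def by (rule finite_subset[OF _ finite_ordm[OF f, of R]]) auto
  have "(\<Sum>a\<in>V. D a) * q = D 0 * q + (\<Sum>a\<in>V - {0}. D a * q)"
  proof (cases "0 \<in> V")
    case True then show ?thesis using finV by (subst sum.remove[of _ 0]) (auto simp: sum_distrib_left algebra_simps)
  next
    case False
    then have "D 0 = 0" using R by (simp add: V_def D)
    then show ?thesis using False by (simp add: sum_distrib_right)
  qed
  also have "\<dots> \<le> D 0 * ln R' + (\<Sum>a\<in>V - {0}. D a * ln (R' / cmod a))"
  proof (intro add_mono sum_mono mult_left_mono)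
    have "ln (R' / R) \<le> ln R'" using R by (simp add: ln_div)
    then show "q \<le> ln R'" using q by simp
    fix a assume a: "a \<in> V - {0}"
    have "ln (R' / R) \<le> ln (R' / cmod a)" using a R by (auto simp: V_def ln_div)
    then show "q \<le> ln (R' / cmod a)" using q by simp
  qed (auto simp: D)
  also have "(\<Sum>a\<in>V - {0}. D a * ln (R' / cmod a)) \<le> (\<Sum>a\<in>W. D a * ln (R' / cmod a))"
    using finW R by (intro sum_mono2) (auto simp: V_def W_def D ln_ge_zero_iff divide_simps intro!: mult_nonneg_nonneg)
  finally have "(\<Sum>a\<in>V. D a) * q \<le> cnt D R'" by (simp add: cnt_def W_def)
  then show ?thesis using up by (simp add: V_def q_def D)
qed

lemma proxim_bound:
  assumes "anrad g r" "\<And>z. cmod z = r \<Longrightarrow> cmod (g z) \<le> M" "M \<ge> 1"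
  shows "proxim g r \<le> ln M"
proof -
  have r: "r > 0" using assms by (simp add: anrad_def)
  have "proxim g r \<le> cavg r (\<lambda>_. ln M)" unfolding proxim_cavg
  proof (intro cavg_mono anrad_logplus assms)
    fix z assume "cmod z = r"
    then have "max 1 (cmod (g z)) \<le> M" using assms by simp
    then have "ln (max 1 (cmod (g z))) \<le> ln M" by (intro ln_mono) auto
    then show "logplus (cmod (g z)) \<le> ln M" by (simp add: logplus_max)
  qed (use r in auto)
  then show ?thesis by simp
qed

lemma anrad_logderiv: "goodrad g r \<Longrightarrow> anrad (\<lambda>z. deriv g z / g z) r"
  unfolding goodrad_def goodpt_def anrad_def by (auto intro!: analytic_on_divide analytic_deriv)

theorem log_derivative_lemma:
  assumes g: "mnz g"
  shows "\<exists>C. eventually (\<lambda>r. proxim (\<lambda>z. deriv g z / g z) r \<le> C * (1 + ln r + ln (max 1 (nev_T g r)))) nevF"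
proof -
  have gm: "g meromorphic_on UNIV" using g by (rule mnz_mero)
  \<comment> \<open>The characteristic is known to increase only along good radii. The infimum over
    the good radii beyond \<open>r\<close> is monotone on all of the half-line and agrees with
    \<open>max 1 (nev_T g r)\<close> at good radii, so the growth lemma applies to it.\<close>
  define Q where "Q r = {max 1 (nev_T g s) | s. s \<ge> r \<and> goodrad g s}" for r
  define \<phi> where "\<phi> r = Inf (Q r)" for r
  have Qne: "Q r \<noteq> {}" if r0: "r \<ge> 0" for r
  proof -
    obtain s where "goodrad g s" "r < s" "s < r + 1" using goodrad_between[OF g r0, of "r + 1"] by auto
    then show ?thesis unfolding Q_def by (auto intro!: exI[of _ s])
  qed
  have Qbd: "bdd_below (Q r)" for r unfolding Q_def by (intro bdd_belowI[of _ 1]) auto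
  have phi1: "\<phi> r \<ge> 1" if "r \<ge> 1" for r
    unfolding \<phi>_def using Qne[of r] that by (intro cInf_greatest) (auto simp: Q_def)
  have phi_mono: "\<phi> x \<le> \<phi> y" if "1 \<le> x" "x \<le> y" for x y
    unfolding \<phi>_def using Qne[of y] Qbd that by (intro cInf_superset_mono) (auto simp: Q_def)
  have phi_good: "\<phi> r = max 1 (nev_T g r)" if "goodrad g r" for r
    unfolding \<phi>_def
  proof (rule cInf_eq_minimum)
    show "max 1 (nev_T g r) \<in> Q r" using that by (auto simp: Q_def)
    fix y assume "y \<in> Q r"
    then obtain s where s: "y = max 1 (nev_T g s)" "s \<ge> r" "goodrad g s" by (auto simp: Q_def)
    then have "nev_T g r \<le> nev_T g s" using nev_T_mono[OF g that s(3)] by (cases "r = s") auto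
    then show "max 1 (nev_T g r) \<le> y" using s by auto
  qed
  define c where "c = \<bar>ln (cmod (lcoef g))\<bar>"
  have c0: "c \<ge> 0" by (simp add: c_def)
  have "eventually (\<lambda>r. goodrad g r \<and> r \<ge> 2 \<and> \<phi> (r + 1 / \<phi> r) \<le> 2 * \<phi> r \<and>
     (\<forall>a. ordm g a \<noteq> 0 \<longrightarrow> 1 / real (card {b. cmod b \<le> cmod a \<and> ordm g b \<noteq> 0}) ^ 2 \<le> \<bar>r - cmod a\<bar>)) nevF"
    by (intro eventually_conj nevF_goodrad g nevF_ge nevF_far_from_divisor borel_growth phi_mono phi1)
  \<comment> \<open>The 9 is the exponent in the pointwise bound \<open>4 * Y ^ 9\<close>
    established below, and \<open>5 + c\<close> arises from bounding \<open>4 * U + c + 1\<close> by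
    \<open>(5 + c) * U\<close>.\<close>
  then have "eventually (\<lambda>r. proxim (\<lambda>z. deriv g z / g z) r
      \<le> (10 + 9 * ln (5 + c)) * (1 + ln r + ln (max 1 (nev_T g r)))) nevF"
  proof (rule eventually_mono)
    fix r assume A: "goodrad g r \<and> r \<ge> 2 \<and> \<phi> (r + 1 / \<phi> r) \<le> 2 * \<phi> r \<and>
     (\<forall>a. ordm g a \<noteq> 0 \<longrightarrow> 1 / real (card {b. cmod b \<le> cmod a \<and> ordm g b \<noteq> 0}) ^ 2 \<le> \<bar>r - cmod a\<bar>)"
    then have r: "goodrad g r" "r \<ge> 2" by auto
    define U where "U = \<phi> r"
    have U1: "U \<ge> 1" using phi1 r by (simp add: U_def)
    have U: "U = max 1 (nev_T g r)" using phi_good r by (simp add: U_def)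
    have iX: "1 / U \<le> 1" "0 < 1 / U" "1 / (2 * U) = 1 / U / 2" "1 / (4 * U) = 1 / U / 4" "3 / (4 * U) = 3 * (1 / U) / 4"
      using U1 by auto
    have iv: "0 \<le> r + 1 / (4 * U)" "r + 1 / (4 * U) < r + 1 / (2 * U)" "0 \<le> r + 3 / (4 * U)" "r + 3 / (4 * U) < r + 1 / U"
      using iX r by linarith+
    \<comment> \<open>Two good radii beyond \<open>r\<close>, both below \<open>r + 1 / U\<close>,
      so that the characteristic is at most \<open>2 * U\<close> at each. The gaps from
      \<open>r\<close> to \<open>R\<close> and from \<open>R\<close> to \<open>R'\<close> are at
      least \<open>1 / (4 * U)\<close>: the first serves the pointwise bound, the second the count
      of zeros and poles.\<close>
    obtain R where R: "goodrad g R" "r + 1 / (4 * U) < R" "R < r + 1 / (2 * U)"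
      by (rule goodrad_between[OF g iv(1,2)])
    obtain R' where R': "goodrad g R'" "r + 3 / (4 * U) < R'" "R' < r + 1 / U"
      by (rule goodrad_between[OF g iv(3,4)])
    have rR: "r < R" "R < R'" "R \<le> r + 1" "R' \<le> r + 1" "R - r \<ge> 1 / (4 * U)" "R' - R \<ge> 1 / (4 * U)"
      using R R' iX by linarith+
    have iR: "1 / (R - r) \<le> 4 * U"
    proof -
      have "1 / (R - r) \<le> 1 / (1 / (4 * U))"
        using rR(5) rR(1) U1 by (intro divide_left_mono mult_pos_pos) auto
      then show ?thesis by simp
    qed
    have T2: "nev_T g s \<le> 2 * U" if "goodrad g s" "r \<le> s" "s \<le> r + 1 / U" for s
    proof -
      have "nev_T g s \<le> \<phi> s" using phi_good[OF that(1)] by simp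
      also have "\<dots> \<le> \<phi> (r + 1 / U)" using that r by (intro phi_mono) auto
      also have "\<dots> \<le> 2 * U" using A by (simp add: U_def)
      finally show ?thesis .
    qed
    have TR: "nev_T g R \<le> 2 * U" "nev_T g R' \<le> 2 * U"
      using T2[OF R(1)] T2[OF R'(1)] R R' rR by linarith+
    define nn where "nn = (\<Sum>a | cmod a < R \<and> ordm g a \<noteq> 0. \<bar>real_of_int (ordm g a)\<bar>)"
    have nn0: "nn \<ge> 0" by (auto simp: nn_def intro: sum_nonneg)
    \<comment> \<open>One quantity that dominates \<open>r + 1\<close>, \<open>4 * U\<close> and
      \<open>4 * U + c\<close>. A crude power of it suffices, since only its logarithm enters the
      conclusion.\<close>
    define Y where "Y = (r + 1) * (4 * U + c + 1)"
    have Y: "Y \<ge> r + 1" "Y \<ge> 4 * U + c" "Y \<ge> 1" "Y \<ge> 4 * U" "Y \<ge> U"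
    proof -
      have "(r + 1) * 1 \<le> Y" unfolding Y_def using r U1 c0 by (intro mult_left_mono) auto
      moreover have "1 * (4 * U + c + 1) \<le> Y" unfolding Y_def using r U1 c0 by (intro mult_right_mono) auto
      ultimately show "Y \<ge> r + 1" "Y \<ge> 4 * U + c" "Y \<ge> 1" "Y \<ge> 4 * U" "Y \<ge> U" using r U1 c0 by auto
    qed
    have nnY: "nn \<le> Y ^ 3"
    proof -
      have "nn * ((R' - R) / R') \<le> 2 * nev_T g R' + c"
        unfolding nn_def c_def using rR r by (intro divisor_count_bound[OF g R'(1)]) auto
      then have 1: "nn * ((R' - R) / R') \<le> 4 * U + c" using TR by simp
      have "1 / (4 * U) / (r + 1) \<le> (R' - R) / R'"
        using rR r U1 by (intro frac_le) auto
      then have "nn * (1 / (4 * U) / (r + 1)) \<le> 4 * U + c"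
        using 1 nn0 mult_left_mono[of "1 / (4 * U) / (r + 1)" "(R' - R) / R'" nn] by linarith
      then have "nn / ((4 * U) * (r + 1)) \<le> 4 * U + c" by simp
      then have "nn \<le> (4 * U + c) * ((4 * U) * (r + 1))"
        using U1 r by (subst (asm) pos_divide_le_eq) auto
      also have "\<dots> \<le> Y * (Y * Y)"
        using Y U1 r c0 by (intro mult_mono) auto
      finally show ?thesis by (simp add: power3_eq_cube)
    qed
    have bound: "cmod (deriv g z / g z) \<le> 4 * Y ^ 9" if z: "cmod z = r" for z
    proof -
      have gz: "goodpt g z" using r z by (simp add: goodrad_def)
      define S where "S = {a. cmod a < R \<and> ordm g a \<noteq> 0}"
      have finS: "finite S" unfolding S_def by (rule finite_subset[OF _ finite_ordm[OF g, of R]]) auto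
      have mu: "cavg R (\<lambda>\<zeta>. \<bar>ln (cmod (g \<zeta>))\<bar>) \<le> 4 * U + c"
      proof -
        have "cavg R (\<lambda>\<zeta>. \<bar>ln (cmod (g \<zeta>))\<bar>) = proxim g R + proxim (\<lambda>z. inverse (g z)) R"
          by (rule proxim_ln(2)[OF R(1)])
        also have "\<dots> \<le> nev_T g R + nev_T (\<lambda>z. inverse (g z)) R"
          using rR r by (intro add_mono proxim_le_T gm mnz_mero mnz_inverse g) auto
        also have "\<dots> \<le> 2 * nev_T g R + c" using first_main_theorem[OF g R(1)] by (simp add: c_def)
        finally show ?thesis using TR by simp
      qed
      have mu0: "cavg R (\<lambda>\<zeta>. \<bar>ln (cmod (g \<zeta>))\<bar>) \<ge> 0" using rR r by (intro cavg_nonneg) auto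
      have "cmod (deriv g z / g z) \<le> 2 * R * cavg R (\<lambda>\<zeta>. \<bar>ln (cmod (g \<zeta>))\<bar>) / (R - cmod z) ^ 2
        + (\<Sum>a\<in>S. \<bar>real_of_int (ordm g a)\<bar> * (1 / cmod (z - a) + 1 / (R - cmod z)))"
        unfolding S_def using rR z by (intro log_derivative_bound[OF g R(1)] gz) auto
      also have "2 * R * cavg R (\<lambda>\<zeta>. \<bar>ln (cmod (g \<zeta>))\<bar>) / (R - cmod z) ^ 2 \<le> 2 * Y ^ 4"
      proof -
        have "(1 / (R - r)) ^ 2 \<le> (4 * U) ^ 2" using iR rR by (intro power_mono) auto
        also have "\<dots> \<le> Y ^ 2" using Y U1 by (intro power_mono) auto
        finally have i: "(1 / (R - r)) ^ 2 \<le> Y ^ 2" .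
        have "2 * R * cavg R (\<lambda>\<zeta>. \<bar>ln (cmod (g \<zeta>))\<bar>) * (1 / (R - r)) ^ 2 \<le> 2 * Y * Y * Y ^ 2"
          using i mu mu0 Y rR r U1 by (intro mult_mono) auto
        then show ?thesis using z by (simp add: power_one_over power2_eq_square eval_nat_numeral mult_ac)
      qed
      also have "(\<Sum>a\<in>S. \<bar>real_of_int (ordm g a)\<bar> * (1 / cmod (z - a) + 1 / (R - cmod z)))
         \<le> (\<Sum>a\<in>S. \<bar>real_of_int (ordm g a)\<bar> * (nn ^ 2 + 4 * U))"
      proof (intro sum_mono mult_left_mono add_mono)
        fix a assume a: "a \<in> S"
        \<comment> \<open>Since \<open>N\<close> is at most the total multiplicity
          \<open>nn\<close>, avoiding the exceptional set keeps \<open>z\<close> at distance at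
          least \<open>1 / nn ^ 2\<close> from \<open>a\<close>.\<close>
        define N where "N = card {b. cmod b \<le> cmod a \<and> ordm g b \<noteq> 0}"
        have "N > 0" unfolding N_def using a finite_ordm[OF g, of "cmod a"]
          by (subst card_gt_0_iff) (auto simp: S_def)
        have "N \<le> card S" unfolding N_def using a finS by (intro card_mono) (auto simp: S_def)
        have "real (card S) = (\<Sum>a\<in>S. 1)" by simp
        also have "\<dots> \<le> nn" unfolding nn_def S_def[symmetric]
        proof (rule sum_mono)
          fix b assume "b \<in> S"
          then have "\<bar>ordm g b\<bar> \<ge> 1" by (auto simp: S_def)
          then show "1 \<le> \<bar>real_of_int (ordm g b)\<bar>" by linarith
        qed
        finally have Nn: "real N \<le> nn" using \<open>N \<le> card S\<close> by linarith
        have "1 / real N ^ 2 \<le> \<bar>r - cmod a\<bar>" using A a by (auto simp: N_def S_def)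
        also have "\<dots> \<le> cmod (z - a)" using norm_triangle_ineq3[of z a] z by simp
        finally have d: "1 / real N ^ 2 \<le> cmod (z - a)" .
        have "1 / real N ^ 2 > 0" using \<open>N > 0\<close> by simp
        then have "1 / cmod (z - a) \<le> 1 / (1 / real N ^ 2)" using d by (intro divide_left_mono mult_pos_pos) auto
        also have "\<dots> = real N ^ 2" by simp
        also have "\<dots> \<le> nn ^ 2" using Nn by (intro power_mono) auto
        finally show "1 / cmod (z - a) \<le> nn ^ 2" .
        show "1 / (R - cmod z) \<le> 4 * U" using iR z by simp
      qed auto
      also have "\<dots> = nn * (nn ^ 2 + 4 * U)" by (simp add: nn_def S_def sum_distrib_right)
      also have "\<dots> \<le> Y ^ 3 * ((Y ^ 3) ^ 2 + Y)"
        using nnY nn0 Y U1 by (intro mult_mono add_mono power_mono) auto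
      also have "\<dots> = Y ^ 9 + Y ^ 4" by (simp add: algebra_simps eval_nat_numeral)
      finally have "cmod (deriv g z / g z) \<le> Y ^ 9 + 3 * Y ^ 4" by simp
      moreover have "Y ^ 4 \<le> Y ^ 9" using Y by (intro power_increasing) auto
      ultimately show ?thesis by simp
    qed
    have "proxim (\<lambda>z. deriv g z / g z) r \<le> ln (4 * Y ^ 9)"
    proof (rule proxim_bound[OF anrad_logderiv[OF r(1)] bound])
      have "1 \<le> Y ^ 9" using Y by (intro one_le_power) auto
      then show "1 \<le> 4 * Y ^ 9" by simp
    qed
    also have "\<dots> = ln 4 + 9 * ln Y" using Y by (simp add: ln_mult ln_realpow)
    also have "ln (4::real) \<le> 3" using ln_le_minus_one[of "4::real"] by simp
    also have "ln Y = ln (r + 1) + ln (4 * U + c + 1)"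
      unfolding Y_def using r U1 c0 by (subst ln_mult) auto
    also have "ln (r + 1) \<le> ln r + 1/2"
    proof -
      have "r + 1 = r * (1 + 1 / r)" using r by (simp add: distrib_left)
      then have "ln (r + 1) = ln (r * (1 + 1 / r))" by simp
      also have "\<dots> = ln r + ln (1 + 1 / r)" using r add_pos_nonneg[of 1 "1 / r"] by (subst ln_mult) auto
      finally have "ln (r + 1) = ln r + ln (1 + 1 / r)" .
      moreover have "ln (1 + 1 / r) \<le> 1 / r" using r by (intro ln_add_one_self_le_self) auto
      moreover have "1 / r \<le> 1/2" using r by (simp add: field_simps)
      ultimately show ?thesis by linarith
    qed
    also have "ln (4 * U + c + 1) \<le> ln (5 + c) + ln U"
    proof -
      have "c * 1 \<le> c * U" using c0 U1 by (intro mult_left_mono) auto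
      then have "4 * U + c + 1 \<le> (5 + c) * U" using U1 by (simp add: algebra_simps)
      then have "ln (4 * U + c + 1) \<le> ln ((5 + c) * U)" using U1 c0 by (intro ln_mono) auto
      also have "\<dots> = ln (5 + c) + ln U" using U1 c0 by (subst ln_mult) auto
      finally show ?thesis .
    qed
    finally have "proxim (\<lambda>z. deriv g z / g z) r \<le> 3 + 9 * (ln r + 1/2 + (ln (5 + c) + ln U))" by simp
    also have "\<dots> \<le> (10 + 9 * ln (5 + c)) * (1 + ln r + ln U)"
    proof -
      have l: "ln (5 + c) \<ge> 0" "ln r \<ge> 0" "ln U \<ge> 0" using c0 r U1 by auto
      then have "ln (5 + c) * ln r \<ge> 0" "ln (5 + c) * ln U \<ge> 0" by auto
      then show ?thesis using l by (simp add: algebra_simps)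
    qed
    finally show "proxim (\<lambda>z. deriv g z / g z) r \<le> (10 + 9 * ln (5 + c)) * (1 + ln r + ln (max 1 (nev_T g r)))"
      by (simp add: U)
  qed
  then show ?thesis by blast
qed

subsection \<open>Growth of transcendental functions\<close>

lemma logplus_mult: "x \<ge> 0 \<Longrightarrow> y \<ge> 0 \<Longrightarrow> logplus (x * y) \<le> logplus x + logplus y"
proof -
  assume xy: "x \<ge> 0" "y \<ge> 0"
  have "max 1 (x * y) \<le> max 1 x * max 1 y"
    using xy mult_mono[of 1 "max 1 x" 1 "max 1 y"] mult_mono[of x "max 1 x" y "max 1 y"] by auto
  then have "ln (max 1 (x * y)) \<le> ln (max 1 x * max 1 y)" by (intro ln_mono) auto
  also have "\<dots> = ln (max 1 x) + ln (max 1 y)" by (rule ln_mult_pos) auto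
  finally show ?thesis using xy by (simp add: logplus_max)
qed

lemma logplus_add: "x \<ge> 0 \<Longrightarrow> y \<ge> 0 \<Longrightarrow> logplus (x + y) \<le> logplus x + logplus y + ln 2"
proof -
  assume xy: "x \<ge> 0" "y \<ge> 0"
  have "max 1 x * 1 \<le> max 1 x * max 1 y" "1 * max 1 y \<le> max 1 x * max 1 y"
    by (rule mult_left_mono mult_right_mono; simp)+
  then have "max 1 (x + y) \<le> 2 * (max 1 x * max 1 y)" by linarith
  then have "ln (max 1 (x + y)) \<le> ln (2 * (max 1 x * max 1 y))" by (intro ln_mono) auto
  also have "\<dots> = ln 2 + (ln (max 1 x) + ln (max 1 y))" by (subst ln_mult_pos ln_mult_pos; auto)+
  finally show ?thesis using xy by (simp add: logplus_max)
qed

lemma logplus_mono: "x \<le> y \<Longrightarrow> logplus x \<le> logplus y"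
  by (auto simp: logplus_def)

lemma anrad_mult: "anrad f r \<Longrightarrow> anrad g r \<Longrightarrow> anrad (\<lambda>z. f z * g z) r"
  unfolding anrad_def by (auto intro!: analytic_intros)

lemma proxim_mult:
  assumes "anrad f r" "anrad g r"
  shows "proxim (\<lambda>z. f z * g z) r \<le> proxim f r + proxim g r"
proof -
  have r: "r \<ge> 0" using assms by (simp add: anrad_def)
  have "proxim (\<lambda>z. f z * g z) r \<le> cavg r (\<lambda>z. logplus (cmod (f z)) + logplus (cmod (g z)))"
    unfolding proxim_cavg using assms r
    by (intro cavg_mono continuous_intros anrad_continuous anrad_mult) (auto simp: norm_mult logplus_mult)
  also have "\<dots> = proxim f r + proxim g r"
    unfolding proxim_cavg using assms r by (intro cavg_add anrad_logplus)
  finally show ?thesis .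
qed

lemma proxim_add:
  assumes "anrad f r" "anrad g r"
  shows "proxim (\<lambda>z. f z + g z) r \<le> proxim f r + proxim g r + ln 2"
proof -
  have r: "r \<ge> 0" using assms by (simp add: anrad_def)
  have "proxim (\<lambda>z. f z + g z) r \<le> cavg r (\<lambda>z. (logplus (cmod (f z)) + logplus (cmod (g z))) + ln 2)"
    unfolding proxim_cavg
  proof (intro cavg_mono continuous_intros anrad_continuous assms r)
    fix z
    have "logplus (cmod (f z + g z)) \<le> logplus (cmod (f z) + cmod (g z))"
      by (intro logplus_mono norm_triangle_ineq)
    also have "\<dots> \<le> logplus (cmod (f z)) + logplus (cmod (g z)) + ln 2" by (intro logplus_add) auto
    finally show "logplus (cmod (f z + g z)) \<le> (logplus (cmod (f z)) + logplus (cmod (g z))) + ln 2" .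
  qed auto
  also have "\<dots> = cavg r (\<lambda>z. logplus (cmod (f z)) + logplus (cmod (g z))) + cavg r (\<lambda>_. ln 2)"
    by (intro cavg_add continuous_intros anrad_continuous assms r) auto
  also have "\<dots> = proxim f r + proxim g r + ln 2"
    unfolding proxim_cavg using assms r by (simp add: cavg_add anrad_logplus)
  finally show ?thesis .
qed

lemma transcendental_mnz:
  assumes "transcendental_mero f"
  shows "mnz f"
proof (rule ccontr)
  assume "\<not> mnz f"
  then have "eventually (\<lambda>z. f z = 0) (cosparse UNIV)"
    using assms mero_cases by (auto simp: transcendental_mero_def)
  then have "\<forall>z. \<forall>\<^sub>F w in at z. f w = 0" using eventually_cosparse_imp_eventually_at by blast
  then have "rational_fun f" unfolding rational_fun_def by (intro exI[of _ 0] exI[of _ 1]) auto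
  then show False using assms by (simp add: transcendental_mero_def)
qed

text \<open>Cauchy's inequality needs only one circle at a time, so an unbounded set of radii with
  the bound already kills the Taylor coefficients of order above \<open>d\<close>.\<close>

lemma entire_polynomial_of_frequent_bound:
  assumes G: "G holomorphic_on UNIV"
    and fr: "\<And>M. \<exists>r>M. r > 0 \<and> (\<forall>z. cmod z = r \<longrightarrow> cmod (G z) \<le> B * r ^ d)"
  shows "\<exists>p. \<forall>z. G z = poly p z"
proof -
  have zero: "(deriv ^^ n) G 0 = 0" if n: "n > d" for n
  proof (rule ccontr)
    assume ne: "(deriv ^^ n) G 0 \<noteq> 0"
    define c where "c = cmod ((deriv ^^ n) G 0)"
    have c: "c > 0" using ne by (simp add: c_def)
    obtain r where r: "r > max 1 (fact n * \<bar>B\<bar> / c)" "r > 0" "\<And>z. cmod z = r \<Longrightarrow> cmod (G z) \<le> B * r ^ d"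
      using fr by blast
    have "cmod ((deriv ^^ n) G 0) \<le> fact n * (B * r ^ d) / r ^ n"
      by (rule Cauchy_inequality)
         (use r G in \<open>auto intro: holomorphic_on_subset holomorphic_on_imp_continuous_on\<close>)
    also have "\<dots> \<le> fact n * \<bar>B\<bar> * r ^ d / r ^ n"
      using r by (intro divide_right_mono) (auto simp: mult_ac intro!: mult_left_mono mult_right_mono)
    also have "\<dots> \<le> fact n * \<bar>B\<bar> / r"
    proof -
      have "r ^ Suc d \<le> r ^ n" using r n by (intro power_increasing) auto
      then have "r ^ d / r ^ n \<le> 1 / r" using r by (simp add: field_simps)
      then have "fact n * \<bar>B\<bar> * (r ^ d / r ^ n) \<le> fact n * \<bar>B\<bar> * (1 / r)" by (intro mult_left_mono) auto
      then show ?thesis by simp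
    qed
    finally have "c * r \<le> fact n * \<bar>B\<bar>" using r by (simp add: c_def field_simps)
    moreover have "fact n * \<bar>B\<bar> / c < r" using r by simp
    then have "fact n * \<bar>B\<bar> < r * c" using c by (simp add: field_simps)
    ultimately show False by (simp add: mult.commute)
  qed
  define p where "p = (\<Sum>i\<le>d. monom ((deriv ^^ i) G 0 / fact i) i)"
  have "G z = poly p z" for z
  proof -
    have "(\<lambda>n. (deriv ^^ n) G 0 / fact n * (z - 0) ^ n) sums G z"
      by (rule holomorphic_power_series[where r = "cmod z + 1"]) (use G in \<open>auto intro: holomorphic_on_subset\<close>)
    moreover have "(\<lambda>n. (deriv ^^ n) G 0 / fact n * (z - 0) ^ n) sums (\<Sum>n\<le>d. (deriv ^^ n) G 0 / fact n * (z - 0) ^ n)"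
      by (rule sums_finite) (auto simp: zero)
    ultimately have "G z = (\<Sum>n\<le>d. (deriv ^^ n) G 0 / fact n * z ^ n)" using sums_unique2 by fastforce
    then show ?thesis by (simp add: p_def poly_sum poly_monom)
  qed
  then show ?thesis by blast
qed

lemma poly_analytic: "poly p analytic_on A" for p :: "complex poly"
proof -
  have "poly p holomorphic_on UNIV"
    unfolding holomorphic_on_def field_differentiable_def by (intro ballI exI, rule poly_DERIV)
  then show ?thesis by (meson analytic_on_holomorphic open_UNIV subset_UNIV)
qed

text \<open>Otherwise the characteristic is below \<open>C * ln r\<close> for arbitrarily large
  radii. Then the number of poles is bounded, multiplying by the polynomial \<open>Q\<close> removes
  them, and the resulting entire function has polynomial growth on arbitrarily large circles; so
  \<open>f\<close> would be rational.\<close>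

lemma transcendental_growth:
  assumes tr: "transcendental_mero f"
  shows "eventually (\<lambda>r. C * ln r \<le> nev_T f r) nevF"
proof (rule ccontr)
  have fz: "mnz f" by (rule transcendental_mnz[OF tr])
  have fm: "f meromorphic_on UNIV" using fz by (rule mnz_mero)
  assume "\<not> eventually (\<lambda>r. C * ln r \<le> nev_T f r) nevF"
  then have freq: "frequently (\<lambda>r. nev_T f r < C * ln r) nevF"
    by (simp add: frequently_def not_less)
  have ex: "\<exists>r. nev_T f r < C * ln r \<and> goodrad f r \<and> r \<ge> M \<and> goodrad g r" if "mnz g" for M g
  proof -
    have "eventually (\<lambda>r. goodrad f r \<and> r \<ge> M \<and> goodrad g r) nevF"
      by (intro eventually_conj nevF_goodrad nevF_ge fz that)
    from frequently_eventually_frequently[OF freq this] show ?thesis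
      by (auto dest: frequently_ex)
  qed
  define P where "P = {a. ordm f a < 0}"
  have card_bd: "real (card {a. cmod a < \<rho> \<and> ordm f a < 0}) \<le> 2 * \<bar>C\<bar>" if \<rho>: "\<rho> \<ge> 1" for \<rho>
  proof -
    define V where "V = {a. cmod a < \<rho> \<and> ordm f a < 0}"
    have finV: "finite V" unfolding V_def by (rule finite_subset[OF _ finite_poles[OF fm, of \<rho>]]) auto
    \<comment> \<open>For \<open>r\<close> at least the square of \<open>\<rho>\<close>, each pole
      of modulus below \<open>\<rho>\<close> weighs at least half of \<open>ln r\<close>. Comparison
      with \<open>C * ln r\<close> leaves at most \<open>2 * \<bar>C\<bar>\<close> poles.\<close>
    obtain r where r: "nev_T f r < C * ln r" "r \<ge> max 2 (\<rho> ^ 2)" using ex[OF fz] by blast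
    have r1: "r \<ge> 2" "r \<ge> \<rho> ^ 2" using r by auto
    have "\<rho> * 1 \<le> \<rho> * \<rho>" using \<rho> by (intro mult_left_mono) auto
    then have r2: "\<rho> \<le> r" using r1 by (simp add: power2_eq_square)
    have half: "ln r / 2 \<le> ln (r / \<rho>)"
    proof -
      have "ln (\<rho> ^ 2) \<le> ln r" using r1 \<rho> by (intro ln_mono) auto
      then have "2 * ln \<rho> \<le> ln r" using \<rho> by (simp add: ln_realpow)
      then show ?thesis using \<rho> r1 by (simp add: ln_div)
    qed
    have lpos: "ln r > 0" using r1 by simp
    define W where "W = {z. 0 < cmod z \<and> cmod z \<le> r \<and> polem f z \<noteq> 0}"
    have finW: "finite W" unfolding W_def by (rule locfin_finite[OF locfin_polem[OF fm]])
    have pol1: "polem f a \<ge> 1" if "a \<in> V" for a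
      using that by (auto simp: V_def polem_def)
    have "real (card V) * (ln r / 2) = (\<Sum>a\<in>V. ln r / 2)" by simp
    also have "\<dots> \<le> (\<Sum>a\<in>V - {0}. ln r / 2) + (if 0 \<in> V then ln r / 2 else 0)"
    proof (cases "0 \<in> V")
      case True
      then show ?thesis using finV by (subst sum.remove[of V 0]) auto
    qed simp
    also have "\<dots> \<le> (\<Sum>a\<in>V - {0}. polem f a * ln (r / cmod a)) + polem f 0 * ln r"
    proof (intro add_mono sum_mono)
      fix a assume a: "a \<in> V - {0}"
      have "ln (r / \<rho>) \<le> ln (r / cmod a)" using a r1 \<rho> by (auto simp: V_def ln_div)
      then have "ln r / 2 \<le> 1 * ln (r / cmod a)" using half by simp
      also have "\<dots> \<le> polem f a * ln (r / cmod a)"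
        using pol1[of a] a \<open>ln r / 2 \<le> 1 * ln (r / cmod a)\<close> lpos by (intro mult_right_mono) auto
      finally show "ln r / 2 \<le> polem f a * ln (r / cmod a)" .
    next
      show "(if 0 \<in> V then ln r / 2 else 0) \<le> polem f 0 * ln r"
        using pol1[of 0] lpos mult_right_mono[of 1 "polem f 0" "ln r"] by auto
    qed
    also have "(\<Sum>a\<in>V - {0}. polem f a * ln (r / cmod a)) \<le> (\<Sum>a\<in>W. polem f a * ln (r / cmod a))"
    proof (rule sum_mono2[OF finW])
      show "V - {0} \<subseteq> W" using r2 by (auto simp: V_def W_def polem_def)
      fix b assume "b \<in> W - (V - {0})"
      then have "cmod b \<le> r" "0 < cmod b" by (auto simp: W_def)
      then show "0 \<le> polem f b * ln (r / cmod b)"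
        by (intro mult_nonneg_nonneg) (auto simp: ln_ge_zero_iff divide_simps)
    qed
    finally have "real (card V) * (ln r / 2) \<le> cnt (polem f) r" by (simp add: cnt_def W_def)
    also have "\<dots> \<le> nev_T f r" using r1 by (intro cnt_polem_le_T fm) auto
    also have "\<dots> \<le> C * ln r" using r(1) by simp
    also have "\<dots> \<le> \<bar>C\<bar> * ln r" using lpos by (intro mult_right_mono) auto
    finally have "real (card V) / 2 * ln r \<le> \<bar>C\<bar> * ln r" by simp
    then show ?thesis using lpos by (simp add: V_def)
  qed
  have finP: "finite P"
  proof (rule ccontr)
    assume "infinite P"
    then obtain B where B: "B \<subseteq> P" "finite B" "card B = nat \<lceil>2 * \<bar>C\<bar>\<rceil> + 1"
      using infinite_arbitrarily_large by blast
    define \<rho> where "\<rho> = 1 + (\<Sum>b\<in>B. cmod b)"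
    have "cmod b < \<rho>" if "b \<in> B" for b
      using member_le_sum[OF that, of cmod] B by (auto simp: \<rho>_def)
    then have "B \<subseteq> {a. cmod a < \<rho> \<and> ordm f a < 0}" using B by (auto simp: P_def)
    moreover have "finite {a. cmod a < \<rho> \<and> ordm f a < 0}"
      by (rule finite_subset[OF _ finite_poles[OF fm, of \<rho>]]) auto
    ultimately have "card B \<le> card {a. cmod a < \<rho> \<and> ordm f a < 0}" by (rule card_mono[rotated])
    moreover have "\<rho> \<ge> 1" by (simp add: \<rho>_def sum_nonneg)
    ultimately have "real (card B) \<le> 2 * \<bar>C\<bar>" using card_bd[of \<rho>] by linarith
    then show False using B(3) by linarith
  qed
  define Q where "Q = (\<Prod>a\<in>P. [:-a, 1:] ^ nat (- ordm f a))"
  have Q0: "Q \<noteq> 0" using finP by (simp add: Q_def)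
  define d where "d = Polynomial.degree Q"
  define g where "g z = f z * poly Q z" for z
  have polyan: "poly Q analytic_on A" for A by (rule poly_analytic)
  have polym: "poly Q meromorphic_on UNIV" by (rule analytic_on_imp_meromorphic_on[OF polyan])
  have gm: "g meromorphic_on UNIV" unfolding g_def by (intro meromorphic_intros fm polym)
  have Qev: "\<forall>\<^sub>F w in at z. poly Q w \<noteq> 0" for z
    using islimpt_finite[OF poly_roots_finite[OF Q0], of z] by (simp add: islimpt_iff_eventually)
  have Qz: "mnz (poly Q)"
    unfolding mnz_iff[OF polym, of 0]
    using has_laurent_expansion_eventually_nonzero_iff[OF le_mero[OF polym, of 0]] Qev by simp
  have gz: "mnz g" unfolding g_def by (rule mnz_mult[OF fz Qz])
  have ordQ: "ordm (poly Q) z \<ge> - ordm f z" if "z \<in> P" for z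
  proof -
    define n where "n = nat (- ordm f z)"
    define Q1 where "Q1 = (\<Prod>a\<in>P - {z}. [:-a, 1:] ^ nat (- ordm f a))"
    have Q1: "Q = [:-z, 1:] ^ n * Q1"
      unfolding Q_def n_def Q1_def by (rule prod.remove[OF finP that])
    have m1: "(\<lambda>w. w - z) meromorphic_on UNIV" by (intro meromorphic_intros)
    have m2: "poly Q1 meromorphic_on UNIV" by (rule analytic_on_imp_meromorphic_on) (rule poly_analytic)
    have e: "poly Q = (\<lambda>w. (w - z) ^ n * poly Q1 w)" by (auto simp: Q1)
    have L: "laurent_expansion (poly Q) z = fls_X ^ n * laurent_expansion (poly Q1) z"
      unfolding e by (subst le_mult) (auto intro!: meromorphic_intros m2 simp: le_power m1 le_ident)
    have "laurent_expansion (poly Q1) z \<noteq> 0" using le_nonzero[OF Qz, of z] L by auto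
    moreover have "ordm (poly Q1) z \<ge> 0" by (rule analytic_ordm(1)[OF poly_analytic m2])
    ultimately have "ordm (poly Q) z \<ge> int n" by (simp add: ordm_def L)
    then show ?thesis using that by (simp add: n_def P_def)
  qed
  have ordg: "ordm g z \<ge> 0" for z
  proof -
    have "ordm g z = ordm f z + ordm (poly Q) z" unfolding g_def by (rule ordm_mult[OF fz Qz])
    moreover have "ordm (poly Q) z \<ge> 0" by (rule analytic_ordm(1)[OF polyan polym])
    ultimately show ?thesis using ordQ[of z] by (cases "z \<in> P") (auto simp: P_def)
  qed
  define G where "G = remove_sings g"
  have Gan: "G analytic_on {z}" for z
    unfolding G_def
  proof (rule remove_sings_analytic_at)
    show "g \<midarrow>z\<rightarrow> fls_nth (laurent_expansion g z) 0"
      by (rule has_laurent_expansion_imp_tendsto[OF le_mero[OF gm]]) (use ordg in \<open>simp add: ordm_def\<close>)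
    show "isolated_singularity_at g z"
      by (rule meromorphic_on_isolated_singularity) (use gm in \<open>auto intro: meromorphic_on_subset\<close>)
  qed
  have Gh: "G holomorphic_on UNIV"
    using Gan by (intro analytic_imp_holomorphic) (subst analytic_on_analytic_at, auto)
  have Gm: "G meromorphic_on UNIV" unfolding G_def by (intro meromorphic_intros gm)
  have Gev: "\<forall>\<^sub>F w in at z. G w = g w" for z
    unfolding G_def by (rule eventually_remove_sings_eq_at)
      (use meromorphic_on_isolated_singularity[OF meromorphic_on_subset[OF gm, of "{z}"]] in simp)
  have Gz: "mnz G"
    unfolding mnz_iff[OF Gm, of 0] using le_nonzero[OF gz, of 0] laurent_expansion_cong[OF Gev refl, of 0] by simp
  have ordG: "ordm G z \<ge> 0" for z by (rule analytic_ordm(1)[OF Gan Gm])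
  define \<rho>0 where "\<rho>0 = 2 + (\<Sum>b\<in>P. cmod b)"
  have P\<rho>: "cmod b \<le> \<rho>0" if "b \<in> P" for b
    using member_le_sum[OF that, of cmod] finP by (auto simp: \<rho>0_def)
  have \<rho>02: "\<rho>0 \<ge> 2" by (simp add: \<rho>0_def sum_nonneg)
  define D where "D = (\<Sum>a\<in>P. nat (- ordm f a))"
  \<comment> \<open>The factor 3 bounds the Poisson kernel at points of modulus
    \<open>r / 2\<close>; \<open>\<bar>C\<bar>\<close> comes from the proximity function of
    \<open>f\<close>, and \<open>2 * real D\<close> from that of the polynomial
    \<open>Q\<close>.\<close>
  define e where "e = nat \<lceil>3 * (\<bar>C\<bar> + 2 * real D)\<rceil>"
  have bound: "\<exists>s>M. s > 0 \<and> (\<forall>z. cmod z = s \<longrightarrow> cmod (G z) \<le> 2 ^ e * s ^ e)" for M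
  proof -
    obtain r where r: "nev_T f r < C * ln r" "goodrad f r" "r \<ge> max \<rho>0 (2 * \<bar>M\<bar> + 2)" "goodrad g r"
      using ex[OF gz] by blast
    have r1: "r \<ge> \<rho>0" "r > 2 * M" "r \<ge> 2" using r \<rho>02 by auto
    have lpos: "ln r > 0" using r1 by simp
    have goodG: "goodrad G r" using r(4) Gan by (auto simp: goodrad_def goodpt_def G_def)
    have "proxim G r = proxim g r"
      unfolding proxim_cavg using r(4) by (intro cavg_cong) (auto simp: goodrad_def goodpt_def G_def)
    also have "\<dots> \<le> proxim f r + proxim (poly Q) r"
      unfolding g_def by (rule proxim_mult[OF goodrad_anrad[OF r(2)]]) (use polyan r1 in \<open>auto simp: anrad_def\<close>)
    also have "proxim (poly Q) r \<le> ln ((2 * r) ^ D)"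
    proof (rule proxim_bound)
      fix z assume z: "cmod z = r"
      have "cmod (poly Q z) = (\<Prod>a\<in>P. cmod (z - a) ^ nat (- ordm f a))"
        by (simp add: Q_def poly_prod prod_norm[symmetric] norm_power algebra_simps)
      also have "\<dots> \<le> (\<Prod>a\<in>P. (2 * r) ^ nat (- ordm f a))"
      proof (rule prod_mono, intro conjI power_mono)
        fix a assume "a \<in> P"
        then show "cmod (z - a) \<le> 2 * r" using norm_triangle_ineq4[of z a] P\<rho>[of a] r1 z by simp
      qed auto
      also have "\<dots> = (2 * r) ^ D" by (simp add: D_def power_sum)
      finally show "cmod (poly Q z) \<le> (2 * r) ^ D" .
    next
      show "1 \<le> (2 * r) ^ D" using r1 by (intro one_le_power) auto
    qed (use polyan r1 in \<open>auto simp: anrad_def\<close>)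
    also have "\<dots> \<le> 2 * real D * ln r"
    proof -
      have "ln (2 * r) \<le> 2 * ln r" using r1 by (simp add: ln_mult)
      then have "real D * ln (2 * r) \<le> real D * (2 * ln r)" by (intro mult_left_mono) auto
      moreover have "ln ((2 * r) ^ D) = real D * ln (2 * r)" by (rule ln_realpow)
      ultimately show ?thesis by linarith
    qed
    also have "proxim f r \<le> \<bar>C\<bar> * ln r"
    proof -
      have "C * ln r \<le> \<bar>C\<bar> * ln r" using lpos by (intro mult_right_mono) auto
      then show ?thesis using r(1) proxim_le_T[OF fm, of r] r1 by linarith
    qed
    finally have pG: "proxim G r \<le> (\<bar>C\<bar> + 2 * real D) * ln r" by (simp add: algebra_simps)
    have "cmod (G z) \<le> 2 ^ e * (r / 2) ^ e" if z: "cmod z = r / 2" for z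
    proof -
      have zr: "cmod z < r" using z r1 by simp
      have "logplus (cmod (G z)) \<le> cavg r (\<lambda>\<zeta>. pkernel r z \<zeta> * logplus (cmod (G \<zeta>)))
        + (\<Sum>a | cmod a < r \<and> ordm G a < 0. polem G a * - ln (cmod (blaschke r a z)))"
        by (rule poisson_jensen_ineq[OF Gz goodG zr Gan])
      also have "{a. cmod a < r \<and> ordm G a < 0} = {}" using ordG by (auto simp: not_less)
      also have "cavg r (\<lambda>\<zeta>. pkernel r z \<zeta> * logplus (cmod (G \<zeta>))) \<le> cavg r (\<lambda>\<zeta>. 3 * logplus (cmod (G \<zeta>)))"
      proof (intro cavg_mono continuous_intros continuous_pkernel zr anrad_continuous goodrad_anrad goodG mult_right_mono)
        fix \<zeta> assume "cmod \<zeta> = r"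
        then have "pkernel r z \<zeta> \<le> (r + cmod z) / (r - cmod z)" by (rule pkernel_bounds(2)[OF _ zr])
        also have "\<dots> = 3" using z r1 by (simp add: field_simps)
        finally show "pkernel r z \<zeta> \<le> 3" .
      qed (use r1 in auto)
      also have "\<dots> = 3 * proxim G r" by (simp add: cavg_cmult proxim_cavg)
      finally have "logplus (cmod (G z)) \<le> 3 * ((\<bar>C\<bar> + 2 * real D) * ln r)" using pG by simp
      also have "\<dots> \<le> real e * ln r"
      proof -
        have "3 * (\<bar>C\<bar> + 2 * real D) \<le> real e" unfolding e_def by linarith
        then show ?thesis using lpos mult_right_mono[of "3 * (\<bar>C\<bar> + 2 * real D)" "real e" "ln r"] by simp
      qed
      also have "\<dots> = ln (r ^ e)" using r1 by (simp add: ln_realpow)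
      finally have le: "logplus (cmod (G z)) \<le> ln (r ^ e)" .
      have "cmod (G z) \<le> r ^ e"
      proof (cases "cmod (G z) \<le> 1")
        case True
        then show ?thesis using r1 by (meson one_le_power order_trans one_le_numeral)
      next
        case False
        then have "ln (cmod (G z)) \<le> ln (r ^ e)" using le by (simp add: logplus_def)
        then show ?thesis using False r1 by (subst (asm) ln_le_cancel_iff) auto
      qed
      then show ?thesis by (simp add: power_divide)
    qed
    then show ?thesis using r1 by (intro exI[of _ "r / 2"]) auto
  qed
  obtain p where p: "\<And>z. G z = poly p z"
    using entire_polynomial_of_frequent_bound[OF Gh bound] by blast
  have "\<forall>\<^sub>F w in at z. f w = poly p w / poly Q w" for z
    using Gev[of z] Qev[of z]
  proof eventually_elim
    case (elim w)
    then show ?case by (simp add: p[symmetric] g_def)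
  qed
  then have "rational_fun f" unfolding rational_fun_def using Q0 by blast
  then show False using tr by (simp add: transcendental_mero_def)
qed

subsection \<open>Small functions\<close>

lemma polem_mult:
  assumes "f meromorphic_on UNIV" "g meromorphic_on UNIV"
  shows "polem (\<lambda>w. f w * g w) z \<le> polem f z + polem g z"
  by (cases "laurent_expansion f z = 0 \<or> laurent_expansion g z = 0")
     (auto simp: polem_def ordm_def le_mult[OF assms])

lemma polem_add:
  assumes "f meromorphic_on UNIV" "g meromorphic_on UNIV"
  shows "polem (\<lambda>w. f w + g w) z \<le> polem f z + polem g z"
proof (cases "laurent_expansion f z + laurent_expansion g z = 0")
  case True
  then show ?thesis by (simp add: polem_def ordm_def le_add[OF assms])
next
  case False
  then have "fls_subdegree (laurent_expansion f z + laurent_expansion g z)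
      \<ge> min (fls_subdegree (laurent_expansion f z)) (fls_subdegree (laurent_expansion g z))"
    by (rule fls_plus_subdegree)
  then show ?thesis by (auto simp: polem_def ordm_def le_add[OF assms])
qed

text \<open>Differentiation raises the order of a pole by one, which is at most a doubling.\<close>

lemma polem_deriv:
  assumes "f meromorphic_on UNIV"
  shows "polem (deriv f) z \<le> 2 * polem f z"
proof (cases "ordm f z \<ge> 0")
  case True
  have "fls_deriv (laurent_expansion f z) = 0 \<or> fls_subdegree (fls_deriv (laurent_expansion f z)) \<ge> 0"
  proof (rule disjCI)
    assume "\<not> fls_subdegree (fls_deriv (laurent_expansion f z)) \<ge> 0"
    define n where "n = fls_subdegree (fls_deriv (laurent_expansion f z))"
    have "n < 0" using \<open>\<not> _\<close> by (simp add: n_def)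
    then have "fls_nth (fls_deriv (laurent_expansion f z)) n = 0"
      using True by (cases "n = -1") (auto simp: ordm_def intro!: fls_eq0_below_subdegree)
    then show "fls_deriv (laurent_expansion f z) = 0" unfolding n_def by (simp only: nth_fls_subdegree_zero_iff)
  qed
  then show ?thesis by (auto simp: polem_def ordm_def le_deriv[OF assms])
next
  case False
  then have "fls_subdegree (fls_deriv (laurent_expansion f z)) = fls_subdegree (laurent_expansion f z) - 1"
    by (intro fls_subdegree_deriv) (auto simp: ordm_def)
  then show ?thesis using False by (simp add: polem_def ordm_def le_deriv[OF assms])
qed

lemma nev_T_cong:
  assumes "eventually (\<lambda>z. g z = h z) (cosparse UNIV)" "g meromorphic_on UNIV" "h meromorphic_on UNIV"
  shows "eventually (\<lambda>r. nev_T g r = nev_T h r) nevF"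
proof -
  have "polem g = polem h" using le_cong_cosparse[OF assms(1)] by (auto simp: polem_def ordm_def)
  then show ?thesis
    using eventually_conj[OF nevF_cosparse[OF assms(1)] nevF_ge[of 1]]
    by (elim eventually_mono) (auto simp: nev_T_eq assms proxim_cavg intro!: cavg_cong)
qed

lemma nev_T_mult:
  assumes "g meromorphic_on UNIV" "h meromorphic_on UNIV"
  shows "eventually (\<lambda>r. nev_T (\<lambda>z. g z * h z) r \<le> nev_T g r + nev_T h r) nevF"
  using eventually_conj[OF nevF_anrad[OF assms(1)] eventually_conj[OF nevF_anrad[OF assms(2)] nevF_ge[of 1]]]
proof (rule eventually_mono)
  fix r assume r: "anrad g r \<and> anrad h r \<and> 1 \<le> r"
  have "cnt (polem (\<lambda>z. g z * h z)) r \<le> cnt (\<lambda>z. polem g z + polem h z) r"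
    using r assms by (intro cnt_mono locfin_add locfin_polem polem_mult meromorphic_intros) auto
  also have "\<dots> = cnt (polem g) r + cnt (polem h) r" by (intro cnt_add locfin_polem assms)
  finally show "nev_T (\<lambda>z. g z * h z) r \<le> nev_T g r + nev_T h r"
    using proxim_mult[of g r h] r assms by (simp add: nev_T_eq meromorphic_intros)
qed

lemma nev_T_add:
  assumes "g meromorphic_on UNIV" "h meromorphic_on UNIV"
  shows "eventually (\<lambda>r. nev_T (\<lambda>z. g z + h z) r \<le> nev_T g r + nev_T h r + ln 2) nevF"
  using eventually_conj[OF nevF_anrad[OF assms(1)] eventually_conj[OF nevF_anrad[OF assms(2)] nevF_ge[of 1]]]
proof (rule eventually_mono)
  fix r assume r: "anrad g r \<and> anrad h r \<and> 1 \<le> r"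
  have "cnt (polem (\<lambda>z. g z + h z)) r \<le> cnt (\<lambda>z. polem g z + polem h z) r"
    using r assms by (intro cnt_mono locfin_add locfin_polem polem_add meromorphic_intros) auto
  also have "\<dots> = cnt (polem g) r + cnt (polem h) r" by (intro cnt_add locfin_polem assms)
  finally show "nev_T (\<lambda>z. g z + h z) r \<le> nev_T g r + nev_T h r + ln 2"
    using proxim_add[of g r h] r assms by (simp add: nev_T_eq meromorphic_intros)
qed

lemma nev_T_const: "eventually (\<lambda>r. nev_T (\<lambda>_. c) r \<le> logplus (cmod c)) nevF"
  using nevF_ge[of 1]
proof (rule eventually_mono)
  fix r :: real assume "1 \<le> r"
  moreover have "polem (\<lambda>_. c) = (\<lambda>_. 0)" by (auto simp: polem_def ordm_def)
  ultimately show "nev_T (\<lambda>_. c) r \<le> logplus (cmod c)"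
    by (simp add: nev_T_eq meromorphic_intros proxim_cavg cnt_def)
qed

lemma nev_T_inverse:
  assumes "mnz g"
  shows "eventually (\<lambda>r. nev_T (\<lambda>z. inverse (g z)) r = nev_T g r - ln (cmod (lcoef g))) nevF"
  using nevF_goodrad[OF assms] by (rule eventually_mono) (rule first_main_theorem[OF assms])

lemma proxim_deriv_le:
  assumes "mnz g"
  shows "eventually (\<lambda>r. proxim (deriv g) r \<le> proxim (\<lambda>z. deriv g z / g z) r + proxim g r) nevF"
  using nevF_goodrad[OF assms]
proof (rule eventually_mono)
  fix r assume r: "goodrad g r"
  have "proxim (deriv g) r = proxim (\<lambda>z. (deriv g z / g z) * g z) r"
    unfolding proxim_cavg using r by (intro cavg_cong) (auto simp: goodrad_def goodpt_def)
  also have "\<dots> \<le> proxim (\<lambda>z. deriv g z / g z) r + proxim g r"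
    by (intro proxim_mult anrad_logderiv goodrad_anrad r)
  finally show "proxim (deriv g) r \<le> proxim (\<lambda>z. deriv g z / g z) r + proxim g r" .
qed

lemma nev_T_deriv:
  assumes "mnz g"
  shows "eventually (\<lambda>r. nev_T (deriv g) r \<le> 2 * nev_T g r + proxim (\<lambda>z. deriv g z / g z) r) nevF"
  using eventually_conj[OF proxim_deriv_le[OF assms] nevF_ge[of 1]]
proof (rule eventually_mono)
  have gm: "g meromorphic_on UNIV" using assms by (rule mnz_mero)
  fix r assume r: "proxim (deriv g) r \<le> proxim (\<lambda>z. deriv g z / g z) r + proxim g r \<and> 1 \<le> r"
  have "cnt (polem (deriv g)) r \<le> cnt (\<lambda>z. 2 * polem g z) r"
    using r gm by (intro cnt_mono locfin_cmult locfin_polem polem_deriv meromorphic_intros) auto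
  also have "\<dots> = 2 * cnt (polem g) r" by (rule cnt_cmult)
  finally show "nev_T (deriv g) r \<le> 2 * nev_T g r + proxim (\<lambda>z. deriv g z / g z) r"
    using r proxim_nonneg[of r g] gm by (simp add: nev_T_eq meromorphic_intros)
qed

text \<open>The error terms \<open>S(r,f)\<close>. Only an upper bound is asked for, so constants of
  either sign, as in Jensen's formula, need no special care.\<close>

definition Sm :: "(complex \<Rightarrow> complex) \<Rightarrow> (real \<Rightarrow> real) \<Rightarrow> bool" where
  "Sm f e \<longleftrightarrow> (\<forall>c>0. eventually (\<lambda>r. e r \<le> c * nev_T f r) nevF)"

lemma SmD: "Sm f e \<Longrightarrow> c > 0 \<Longrightarrow> eventually (\<lambda>r. e r \<le> c * nev_T f r) nevF"
  by (simp add: Sm_def)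

lemma SmI: "(\<And>c. c > 0 \<Longrightarrow> eventually (\<lambda>r. e r \<le> c * nev_T f r) nevF) \<Longrightarrow> Sm f e"
  by (simp add: Sm_def)

definition Bm :: "(complex \<Rightarrow> complex) \<Rightarrow> (real \<Rightarrow> real) \<Rightarrow> bool" where
  "Bm f e \<longleftrightarrow> (\<exists>c\<ge>1. eventually (\<lambda>r. e r \<le> c * nev_T f r) nevF)"

locale transc =
  fixes f :: "complex \<Rightarrow> complex"
  assumes tr: "transcendental_mero f"
begin

lemma f_mnz: "mnz f" by (rule transcendental_mnz[OF tr])

lemma f_mero: "f meromorphic_on UNIV" using f_mnz by (rule mnz_mero)

lemma T_ge: "eventually (\<lambda>r. nev_T f r \<ge> M) nevF"
proof -
  have "eventually (\<lambda>r. \<bar>M\<bar> * ln r \<le> nev_T f r \<and> r \<ge> exp 1) nevF"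
    by (intro eventually_conj transcendental_growth tr nevF_ge)
  then show ?thesis
  proof (rule eventually_mono)
    fix r assume r: "\<bar>M\<bar> * ln r \<le> nev_T f r \<and> r \<ge> exp 1"
    then have "ln r \<ge> 1" by (meson exp_gt_zero ln_ge_iff order_less_le_trans)
    then have "\<bar>M\<bar> * 1 \<le> \<bar>M\<bar> * ln r" by (intro mult_left_mono) auto
    then show "nev_T f r \<ge> M" using r by linarith
  qed
qed

lemma Sm_mono:
  assumes "Sm f e" "eventually (\<lambda>r. e' r \<le> e r) nevF"
  shows "Sm f e'"
  unfolding Sm_def
proof (intro allI impI)
  fix c :: real assume "c > 0"
  then have "eventually (\<lambda>r. e r \<le> c * nev_T f r) nevF" using assms(1) by (simp add: Sm_def)
  then show "eventually (\<lambda>r. e' r \<le> c * nev_T f r) nevF" using assms(2) by eventually_elim linarith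
qed

lemma Sm_add:
  assumes "Sm f e" "Sm f e'"
  shows "Sm f (\<lambda>r. e r + e' r)"
proof (rule SmI)
  fix c :: real assume "c > 0"
  then have "c / 2 > 0" by simp
  from SmD[OF assms(1) this] SmD[OF assms(2) this]
  show "eventually (\<lambda>r. e r + e' r \<le> c * nev_T f r) nevF" by eventually_elim auto
qed

lemma Sm_cmult:
  assumes "Sm f e" "k \<ge> 0"
  shows "Sm f (\<lambda>r. k * e r)"
proof (rule SmI)
  fix c :: real assume c: "c > 0"
  then have "c / (k + 1) > 0" using assms by simp
  from SmD[OF assms(1) this] T_ge[of 0]
  show "eventually (\<lambda>r. k * e r \<le> c * nev_T f r) nevF"
  proof eventually_elim
    case (elim r)
    then have "k * e r \<le> k * (c / (k + 1) * nev_T f r)" using assms by (intro mult_left_mono) auto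
    also have "\<dots> = (k / (k + 1)) * (c * nev_T f r)" by simp
    also have "\<dots> \<le> 1 * (c * nev_T f r)" using assms c elim by (intro mult_right_mono) auto
    finally show ?case by simp
  qed
qed

lemma Sm_const: "Sm f (\<lambda>_. k)"
  unfolding Sm_def
proof (intro allI impI)
  fix c :: real assume "c > 0"
  show "eventually (\<lambda>r. k \<le> c * nev_T f r) nevF"
    using T_ge[of "k / c"] by (rule eventually_mono) (use \<open>c > 0\<close> in \<open>simp add: field_simps\<close>)
qed

lemma Sm_ln: "Sm f ln"
  unfolding Sm_def
proof (intro allI impI)
  fix c :: real assume "c > 0"
  show "eventually (\<lambda>r. ln r \<le> c * nev_T f r) nevF"
    using transcendental_growth[OF tr, of "1 / c"] by (rule eventually_mono) (use \<open>c > 0\<close> in \<open>simp add: field_simps\<close>)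
qed

lemma Sm_sum: "finite I \<Longrightarrow> (\<And>i. i \<in> I \<Longrightarrow> Sm f (e i)) \<Longrightarrow> Sm f (\<lambda>r. \<Sum>i\<in>I. e i r)"
  by (induction I rule: finite_induct) (auto intro: Sm_const Sm_add)

lemma Bm_mono:
  assumes "Bm f e" "eventually (\<lambda>r. e' r \<le> e r) nevF"
  shows "Bm f e'"
proof -
  obtain c where c: "c \<ge> 1" "eventually (\<lambda>r. e r \<le> c * nev_T f r) nevF" using assms(1) by (auto simp: Bm_def)
  have "eventually (\<lambda>r. e' r \<le> c * nev_T f r) nevF" using c(2) assms(2) by eventually_elim linarith
  then show ?thesis using c(1) by (auto simp: Bm_def)
qed

lemma Bm_add: "Bm f e \<Longrightarrow> Bm f e' \<Longrightarrow> Bm f (\<lambda>r. e r + e' r)"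
proof -
  assume "Bm f e" "Bm f e'"
  then obtain c c' where c: "c \<ge> 1" "eventually (\<lambda>r. e r \<le> c * nev_T f r) nevF"
    "c' \<ge> 1" "eventually (\<lambda>r. e' r \<le> c' * nev_T f r) nevF"
    unfolding Bm_def by blast
  have "eventually (\<lambda>r. e r + e' r \<le> (c + c') * nev_T f r) nevF"
    using c(2,4) by eventually_elim (auto simp: algebra_simps)
  then show ?thesis unfolding Bm_def using c by (intro exI[of _ "c + c'"]) auto
qed

lemma Sm_imp_Bm: "Sm f e \<Longrightarrow> Bm f e"
  unfolding Bm_def using SmD[of f e 1] by (intro exI[of _ 1]) auto

lemma not_Sm_T: "\<not> Sm f (nev_T f)"
proof
  assume "Sm f (nev_T f)"
  then have "eventually (\<lambda>r. nev_T f r \<le> 1/2 * nev_T f r) nevF" by (rule SmD) simp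
  then have "eventually (\<lambda>_. False) nevF" using T_ge[of 1] by eventually_elim auto
  then show False using nevF_neq_bot by (simp add: trivial_limit_def)
qed

lemma Sm_ln_Bm:
  assumes "Bm f e"
  shows "Sm f (\<lambda>r. ln (max 1 (e r)))"
proof -
  obtain k where k: "k \<ge> 1" "eventually (\<lambda>r. e r \<le> k * nev_T f r) nevF" using assms unfolding Bm_def by blast
  show ?thesis unfolding Sm_def
  proof (intro allI impI)
    fix c :: real assume c: "c > 0"
    \<comment> \<open>Chosen so that \<open>a * (k * t) = c * t / 2\<close>. The inequality
      \<open>ln y \<le> y - 1\<close> at this point spends half of the allowance, and large
      \<open>t\<close> absorbs \<open>- ln a\<close> in the other half.\<close>
    define a where "a = c / (2 * k)"
    have a: "a > 0" using c k by (simp add: a_def)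
    show "eventually (\<lambda>r. ln (max 1 (e r)) \<le> c * nev_T f r) nevF"
      using k(2) T_ge[of "max 1 (2 * (- ln a) / c)"]
    proof eventually_elim
      case (elim r)
      define t where "t = nev_T f r"
      have t: "t \<ge> 1" "- ln a \<le> c * t / 2" using elim c by (auto simp: t_def field_simps)
      have kt: "k * t \<ge> 1" using k t mult_mono[of 1 k 1 t] by simp
      have "ln (max 1 (e r)) \<le> ln (k * t)" using elim kt by (intro ln_mono) (auto simp: t_def)
      also have "\<dots> = ln (a * (k * t)) - ln a" using ln_mult_pos[of a "k * t"] a k t by simp
      also have "ln (a * (k * t)) \<le> a * (k * t) - 1" using mult_pos_pos[of a "k * t"] a kt by (intro ln_le_minus_one) auto
      also have "a * (k * t) = c * t / 2" using k by (simp add: a_def)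
      finally show ?case using t by (simp add: t_def)
    qed
  qed
qed

lemma log_derivative_small:
  assumes "mnz g" "Bm f (nev_T g)"
  shows "Sm f (\<lambda>r. proxim (\<lambda>z. deriv g z / g z) r)"
proof -
  obtain C where C: "eventually (\<lambda>r. proxim (\<lambda>z. deriv g z / g z) r \<le> C * (1 + ln r + ln (max 1 (nev_T g r)))) nevF"
    using log_derivative_lemma[OF assms(1)] by blast
  have "Sm f (\<lambda>r. \<bar>C\<bar> * (1 + ln r + ln (max 1 (nev_T g r))))"
    by (intro Sm_cmult Sm_add Sm_const Sm_ln Sm_ln_Bm assms) auto
  then show ?thesis
  proof (rule Sm_mono)
    show "eventually (\<lambda>r. proxim (\<lambda>z. deriv g z / g z) r \<le> \<bar>C\<bar> * (1 + ln r + ln (max 1 (nev_T g r)))) nevF"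
      using C nevF_ge[of 1]
    proof eventually_elim
      case (elim r)
      have "0 \<le> 1 + ln r + ln (max 1 (nev_T g r))" using elim by (auto intro!: add_nonneg_nonneg)
      then have "C * (1 + ln r + ln (max 1 (nev_T g r))) \<le> \<bar>C\<bar> * (1 + ln r + ln (max 1 (nev_T g r)))"
        by (intro mult_right_mono) auto
      then show ?case using elim by linarith
    qed
  qed
qed

end

text \<open>Both the functions of characteristic \<open>o(T(r,f))\<close> and those of characteristic
  \<open>O(T(r,f))\<close> form differential fields; the closure proofs only use the listed properties.\<close>
locale nevclass = transc +
  fixes Q :: "(real \<Rightarrow> real) \<Rightarrow> bool"
  assumes Q_add: "Q e \<Longrightarrow> Q e' \<Longrightarrow> Q (\<lambda>r. e r + e' r)"
    and Q_mono: "Q e \<Longrightarrow> eventually (\<lambda>r. e' r \<le> e r) nevF \<Longrightarrow> Q e'"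
    and Q_Sm: "Sm f e \<Longrightarrow> Q e" and Q_Bm: "Q e \<Longrightarrow> Bm f e"
begin

definition cfun :: "(complex \<Rightarrow> complex) \<Rightarrow> bool" where
  "cfun g \<longleftrightarrow> g meromorphic_on UNIV \<and> Q (nev_T g)"

lemma cfun_mero: "cfun g \<Longrightarrow> g meromorphic_on UNIV" by (simp add: cfun_def)

lemma cfun_const: "cfun (\<lambda>_. c)"
  unfolding cfun_def using Q_mono[OF Q_Sm[OF Sm_const] nev_T_const] by (auto intro: meromorphic_intros)

lemma cfun_cong:
  assumes "cfun g" "eventually (\<lambda>z. h z = g z) (cosparse UNIV)" "h meromorphic_on UNIV"
  shows "cfun h"
proof -
  have "eventually (\<lambda>r. nev_T h r \<le> nev_T g r) nevF"
    using nev_T_cong[OF assms(2,3) cfun_mero[OF assms(1)]] by (rule eventually_mono) auto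
  then show ?thesis using assms Q_mono unfolding cfun_def by blast
qed

lemma cfun_mult: "cfun g \<Longrightarrow> cfun h \<Longrightarrow> cfun (\<lambda>z. g z * h z)"
  unfolding cfun_def using Q_mono[OF Q_add nev_T_mult] by (auto intro: meromorphic_intros)

lemma cfun_add: "cfun g \<Longrightarrow> cfun h \<Longrightarrow> cfun (\<lambda>z. g z + h z)"
  unfolding cfun_def
  using Q_mono[OF Q_add[OF Q_add Q_Sm[OF Sm_const]] nev_T_add] by (auto intro: meromorphic_intros)

lemma cfun_diff: "cfun g \<Longrightarrow> cfun h \<Longrightarrow> cfun (\<lambda>z. g z - h z)"
  using cfun_add[of g "\<lambda>z. (-1) * h z"] cfun_mult[OF cfun_const[of "-1"]] by simp

lemma cfun_zero_ae:
  assumes "g meromorphic_on UNIV" "\<not> mnz g"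
  shows "cfun g"
  using cfun_cong[OF cfun_const[of 0], of g] mero_cases[OF assms(1)] assms by blast

lemma cfun_inverse: "cfun g \<Longrightarrow> cfun (\<lambda>z. inverse (g z))"
proof (cases "mnz g")
  case True
  assume g: "cfun g"
  have "eventually (\<lambda>r. nev_T (\<lambda>z. inverse (g z)) r \<le> nev_T g r + \<bar>ln (cmod (lcoef g))\<bar>) nevF"
    using nev_T_inverse[OF True] by (rule eventually_mono) auto
  then show ?thesis using g Q_mono[OF Q_add[OF _ Q_Sm[OF Sm_const]]] unfolding cfun_def
    by (auto intro: meromorphic_intros)
next
  \<comment> \<open>Here \<open>g\<close> vanishes off a sparse set, and by the convention
    \<open>inverse 0 = 0\<close> so does its inverse.\<close>
  case False
  assume g: "cfun g"
  have m: "(\<lambda>z. inverse (g z)) meromorphic_on UNIV" using g by (auto simp: cfun_def intro: meromorphic_intros)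
  moreover have "\<not> mnz (\<lambda>z. inverse (g z))"
    using False g unfolding mnz_iff[OF m, of 0] by (simp add: le_inverse cfun_def mnz_iff[of g 0])
  ultimately show ?thesis by (rule cfun_zero_ae)
qed

lemma cfun_divide: "cfun g \<Longrightarrow> cfun h \<Longrightarrow> cfun (\<lambda>z. g z / h z)"
  unfolding divide_inverse by (intro cfun_mult cfun_inverse)

lemma cfun_deriv:
  assumes g: "cfun g"
  shows "cfun (deriv g)"
proof (cases "mnz g")
  case True
  have Q: "Q (nev_T g)" using g by (simp add: cfun_def)
  have "Q (\<lambda>r. (nev_T g r + nev_T g r) + proxim (\<lambda>z. deriv g z / g z) r)"
    by (intro Q_add Q Q_Sm log_derivative_small True Q_Bm)
  moreover have "eventually (\<lambda>r. nev_T (deriv g) r \<le> (nev_T g r + nev_T g r) + proxim (\<lambda>z. deriv g z / g z) r) nevF"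
    using nev_T_deriv[OF True] by (rule eventually_mono) auto
  ultimately have "Q (nev_T (deriv g))" by (rule Q_mono)
  then show ?thesis using g by (auto simp: cfun_def intro: meromorphic_intros)
next
  case False
  have m: "deriv g meromorphic_on UNIV" using g by (auto simp: cfun_def intro: meromorphic_intros)
  moreover have "\<not> mnz (deriv g)"
    using False g unfolding mnz_iff[OF m, of 0] by (simp add: le_deriv cfun_def mnz_iff[of g 0])
  ultimately show ?thesis by (rule cfun_zero_ae)
qed

lemma cfun_power: "cfun g \<Longrightarrow> cfun (\<lambda>z. g z ^ n)"
  by (induction n) (auto intro: cfun_const cfun_mult)

lemma cfun_prod: "(\<And>i. i \<in> I \<Longrightarrow> cfun (g i)) \<Longrightarrow> cfun (\<lambda>z. \<Prod>i\<in>I. g i z)"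
  by (induction I rule: infinite_finite_induct) (auto intro: cfun_const cfun_mult)

lemma cfun_higher_deriv: "cfun g \<Longrightarrow> cfun ((deriv ^^ n) g)"
  by (induction n) (auto intro: cfun_deriv)

end

context transc
begin

sublocale s: nevclass f "Sm f"
  by unfold_locales (auto intro: Sm_add Sm_mono Sm_imp_Bm)

sublocale b: nevclass f "Bm f"
  by unfold_locales (auto intro: Bm_add Bm_mono Sm_imp_Bm)

lemma small_imp_big: "s.cfun g \<Longrightarrow> b.cfun g"
  by (auto simp: s.cfun_def b.cfun_def Sm_imp_Bm)

lemma big_f: "b.cfun f"
  unfolding b.cfun_def Bm_def using f_mero by (auto intro!: exI[of _ 1])

lemma Sm_cnt_zerom:
  assumes "s.cfun g" "mnz g"
  shows "Sm f (cnt (zerom g))"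
proof -
  have "Sm f (nev_T (\<lambda>z. inverse (g z)))" using s.cfun_inverse[OF assms(1)] by (simp add: s.cfun_def)
  then show ?thesis
  proof (rule Sm_mono)
    show "eventually (\<lambda>r. cnt (zerom g) r \<le> nev_T (\<lambda>z. inverse (g z)) r) nevF"
      using nevF_ge[of 1]
    proof (rule eventually_mono)
      fix r :: real assume "1 \<le> r"
      then show "cnt (zerom g) r \<le> nev_T (\<lambda>z. inverse (g z)) r"
        using cnt_polem_le_T[of "\<lambda>z. inverse (g z)" r] assms
        by (simp add: zerom_inverse mnz_mero mnz_inverse)
    qed
  qed
qed

lemma Sm_cnt_polem: "s.cfun g \<Longrightarrow> Sm f (cnt (polem g))"
proof -
  assume g: "s.cfun g"
  have "eventually (\<lambda>r. cnt (polem g) r \<le> nev_T g r) nevF"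
    using nevF_ge[of 1] by (rule eventually_mono) (use g in \<open>auto intro: cnt_polem_le_T simp: s.cfun_def\<close>)
  then show ?thesis using g Sm_mono by (auto simp: s.cfun_def)
qed

lemma Sm_proxim: "s.cfun g \<Longrightarrow> Sm f (proxim g)"
proof -
  assume g: "s.cfun g"
  have "eventually (\<lambda>r. proxim g r \<le> nev_T g r) nevF"
    using nevF_ge[of 1] by (rule eventually_mono) (use g in \<open>auto intro: proxim_le_T simp: s.cfun_def\<close>)
  then show ?thesis using g Sm_mono by (auto simp: s.cfun_def)
qed

lemma small_cfunI:
  assumes "g meromorphic_on UNIV" "Sm f (proxim g)" "Sm f (cnt (polem g))"
  shows "s.cfun g"
proof -
  have "eventually (\<lambda>r. nev_T g r \<le> proxim g r + cnt (polem g) r) nevF"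
    using nevF_ge[of 1] by (rule eventually_mono) (simp add: nev_T_eq assms(1))
  from Sm_mono[OF Sm_add[OF assms(2,3)] this] show ?thesis using assms(1) by (simp add: s.cfun_def)
qed

text \<open>The germ at 0 of a meromorphic function determines it, so the small functions are
  treated as a subfield of the field of Laurent series.\<close>
definition KS :: "complex fls set" where
  "KS = {laurent_expansion g 0 | g. s.cfun g}"

text \<open>Trades a sum for a product, whose logarithm splits into separate terms, one for each
  proximity function.\<close>

lemma prod_ge_one_plus_sum:
  "finite I \<Longrightarrow> 1 + (\<Sum>i\<in>I. x i) \<le> real (card I + 1) * (\<Prod>i\<in>I. max 1 (x i))" for x :: "nat \<Rightarrow> real"
proof (induction I rule: finite_induct)
  case (insert i I)
  define P where "P = (\<Prod>i\<in>I. max 1 (x i))"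
  have P1: "P \<ge> 1" unfolding P_def by (intro prod_ge_1) auto
  have "x i \<le> max 1 (x i) * P" using P1 mult_mono[of "x i" "max 1 (x i)" 1 P] by auto
  moreover have "real (card I + 1) * P \<le> real (card I + 1) * (max 1 (x i) * P)"
    using P1 mult_right_mono[of 1 "max 1 (x i)" P] by (intro mult_left_mono) auto
  ultimately show ?case using insert by (simp add: P_def[symmetric] algebra_simps)
qed simp

text \<open>After division by the leading coefficient, \<open>f\<close> satisfies a monic equation
  with small coefficients \<open>b i\<close>. Then \<open>cmod (f z)\<close> is at most
  \<open>1 + (\<Sum>i<d. cmod (b i z))\<close>, and every pole of \<open>f\<close> is matched by a
  pole of some \<open>b i\<close> of at least the same order. Hence \<open>f\<close> would be small
  compared with itself.\<close>

lemma f_transcendental_over_small: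
  assumes coeffs: "\<forall>i. Polynomial.coeff p i \<in> KS" and root: "poly p (laurent_expansion f 0) = 0"
  shows "p = 0"
proof (rule ccontr)
  assume p0: "p \<noteq> 0"
  define d where "d = Polynomial.degree p"
  have "\<exists>g. \<forall>i. s.cfun (g i) \<and> Polynomial.coeff p i = laurent_expansion (g i) 0"
  proof (intro choice allI)
    fix i
    have "Polynomial.coeff p i \<in> KS" using coeffs by simp
    then show "\<exists>g. s.cfun g \<and> Polynomial.coeff p i = laurent_expansion g 0" unfolding KS_def by auto
  qed
  then obtain g where g: "\<And>i. s.cfun (g i)" "\<And>i. Polynomial.coeff p i = laurent_expansion (g i) 0" by blast
  have gm: "g i meromorphic_on UNIV" for i using g s.cfun_mero by blast
  have "Polynomial.coeff p d \<noteq> 0" using p0 by (simp add: d_def)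
  then have gd: "mnz (g d)" using g(2)[of d] mnz_iff[OF gm[of d], of 0] by simp
  define b where "b i z = g i z / g d z" for i z
  have b: "s.cfun (b i)" for i unfolding b_def by (intro s.cfun_divide g)
  have bm: "b i meromorphic_on UNIV" for i using b s.cfun_mero by blast
  define h where "h z = f z ^ d + (\<Sum>i<d. b i z * f z ^ i)" for z
  have hm: "h meromorphic_on UNIV" unfolding h_def by (intro meromorphic_intros f_mero bm)
  have leh: "laurent_expansion h z = laurent_expansion f z ^ d + (\<Sum>i<d. laurent_expansion (b i) z * laurent_expansion f z ^ i)" for z
    unfolding h_def by (rule laurent_expansion_eqI) (intro laurent_expansion_intros le_mero f_mero bm)
  have "laurent_expansion h 0 = 0"
  proof -
    define F where "F = laurent_expansion f 0"
    define c where "c = laurent_expansion (g d) 0"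
    have c0: "c \<noteq> 0" unfolding c_def by (rule le_nonzero[OF gd])
    have "poly p F = (\<Sum>i<Suc d. laurent_expansion (g i) 0 * F ^ i)"
      unfolding poly_altdef d_def[symmetric] g(2) by (simp add: lessThan_Suc_atMost)
    then have "0 = (\<Sum>i<d. laurent_expansion (g i) 0 * F ^ i) + c * F ^ d"
      using root by (simp add: F_def c_def)
    then have "0 = ((\<Sum>i<d. laurent_expansion (g i) 0 * F ^ i) + c * F ^ d) / c" by simp
    also have "\<dots> = (\<Sum>i<d. laurent_expansion (g i) 0 / c * F ^ i) + F ^ d"
      using c0 by (simp add: add_divide_distrib sum_divide_distrib)
    finally show ?thesis unfolding leh
      by (simp add: b_def[abs_def] le_divide[OF gm gm] F_def[symmetric] c_def[symmetric] add.commute)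
  qed
  then have "\<not> mnz h" using mnz_iff[OF hm, of 0] by simp
  then have hev: "eventually (\<lambda>z. h z = 0) (cosparse UNIV)" using mero_cases[OF hm] by blast
  have d0: "d > 0"
  proof (rule ccontr)
    assume "\<not> d > 0"
    then have "h = (\<lambda>_. 1)" by (auto simp: h_def)
    then show False using \<open>\<not> mnz h\<close> mnz_const[of 1] by simp
  qed
  have "Sm f (\<lambda>r. (\<Sum>i<d. proxim (b i) r) + ln (real (d + 1)) + (\<Sum>i<d. cnt (polem (b i)) r))"
    by (intro Sm_add Sm_sum Sm_const Sm_proxim Sm_cnt_polem b) auto
  then have "Sm f (nev_T f)"
  proof (rule Sm_mono)
    have "eventually (\<lambda>r. (\<forall>i\<in>{..<d}. anrad (b i) r) \<and> anrad f r \<and> r \<ge> 1 \<and> (\<forall>z. cmod z = r \<longrightarrow> h z = 0)) nevF"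
      by (intro eventually_conj eventually_ball_finite nevF_anrad f_mero bm nevF_ge nevF_cosparse hev ballI) auto
    then show "eventually (\<lambda>r. nev_T f r \<le> (\<Sum>i<d. proxim (b i) r) + ln (real (d + 1)) + (\<Sum>i<d. cnt (polem (b i)) r)) nevF"
    proof (rule eventually_mono)
      fix r assume r: "(\<forall>i\<in>{..<d}. anrad (b i) r) \<and> anrad f r \<and> r \<ge> 1 \<and> (\<forall>z. cmod z = r \<longrightarrow> h z = 0)"
      have "proxim f r \<le> cavg r (\<lambda>z. (\<Sum>i<d. logplus (cmod (b i z))) + ln (real (d + 1)))"
        unfolding proxim_cavg
      proof (intro cavg_mono continuous_intros anrad_continuous)
        fix z assume z: "cmod z = r"
        define x where "x i = cmod (b i z)" for i
        have x0: "x i \<ge> 0" for i by (simp add: x_def)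
        have "cmod (f z) \<le> 1 + (\<Sum>i<d. x i)"
        proof (cases "cmod (f z) \<le> 1")
          case True
          then show ?thesis using sum_nonneg[of "{..<d}" x] x0 by fastforce
        next
          case False
          have "f z ^ d = - (\<Sum>i<d. b i z * f z ^ i)" using r z by (simp add: h_def eq_neg_iff_add_eq_0)
          then have "cmod (f z) ^ d = cmod (\<Sum>i<d. b i z * f z ^ i)" by (metis norm_minus_cancel norm_power)
          also have "\<dots> \<le> (\<Sum>i<d. x i * cmod (f z) ^ (d - 1))"
          proof (rule sum_norm_le)
            fix i assume "i \<in> {..<d}"
            then have "cmod (f z) ^ i \<le> cmod (f z) ^ (d - 1)" using False by (intro power_increasing) auto
            then show "cmod (b i z * f z ^ i) \<le> x i * cmod (f z) ^ (d - 1)"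
              by (simp add: norm_mult norm_power x_def mult_left_mono)
          qed
          also have "\<dots> = (\<Sum>i<d. x i) * cmod (f z) ^ (d - 1)" by (simp add: sum_distrib_right)
          finally have "cmod (f z) * cmod (f z) ^ (d - 1) \<le> (\<Sum>i<d. x i) * cmod (f z) ^ (d - 1)"
            using d0 by (simp add: power_eq_if)
          moreover have "cmod (f z) ^ (d - 1) > 0" using False by (intro zero_less_power) linarith
          ultimately have "cmod (f z) \<le> (\<Sum>i<d. x i)" by simp
          then show ?thesis by simp
        qed
        also have "\<dots> \<le> real (d + 1) * (\<Prod>i<d. max 1 (x i))" using prod_ge_one_plus_sum[of "{..<d}" x] by simp
        finally have le: "cmod (f z) \<le> real (d + 1) * (\<Prod>i<d. max 1 (x i))" .
        have pos: "(\<Prod>i<d. max 1 (x i)) \<ge> 1" by (intro prod_ge_1) auto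
        then have "real (d + 1) * (\<Prod>i<d. max 1 (x i)) \<ge> 1"
          using mult_mono[of 1 "real (d + 1)" 1 "\<Prod>i<d. max 1 (x i)"] by simp
        then have "ln (max 1 (cmod (f z))) \<le> ln (real (d + 1) * (\<Prod>i<d. max 1 (x i)))" using le by (intro ln_mono) auto
        also have "\<dots> = ln (real (d + 1)) + (\<Sum>i<d. ln (max 1 (x i)))" using pos by (subst ln_mult) (auto simp: ln_prod)
        finally show "logplus (cmod (f z)) \<le> (\<Sum>i<d. logplus (cmod (b i z))) + ln (real (d + 1))"
          by (simp add: logplus_max x_def)
      qed (use r in auto)
      also have "\<dots> = cavg r (\<lambda>z. \<Sum>i<d. logplus (cmod (b i z))) + cavg r (\<lambda>_. ln (real (d + 1)))"
        using r by (intro cavg_add continuous_intros anrad_continuous) auto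
      also have "cavg r (\<lambda>z. \<Sum>i<d. logplus (cmod (b i z))) = (\<Sum>i<d. proxim (b i) r)"
        unfolding proxim_cavg using r by (intro cavg_sum anrad_logplus) auto
      finally have m: "proxim f r \<le> (\<Sum>i<d. proxim (b i) r) + ln (real (d + 1))" by simp
      have pole: "polem f z \<le> (\<Sum>i<d. polem (b i) z)" for z
      proof (cases "ordm f z \<ge> 0")
        case True
        then show ?thesis by (simp add: polem_def sum_nonneg)
      next
        case False
        define F where "F = laurent_expansion f z"
        define m where "m = ordm f z"
        have m: "m < 0" using False by (simp add: m_def)
        have F0: "F \<noteq> 0" unfolding F_def by (rule le_nonzero[OF f_mnz])
        have "laurent_expansion h z = 0" using \<open>\<not> mnz h\<close> mnz_iff[OF hm, of z] by simp
        then have e: "F ^ d = - (\<Sum>i<d. laurent_expansion (b i) z * F ^ i)"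
          unfolding leh F_def by (simp add: eq_neg_iff_add_eq_0)
        have "fls_nth (F ^ d) (int d * m) \<noteq> 0"
        proof -
          have "fls_subdegree (F ^ d) = int d * m" by (simp add: m_def ordm_def F_def fls_subdegree_pow)
          then show ?thesis using F0 nth_fls_subdegree_zero_iff[of "F ^ d"] by simp
        qed
        then have "(\<Sum>i<d. fls_nth (laurent_expansion (b i) z * F ^ i) (int d * m)) \<noteq> 0"
          unfolding e by (simp add: fls_nth_sum)
        then obtain i where i: "i < d" "fls_nth (laurent_expansion (b i) z * F ^ i) (int d * m) \<noteq> 0"
          by (metis (no_types, lifting) lessThan_iff sum.neutral)
        then have b0: "laurent_expansion (b i) z \<noteq> 0" by auto
        have "fls_subdegree (laurent_expansion (b i) z * F ^ i) \<le> int d * m" using i(2) by (rule fls_subdegree_leI)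
        then have "ordm (b i) z + int i * m \<le> int d * m"
          using b0 F0 by (simp add: ordm_def m_def F_def fls_subdegree_pow)
        then have "ordm (b i) z \<le> (int d - int i) * m" by (simp add: algebra_simps)
        also have "\<dots> \<le> 1 * m" using i(1) m by (intro mult_right_mono_neg) auto
        finally have "polem f z \<le> polem (b i) z" by (simp add: polem_def m_def)
        also have "\<dots> \<le> (\<Sum>i<d. polem (b i) z)" using i(1) by (intro member_le_sum) auto
        finally show ?thesis .
      qed
      have lf: "locfin (\<lambda>z. \<Sum>i\<in>I. polem (b i) z) \<and> cnt (\<lambda>z. \<Sum>i\<in>I. polem (b i) z) r = (\<Sum>i\<in>I. cnt (polem (b i)) r)" if "finite I" for I
        using that
      proof induction
        case empty then show ?case by (simp add: locfin_def cnt_def)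
      next
        case (insert i I)
        then show ?case using locfin_polem[OF bm] by (simp add: locfin_add cnt_add)
      qed
      have "cnt (polem f) r \<le> cnt (\<lambda>z. \<Sum>i<d. polem (b i) z) r"
        using r lf[of "{..<d}"] by (intro cnt_mono locfin_polem f_mero pole) auto
      then have "cnt (polem f) r \<le> (\<Sum>i<d. cnt (polem (b i)) r)" using lf[of "{..<d}"] by simp
      then show "nev_T f r \<le> (\<Sum>i<d. proxim (b i) r) + ln (real (d + 1)) + (\<Sum>i<d. cnt (polem (b i)) r)"
        using m r by (simp add: nev_T_eq f_mero)
    qed
  qed
  then show False using not_Sm_T by blast
qed

end

subsection \<open>Local computations with Laurent series\<close>

lemma fls_times_nth_low:
  fixes F G :: "complex fls"
  shows "fls_nth (F * G) (fls_subdegree F + fls_subdegree G)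
      = fls_nth F (fls_subdegree F) * fls_nth G (fls_subdegree G)"
    and "fls_nth (F * G) (fls_subdegree F + fls_subdegree G + 1)
      = fls_nth F (fls_subdegree F) * fls_nth G (fls_subdegree G + 1)
       + fls_nth F (fls_subdegree F + 1) * fls_nth G (fls_subdegree G)"
proof -
  define a b where "a = fls_subdegree F" and "b = fls_subdegree G"
  have "fls_nth (F * G) (a + b) = (\<Sum>i=0..0::int. fls_nth F (a + i) * fls_nth G (b - i))"
    using fls_times_nth(4)[of F G "a + b"] by (simp add: a_def b_def)
  then show "fls_nth (F * G) (fls_subdegree F + fls_subdegree G)
      = fls_nth F (fls_subdegree F) * fls_nth G (fls_subdegree G)" by (simp add: a_def b_def)
  have "fls_nth (F * G) (a + b + 1) = (\<Sum>i=0..1::int. fls_nth F (a + i) * fls_nth G (b + 1 - i))"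
    using fls_times_nth(4)[of F G "a + b + 1"] by (simp add: a_def b_def algebra_simps)
  also have "{0..1::int} = {0, 1}" by auto
  finally show "fls_nth (F * G) (fls_subdegree F + fls_subdegree G + 1)
      = fls_nth F (fls_subdegree F) * fls_nth G (fls_subdegree G + 1)
       + fls_nth F (fls_subdegree F + 1) * fls_nth G (fls_subdegree G)" by (simp add: a_def b_def)
qed

text \<open>The constant term of the logarithmic derivative, so that it turns products into sums.\<close>
definition c0 :: "complex fls \<Rightarrow> complex" where
  "c0 F = fls_nth F (fls_subdegree F + 1) / fls_nth F (fls_subdegree F)"

lemma c0_mult:
  assumes "F \<noteq> 0" "G \<noteq> 0"
  shows "c0 (F * G) = c0 F + c0 G"
proof -
  have "fls_nth F (fls_subdegree F) \<noteq> 0" "fls_nth G (fls_subdegree G) \<noteq> 0" using assms by auto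
  then show ?thesis
    unfolding c0_def fls_subdegree_mult[OF assms] fls_times_nth_low by (simp add: add_divide_distrib)
qed

lemma c0_1 [simp]: "c0 1 = 0" by (simp add: c0_def)

lemma c0_const [simp]: "c \<noteq> 0 \<Longrightarrow> c0 (fls_const c) = 0" by (simp add: c0_def)

lemma c0_power: "F \<noteq> 0 \<Longrightarrow> c0 (F ^ n) = of_nat n * c0 F"
  by (induction n) (auto simp: c0_mult algebra_simps)

lemma c0_inverse: "F \<noteq> 0 \<Longrightarrow> c0 (inverse F) = - c0 F"
  using c0_mult[of F "inverse F"] by (simp add: eq_neg_iff_add_eq_0 add.commute)

lemma c0_divide: "F \<noteq> 0 \<Longrightarrow> G \<noteq> 0 \<Longrightarrow> c0 (F / G) = c0 F - c0 G"
  unfolding divide_inverse by (simp add: c0_mult c0_inverse)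

lemma c0_prod: "(\<And>i. i \<in> I \<Longrightarrow> F i \<noteq> 0) \<Longrightarrow> c0 (\<Prod>i\<in>I. F i) = (\<Sum>i\<in>I. c0 (F i))"
  by (induction I rule: infinite_finite_induct) (auto simp: c0_mult)

lemma c0_deriv:
  assumes "fls_subdegree F \<noteq> 0"
  shows "c0 (fls_deriv F) = of_int (fls_subdegree F + 1) / of_int (fls_subdegree F) * c0 F"
  unfolding c0_def fls_subdegree_deriv[OF assms] by simp

lemma fls_logderiv_nth_0:
  assumes "F \<noteq> 0" "fls_subdegree F = 0"
  shows "fls_nth (fls_deriv F / F) 0 = c0 F"
    and "fls_deriv F / F = 0 \<or> fls_subdegree (fls_deriv F / F) \<ge> 0"
proof -
  define L where "L = fls_deriv F / F"
  have LF: "L * F = fls_deriv F" using assms by (simp add: L_def)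
  show ge: "L = 0 \<or> fls_subdegree L \<ge> 0"
  proof (rule disjCI)
    assume nl: "\<not> fls_subdegree L \<ge> 0"
    define n where "n = fls_subdegree L"
    have n: "n < 0" using nl by (simp add: n_def)
    have "fls_nth (L * F) n = fls_nth L n * fls_nth F 0"
      using fls_times_nth_low(1)[of L F] assms by (simp add: n_def)
    moreover have "fls_nth (L * F) n = 0"
      unfolding LF using n assms by (cases "n = -1") (auto intro!: fls_eq0_below_subdegree)
    moreover have "fls_nth F 0 \<noteq> 0" using assms by (metis nth_fls_subdegree_zero_iff)
    ultimately have "fls_nth L (fls_subdegree L) = 0" by (simp add: n_def)
    then show "L = 0" by (simp only: nth_fls_subdegree_zero_iff)
  qed
  have F0: "fls_nth F 0 \<noteq> 0" using assms by (metis nth_fls_subdegree_zero_iff)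
  have "fls_nth (L * F) 0 = fls_nth L 0 * fls_nth F 0"
  proof (cases "L = 0 \<or> fls_subdegree L > 0")
    case True
    then have "fls_nth L 0 = 0" by (auto intro: fls_eq0_below_subdegree)
    moreover have "fls_nth (L * F) 0 = 0"
      using True assms by (cases "L = 0") (auto intro!: fls_times_nth_eq0)
    ultimately show ?thesis by simp
  next
    case False
    then have "fls_subdegree L = 0" using ge by auto
    then show ?thesis using fls_times_nth_low(1)[of L F] assms by simp
  qed
  then have "fls_nth L 0 * fls_nth F 0 = fls_nth F 1" unfolding LF by simp
  then show "fls_nth L 0 = c0 F" using F0 assms(2) by (simp add: c0_def field_simps)
qed

text \<open>A derivative lowers the order by exactly one unless the order is 0. The hypothesis keeps
  the order away from 0 until all \<open>m\<close> derivatives have been taken.\<close>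

lemma fls_higher_deriv_subdegree:
  fixes F :: "complex fls"
  assumes "F \<noteq> 0" "fls_subdegree F < 0 \<or> fls_subdegree F \<ge> int m"
  shows "(fls_deriv ^^ m) F \<noteq> 0 \<and> fls_subdegree ((fls_deriv ^^ m) F) = fls_subdegree F - int m"
  using assms(2)
proof (induction m)
  case 0 then show ?case using assms(1) by simp
next
  case (Suc m)
  define G where "G = (fls_deriv ^^ m) F"
  have G: "G \<noteq> 0" "fls_subdegree G = fls_subdegree F - int m" using Suc by (auto simp: G_def)
  then have s: "fls_subdegree G \<noteq> 0" using Suc.prems by auto
  then have d: "fls_subdegree (fls_deriv G) = fls_subdegree G - 1" by (rule fls_subdegree_deriv)
  have "fls_nth (fls_deriv G) (fls_subdegree G - 1) \<noteq> fls_nth 0 (fls_subdegree G - 1)" using G(1) s by simp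
  then have "fls_deriv G \<noteq> 0" by metis
  then show ?case using d G by (simp add: G_def)
qed

lemma fls_deriv_subdegree_ge:
  fixes F :: "complex fls"
  shows "fls_deriv F = 0 \<or> fls_subdegree (fls_deriv F) \<ge> fls_subdegree F - 1"
proof (rule disjCI)
  assume "\<not> fls_subdegree (fls_deriv F) \<ge> fls_subdegree F - 1"
  then have "fls_nth (fls_deriv F) (fls_subdegree (fls_deriv F)) = 0"
    by (auto intro!: fls_eq0_below_subdegree)
  then show "fls_deriv F = 0" by (simp only: nth_fls_subdegree_zero_iff)
qed

lemma fls_deriv_subdegree_nonneg:
  fixes F :: "complex fls"
  assumes "fls_subdegree F \<ge> 0"
  shows "fls_subdegree (fls_deriv F) \<ge> 0"
proof (rule ccontr)
  define n where "n = fls_subdegree (fls_deriv F)"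
  assume "\<not> fls_subdegree (fls_deriv F) \<ge> 0"
  then have n: "n < 0" by (simp add: n_def)
  then have "fls_nth (fls_deriv F) n = 0"
    using assms by (cases "n = -1") (auto intro!: fls_eq0_below_subdegree)
  then have "fls_deriv F = 0" unfolding n_def by (simp only: nth_fls_subdegree_zero_iff)
  then show False using n by (simp add: n_def)
qed

lemma fls_higher_deriv_subdegree_nonneg:
  fixes F :: "complex fls"
  assumes "fls_subdegree F \<ge> 0"
  shows "fls_subdegree ((fls_deriv ^^ m) F) \<ge> 0"
  by (induction m) (auto simp: assms fls_deriv_subdegree_nonneg)

section \<open>Orders of the differential monomial and of \<open>G' / (G - 1)\<close>\<close>

definition fls_monomial :: "nat \<Rightarrow> (nat \<Rightarrow> nat) \<Rightarrow> (nat \<Rightarrow> nat) \<Rightarrow> complex fls \<Rightarrow> complex fls" where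
  "fls_monomial k l m F = F ^ l 0 * (\<Prod>i=1..k. (fls_deriv ^^ m i) (F ^ l i))"

lemma fls_subdegree_mult_nonneg:
  fixes F G :: "complex fls"
  assumes "fls_subdegree F \<ge> 0" "fls_subdegree G \<ge> 0"
  shows "fls_subdegree (F * G) \<ge> 0"
  using assms by (cases "F = 0 \<or> G = 0") auto

lemma fls_subdegree_prod_nonneg:
  fixes F :: "nat \<Rightarrow> complex fls"
  assumes "\<And>i. i \<in> I \<Longrightarrow> fls_subdegree (F i) \<ge> 0"
  shows "fls_subdegree (\<Prod>i\<in>I. F i) \<ge> 0"
  using assms
  by (induction I rule: infinite_finite_induct) (auto intro: fls_subdegree_mult_nonneg)

text \<open>At a zero of order \<open>p\<close> the factor \<open>F ^ l i\<close> has order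
  \<open>l i * p\<close>, which is at least \<open>l i\<close> and so at least \<open>m i\<close>;
  no derivative meets a constant term too early. This is where \<open>l i \<ge> m i\<close>
  enters.\<close>

lemma fls_monomial_subdegree:
  assumes F: "F \<noteq> 0" and lm: "\<forall>i\<in>{1..k}. l i \<ge> m i" and p: "fls_subdegree F \<noteq> 0"
  shows "fls_monomial k l m F \<noteq> 0 \<and> fls_subdegree (fls_monomial k l m F)
     = int (l 0 + (\<Sum>i=1..k. l i)) * fls_subdegree F - int (\<Sum>i=1..k. m i)"
proof -
  define p where "p = fls_subdegree F"
  have each: "(fls_deriv ^^ m i) (F ^ l i) \<noteq> 0 \<and> fls_subdegree ((fls_deriv ^^ m i) (F ^ l i)) = int (l i) * p - int (m i)"
    if i: "i \<in> {1..k}" for i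
  proof -
    have s: "fls_subdegree (F ^ l i) = int (l i) * p" by (simp add: p_def fls_subdegree_pow)
    have "int (l i) * p < 0 \<or> int (l i) * p \<ge> int (m i)"
    proof (cases "p > 0")
      case True
      then have "int (l i) * 1 \<le> int (l i) * p" by (intro mult_left_mono) auto
      moreover have "int (m i) \<le> int (l i)" using lm i by simp
      ultimately show ?thesis by simp
    next
      case False
      then have "p < 0" using p p_def by simp
      moreover have "m i \<le> l i" using lm i by blast
      ultimately show ?thesis by (cases "l i = 0") (auto simp: mult_pos_neg)
    qed
    then show ?thesis using fls_higher_deriv_subdegree[of "F ^ l i" "m i"] F s by simp
  qed
  have prod: "(\<Prod>i\<in>I. (fls_deriv ^^ m i) (F ^ l i)) \<noteq> 0 \<and>
     fls_subdegree (\<Prod>i\<in>I. (fls_deriv ^^ m i) (F ^ l i)) = (\<Sum>i\<in>I. int (l i) * p - int (m i))"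
    if "finite I" "I \<subseteq> {1..k}" for I
    using that by induction (use each in auto)
  show ?thesis
    using prod[of "{1..k}"] F unfolding fls_monomial_def
    by (simp add: fls_subdegree_pow p_def[symmetric] sum_subtractf sum_distrib_left algebra_simps)
qed

lemma fls_monomial_subdegree_nonneg:
  assumes "fls_subdegree F \<ge> 0"
  shows "fls_subdegree (fls_monomial k l m F) \<ge> 0"
proof -
  have "fls_subdegree (\<Prod>i=1..k. (fls_deriv ^^ m i) (F ^ l i)) \<ge> 0"
    using assms by (intro fls_subdegree_prod_nonneg fls_higher_deriv_subdegree_nonneg) (simp add: fls_subdegree_pow)
  moreover have "fls_subdegree (F ^ l 0) \<ge> 0" using assms by (simp add: fls_subdegree_pow)
  ultimately show ?thesis unfolding fls_monomial_def by (intro fls_subdegree_mult_nonneg)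
qed

text \<open>A logarithmic derivative has at most simple poles, at zeros and poles of
  \<open>G - 1\<close>. Those come from poles of the underlying function, from zeros of
  \<open>F - w\<close>, or from interference with zeros and poles of \<open>w\<close>, for which the
  term with the absolute value pays. A zero of order \<open>p\<close> gives \<open>G\<close> the
  order \<open>L * p - M\<close> up to that of \<open>w\<close>, of which differentiation costs
  one.\<close>

lemma log_derivative_order:
  fixes F w :: "complex fls" and p :: int
  assumes w: "w \<noteq> 0" and G: "G = F / w" "fls_deriv G \<noteq> 0"
    and pn: "p \<noteq> 0 \<Longrightarrow> F \<noteq> 0 \<and> fls_subdegree F = int L * p - int M"
    and p0: "p = 0 \<Longrightarrow> fls_subdegree F \<ge> 0"
  shows "fls_subdegree (fls_deriv G / (G - 1)) \<ge> int L * max p 0 - (if p > 0 then int M + 1 else 0)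
     - (if p < 0 then 1 else 0) - \<bar>fls_subdegree w\<bar> - (if fls_subdegree (F - w) > 0 then 1 else 0)"
    and "fls_subdegree (fls_deriv G / (G - 1)) \<ge> -1"
proof -
  define q where "q = fls_subdegree w"
  have Q0: "G - 1 \<noteq> 0" using G(2) by auto
  have dQ: "fls_deriv (G - 1) = fls_deriv G" by simp
  have W: "fls_subdegree (fls_deriv G / (G - 1)) = fls_subdegree (fls_deriv G) - fls_subdegree (G - 1)"
    using G(2) Q0 by (rule fls_divide_subdegree)
  have "fls_subdegree (fls_deriv (G - 1)) \<ge> fls_subdegree (G - 1) - 1"
    using fls_deriv_subdegree_ge[of "G - 1"] G(2) by simp
  then show m1: "fls_subdegree (fls_deriv G / (G - 1)) \<ge> -1" unfolding W dQ by simp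
  have G0: "G \<noteq> 0" using G(2) by auto
  then have F0: "F \<noteq> 0" using G by auto
  have ordG: "fls_subdegree G = fls_subdegree F - q" using F0 w by (simp add: G q_def fls_divide_subdegree)
  \<comment> \<open>If \<open>G\<close> vanishes, \<open>G - 1\<close> is a unit, and only the
    derivative matters.\<close>
  have pos: "fls_subdegree (fls_deriv G / (G - 1)) = fls_subdegree G - 1" if g: "fls_subdegree G > 0"
  proof -
    have "fls_nth (G - 1) 0 = -1" using g by (simp add: fls_eq0_below_subdegree)
    then have "fls_subdegree (G - 1) \<le> 0" by (intro fls_subdegree_leI) simp
    moreover have "fls_subdegree (G - 1) \<ge> 0"
      using fls_plus_subdegree[of G "-1"] Q0 g by simp
    ultimately have "fls_subdegree (G - 1) = 0" by simp
    then show ?thesis unfolding W using g by (simp add: fls_subdegree_deriv)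
  qed
  show "fls_subdegree (fls_deriv G / (G - 1)) \<ge> int L * max p 0 - (if p > 0 then int M + 1 else 0)
     - (if p < 0 then 1 else 0) - \<bar>fls_subdegree w\<bar> - (if fls_subdegree (F - w) > 0 then 1 else 0)"
  proof (cases p "0 :: int" rule: linorder_cases)
    case less
    then show ?thesis using m1 by (auto simp: max_def)
  next
    case greater
    then have f: "fls_subdegree F = int L * p - int M" using pn by simp
    show ?thesis
    proof (cases "fls_subdegree G > 0")
      case True
      then show ?thesis using pos[OF True] ordG f greater by (auto simp: max_def q_def)
    next
      case False
      then show ?thesis using m1 ordG f greater by (auto simp: max_def q_def)
    qed
  next
    case equal
    then have f: "fls_subdegree F \<ge> 0" using p0 by simp
    show ?thesis
    proof (cases "q = 0")
      case False
      then show ?thesis using m1 equal by (auto simp: q_def)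
    next
      case True
      then have g: "fls_subdegree G \<ge> 0" using ordG f by simp
      have eq: "F - w = w * (G - 1)" using w by (simp add: G algebra_simps)
      have "fls_subdegree (F - w) = fls_subdegree (G - 1)"
        unfolding eq using w Q0 True by (simp add: q_def)
      moreover have "fls_subdegree (G - 1) \<ge> 0" using fls_plus_subdegree[of G "-1"] Q0 g by simp
      moreover have "fls_subdegree (fls_deriv G) \<ge> 0" using g by (rule fls_deriv_subdegree_nonneg)
      ultimately show ?thesis using m1 equal True unfolding W by (auto simp: q_def)
    qed
  qed
qed

text \<open>At a simple pole of \<open>f\<close> the two leading coefficients of \<open>G' = \<phi> f (G - 1)\<close> determine the
  principal part of \<open>f' - A f\<^sup>2\<close>, which the choice of \<open>B\<close> removes.\<close>
lemma riccati_at_simple_pole: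
  fixes F w :: "complex fls"
  assumes F: "fls_subdegree F = -1" and w: "w \<noteq> 0" "fls_subdegree w = 0"
    and lm: "\<forall>i\<in>{1..k}. l i \<ge> m i"
    and n: "n > 0" "int (2 * n) = int (l 0 + (\<Sum>i=1..k. l i)) + int (\<Sum>i=1..k. m i)"
    and \<kappa>: "\<kappa> = of_nat (l 0) + (\<Sum>i=1..k. of_nat (l i) * (\<Prod>j<m i. (of_nat (l i + j) - 1) / of_nat (l i + j)))"
      "\<kappa> + 2 * of_nat n \<noteq> (0 :: complex)"
    and G: "G = fls_monomial k l m F / w"
    and \<phi>: "\<phi> = fls_deriv G / (G - 1) / F"
    and A: "A = \<phi> / of_nat (2 * n)"
    and B: "B = fls_deriv \<phi> / \<phi> + fls_const (2 / (\<kappa> + 2 * of_nat n)) * (fls_deriv w / w - of_nat (2 * n) * (fls_deriv \<phi> / \<phi>))"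
  shows "fls_subdegree (fls_deriv F - A * F ^ 2 - B * F) \<ge> 0"
proof -
  have F0: "F \<noteq> 0" using F by auto
  define P where "P = fls_monomial k l m F"
  have P: "P \<noteq> 0" "fls_subdegree P = - int (2 * n)"
    using fls_monomial_subdegree[OF F0 lm] F n by (auto simp: P_def algebra_simps)
  \<comment> \<open>After \<open>i\<close> derivatives the order is \<open>- (a + i)\<close>, so the
    next one multiplies the two leading coefficients by factors with quotient
    \<open>(a + i - 1) / (a + i)\<close>.\<close>
  have cder: "c0 ((fls_deriv ^^ j) (F ^ a)) = of_nat a * (\<Prod>i<j. (of_nat (a + i) - 1) / of_nat (a + i)) * c0 F"
    if a: "a > 0 \<or> j = 0" for a j
    using a
  proof (induction j)
    case 0 then show ?case using F0 by (simp add: c0_power)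
  next
    case (Suc j)
    define H where "H = (fls_deriv ^^ j) (F ^ a)"
    have s: "fls_subdegree (F ^ a) = - int a" using F by (simp add: fls_subdegree_pow)
    have "H \<noteq> 0 \<and> fls_subdegree H = - int a - int j"
      unfolding H_def using fls_higher_deriv_subdegree[of "F ^ a" j] F0 s Suc.prems by simp
    then have sH: "fls_subdegree H = - int (a + j)" by simp
    then have "c0 (fls_deriv H) = of_int (- int (a + j) + 1) / of_int (- int (a + j)) * c0 H"
      using Suc.prems by (subst c0_deriv) auto
    also have "of_int (- int (a + j) + 1) / of_int (- int (a + j)) = (of_nat (a + j) - 1) / (of_nat (a + j) :: complex)"
    proof -
      have "of_int (- int (a + j) + 1) = - (of_nat (a + j) - 1 :: complex)" "of_int (- int (a + j)) = - (of_nat (a + j) :: complex)"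
        by simp_all
      then show ?thesis by (simp only: minus_divide_divide)
    qed
    finally show ?case using Suc by (simp add: H_def mult_ac)
  qed
  have nz: "(fls_deriv ^^ m i) (F ^ l i) \<noteq> 0" if "i \<in> {1..k}" for i
  proof -
    have "m i \<le> l i" using lm that by blast
    then show ?thesis using fls_higher_deriv_subdegree[of "F ^ l i" "m i"] F0 F
      by (cases "l i = 0") (auto simp: fls_subdegree_pow)
  qed
  have cP: "c0 P = \<kappa> * c0 F"
  proof -
    have "(\<Prod>i=1..k. (fls_deriv ^^ m i) (F ^ l i)) \<noteq> 0" using nz by simp
    then have "c0 P = c0 (F ^ l 0) + c0 (\<Prod>i=1..k. (fls_deriv ^^ m i) (F ^ l i))"
      unfolding P_def fls_monomial_def using F0 by (intro c0_mult) auto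
    also have "c0 (\<Prod>i=1..k. (fls_deriv ^^ m i) (F ^ l i)) = (\<Sum>i=1..k. c0 ((fls_deriv ^^ m i) (F ^ l i)))"
      by (rule c0_prod[OF nz])
    also have "c0 (F ^ l 0) = of_nat (l 0) * c0 F" using F0 by (rule c0_power)
    also have "(\<Sum>i=1..k. c0 ((fls_deriv ^^ m i) (F ^ l i)))
      = (\<Sum>i=1..k. of_nat (l i) * (\<Prod>j<m i. (of_nat (l i + j) - 1) / of_nat (l i + j)) * c0 F)"
      using lm by (intro sum.cong refl cder) (metis atLeastAtMost_iff gr0I le_zero_eq)
    finally show ?thesis by (simp add: \<kappa> algebra_simps sum_distrib_left)
  qed
  have G0: "G \<noteq> 0" using P w by (simp add: G P_def)
  have sG: "fls_subdegree G = - int (2 * n)" using P w by (simp add: G P_def[symmetric] fls_divide_subdegree)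
  have cG: "c0 G = \<kappa> * c0 F - c0 w" unfolding G P_def[symmetric] using P w cP by (simp add: c0_divide)
  have Gn: "fls_nth (G - 1) j = fls_nth G j" if "j < 0" for j using that by simp
  have nz1: "fls_nth (G - 1) (- int (2 * n)) \<noteq> 0"
    using Gn[of "- int (2 * n)"] n(1) G0 sG by (metis neg_less_0_iff_less nat_0_less_mult_iff of_nat_0_less_iff pos2 nth_fls_subdegree_zero_iff)
  then have Q0: "G - 1 \<noteq> 0" by auto
  have sQ: "fls_subdegree (G - 1) = - int (2 * n)"
  proof (rule antisym)
    show "fls_subdegree (G - 1) \<le> - int (2 * n)" using nz1 by (rule fls_subdegree_leI)
    show "- int (2 * n) \<le> fls_subdegree (G - 1)" using fls_plus_subdegree[of G "-1"] Q0 sG n by simp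
  qed
  have cQ: "c0 (G - 1) = c0 G"
    unfolding c0_def sQ sG using n Gn[of "- int (2 * n)"] Gn[of "- int (2 * n) + 1"] by simp
  have sdG: "fls_subdegree (fls_deriv G) = - int (2 * n) - 1" using fls_subdegree_deriv[of G] sG n by simp
  then have dG0: "fls_deriv G \<noteq> 0" by auto
  define W where "W = fls_deriv G / (G - 1)"
  have sW: "fls_subdegree W = -1" using dG0 Q0 sdG sQ by (simp add: W_def fls_divide_subdegree)
  then have W0: "W \<noteq> 0" by auto
  have cdG: "c0 (fls_deriv G) = (2 * of_nat n - 1) / (2 * of_nat n) * c0 G"
  proof -
    have "c0 (fls_deriv G) = of_int (- int (2 * n) + 1) / of_int (- int (2 * n)) * c0 G"
      using sG n by (subst c0_deriv) auto
    also have "of_int (- int (2 * n) + 1) / of_int (- int (2 * n)) = (2 * of_nat n - 1) / (2 * of_nat n :: complex)"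
    proof -
      have "of_int (- int (2 * n) + 1) = - (2 * of_nat n - 1 :: complex)" "of_int (- int (2 * n)) = - (2 * of_nat n :: complex)"
        by simp_all
      then show ?thesis by (simp only: minus_divide_divide)
    qed
    finally show ?thesis .
  qed
  have nn: "(of_nat n :: complex) \<noteq> 0" using n by simp
  have cW: "2 * of_nat n * c0 W = - c0 G"
    unfolding W_def using dG0 Q0 nn by (simp add: c0_divide cdG cQ field_simps)
  have phi0: "\<phi> \<noteq> 0" using W0 F0 by (simp add: \<phi> W_def)
  have sphi: "fls_subdegree \<phi> = 0" using W0 F0 sW F by (simp add: \<phi> W_def[symmetric] fls_divide_subdegree)
  have cphi: "c0 \<phi> = c0 W - c0 F" unfolding \<phi> W_def[symmetric] using W0 F0 by (simp add: c0_divide)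
  \<comment> \<open>The second coefficients express \<open>c0 F\<close>, a datum of the function
    under study, by the small functions \<open>w\<close> and \<open>\<phi>\<close>; solving for it
    is the reason to require that \<open>\<kappa> + 2 * of_nat n\<close> is nonzero. Cancelling the
    residue needs a function with value \<open>c0 \<phi> + 2 * c0 F\<close> at the pole, and
    \<open>B\<close> is that expression after the substitution, with each \<open>c0\<close> replaced
    by a logarithmic derivative.\<close>
  have key: "(\<kappa> + 2 * of_nat n) * c0 F = c0 w - 2 * of_nat n * c0 \<phi>"
    using cW unfolding cphi cG by (simp add: algebra_simps)
  define a where "a = fls_nth F (-1)"
  have a0: "a \<noteq> 0" unfolding a_def using F0 F by (metis nth_fls_subdegree_zero_iff)
  have W1: "fls_nth W (-1) = - 2 * of_nat n"
  proof -
    have "W * (G - 1) = fls_deriv G" using Q0 by (simp add: W_def)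
    then have "fls_nth (fls_deriv G) (-1 + - int (2 * n)) = fls_nth W (-1) * fls_nth (G - 1) (- int (2 * n))"
      using fls_times_nth_low(1)[of W "G - 1"] sW sQ by simp
    moreover have "fls_nth (fls_deriv G) (-1 + - int (2 * n)) = - 2 * of_nat n * fls_nth G (- int (2 * n))" by simp
    moreover have e: "fls_nth (G - 1) (- int (2 * n)) = fls_nth G (- int (2 * n))" using n by (intro Gn) simp
    ultimately have "fls_nth W (-1) * fls_nth G (- int (2 * n)) = (- 2 * of_nat n) * fls_nth G (- int (2 * n))"
      by (simp only:)
    then show ?thesis using nz1 unfolding e by (metis mult_right_cancel)
  qed
  have "\<phi> * F = W" using F0 by (simp add: \<phi> W_def)
  then have "fls_nth \<phi> 0 * a = fls_nth W (-1)"
    using fls_times_nth_low(1)[of \<phi> F] sphi F by (simp add: a_def)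
  then have phi_0: "fls_nth \<phi> 0 * a = - 2 * of_nat n" by (simp add: W1)
  have A_eq: "A = fls_const (1 / (2 * of_nat n)) * \<phi>"
  proof -
    have "fls_const (1 / (2 * of_nat n)) * of_nat (2 * n) = (1 :: complex fls)"
      unfolding fls_of_nat fls_const_mult_const[symmetric] using nn by simp
    then have "fls_const (1 / (2 * of_nat n)) * \<phi> * of_nat (2 * n) = \<phi>" by (metis mult.assoc mult.commute mult_1)
    moreover have "(of_nat (2 * n) :: complex fls) \<noteq> 0" using n by (simp only: of_nat_eq_0_iff)
    ultimately show ?thesis unfolding A by (metis nonzero_mult_div_cancel_right)
  qed
  have cn: "fls_const (1 / (2 * of_nat n)) \<noteq> (0 :: complex fls)" using nn by simp
  have AnZ: "A \<noteq> 0" unfolding A_eq using cn phi0 by simp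
  have sA: "fls_subdegree A = 0" unfolding A_eq using cn phi0 sphi by (subst fls_subdegree_mult) auto
  have cA: "c0 A = c0 \<phi>" unfolding A_eq using cn phi0 nn by (subst c0_mult) auto
  \<comment> \<open>With this value the double-pole coefficient of \<open>A * F ^ 2\<close> is
    \<open>- a\<close>, the same as that of \<open>fls_deriv F\<close>.\<close>
  have A0a: "fls_nth A 0 * a = -1" using phi_0 nn unfolding A_eq by (simp add: field_simps)
  have sF2: "fls_subdegree (F ^ 2) = -2" using F by (simp add: fls_subdegree_pow)
  have F20: "F ^ 2 \<noteq> 0" using F0 by simp
  have nF2: "fls_nth (F ^ 2) (-2) = a ^ 2"
    using fls_times_nth_low(1)[of F F] F by (simp add: a_def power2_eq_square)
  have sAF: "fls_subdegree (A * F ^ 2) = -2" using AnZ F20 sA sF2 by simp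
  have nAF2: "fls_nth (A * F ^ 2) (-2) = - a"
  proof -
    have "fls_nth (A * F ^ 2) (-2) = fls_nth A 0 * a ^ 2"
      using fls_times_nth_low(1)[of A "F ^ 2"] sA sF2 nF2 by simp
    also have "\<dots> = (fls_nth A 0 * a) * a" by (simp add: power2_eq_square)
    finally show ?thesis by (simp add: A0a)
  qed
  have nAF1: "fls_nth (A * F ^ 2) (-1) = - a * (c0 \<phi> + 2 * c0 F)"
  proof -
    have "c0 (A * F ^ 2) = c0 \<phi> + 2 * c0 F" using AnZ F20 F0 by (simp add: c0_mult c0_power cA)
    then have "fls_nth (A * F ^ 2) (-1) / fls_nth (A * F ^ 2) (-2) = c0 \<phi> + 2 * c0 F"
      unfolding c0_def[of "A * F ^ 2"] sAF by simp
    then have "fls_nth (A * F ^ 2) (-1) = (c0 \<phi> + 2 * c0 F) * (- a)"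
      unfolding nAF2 using a0 by (subst (asm) nonzero_divide_eq_eq) auto
    then show ?thesis by simp
  qed
  define B1 where "B1 = fls_deriv \<phi> / \<phi>"
  define B2 where "B2 = fls_deriv w / w"
  have B1: "fls_nth B1 0 = c0 \<phi>" "\<And>j. j < 0 \<Longrightarrow> fls_nth B1 j = 0"
    using fls_logderiv_nth_0[OF phi0 sphi] unfolding B1_def by (auto intro: fls_eq0_below_subdegree)
  have B2: "fls_nth B2 0 = c0 w" "\<And>j. j < 0 \<Longrightarrow> fls_nth B2 j = 0"
    using fls_logderiv_nth_0[OF w] unfolding B2_def by (auto intro: fls_eq0_below_subdegree)
  have Bn: "fls_nth B j = fls_nth B1 j + 2 / (\<kappa> + 2 * of_nat n) * (fls_nth B2 j - 2 * of_nat n * fls_nth B1 j)" for j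
    unfolding B B1_def[symmetric] B2_def[symmetric] fls_of_nat by simp
  have Bneg: "fls_nth B j = 0" if "j < 0" for j using that by (simp add: Bn B1 B2)
  have B0: "fls_nth B 0 = c0 \<phi> + 2 * c0 F"
  proof -
    have "2 / (\<kappa> + 2 * of_nat n) * (c0 w - 2 * of_nat n * c0 \<phi>) = 2 * c0 F"
      unfolding key[symmetric] using \<kappa>(2) by simp
    then show ?thesis by (simp add: Bn B1 B2)
  qed
  have sB: "B = 0 \<or> fls_subdegree B \<ge> 0"
    using Bneg[of "fls_subdegree B"] nth_fls_subdegree_zero_iff[of B] by (cases "fls_subdegree B < 0") auto
  have BF: "fls_nth (B * F) (-1) = fls_nth B 0 * a" "\<And>j. j < -1 \<Longrightarrow> fls_nth (B * F) j = 0"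
  proof -
    show "fls_nth (B * F) j = 0" if "j < -1" for j
      using sB F that by (cases "B = 0") (auto intro!: fls_times_nth_eq0)
    show "fls_nth (B * F) (-1) = fls_nth B 0 * a"
    proof (cases "B = 0 \<or> fls_subdegree B > 0")
      case True
      then have "fls_nth B 0 = 0" by (auto intro: fls_eq0_below_subdegree)
      moreover have "fls_nth (B * F) (-1) = 0" using True F by (cases "B = 0") (auto intro!: fls_times_nth_eq0)
      ultimately show ?thesis by simp
    next
      case False
      then have "fls_subdegree B = 0" using sB by auto
      then show ?thesis using fls_times_nth_low(1)[of B F] F by (simp add: a_def)
    qed
  qed
  have zero: "fls_nth (fls_deriv F - A * F ^ 2 - B * F) j = 0" if j: "j < 0" for j
  proof -
    have "j = -1 \<or> j = -2 \<or> j < -2" using j by auto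
    then show ?thesis
    proof (elim disjE)
      assume "j = -1"
      then show ?thesis using nAF1 BF(1) B0 by (simp add: algebra_simps)
    next
      assume "j = -2"
      then show ?thesis using nAF2 BF(2)[of "-2"] by (simp add: a_def)
    next
      assume "j < -2"
      moreover from this have "fls_nth F (j + 1) = 0" using F by (intro fls_eq0_below_subdegree) simp
      moreover have "fls_nth (A * F ^ 2) j = 0" using sAF \<open>j < -2\<close> by (intro fls_eq0_below_subdegree) simp
      ultimately show ?thesis using BF(2)[of j] by simp
    qed
  qed
  show ?thesis
    using zero[of "fls_subdegree (fls_deriv F - A * F ^ 2 - B * F)"]
      nth_fls_subdegree_zero_iff[of "fls_deriv F - A * F ^ 2 - B * F"]
    by (cases "fls_subdegree (fls_deriv F - A * F ^ 2 - B * F) < 0") auto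
qed

subsection \<open>Polynomials whose Hessian and Jacobian covariants are dependent\<close>

text \<open>With the extra factor \<open>Y\<close> only the exponent \<open>a\<close> occurs, so
  small exponents need no case distinction and no subtraction of naturals appears.\<close>

lemma euler_pderiv_aux:
  fixes S Y :: "'a :: idom poly"
  assumes "pderiv Y = 1"
  shows "Y * pderiv (Y ^ a * S) = Y ^ a * (of_nat a * S + Y * pderiv S)"
proof (cases a)
  case (Suc b)
  have "pderiv (Y ^ Suc b) = of_nat (Suc b) * Y ^ b"
    by (subst pderiv_power_Suc) (simp add: assms of_nat_poly)
  then show ?thesis
    unfolding Suc pderiv_mult by (simp only:) (simp add: algebra_simps)
qed (simp add: algebra_simps)

lemma euler_pderiv:
  fixes S :: "'a :: idom poly"
  shows "[:-q, 1:] * pderiv ([:-q, 1:] ^ a * S) = [:-q, 1:] ^ a * (of_nat a * S + [:-q, 1:] * pderiv S)"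
  by (rule euler_pderiv_aux) (simp add: pderiv_pCons)

lemma order_eqI:
  assumes "p = [:-x, 1:] ^ k * q" "poly q x \<noteq> 0"
  shows "Polynomial.order x p = k"
proof -
  have "q \<noteq> 0" using assms(2) by auto
  then have "p \<noteq> 0" using assms(1) by auto
  then show ?thesis
    using assms order_mult[of "[:-x, 1:] ^ k" q x] by (simp add: order_0I order_power_n_n)
qed

text \<open>Dehomogenised covariants, up to constant factors, of a binary form of degree \<open>N\<close>.\<close>
definition hessian :: "nat \<Rightarrow> 'a :: idom poly \<Rightarrow> 'a poly" where
  "hessian N Q = (of_nat N - 1) * pderiv Q ^ 2 - of_nat N * (Q * pderiv (pderiv Q))"

definition jacobian :: "nat \<Rightarrow> 'a :: idom poly \<Rightarrow> 'a poly" where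
  "jacobian N Q = of_nat N * (pderiv (hessian N Q) * Q)
     - (2 * of_nat N - 4) * (hessian N Q * pderiv Q)"

text \<open>At an \<open>a\<close>-fold root the Hessian has order \<open>2 * a - 2\<close>, unless
  its coefficient \<open>a * (N - a)\<close> vanishes. The last clause serves the case of one root
  of full multiplicity, where the Hessian is zero.\<close>

lemma hessian_local:
  fixes S :: "'a :: idom poly"
  assumes "Q = [:-q, 1:] ^ a * S"
  obtains H where "[:-q, 1:] ^ 2 * hessian N Q = [:-q, 1:] ^ (2 * a) * H"
    "poly H q = of_nat a * (of_nat N - of_nat a) * poly S q ^ 2"
    "pderiv S = 0 \<Longrightarrow> a = N \<Longrightarrow> H = 0"
proof -
  define Y where "Y = [:-q, 1:]"
  have dY: "pderiv Y = 1" by (simp add: Y_def pderiv_pCons)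
  define Q1 where "Q1 = of_nat a * S + Y * pderiv S"
  define Q2 where "Q2 = of_nat a * Q1 + Y * pderiv Q1 - Q1"
  have 1: "Y * pderiv Q = Y ^ a * Q1"
    unfolding assms Q1_def Y_def by (rule euler_pderiv)
  have "Y * pderiv (Y * pderiv Q) = Y ^ a * (of_nat a * Q1 + Y * pderiv Q1)"
    unfolding 1 unfolding Y_def by (rule euler_pderiv)
  moreover have "pderiv (Y * pderiv Q) = pderiv Q + Y * pderiv (pderiv Q)"
    using dY by (simp add: pderiv_mult algebra_simps)
  ultimately have 2: "Y ^ 2 * pderiv (pderiv Q) = Y ^ a * Q2"
    using 1 by (simp add: Q2_def algebra_simps power2_eq_square)
  define H where "H = (of_nat N - 1) * Q1 ^ 2 - of_nat N * (S * Q2)"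
  have "Y ^ 2 * hessian N Q = (of_nat N - 1) * (Y * pderiv Q) ^ 2 - of_nat N * (Q * (Y ^ 2 * pderiv (pderiv Q)))"
    unfolding hessian_def by (simp add: algebra_simps power2_eq_square)
  also have "\<dots> = Y ^ (2 * a) * H"
    unfolding 1 2 H_def unfolding assms Y_def[symmetric]
    unfolding mult_2 power_add by (simp add: algebra_simps power2_eq_square)
  finally have "Y ^ 2 * hessian N Q = Y ^ (2 * a) * H" .
  moreover have "poly H q = of_nat a * (of_nat N - of_nat a) * poly S q ^ 2"
    by (simp add: H_def Q2_def Q1_def Y_def algebra_simps power2_eq_square)
  moreover have "H = 0" if "pderiv S = 0" "a = N"
    using that by (simp add: H_def Q2_def Q1_def Y_def algebra_simps power2_eq_square pderiv_mult)
  ultimately show ?thesis using that unfolding Y_def by blast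
qed

lemma alg_closed_prod_roots:
  fixes p :: "'a :: alg_closed_field poly"
  assumes "p \<noteq> 0"
  shows "p = smult (lead_coeff p) (\<Prod>x | poly p x = 0. [:-x, 1:] ^ Polynomial.order x p)"
proof -
  obtain A where A: "p = smult (lead_coeff p) (\<Prod>x\<in>#A. [:-x, 1:])"
    using alg_closed_imp_factorization[OF assms] by blast
  have "Polynomial.order x (\<Prod>y\<in>#A. [:-y, 1:]) = count A x" for x
  proof (induction A)
    case (add y A)
    have "(\<Prod>y\<in>#A. [:-y, 1:]) \<noteq> 0" by auto
    moreover have "Polynomial.order x [:-y, 1:] = (if x = y then 1 else 0)"
      using order_power_n_n[of x 1] by (auto simp: order_0I)
    ultimately show ?case using add
      by (auto simp: order_mult simp del: mult_pCons_left)
  qed auto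
  moreover have "Polynomial.order x p = Polynomial.order x (\<Prod>y\<in>#A. [:-y, 1:])" for x
    using assms by (subst A) (simp add: order_smult)
  ultimately have ord: "Polynomial.order x p = count A x" for x by simp
  have "set_mset A = {x. poly p x = 0}"
    using order_root[of p] assms by (auto simp: ord not_in_iff)
  then have "(\<Prod>x\<in>#A. [:-x, 1:]) = (\<Prod>x | poly p x = 0. [:-x, 1:] ^ Polynomial.order x p)"
    by (subst image_prod_mset_multiplicity) (simp add: ord)
  with A show ?thesis by simp
qed

lemma alg_closed_proportional:
  fixes p q :: "'a :: alg_closed_field poly"
  assumes "p \<noteq> 0" "q \<noteq> 0" "\<And>x. Polynomial.order x p = Polynomial.order x q"
  obtains c where "p = smult c q" "c \<noteq> 0"
proof -
  have "{x. poly p x = 0} = {x. poly q x = 0}"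
    using assms by (auto simp: order_root)
  then have "(\<Prod>x | poly p x = 0. [:-x, 1:] ^ Polynomial.order x p)
     = (\<Prod>x | poly q x = 0. [:-x, 1:] ^ Polynomial.order x q)"
    using assms by simp
  then obtain P where "p = smult (lead_coeff p) P" "q = smult (lead_coeff q) P"
    using alg_closed_prod_roots[OF assms(1)] alg_closed_prod_roots[OF assms(2)] by metis
  then have "smult (lead_coeff p / lead_coeff q) q = p"
    using assms(2) by (metis leading_coeff_0_iff nonzero_eq_divide_eq smult_smult)
  then show ?thesis using that[of "lead_coeff p / lead_coeff q"] assms by simp
qed

text \<open>If \<open>J = 0\<close>, the local expansion forces multiplicity \<open>N / 2\<close> at
  every root. Otherwise \<open>H\<close> vanishes only at roots of \<open>Q\<close>, so
  \<open>H * S ^ 2\<close> is a constant multiple of \<open>Q ^ 2\<close>, where \<open>S\<close> is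
  the product of the distinct linear factors. The relation between \<open>J\<close> and
  \<open>H\<close> then bounds the degree of a combination \<open>E\<close> of
  \<open>S * pderiv Q\<close> and \<open>pderiv S * Q\<close>, whose formal top coefficient is a
  nonzero multiple of \<open>4 - 2 * card Z\<close>.\<close>

lemma covariant_syzygy_two_roots:
  fixes Q :: "'a :: {alg_closed_field, field_char_0} poly"
  assumes deg: "Polynomial.degree Q = N" "N > 0" and H0: "hessian N Q \<noteq> 0"
    and syz: "jacobian N Q ^ 2 = smult c (hessian N Q ^ 3)"
  shows "card {x. poly Q x = 0} = 2"
proof -
  define H where "H = hessian N Q"
  define J where "J = jacobian N Q"
  define Z where "Z = {x. poly Q x = 0}"
  have Q0: "Q \<noteq> 0" using deg by auto
  then have finZ: "finite Z" unfolding Z_def by (rule poly_roots_finite)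
  have Hne: "H \<noteq> 0" using H0 unfolding H_def .
  have JH: "J = of_nat N * (pderiv H * Q) - (2 * of_nat N - 4) * (H * pderiv Q)"
    by (simp add: J_def H_def jacobian_def)
  have deco: "Q = smult (lead_coeff Q) (\<Prod>x\<in>Z. [:-x, 1:] ^ Polynomial.order x Q)"
    unfolding Z_def by (rule alg_closed_prod_roots[OF Q0])
  have "Polynomial.degree Q = Polynomial.degree (\<Prod>x\<in>Z. [:-x, 1:] ^ Polynomial.order x Q)"
    using Q0 by (subst (1) deco) simp
  also have "\<dots> = (\<Sum>x\<in>Z. Polynomial.order x Q)"
    by (subst degree_prod_sum_eq) (auto simp: degree_power_eq)
  finally have sumord: "(\<Sum>x\<in>Z. Polynomial.order x Q) = N" using deg by simp
  have root: "Polynomial.order q Q > 0 \<and> Polynomial.order q Q < N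
      \<and> Polynomial.order q H + 2 = 2 * Polynomial.order q Q
      \<and> (J = 0 \<longrightarrow> 2 * Polynomial.order q Q = N)" if q: "q \<in> Z" for q
  proof -
    define a where "a = Polynomial.order q Q"
    define Y where "Y = [:-q, 1:]"
    have Y0: "Y \<noteq> 0" by (simp add: Y_def)
    obtain S where S: "Q = Y ^ a * S" "\<not> Y dvd S"
      using order_decomp[OF Q0, of q] unfolding a_def Y_def by auto
    have Sq: "poly S q \<noteq> 0" using S(2) by (simp add: Y_def poly_eq_0_iff_dvd)
    obtain H1 where H1: "Y ^ 2 * H = Y ^ (2 * a) * H1"
      "poly H1 q = of_nat a * (of_nat N - of_nat a) * poly S q ^ 2"
      "pderiv S = 0 \<Longrightarrow> a = N \<Longrightarrow> H1 = 0"
      using hessian_local[OF S(1)[unfolded Y_def], of N] unfolding Y_def H_def by blast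
    have apos: "a > 0" using q Q0 order_root[of Q q] by (simp add: a_def Z_def)
    have degS: "Polynomial.degree S + a = N"
    proof -
      have "S \<noteq> 0" using Sq by auto
      then have "Polynomial.degree Q = a + Polynomial.degree S"
        unfolding S(1) by (subst degree_mult_eq) (auto simp: Y_def degree_power_eq)
      then show ?thesis using deg by simp
    qed
    have "a \<noteq> N"
    proof
      assume "a = N"
      then have "pderiv S = 0" using degS by (simp add: pderiv_eq_0_iff)
      then have "Y ^ 2 * H = 0" using H1(1,3) \<open>a = N\<close> by simp
      then show False using Y0 Hne by simp
    qed
    then have aN: "a < N" using degS by simp
    then have "(of_nat N - of_nat a :: 'a) \<noteq> 0" by simp
    then have H1q: "poly H1 q \<noteq> 0" using H1(2) Sq apos by auto
    have "Polynomial.order q (Y ^ 2 * H) = 2 + Polynomial.order q H"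
      using Hne Y0 by (subst order_mult) (auto simp: Y_def order_power_n_n)
    moreover have "Polynomial.order q (Y ^ 2 * H) = 2 * a"
      using H1(1) H1q unfolding Y_def by (rule order_eqI)
    ultimately have ordH: "Polynomial.order q H + 2 = 2 * a" by simp
    have "2 * a = N" if "J = 0"
    proof -
      define h where "h = Polynomial.order q H"
      have h: "h + 2 = 2 * a" using ordH by (simp add: h_def)
      have "Y ^ 2 * H = Y ^ 2 * (Y ^ h * H1)"
        using H1(1) unfolding h[symmetric] by (simp add: power_add power2_eq_square algebra_simps)
      then have HX: "H = Y ^ h * H1" using Y0 by simp
      have e1: "Y * pderiv H = Y ^ h * (of_nat h * H1 + Y * pderiv H1)"
        unfolding HX Y_def by (rule euler_pderiv)
      have e2: "Y * pderiv Q = Y ^ a * (of_nat a * S + Y * pderiv S)"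
        unfolding S(1) Y_def by (rule euler_pderiv)
      have "0 = Y * J" using that by simp
      also have "\<dots> = of_nat N * ((Y * pderiv H) * Q) - (2 * of_nat N - 4) * (H * (Y * pderiv Q))"
        unfolding JH by (simp add: algebra_simps)
      also have "\<dots> = Y ^ (h + a) * (of_nat N * ((of_nat h * H1 + Y * pderiv H1) * S)
          - (2 * of_nat N - 4) * (H1 * (of_nat a * S + Y * pderiv S)))"
        unfolding e1 e2 unfolding HX S(1) by (simp add: algebra_simps power_add)
      finally have "of_nat N * ((of_nat h * H1 + Y * pderiv H1) * S)
          - (2 * of_nat N - 4) * (H1 * (of_nat a * S + Y * pderiv S)) = 0"
        using Y0 by simp
      then have "poly (of_nat N * ((of_nat h * H1 + Y * pderiv H1) * S)
          - (2 * of_nat N - 4) * (H1 * (of_nat a * S + Y * pderiv S))) q = 0" by simp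
      then have "(of_nat N * of_nat h - (2 * of_nat N - 4) * of_nat a) * (poly H1 q * poly S q) = 0"
        by (simp add: Y_def algebra_simps)
      then have "of_nat N * of_nat h = (2 * of_nat N - 4) * (of_nat a :: 'a)"
        using H1q Sq by simp
      moreover have "of_nat h = 2 * of_nat a - (2 :: 'a)"
        using arg_cong[OF h, of "of_nat :: nat \<Rightarrow> 'a"] by (simp add: algebra_simps)
      ultimately have "4 * of_nat a = (2 * of_nat N :: 'a)" by (simp add: algebra_simps)
      then have "(of_nat (4 * a) :: 'a) = of_nat (2 * N)" by simp
      then show ?thesis by (simp only: of_nat_eq_iff)
    qed
    then show ?thesis using apos aN ordH unfolding a_def by blast
  qed
  show ?thesis
  proof (cases "J = 0")
    case True
    then have "\<And>q. q \<in> Z \<Longrightarrow> 2 * Polynomial.order q Q = N" using root by blast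
    then have "(\<Sum>x\<in>Z. 2 * Polynomial.order x Q) = card Z * N" by simp
    then have "2 * N = card Z * N" using sumord by (simp flip: sum_distrib_left)
    then show ?thesis using deg by (simp add: Z_def)
  next
    case False
    have syz': "J ^ 2 = smult c (H ^ 3)" using syz by (simp add: J_def H_def)
    then have c0: "c \<noteq> 0" using False by auto
    \<comment> \<open>At a root of \<open>H\<close> of order \<open>e\<close> where \<open>Q\<close>
      does not vanish, \<open>J\<close> has order \<open>e - 1\<close> because of the term with
      \<open>pderiv H\<close>. Then \<open>2 * (e - 1) = 3 * e\<close>, which is impossible.\<close>
    have H_no_root: "Polynomial.order x H = 0" if "x \<notin> Z" for x
    proof (rule ccontr)
      define e where "e = Polynomial.order x H"
      define Y where "Y = [:-x, 1:]"
      have Y0: "Y \<noteq> 0" by (simp add: Y_def)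
      assume "Polynomial.order x H \<noteq> 0"
      then have e: "e > 0" by (simp add: e_def)
      obtain S where S: "H = Y ^ e * S" "\<not> Y dvd S"
        using order_decomp[OF Hne, of x] unfolding e_def Y_def by auto
      have Sx: "poly S x \<noteq> 0" using S(2) by (simp add: Y_def poly_eq_0_iff_dvd)
      have Qx: "poly Q x \<noteq> 0" using that by (simp add: Z_def)
      have e1: "Y * pderiv H = Y ^ e * (of_nat e * S + Y * pderiv S)"
        unfolding S(1) Y_def by (rule euler_pderiv)
      have "Y * J = of_nat N * ((Y * pderiv H) * Q) - (2 * of_nat N - 4) * (Y * H * pderiv Q)"
        unfolding JH by (simp add: algebra_simps)
      also have "\<dots> = Y ^ e * (of_nat N * ((of_nat e * S + Y * pderiv S) * Q)
          - (2 * of_nat N - 4) * (Y * S * pderiv Q))"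
        unfolding e1 unfolding S(1) by (simp add: algebra_simps)
      finally have YJ: "Y * J = Y ^ e * (of_nat N * ((of_nat e * S + Y * pderiv S) * Q)
          - (2 * of_nat N - 4) * (Y * S * pderiv Q))" .
      have "Polynomial.order x (Y * J) = e"
        unfolding Y_def by (rule order_eqI[OF YJ[unfolded Y_def]])
           (use Sx Qx e deg in \<open>auto simp: Y_def\<close>)
      moreover have "Polynomial.order x (Y * J) = 1 + Polynomial.order x J"
        using False Y0 order_power_n_n[of x 1] by (subst order_mult) (simp_all add: Y_def del: mult_pCons_left)
      ultimately have "Polynomial.order x J + 1 = e" by simp
      moreover have "Polynomial.order x (J ^ 2) = 2 * Polynomial.order x J"
        using False by (simp add: power2_eq_square order_mult)
      moreover have "Polynomial.order x (H ^ 3) = 3 * e"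
        using Hne by (simp add: power3_eq_cube order_mult e_def)
      moreover have "Polynomial.order x (J ^ 2) = Polynomial.order x (H ^ 3)"
        using c0 by (simp add: syz' order_smult)
      ultimately show False by simp
    qed
    define S where "S = (\<Prod>x\<in>Z. [:-x, 1:])"
    have S0: "S \<noteq> 0" using finZ by (simp add: S_def)
    have ordS: "Polynomial.order x S = (if x \<in> Z then 1 else 0)" for x
    proof -
      have "Polynomial.order x (\<Prod>x\<in>W. [:-x, 1:]) = (if x \<in> W then 1 else 0)" if "finite W" for W
        using that
      proof induction
        case (insert y W)
        have "(\<Prod>x\<in>W. [:-x, 1:]) \<noteq> 0" using insert by simp
        moreover have "Polynomial.order x [:-y, 1:] = (if x = y then 1 else 0)"
          using order_power_n_n[of x 1] by (auto simp: order_0I)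
        ultimately show ?case using insert
          by (auto simp: order_mult simp del: mult_pCons_left)
      qed simp
      then show ?thesis using finZ by (simp add: S_def)
    qed
    have "Polynomial.order x (H * S ^ 2) = Polynomial.order x (Q ^ 2)" for x
    proof (cases "x \<in> Z")
      case True
      then show ?thesis using root[OF True] Hne S0 Q0 ordS[of x]
        by (simp add: order_mult power2_eq_square)
    next
      case False
      then show ?thesis using H_no_root[OF False] Hne S0 Q0 ordS[of x]
        by (simp add: order_mult power2_eq_square order_0I Z_def)
    qed
    then obtain d where d: "H * S ^ 2 = smult d (Q ^ 2)" "d \<noteq> 0"
      using alg_closed_proportional[of "H * S ^ 2" "Q ^ 2"] Hne S0 Q0 by auto
    define dd where "dd = [:d:]"
    have ddd: "pderiv dd = 0" by (simp add: dd_def)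
    have d': "H * S ^ 2 = dd * Q ^ 2" using d by (simp add: dd_def)
    have "pderiv (H * S ^ 2) = pderiv (dd * Q ^ 2)" using d' by simp
    then have "pderiv H * S ^ 2 + 2 * H * S * pderiv S = 2 * dd * Q * pderiv Q"
      by (simp add: pderiv_mult power2_eq_square ddd algebra_simps)
    then have "(pderiv H * S ^ 2 + 2 * H * S * pderiv S) * Q = 2 * (dd * Q ^ 2) * pderiv Q"
      by (simp add: power2_eq_square algebra_simps)
    then have "S * (pderiv H * S * Q + 2 * H * pderiv S * Q) = S * (2 * H * S * pderiv Q)"
      unfolding d'[symmetric] by (simp add: power2_eq_square algebra_simps)
    then have k: "pderiv H * S * Q = 2 * H * S * pderiv Q - 2 * H * pderiv S * Q"
      using S0 by (simp add: eq_diff_eq)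
    \<comment> \<open>Eliminating \<open>pderiv H\<close> from the definition of \<open>J\<close>
      with the help of the preceding identity gives \<open>J * S = H * E\<close>. Squaring makes
      \<open>E ^ 2\<close> proportional to \<open>Q ^ 2\<close>, so \<open>E\<close> has degree
      exactly \<open>N\<close>.\<close>
    define E where "E = 4 * (S * pderiv Q) - 2 * of_nat N * (pderiv S * Q)"
    have "J * S = of_nat N * (pderiv H * S * Q) - (2 * of_nat N - 4) * (H * S * pderiv Q)"
      by (simp add: JH algebra_simps)
    also have "\<dots> = H * E" unfolding k by (simp add: E_def algebra_simps)
    finally have JS: "J * S = H * E" .
    have "H ^ 2 * E ^ 2 = J ^ 2 * S ^ 2" unfolding power_mult_distrib[symmetric] JS ..
    also have "\<dots> = smult c (H ^ 2 * (H * S ^ 2))"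
      unfolding syz' by (simp add: power2_eq_square power3_eq_cube mult_ac)
    also have "\<dots> = H ^ 2 * smult (c * d) (Q ^ 2)" by (simp add: d)
    finally have "E ^ 2 = smult (c * d) (Q ^ 2)"
      using Hne by (metis mult_left_cancel power_not_zero)
    then have "Polynomial.degree (E ^ 2) = Polynomial.degree (Q ^ 2)" using c0 d by simp
    moreover have "Polynomial.degree (P ^ 2) = 2 * Polynomial.degree P" for P :: "'a poly"
      by (cases "P = 0") (auto simp: degree_power_eq)
    ultimately have degE: "Polynomial.degree E = N" using deg by simp
    have degS: "Polynomial.degree S = card Z"
      unfolding S_def by (subst degree_prod_sum_eq) auto
    have lcS: "lead_coeff S = 1" unfolding S_def by (simp add: lead_coeff_prod)
    have "Z \<noteq> {}" using sumord deg by auto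
    then have Zpos: "card Z > 0" using finZ by (simp add: card_gt_0_iff)
    have "card Z \<noteq> 1"
    proof
      assume "card Z = 1"
      then obtain q where "Z = {q}" by (auto simp: card_1_singleton_iff)
      then show False using root[of q] sumord by simp
    qed
    then have two: "card Z \<ge> 2" using Zpos by simp
    have "coeff (S * pderiv Q) (card Z + (N - 1)) = of_nat N * lead_coeff Q"
    proof -
      have "coeff (S * pderiv Q) (Polynomial.degree S + Polynomial.degree (pderiv Q)) = lead_coeff S * lead_coeff (pderiv Q)"
        by (rule coeff_mult_degree_sum)
      then show ?thesis using degS lcS deg by (simp add: degree_pderiv coeff_pderiv)
    qed
    moreover have "coeff (pderiv S * Q) (card Z + (N - 1)) = of_nat (card Z) * lead_coeff Q"
    proof -
      have "coeff (pderiv S * Q) (Polynomial.degree (pderiv S) + Polynomial.degree Q) = lead_coeff (pderiv S) * lead_coeff Q"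
        by (rule coeff_mult_degree_sum)
      moreover have "card Z - 1 + N = card Z + (N - 1)" using Zpos deg by simp
      ultimately show ?thesis using degS lcS deg Zpos by (simp add: degree_pderiv coeff_pderiv)
    qed
    moreover have "coeff E i = 4 * coeff (S * pderiv Q) i - 2 * of_nat N * coeff (pderiv S * Q) i" for i
      unfolding E_def of_nat_poly numeral_poly by (simp add: mult_ac)
    ultimately have "coeff E (card Z + (N - 1)) = 4 * (of_nat N * lead_coeff Q) - 2 * of_nat N * (of_nat (card Z) * lead_coeff Q)"
      by simp
    then have cE: "coeff E (card Z + (N - 1)) = (4 - 2 * of_nat (card Z)) * (of_nat N * lead_coeff Q)"
      by (simp add: algebra_simps)
    have "coeff E (card Z + (N - 1)) = 0"
      by (rule coeff_eq_0) (use two deg degE in simp)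
    moreover have "coeff Q N \<noteq> 0" using deg Q0 by auto
    ultimately have "(4 :: 'a) = 2 * of_nat (card Z)" using cE deg by auto
    then have "(of_nat 4 :: 'a) = of_nat (2 * card Z)" by simp
    then have "4 = 2 * card Z" by (simp only: of_nat_eq_iff)
    then show ?thesis by (simp add: Z_def)
  qed
qed

subsection \<open>The Riccati derivation on polynomials\<close>

lemma coeff_mult_low:
  fixes p q :: "'a :: comm_semiring_1 poly"
  assumes "\<And>i. i < a \<Longrightarrow> coeff p i = 0" "\<And>i. i < b \<Longrightarrow> coeff q i = 0"
  shows "coeff (p * q) (a + b) = coeff p a * coeff q b"
    and "i < a + b \<Longrightarrow> coeff (p * q) i = 0"
proof -
  have "coeff (p * q) (a + b) = (\<Sum>j\<le>a + b. coeff p j * coeff q (a + b - j))"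
    by (rule coeff_mult)
  also have "\<dots> = (\<Sum>j\<in>{a}. coeff p j * coeff q (a + b - j))"
  proof (rule sum.mono_neutral_right, simp, simp, rule ballI)
    fix j assume "j \<in> {..a + b} - {a}"
    then have "j < a \<or> a + b - j < b" by auto
    then show "coeff p j * coeff q (a + b - j) = 0" using assms by auto
  qed
  finally show "coeff (p * q) (a + b) = coeff p a * coeff q b" by simp
  show "coeff (p * q) i = 0" if "i < a + b"
    unfolding coeff_mult
  proof (rule sum.neutral, rule ballI)
    fix j assume "j \<in> {..i}"
    then have "j < a \<or> i - j < b" using that by auto
    then show "coeff p j * coeff q (i - j) = 0" using assms by auto
  qed
qed

lemma coeff_mult_high:
  fixes p q :: "'a :: comm_semiring_1 poly"
  assumes "Polynomial.degree p \<le> a" "Polynomial.degree q \<le> b"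
  shows "coeff (p * q) (a + b) = coeff p a * coeff q b"
proof -
  have "coeff (p * q) (a + b) = (\<Sum>j\<le>a + b. coeff p j * coeff q (a + b - j))"
    by (rule coeff_mult)
  also have "\<dots> = (\<Sum>j\<in>{a}. coeff p j * coeff q (a + b - j))"
  proof (rule sum.mono_neutral_right, simp, simp, rule ballI)
    fix j assume "j \<in> {..a + b} - {a}"
    then have "j > a \<or> a + b - j > b" by auto
    then show "coeff p j * coeff q (a + b - j) = 0"
      using assms by (auto simp: coeff_eq_0)
  qed
  finally show ?thesis by simp
qed

lemma coeff_prod_low:
  fixes p :: "'b \<Rightarrow> 'a :: comm_semiring_1 poly"
  assumes "finite I" "\<And>i j. i \<in> I \<Longrightarrow> j < d i \<Longrightarrow> coeff (p i) j = 0"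
  shows "coeff (\<Prod>i\<in>I. p i) (\<Sum>i\<in>I. d i) = (\<Prod>i\<in>I. coeff (p i) (d i))
    \<and> (\<forall>j<(\<Sum>i\<in>I. d i). coeff (\<Prod>i\<in>I. p i) j = 0)"
  using assms
proof (induction I)
  case (insert x I)
  then show ?case
    using coeff_mult_low[of "d x" "p x" "\<Sum>i\<in>I. d i" "\<Prod>i\<in>I. p i"] by simp
qed simp

lemma coeff_prod_high:
  fixes p :: "'b \<Rightarrow> 'a :: comm_semiring_1 poly"
  assumes "finite I" "\<And>i. i \<in> I \<Longrightarrow> Polynomial.degree (p i) \<le> d i"
  shows "coeff (\<Prod>i\<in>I. p i) (\<Sum>i\<in>I. d i) = (\<Prod>i\<in>I. coeff (p i) (d i))
    \<and> Polynomial.degree (\<Prod>i\<in>I. p i) \<le> (\<Sum>i\<in>I. d i)"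
  using assms
proof (induction I)
  case (insert x I)
  then show ?case
    using coeff_mult_high[of "p x" "d x" "\<Prod>i\<in>I. p i" "\<Sum>i\<in>I. d i"]
      degree_mult_le[of "p x" "\<Prod>i\<in>I. p i"] by fastforce
qed simp

locale derivation =
  fixes \<delta> :: "'a :: field_char_0 \<Rightarrow> 'a"
  assumes add: "\<delta> (x + y) = \<delta> x + \<delta> y"
    and mult: "\<delta> (x * y) = \<delta> x * y + x * \<delta> y"
begin

lemma zero [simp]: "\<delta> 0 = 0" using add[of 0 0] by simp

lemma one [simp]: "\<delta> 1 = 0" using mult[of 1 1] by simp

lemma uminus: "\<delta> (- x) = - \<delta> x" using add[of x "-x"] by (simp add: eq_neg_iff_add_eq_0 add.commute)

lemma diff: "\<delta> (x - y) = \<delta> x - \<delta> y" using add[of x "-y"] by (simp add: uminus)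

lemma sum: "\<delta> (\<Sum>i\<in>I. g i) = (\<Sum>i\<in>I. \<delta> (g i))"
  by (induction I rule: infinite_finite_induct) (auto simp: add)

lemma of_nat_mult: "\<delta> (of_nat n * x) = of_nat n * \<delta> x"
  by (induction n) (auto simp: add algebra_simps)

lemma of_nat [simp]: "\<delta> (of_nat n) = 0" using of_nat_mult[of n 1] by simp

text \<open>The total derivative along \<open>\<delta> x = poly \<rho> x\<close>: the coefficients
  are differentiated by \<open>\<delta>\<close>, and the variable by the chain rule.\<close>

definition dpoly :: "'a poly \<Rightarrow> 'a poly \<Rightarrow> 'a poly" where
  "dpoly \<rho> Q = map_poly \<delta> Q + pderiv Q * \<rho>"

lemma coeff_map_deriv [simp]: "coeff (map_poly \<delta> Q) i = \<delta> (coeff Q i)"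
  by (simp add: coeff_map_poly)

lemma map_poly_mult: "map_poly \<delta> (P * Q) = map_poly \<delta> P * Q + P * map_poly \<delta> Q"
  by (intro poly_eqI) (simp add: coeff_mult sum mult sum.distrib)

lemma map_poly_diff: "map_poly \<delta> (P - Q) = map_poly \<delta> P - map_poly \<delta> Q"
  by (intro poly_eqI) (simp add: diff)

lemma pderiv_map_poly: "pderiv (map_poly \<delta> Q) = map_poly \<delta> (pderiv Q)"
  by (intro poly_eqI) (simp add: coeff_pderiv of_nat_mult del: of_nat_Suc)

lemma dpoly_mult: "dpoly \<rho> (P * Q) = dpoly \<rho> P * Q + P * dpoly \<rho> Q"
  by (simp add: dpoly_def map_poly_mult pderiv_mult algebra_simps)

lemma dpoly_diff: "dpoly \<rho> (P - Q) = dpoly \<rho> P - dpoly \<rho> Q"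
  by (simp add: dpoly_def map_poly_diff pderiv_diff algebra_simps)

lemma dpoly_of_nat [simp]: "dpoly \<rho> (of_nat n) = 0"
  by (simp add: dpoly_def of_nat_poly map_poly_pCons)

lemma dpoly_1 [simp]: "dpoly \<rho> 1 = 0" using dpoly_of_nat[of \<rho> 1] by simp

lemma dpoly_numeral [simp]: "dpoly \<rho> (numeral n) = 0" using dpoly_of_nat[of \<rho> "numeral n"] by simp

lemma dpoly_pderiv: "dpoly \<rho> (pderiv Q) = pderiv (dpoly \<rho> Q) - pderiv \<rho> * pderiv Q"
  by (simp add: dpoly_def pderiv_add pderiv_mult pderiv_map_poly algebra_simps)

lemma deriv_poly:
  assumes "\<delta> x = poly \<rho> x"
  shows "\<delta> (poly Q x) = poly (dpoly \<rho> Q) x"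
proof (induction Q)
  case (pCons a Q)
  then show ?case
    by (simp add: dpoly_def map_poly_pCons pderiv_pCons add mult assms algebra_simps)
qed (simp add: dpoly_def)

lemma higher_deriv_poly:
  assumes "\<delta> x = poly \<rho> x"
  shows "(\<delta> ^^ n) (poly Q x) = poly ((dpoly \<rho> ^^ n) Q) x"
  by (induction n) (auto simp: deriv_poly[OF assms])

lemma coeff_dpoly:
  "coeff (dpoly [:R, B, A:] Q) i = \<delta> (coeff Q i) + of_nat (Suc i) * (R * coeff Q (Suc i))
     + of_nat i * (B * coeff Q i) + (if i = 0 then 0 else of_nat (i - 1) * (A * coeff Q (i - 1)))"
proof -
  have "pderiv Q * [:R, B, A:] = smult R (pderiv Q) + pCons 0 (smult B (pderiv Q) + pCons 0 (smult A (pderiv Q)))"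
    by (simp add: mult.commute[of "pderiv Q"])
  then show ?thesis
    by (auto simp: dpoly_def coeff_pCons coeff_pderiv split: nat.splits)
qed

text \<open>Of the three terms of the Riccati right-hand side only \<open>A\<close> raises the
  degree and only \<open>R\<close> lowers it. Iteration therefore produces a rising factorial at the
  top and, in the next lemma, a falling factorial at the bottom; the final contradiction compares
  the two.\<close>

lemma higher_dpoly_monom_high:
  "Polynomial.degree ((dpoly [:R, B, A:] ^^ m) (monom 1 l)) \<le> l + m \<and>
   coeff ((dpoly [:R, B, A:] ^^ m) (monom 1 l)) (l + m) = of_nat (\<Prod>j<m. l + j) * A ^ m"
proof (induction m)
  case (Suc m)
  define Q where "Q = (dpoly [:R, B, A:] ^^ m) (monom 1 l)"
  have Q: "coeff Q i = 0" if "i > l + m" for i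
    using Suc that by (simp add: Q_def coeff_eq_0)
  have "coeff (dpoly [:R, B, A:] Q) i = 0" if "i > l + Suc m" for i
    using that Q[of i] Q[of "Suc i"] Q[of "i - 1"] by (simp add: coeff_dpoly)
  then have "Polynomial.degree (dpoly [:R, B, A:] Q) \<le> l + Suc m" by (auto intro: degree_le)
  moreover have "coeff (dpoly [:R, B, A:] Q) (l + Suc m) = of_nat (\<Prod>j<Suc m. l + j) * A ^ Suc m"
    using Suc by (simp add: coeff_dpoly Q Q_def[symmetric])
  ultimately show ?case by (simp add: Q_def)
qed (simp add: degree_monom_le)

lemma higher_dpoly_monom_low:
  assumes "m \<le> l"
  shows "(\<forall>i<l - m. coeff ((dpoly [:R, B, A:] ^^ m) (monom 1 l)) i = 0) \<and>
   coeff ((dpoly [:R, B, A:] ^^ m) (monom 1 l)) (l - m) = of_nat (\<Prod>j<m. l - j) * R ^ m"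
  using assms
proof (induction m)
  case (Suc m)
  define Q where "Q = (dpoly [:R, B, A:] ^^ m) (monom 1 l)"
  have Q: "coeff Q i = 0" if "i < l - m" for i
    using Suc that by (simp add: Q_def)
  have "coeff (dpoly [:R, B, A:] Q) i = 0" if "i < l - Suc m" for i
    using that Q[of i] Q[of "Suc i"] Q[of "i - 1"] by (simp add: coeff_dpoly)
  moreover have "coeff (dpoly [:R, B, A:] Q) (l - Suc m) = of_nat (\<Prod>j<Suc m. l - j) * R ^ Suc m"
  proof -
    have e: "Suc (l - Suc m) = l - m" using Suc.prems by simp
    have "coeff (dpoly [:R, B, A:] Q) (l - Suc m) = of_nat (l - m) * (R * coeff Q (l - m))"
      using Suc.prems Q[of "l - Suc m"] Q[of "l - Suc m - 1"] by (simp add: coeff_dpoly e del: of_nat_Suc)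
    then show ?thesis using Suc by (simp add: Q_def[symmetric] mult_ac)
  qed
  ultimately show ?case by (simp add: Q_def)
qed simp

text \<open>The computations behind the two semi-invariance claims, in the literal shape left by the
  product and difference rules for \<open>dpoly\<close>. The summands with 0 are derivatives of
  integer constants.\<close>

lemma covariant_ring_ids:
  fixes n a y b q q1 q2 h h1 :: "'c :: comm_ring_1"
  shows "(0 - 0) * (q1 * q1) + (n - 1) * ((n * a * q + ((n - 2) * a * y - b) * q1) * q1
      + q1 * (n * a * q + ((n - 2) * a * y - b) * q1))
     - (0 * (q * q2) + n * (n * a * y * q * q2 + q * ((2 * n - 2) * a * q1 + ((n - 4) * a * y - 2 * b) * q2)))
     = 2 * ((n - 2) * a * y - b) * ((n - 1) * (q1 * q1) - n * (q * q2))"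
    and "0 * (h1 * q) + n * (((2 * n - 4) * a * h + ((2 * n - 6) * a * y - 3 * b) * h1) * q + h1 * (n * a * y * q))
     - ((0 * n + 2 * 0 - 0) * (h * q1)
        + (2 * n - 4) * (2 * ((n - 2) * a * y - b) * h * q1 + h * (n * a * q + ((n - 2) * a * y - b) * q1)))
     = 3 * ((n - 2) * a * y - b) * (n * (h1 * q) - (2 * n - 4) * (h * q1))"
  by (simp_all add: algebra_simps)

text \<open>The hypothesis says that the Riccati motion only rescales the form \<open>Q\<close>, so
  it rescales the covariants of \<open>Q\<close> as well. The factors are 2 and 3 times the same
  linear polynomial, which makes the square of the Jacobian and the cube of the Hessian
  comparable.\<close>

lemma dpoly_covariants:
  assumes Q: "dpoly [:R, B, A:] Q = [:0, of_nat N * A:] * Q"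
  shows "dpoly [:R, B, A:] (hessian N Q) = 2 * [:-B, (of_nat N - 2) * A:] * hessian N Q"
    and "dpoly [:R, B, A:] (jacobian N Q) = 3 * [:-B, (of_nat N - 2) * A:] * jacobian N Q"
proof -
  define \<rho> where "\<rho> = [:R, B, A:]"
  define a b Y where "a = [:A:]" and "b = [:B:]" and "Y = ([:0, 1:] :: 'a poly)"
  have pd: "pderiv a = 0" "pderiv b = 0" "pderiv Y = 1"
    by (simp_all add: a_def b_def Y_def pderiv_pCons)
  have pdnum: "pderiv (numeral j :: 'a poly) = 0" for j by (simp add: numeral_poly)
  have rho: "pderiv \<rho> = 2 * a * Y + b"
    by (simp add: \<rho>_def a_def b_def Y_def pderiv_pCons numeral_poly)
  have "[:0, of_nat N * A:] = of_nat N * a * Y"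
    by (simp add: a_def Y_def of_nat_poly)
  then have DQ: "dpoly \<rho> Q = of_nat N * a * Y * Q" using Q by (simp add: \<rho>_def)
  have cof: "[:-B, (of_nat N - 2) * A:] = (of_nat N - 2) * a * Y - b"
    by (simp add: a_def b_def Y_def of_nat_poly numeral_poly)
  have DQ1: "dpoly \<rho> (pderiv Q) = of_nat N * a * Q + ((of_nat N - 2) * a * Y - b) * pderiv Q"
    unfolding dpoly_pderiv DQ rho by (simp add: pderiv_mult pd algebra_simps)
  have DQ2: "dpoly \<rho> (pderiv (pderiv Q)) = (2 * of_nat N - 2) * a * pderiv Q
     + ((of_nat N - 4) * a * Y - 2 * b) * pderiv (pderiv Q)"
    unfolding dpoly_pderiv[of \<rho> "pderiv Q"] DQ1 rho
    by (simp add: pderiv_mult pderiv_add pderiv_diff pd algebra_simps)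
  have DH: "dpoly \<rho> (hessian N Q) = 2 * ((of_nat N - 2) * a * Y - b) * hessian N Q"
    unfolding hessian_def
    by (simp only: dpoly_diff dpoly_mult dpoly_of_nat dpoly_1 DQ DQ1 DQ2 power2_eq_square covariant_ring_ids(1))
  then show "dpoly [:R, B, A:] (hessian N Q) = 2 * [:-B, (of_nat N - 2) * A:] * hessian N Q"
    unfolding cof \<rho>_def .
  define H where "H = hessian N Q"
  have DH': "dpoly \<rho> H = 2 * ((of_nat N - 2) * a * Y - b) * H" using DH by (simp add: H_def)
  have DH1: "dpoly \<rho> (pderiv H) = (2 * of_nat N - 4) * a * H + ((2 * of_nat N - 6) * a * Y - 3 * b) * pderiv H"
    unfolding dpoly_pderiv DH' rho
    by (simp add: pderiv_mult pderiv_diff pderiv_add pd pdnum algebra_simps)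
  have "dpoly \<rho> (jacobian N Q) = 3 * ((of_nat N - 2) * a * Y - b) * jacobian N Q"
    unfolding jacobian_def H_def[symmetric]
    by (simp only: dpoly_diff dpoly_mult dpoly_of_nat dpoly_numeral DQ DQ1 DH' DH1 covariant_ring_ids(2))
  then show "dpoly [:R, B, A:] (jacobian N Q) = 3 * [:-B, (of_nat N - 2) * A:] * jacobian N Q"
    unfolding cof \<rho>_def .
qed

text \<open>After cancelling, \<open>lin\<close> eliminates the ratio of \<open>p\<close> and
  \<open>q\<close>. With \<open>t = a - n\<close> the absolute values give
  \<open>L * b ^ t = n * M * a ^ t\<close>, against \<open>L \<le> M\<close>,
  \<open>b \<le> a\<close> and \<open>n \<ge> 2\<close>.\<close>

lemma two_root_arith_aux:
  fixes p q :: "'b :: field_char_0"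
  assumes eq: "of_nat L * (p * q) ^ n = of_nat (n * M) * (p ^ a * q ^ b)"
    and lin: "of_nat a * q = - of_nat b * p" and "a + b = 2 * n" "p \<noteq> 0" "q \<noteq> 0"
    and "0 < L" "L \<le> M" "n \<ge> 2" "b \<le> a"
  shows False
proof -
  define t where "t = a - n"
  have a: "a = n + t" and b: "n = b + t" using assms by (auto simp: t_def)
  have "p ^ n * q ^ b * (of_nat L * q ^ t) = p ^ n * q ^ b * (of_nat (n * M) * p ^ t)"
    using eq by (simp add: a b power_add power_mult_distrib algebra_simps)
  then have "of_nat L * q ^ t = of_nat (n * M) * p ^ t" using assms by simp
  then have "of_nat L * (of_nat b ^ t * q ^ t) = of_nat (n * M) * (of_nat b * p) ^ t"
    by (simp add: power_mult_distrib algebra_simps)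
  also have "of_nat b * p = - of_nat a * q" using lin by simp
  finally have "of_nat L * of_nat b ^ t * q ^ t = of_nat (n * M) * (- of_nat a) ^ t * q ^ t"
    unfolding power_mult_distrib by (simp only: mult_ac)
  then have "of_nat L * of_nat b ^ t = of_nat (n * M) * (- of_nat a :: 'b) ^ t"
    using assms by simp
  then have "(of_int (int L * int b ^ t) :: 'b) = of_int (int (n * M) * (- int a) ^ t)"
    by simp
  then have "int L * int b ^ t = int (n * M) * (- int a) ^ t" by (simp only: of_int_eq_iff)
  then have "\<bar>int L * int b ^ t\<bar> = \<bar>int (n * M) * (- int a) ^ t\<bar>" by simp
  then have "int (L * b ^ t) = int (n * M * a ^ t)" by (simp add: abs_mult power_abs)
  then have e: "L * b ^ t = n * M * a ^ t" by (simp only: of_nat_eq_iff)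
  have "L * b ^ t \<le> M * a ^ t" using assms by (intro mult_mono power_mono) auto
  moreover have "M * a ^ t < n * (M * a ^ t)" using assms a by simp
  ultimately show False using e by (simp add: mult.assoc)
qed

lemma two_root_arith:
  fixes p q :: "'b :: field_char_0"
  assumes "of_nat L * (p * q) ^ n = of_nat (n * M) * (p ^ a * q ^ b)"
    and "of_nat a * q = - of_nat b * p" and "a + b = 2 * n" "p \<noteq> 0" "q \<noteq> 0"
    and "0 < L" "L \<le> M" "n \<ge> 2"
  shows False
proof (cases "b \<le> a")
  case True
  then show ?thesis using two_root_arith_aux assms by blast
next
  case False
  have "of_nat L * (q * p) ^ n = of_nat (n * M) * (q ^ b * p ^ a)"
    using assms(1) by (simp add: mult_ac)
  moreover have "of_nat b * p = - of_nat a * q" using assms(2) by simp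
  ultimately show ?thesis
    using two_root_arith_aux[of L q p n M b a] assms False by simp
qed

section \<open>Transfer of the covariants to the algebraic closure\<close>

lemma map_poly_to_ac_mult: "map_poly to_ac (p * q) = map_poly to_ac p * map_poly to_ac (q :: 'b :: field poly)"
  by (intro poly_eqI) (simp add: coeff_map_poly coeff_mult to_ac_sum)

lemma map_poly_to_ac_diff: "map_poly to_ac (p - q) = map_poly to_ac p - map_poly to_ac (q :: 'b :: field poly)"
  by (intro poly_eqI) (simp add: coeff_map_poly)

lemma map_poly_to_ac_of_nat: "map_poly to_ac (of_nat n :: 'b :: field poly) = of_nat n"
  by (simp add: of_nat_poly map_poly_pCons)

lemma map_poly_to_ac_pderiv: "map_poly to_ac (pderiv p) = pderiv (map_poly to_ac (p :: 'b :: field poly))"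
  by (intro poly_eqI) (simp add: coeff_map_poly coeff_pderiv)

lemma map_poly_to_ac_covariants:
  fixes Q :: "'b :: field poly"
  shows "map_poly to_ac (hessian N Q) = hessian N (map_poly to_ac Q)"
    and "map_poly to_ac (jacobian N Q) = jacobian N (map_poly to_ac Q)"
proof -
  have 1: "map_poly to_ac (1 :: 'b poly) = 1" and 2: "map_poly to_ac (2 :: 'b poly) = 2"
    and 4: "map_poly to_ac (4 :: 'b poly) = 4"
    using map_poly_to_ac_of_nat[of 1] map_poly_to_ac_of_nat[of 2] map_poly_to_ac_of_nat[of 4] by simp_all
  show *: "map_poly to_ac (hessian N Q) = hessian N (map_poly to_ac Q)"
    by (simp add: hessian_def map_poly_to_ac_diff map_poly_to_ac_mult map_poly_to_ac_of_nat
        map_poly_to_ac_pderiv 1 power2_eq_square)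
  show "map_poly to_ac (jacobian N Q) = jacobian N (map_poly to_ac Q)"
    by (simp add: jacobian_def map_poly_to_ac_diff map_poly_to_ac_mult map_poly_to_ac_of_nat
        map_poly_to_ac_pderiv 2 4 *)
qed

lemma rising_ge_falling: "0 < (\<Prod>j<m. l - j) \<and> (\<Prod>j<m. l - j) \<le> (\<Prod>j<m. l + j)" if "m \<le> l" for l m :: nat
  using that by (auto intro!: prod_pos prod_mono)

text \<open>The purely algebraic end of the proof: \<open>K\<close> stands for the small functions
  and \<open>x\<close> for \<open>f\<close>. By transcendence of \<open>x\<close> every differential
  relation that holds at \<open>x\<close> becomes an identity between polynomials over
  \<open>K\<close>.\<close>

lemma riccati_monomial_contradiction:
  fixes K :: "'a set" and x A B R w :: 'a and l m :: "nat \<Rightarrow> nat" and k :: nat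
  defines "n \<equiv> Suc (\<Sum>i=1..k. m i)"
  defines "G \<equiv> x ^ l 0 * (\<Prod>i=1..k. (\<delta> ^^ m i) (x ^ l i)) / w"
  assumes K: "\<And>u v. u \<in> K \<Longrightarrow> v \<in> K \<Longrightarrow> u + v \<in> K" "\<And>u v. u \<in> K \<Longrightarrow> v \<in> K \<Longrightarrow> u * v \<in> K"
      "\<And>u. u \<in> K \<Longrightarrow> inverse u \<in> K" "\<And>u. u \<in> K \<Longrightarrow> \<delta> u \<in> K" "\<And>u. \<delta> u = 0 \<Longrightarrow> u \<in> K"
    and trans: "\<And>p. \<forall>i. coeff p i \<in> K \<Longrightarrow> poly p x = 0 \<Longrightarrow> p = 0"
    and mem: "A \<in> K" "B \<in> K" "R \<in> K" "w \<in> K" and A0: "A \<noteq> 0" and w0: "w \<noteq> 0"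
    and x: "\<delta> x = A * x ^ 2 + B * x + R"
    and l0: "l 0 = 1" and lsum: "(\<Sum>i=1..k. l i) = n" and lm: "\<forall>i\<in>{1..k}. l i \<ge> m i"
    and mpos: "(\<Sum>i=1..k. m i) > 0"
    and G: "\<delta> G = of_nat (2 * n) * A * x * (G - 1)"
  shows False
proof -
  define KP where "KP = {p. \<forall>i. coeff p i \<in> K}"
  have K_const: "0 \<in> K" "1 \<in> K" "\<And>j. of_nat j \<in> K" using K(5) by simp_all
  have "-1 \<in> K" using K(5)[of "-1"] by (simp add: uminus)
  then have K_minus: "u \<in> K \<Longrightarrow> - u \<in> K" for u using K(2)[of "-1" u] by simp
  have K_sum: "(\<And>i. i \<in> I \<Longrightarrow> g i \<in> K) \<Longrightarrow> (\<Sum>i\<in>I. g i) \<in> K" for I and g :: "nat \<Rightarrow> 'a"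
    by (induction I rule: infinite_finite_induct) (auto simp: K_const K)
  have KP_add: "p + q \<in> KP" if "p \<in> KP" "q \<in> KP" for p q using that K by (auto simp: KP_def)
  have KP_diff: "p - q \<in> KP" if "p \<in> KP" "q \<in> KP" for p q
  proof -
    have "coeff p i + (- coeff q i) \<in> K" for i
      by (rule K(1)) (use that K_minus in \<open>auto simp: KP_def\<close>)
    then show ?thesis by (simp add: KP_def)
  qed
  have KP_mult: "p * q \<in> KP" if "p \<in> KP" "q \<in> KP" for p q
    using that K(2) by (auto simp: KP_def coeff_mult intro!: K_sum)
  have KP_smult: "smult u p \<in> KP" if "p \<in> KP" "u \<in> K" for p u
    using that K(2) by (auto simp: KP_def)
  have KP_pderiv: "pderiv p \<in> KP" if "p \<in> KP" for p
    using that K(2)[OF K_const(3)] by (auto simp: KP_def coeff_pderiv simp del: of_nat_Suc)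
  have KP_map: "map_poly \<delta> p \<in> KP" if "p \<in> KP" for p
    using that K(4) by (auto simp: KP_def)
  have KP_const: "[:u:] \<in> KP" if "u \<in> K" for u
    using that K_const by (auto simp: KP_def coeff_pCons split: nat.split)
  have KP_pCons: "pCons u p \<in> KP" if "u \<in> K" "p \<in> KP" for u p
    using that by (auto simp: KP_def coeff_pCons split: nat.split)
  have KP_of_nat: "of_nat j \<in> KP" for j unfolding of_nat_poly by (rule KP_const) (rule K_const)
  then have KP_num: "1 \<in> KP" "2 \<in> KP" "4 \<in> KP"
    using KP_of_nat[of 1] KP_of_nat[of 2] KP_of_nat[of 4] by simp_all
  have KP_0: "0 \<in> KP" using KP_of_nat[of 0] by simp
  have KP_prod: "(\<And>i. i \<in> I \<Longrightarrow> g i \<in> KP) \<Longrightarrow> (\<Prod>i\<in>I. g i) \<in> KP" for I and g :: "nat \<Rightarrow> 'a poly"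
    by (induction I rule: infinite_finite_induct) (auto simp: KP_num KP_mult)
  have KP_monom: "monom 1 j \<in> KP" for j by (auto simp: KP_def K_const)
  have trans': "p = 0" if "p \<in> KP" "poly p x = 0" for p using trans that by (auto simp: KP_def)
  define \<rho> where "\<rho> = [:R, B, A:]"
  have rho: "\<rho> \<in> KP" unfolding \<rho>_def using mem KP_pCons KP_0 by simp
  have xr: "\<delta> x = poly \<rho> x" by (simp add: x \<rho>_def algebra_simps power2_eq_square)
  have KP_dpoly: "dpoly \<rho> p \<in> KP" if "p \<in> KP" for p
    unfolding dpoly_def by (intro KP_add KP_mult KP_map KP_pderiv rho that)
  have KP_dpolyn: "(dpoly \<rho> ^^ j) p \<in> KP" if "p \<in> KP" for p j
    by (induction j) (auto simp: that KP_dpoly)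
  define N where "N = 2 * n"
  define F where "F i = (dpoly \<rho> ^^ m i) (monom 1 (l i))" for i
  define \<Phi> where "\<Phi> = monom 1 1 * (\<Prod>i=1..k. F i)"
  define Q where "Q = smult (inverse w) \<Phi> - 1"
  have "poly (F i) x = (\<delta> ^^ m i) (x ^ l i)" for i
    unfolding F_def higher_deriv_poly[OF xr, symmetric] by (simp add: poly_monom)
  then have Gx: "poly Q x = G - 1"
    by (simp add: Q_def \<Phi>_def poly_prod G_def l0 poly_monom field_simps)
  have QK: "Q \<in> KP" unfolding Q_def \<Phi>_def F_def
    by (intro KP_diff KP_smult KP_mult KP_prod KP_dpolyn KP_num KP_monom K mem)
  have XK: "[:0, of_nat N * A:] \<in> KP"
    by (intro KP_pCons K_const KP_0 K mem)
  have "poly (dpoly \<rho> Q - [:0, of_nat N * A:] * Q) x = 0"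
    using G by (simp add: deriv_poly[OF xr, symmetric] Gx diff N_def algebra_simps)
  then have ODE: "dpoly \<rho> Q = [:0, of_nat N * A:] * Q"
    using trans'[OF KP_diff[OF KP_dpoly[OF QK] KP_mult[OF XK QK]]] by (simp only: right_minus_eq)
  define L M where "L = (\<Prod>i=1..k. \<Prod>j<m i. l i - j)" and "M = (\<Prod>i=1..k. \<Prod>j<m i. l i + j)"
  have LM: "0 < L" "L \<le> M"
    unfolding L_def M_def using rising_ge_falling lm by (auto intro!: prod_pos prod_mono simp: less_imp_le)
  have n2: "n \<ge> 2" using mpos by (simp add: n_def)
  have mn: "(\<Sum>i=1..k. m i) = n - 1" by (simp add: n_def)
  have prodpow: "(\<Prod>i=1..k. of_nat (g i) * u ^ m i) = of_nat (\<Prod>i=1..k. g i) * u ^ (n - 1)" for g and u :: 'a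
    unfolding prod.distrib mn[symmetric] power_sum by simp
  have low: "(\<forall>j<l i - m i. coeff (F i) j = 0) \<and> coeff (F i) (l i - m i) = of_nat (\<Prod>j<m i. l i - j) * R ^ m i"
    if "i \<in> {1..k}" for i
    unfolding F_def \<rho>_def using lm that by (intro higher_dpoly_monom_low) auto
  have plow: "(\<Prod>i=1..k. coeff (F i) (l i - m i)) = of_nat L * R ^ (n - 1)"
    unfolding L_def prodpow[symmetric] using low by (intro prod.cong) blast+
  \<comment> \<open>The product of the \<open>F i\<close> starts in degree 1, and the factor from
    \<open>l 0 = 1\<close> shifts this to 2. So \<open>Q\<close> is -1 plus terms of degree at least
    2, a gap that gives strong information about its roots.\<close>
  have "(\<Sum>i=1..k. l i - m i) = 1"
    using lm lsum mn n2 by (subst sum_subtractf_nat) auto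
  then have lowP: "coeff (\<Prod>i=1..k. F i) 1 = of_nat L * R ^ (n - 1)" "coeff (\<Prod>i=1..k. F i) 0 = 0"
    using coeff_prod_low[of "{1..k}" "\<lambda>i. l i - m i" F] low plow by auto
  have high: "Polynomial.degree (F i) \<le> l i + m i \<and> coeff (F i) (l i + m i) = of_nat (\<Prod>j<m i. l i + j) * A ^ m i" for i
    unfolding F_def \<rho>_def by (rule higher_dpoly_monom_high)
  have phigh: "(\<Prod>i=1..k. coeff (F i) (l i + m i)) = of_nat M * A ^ (n - 1)"
    unfolding M_def prodpow[symmetric] using high by (intro prod.cong) blast+
  have "(\<Sum>i=1..k. l i + m i) = N - 1" using lsum mn n2 by (simp add: sum.distrib N_def)
  then have highP: "coeff (\<Prod>i=1..k. F i) (N - 1) = of_nat M * A ^ (n - 1)"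
    "Polynomial.degree (\<Prod>i=1..k. F i) \<le> N - 1"
    using coeff_prod_high[of "{1..k}" F "\<lambda>i. l i + m i"] high phigh by auto
  have Ph: "\<Phi> = pCons 0 (\<Prod>i=1..k. F i)" by (simp add: \<Phi>_def monom_altdef)
  define g2 where "g2 = coeff Q 2"
  have N2: "N > 2" using n2 by (simp add: N_def)
  have c0: "coeff Q 0 = -1" and c1: "coeff Q 1 = 0"
    and g2: "g2 = of_nat L * R ^ (n - 1) / w"
    and cN: "coeff Q N = of_nat M * A ^ (n - 1) / w"
    using lowP highP(1) N2
    by (auto simp: Q_def Ph g2_def coeff_pCons numeral_2_eq_2 field_simps split: nat.splits)
  have degQ: "Polynomial.degree Q = N"
  proof (rule antisym)
    show "Polynomial.degree Q \<le> N"
      unfolding Q_def using highP(2) N2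
      by (intro degree_diff_le) (auto simp: Ph intro!: order.trans[OF degree_smult_le] order.trans[OF degree_pCons_le])
    show "N \<le> Polynomial.degree Q" using cN A0 w0 LM by (intro le_degree) auto
  qed
  \<comment> \<open>In degree 1 only the term with \<open>R\<close> survives on the left, while the
    right-hand side sees the constant term -1 of \<open>Q\<close>.\<close>
  have "coeff (dpoly \<rho> Q) 1 = coeff ([:0, of_nat N * A:] * Q) 1" using ODE by simp
  then have Rg: "R * g2 = - of_nat n * A"
    by (simp add: \<rho>_def coeff_dpoly c0 c1[simplified] g2_def[unfolded numeral_2_eq_2] N_def)
  then have g20: "g2 \<noteq> 0" and R0: "R \<noteq> 0" using A0 n2 by auto
  \<comment> \<open>An identically vanishing Hessian would mean a single root of multiplicity
    \<open>N\<close>; the value at 0 rules this out.\<close>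
  have "poly (hessian N Q) 0 = 2 * of_nat N * g2"
  proof -
    have "poly Q 0 = -1" "poly (pderiv Q) 0 = 0" "poly (pderiv (pderiv Q)) 0 = 2 * g2"
      using c0 c1 by (simp_all add: poly_0_coeff_0 coeff_pderiv g2_def numeral_2_eq_2)
    then show ?thesis by (simp add: hessian_def)
  qed
  then have H0: "hessian N Q \<noteq> 0" using g20 N2 by auto
  have HK: "hessian N Q \<in> KP"
    unfolding hessian_def power2_eq_square by (intro KP_diff KP_mult KP_of_nat KP_num QK KP_pderiv)
  have JK: "jacobian N Q \<in> KP"
    unfolding jacobian_def by (intro KP_diff KP_mult KP_of_nat KP_num QK KP_pderiv HK)
  define h j where "h = poly (hessian N Q) x" and "j = poly (jacobian N Q) x"
  define e where "e = (of_nat N - 2) * A * x - B"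
  have h0: "h \<noteq> 0" using trans'[OF HK] H0 by (auto simp: h_def)
  have dh: "\<delta> h = 2 * e * h" and dj: "\<delta> j = 3 * e * j"
    unfolding h_def j_def deriv_poly[OF xr] unfolding \<rho>_def dpoly_covariants[OF ODE[unfolded \<rho>_def]]
    by (simp_all add: e_def algebra_simps)
  \<comment> \<open>Both \<open>j ^ 2\<close> and \<open>h ^ 3\<close> solve the equation
    \<open>\<delta> y = 6 * e * y\<close>, so their quotient is a constant of the derivation and
    lies in \<open>K\<close>.\<close>
  define c where "c = j ^ 2 / h ^ 3"
  have "c * h ^ 3 = j ^ 2" using h0 by (simp add: c_def)
  then have "\<delta> (c * h ^ 3) = \<delta> (j ^ 2)" by simp
  then have "\<delta> c * h ^ 3 + c * (6 * e * h ^ 3) = 6 * e * j ^ 2"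
    by (simp add: mult dh dj power2_eq_square power3_eq_cube algebra_simps)
  also have "j ^ 2 = c * h ^ 3" using h0 by (simp add: c_def)
  finally have "\<delta> c * h ^ 3 = 0" by (simp add: algebra_simps)
  then have "\<delta> c = 0" using h0 by simp
  then have cK: "c \<in> K" by (rule K)
  have "poly (jacobian N Q ^ 2 - smult c (hessian N Q ^ 3)) x = 0"
    using h0 by (simp add: c_def h_def j_def)
  moreover have "jacobian N Q ^ 2 - smult c (hessian N Q ^ 3) \<in> KP"
    unfolding power2_eq_square power3_eq_cube by (intro KP_diff KP_smult KP_mult JK HK cK)
  ultimately have syz: "jacobian N Q ^ 2 = smult c (hessian N Q ^ 3)" using trans' by fastforce
  define P where "P = map_poly to_ac Q"
  have degP: "Polynomial.degree P = N" unfolding P_def using degQ by (subst degree_map_poly) auto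
  have "map_poly to_ac (jacobian N Q ^ 2) = map_poly to_ac (smult c (hessian N Q ^ 3))" using syz by simp
  then have syzP: "jacobian N P ^ 2 = smult (to_ac c) (hessian N P ^ 3)"
    by (simp add: power2_eq_square power3_eq_cube map_poly_to_ac_mult map_poly_smult map_poly_to_ac_covariants P_def)
  have HP: "hessian N P \<noteq> 0"
    using H0 unfolding P_def map_poly_to_ac_covariants[symmetric] by (subst map_poly_eq_0_iff) auto
  have "card {z. poly P z = 0} = 2"
    using covariant_syzygy_two_roots[OF degP _ HP syzP] N2 by simp
  then obtain p q where pq: "{z. poly P z = 0} = {p, q}" "p \<noteq> q" by (auto simp: card_2_iff)
  define a b where "a = Polynomial.order p P" and "b = Polynomial.order q P"
  define g where "g = lead_coeff P"
  have P0: "P \<noteq> 0" using degP N2 by auto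
  have deco: "P = smult g ([:-p, 1:] ^ a * [:-q, 1:] ^ b)"
    using alg_closed_prod_roots[OF P0] pq by (simp add: a_def b_def g_def)
  have g0: "g \<noteq> 0" using P0 by (simp add: g_def)
  have ab: "a + b = 2 * n"
    using degP g0 by (subst (asm) deco) (simp add: degree_mult_eq degree_power_eq N_def)
  have cP: "coeff P i = to_ac (coeff Q i)" for i by (simp add: P_def coeff_map_poly)
  have "poly P 0 = -1" using cP[of 0] c0 by (simp add: poly_0_coeff_0)
  then have gpq: "g * (p ^ a * q ^ b) = -1"
  proof -
    have "g * ((-p) ^ a * (-q) ^ b) = -1" using \<open>poly P 0 = -1\<close> by (subst (asm) deco) simp
    moreover have "(-p) ^ a * (-q) ^ b = (-1) ^ (a + b) * (p ^ a * q ^ b)"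
      by (simp add: power_minus[of p] power_minus[of q] power_add)
    ultimately show ?thesis using ab by simp
  qed
  have "poly P p = 0" "poly P q = 0" using pq by auto
  then have p0: "p \<noteq> 0" and q0: "q \<noteq> 0" using \<open>poly P 0 = -1\<close> by auto
  define Y Z where "Y = [:-p, 1:]" and "Z = [:-q, 1:]"
  have PY: "P = Y ^ a * smult g (Z ^ b)" and PZ: "P = Z ^ b * smult g (Y ^ a)"
    by (subst deco, simp add: Y_def Z_def mult_ac)+
  \<comment> \<open>The logarithmic derivative of \<open>P\<close> with denominators cleared. Its
    value at 0 ties the two roots together, because \<open>P\<close> has no linear term.\<close>
  have log: "Y * Z * pderiv P = (of_nat a * Z + of_nat b * Y) * P"
  proof -
    have "pderiv P = pderiv (Y ^ a) * smult g (Z ^ b) + Y ^ a * smult g (pderiv (Z ^ b))"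
      by (subst PY) (simp add: pderiv_mult pderiv_smult smult_add_right mult_ac)
    then have "Y * Z * pderiv P = (Y * pderiv (Y ^ a * 1)) * (Z * smult g (Z ^ b))
         + (Y * Y ^ a) * smult g (Z * pderiv (Z ^ b * 1))"
      by (simp add: algebra_simps)
    also have "Y * pderiv (Y ^ a * 1) = Y ^ a * (of_nat a * 1 + Y * pderiv 1)"
      unfolding Y_def by (rule euler_pderiv)
    also have "Z * pderiv (Z ^ b * 1) = Z ^ b * (of_nat b * 1 + Z * pderiv 1)"
      unfolding Z_def by (rule euler_pderiv)
    finally have "Y * Z * pderiv P = (of_nat a * Z + of_nat b * Y) * (Y ^ a * smult g (Z ^ b))"
      by (simp add: algebra_simps smult_add_right)
    then show ?thesis by (simp only: PY[symmetric])
  qed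
  have dP0: "poly (pderiv P) 0 = 0" using cP[of 1] c1 by (simp add: poly_0_coeff_0 coeff_pderiv)
  have "poly (Y * Z * pderiv P) 0 = poly ((of_nat a * Z + of_nat b * Y) * P) 0" using log by simp
  then have lin: "of_nat a * q = - of_nat b * p"
    using dP0 \<open>poly P 0 = -1\<close> by (simp add: Y_def Z_def eq_neg_iff_add_eq_0 add.commute mult.commute)
  \<comment> \<open>One more derivative at 0 brings in the quadratic coefficient \<open>g2\<close>
    and thereby the product of the roots.\<close>
  have "pderiv (Y * Z * pderiv P) = pderiv ((of_nat a * Z + of_nat b * Y) * P)" using log by simp
  then have "pderiv (Y * Z) * pderiv P + Y * Z * pderiv (pderiv P)
      = (of_nat a + of_nat b) * P + (of_nat a * Z + of_nat b * Y) * pderiv P"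
    by (simp add: pderiv_mult pderiv_add Y_def[THEN arg_cong[of _ _ pderiv]] Z_def[THEN arg_cong[of _ _ pderiv]]
        pderiv_pCons algebra_simps)
  then have "poly (pderiv (Y * Z) * pderiv P + Y * Z * pderiv (pderiv P)) 0
      = poly ((of_nat a + of_nat b) * P + (of_nat a * Z + of_nat b * Y) * pderiv P) 0" by simp
  then have "p * q * poly (pderiv (pderiv P)) 0 = - (of_nat a + of_nat b)"
    using dP0 \<open>poly P 0 = -1\<close> by (simp add: Y_def Z_def mult.commute[of p])
  moreover have "poly (pderiv (pderiv P)) 0 = 2 * to_ac g2"
    using cP[of 2] by (simp add: poly_0_coeff_0 coeff_pderiv g2_def numeral_2_eq_2)
  moreover have "(of_nat a + of_nat b :: 'a alg_closure) = 2 * of_nat n"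
    using arg_cong[OF ab, of "of_nat :: nat \<Rightarrow> 'a alg_closure"] by simp
  ultimately have pg: "p * q * to_ac g2 = - of_nat n" by (simp add: mult.assoc)
  have "to_ac R * to_ac g2 = - of_nat n * to_ac A"
    using arg_cong[OF Rg, of to_ac] by simp
  also have "\<dots> = to_ac A * (p * q) * to_ac g2" using pg by (simp add: mult.assoc)
  \<comment> \<open>The Riccati relation for \<open>R * g2\<close> and the root relation for
    \<open>p * q * g2\<close> share the factor \<open>g2\<close>. Its elimination leaves only roots
    and the coefficient \<open>A\<close>.\<close>
  finally have RA: "to_ac R = to_ac A * (p * q)" using g20 by simp
  have wg: "to_ac w * to_ac g2 = of_nat L * to_ac R ^ (n - 1)"
    using arg_cong[OF g2, of to_ac] w0 by simp
  have 1: "of_nat L * (to_ac A ^ (n - 1) * (p * q) ^ n) = - of_nat n * to_ac w"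
  proof -
    obtain n' where n': "n = Suc n'" using n2 by (cases n) auto
    have "of_nat L * (to_ac A ^ (n - 1) * (p * q) ^ n) = p * q * (of_nat L * to_ac R ^ (n - 1))"
      by (simp add: RA n' power_mult_distrib mult_ac)
    also have "\<dots> = to_ac w * (p * q * to_ac g2)"
      using wg by (simp add: mult_ac)
    finally show ?thesis unfolding pg by (simp add: mult_ac)
  qed
  have gM: "to_ac w * g = of_nat M * to_ac A ^ (n - 1)"
  proof -
    have "g = to_ac (coeff Q N)" unfolding g_def degP cP ..
    then show ?thesis using arg_cong[OF cN, of to_ac] w0 by simp
  qed
  have h1: "of_nat M * to_ac A ^ (n - 1) * (p ^ a * q ^ b) = - to_ac w"
    unfolding gM[symmetric] using gpq by (simp add: mult.assoc)
  have "to_ac A ^ (n - 1) * (of_nat L * (p * q) ^ n) = of_nat L * (to_ac A ^ (n - 1) * (p * q) ^ n)"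
    by (simp only: mult_ac)
  also have "\<dots> = of_nat n * (- to_ac w)" unfolding 1 by simp
  also have "\<dots> = of_nat n * (of_nat M * to_ac A ^ (n - 1) * (p ^ a * q ^ b))" unfolding h1 ..
  also have "\<dots> = to_ac A ^ (n - 1) * (of_nat (n * M) * (p ^ a * q ^ b))"
    by (simp only: semiring_1_class.of_nat_mult mult_ac)
  finally have "to_ac A ^ (n - 1) * (of_nat L * (p * q) ^ n) = to_ac A ^ (n - 1) * (of_nat (n * M) * (p ^ a * q ^ b))" .
  then have "of_nat L * (p * q) ^ n = of_nat (n * M) * (p ^ a * q ^ b)" using A0 by simp
  then show False using two_root_arith lin ab p0 q0 LM n2 by blast
qed

end

subsection \<open>Proximity estimates for differential monomials\<close>

lemma le_higher_deriv:
  "g meromorphic_on UNIV \<Longrightarrow> laurent_expansion ((deriv ^^ n) g) z = (fls_deriv ^^ n) (laurent_expansion g z)"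
  by (induction n) (auto simp: le_deriv meromorphic_intros)

lemma logplus_power: "x \<ge> 0 \<Longrightarrow> logplus (x ^ n) = real n * logplus x"
proof (cases "x \<le> 1")
  case False
  have "x ^ n > 1" if "n > 0" using one_less_power[of x n] False that by simp
  then have "\<not> x ^ n \<le> 1" if "n > 0" using that by (simp add: not_le)
  then show ?thesis using False by (cases "n = 0") (auto simp: logplus_def ln_realpow)
qed (auto simp: logplus_def power_le_one)

lemma proxim_power: "proxim (\<lambda>z. g z ^ n) r = real n * proxim g r"
  by (simp add: proxim_cavg norm_power logplus_power cavg_cmult)

lemma proxim_cong: "r \<ge> 0 \<Longrightarrow> (\<And>z. cmod z = r \<Longrightarrow> g z = h z) \<Longrightarrow> proxim g r = proxim h r"
  unfolding proxim_cavg by (intro cavg_cong) auto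

lemma anrad_const: "r > 0 \<Longrightarrow> anrad (\<lambda>_. c) r"
  by (simp add: anrad_def)

lemma proxim_uminus: "proxim (\<lambda>z. - g z) r = proxim g r"
  by (simp add: proxim_cavg)

lemma proxim_const: "proxim (\<lambda>_. c) r = logplus (cmod c)"
  by (simp add: proxim_cavg)

lemma proxim_prod:
  assumes "finite I" "\<And>i. i \<in> I \<Longrightarrow> anrad (g i) r" "r > 0"
  shows "proxim (\<lambda>z. \<Prod>i\<in>I. g i z) r \<le> (\<Sum>i\<in>I. proxim (g i) r) \<and> anrad (\<lambda>z. \<Prod>i\<in>I. g i z) r"
  using assms
proof (induction I)
  case empty then show ?case by (simp add: proxim_const logplus_def anrad_const)
next
  case (insert i I)
  then have IH: "proxim (\<lambda>z. \<Prod>i\<in>I. g i z) r \<le> (\<Sum>i\<in>I. proxim (g i) r)" "anrad (\<lambda>z. \<Prod>i\<in>I. g i z) r"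
    and gi: "anrad (g i) r" by auto
  show ?case using proxim_mult[OF gi IH(2)] anrad_mult[OF gi IH(2)] IH(1) insert by simp
qed

context transc
begin

lemma Sm_proxim_mult:
  assumes "g meromorphic_on UNIV" "h meromorphic_on UNIV" "Sm f (proxim g)" "Sm f (proxim h)"
  shows "Sm f (proxim (\<lambda>z. g z * h z))"
  using eventually_conj[OF nevF_anrad[OF assms(1)] nevF_anrad[OF assms(2)]]
  by (intro Sm_mono[OF Sm_add[OF assms(3,4)]]) (auto elim!: eventually_mono intro: proxim_mult)

lemma Sm_proxim_add:
  assumes "g meromorphic_on UNIV" "h meromorphic_on UNIV" "Sm f (proxim g)" "Sm f (proxim h)"
  shows "Sm f (proxim (\<lambda>z. g z + h z))"
  using eventually_conj[OF nevF_anrad[OF assms(1)] nevF_anrad[OF assms(2)]]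
  by (intro Sm_mono[OF Sm_add[OF Sm_add[OF assms(3,4)] Sm_const[of "ln 2"]]]) (auto elim!: eventually_mono intro: proxim_add)

text \<open>The quotient is a telescoping product of logarithmic derivatives of successive
  derivatives, all of characteristic \<open>O(T(r,f))\<close>. Once a derivative vanishes
  identically there is nothing left to estimate.\<close>

lemma Sm_proxim_higher_deriv:
  assumes g: "mnz g" "b.cfun g"
  shows "Sm f (proxim (\<lambda>z. (deriv ^^ j) g z / g z))"
proof (induction j)
  case 0
  show ?case
  proof (rule Sm_mono[OF Sm_const[of 0]])
    show "\<forall>\<^sub>F r in nevF. proxim (\<lambda>z. (deriv ^^ 0) g z / g z) r \<le> 0"
      using nevF_goodrad[OF g(1)]
    proof (rule eventually_mono)
      fix r assume r: "goodrad g r"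
      then have "proxim (\<lambda>z. (deriv ^^ 0) g z / g z) r = proxim (\<lambda>_. 1) r"
        by (intro proxim_cong) (auto simp: goodrad_def goodpt_def)
      then show "proxim (\<lambda>z. (deriv ^^ 0) g z / g z) r \<le> 0" by (simp add: proxim_const logplus_def)
    qed
  qed
next
  case (Suc j)
  define h where "h = (deriv ^^ j) g"
  have hb: "b.cfun h" unfolding h_def by (rule b.cfun_higher_deriv[OF g(2)])
  have hm: "h meromorphic_on UNIV" using hb by (rule b.cfun_mero)
  show ?case
  proof (cases "mnz h")
    case True
    have "Sm f (\<lambda>r. proxim (\<lambda>z. deriv h z / h z) r + proxim (\<lambda>z. h z / g z) r)"
      using Suc by (intro Sm_add log_derivative_small True) (use hb in \<open>auto simp: h_def b.cfun_def\<close>)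
    then show ?thesis
    proof (rule Sm_mono)
      show "\<forall>\<^sub>F r in nevF. proxim (\<lambda>z. (deriv ^^ Suc j) g z / g z) r
          \<le> proxim (\<lambda>z. deriv h z / h z) r + proxim (\<lambda>z. h z / g z) r"
        using eventually_conj[OF nevF_goodrad[OF g(1)] nevF_goodrad[OF True]]
      proof (rule eventually_mono)
        fix r assume r: "goodrad g r \<and> goodrad h r"
        have "proxim (\<lambda>z. (deriv ^^ Suc j) g z / g z) r = proxim (\<lambda>z. (deriv h z / h z) * (h z / g z)) r"
          using r by (intro proxim_cong) (auto simp: goodrad_def goodpt_def h_def)
        also have "\<dots> \<le> proxim (\<lambda>z. deriv h z / h z) r + proxim (\<lambda>z. h z / g z) r"
        proof (rule proxim_mult)
          show "anrad (\<lambda>z. deriv h z / h z) r" using r by (intro anrad_logderiv) simp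
          show "anrad (\<lambda>z. h z / g z) r"
            using r unfolding goodrad_def goodpt_def anrad_def by (auto intro!: analytic_on_divide)
        qed
        finally show "proxim (\<lambda>z. (deriv ^^ Suc j) g z / g z) r
          \<le> proxim (\<lambda>z. deriv h z / h z) r + proxim (\<lambda>z. h z / g z) r" .
      qed
    qed
  next
    case False
    have dm: "deriv h meromorphic_on UNIV" using hm by (intro meromorphic_intros)
    have "\<not> mnz (deriv h)"
      using False unfolding mnz_iff[OF dm, of 0] mnz_iff[OF hm, of 0] by (simp add: le_deriv[OF hm])
    then have ev: "eventually (\<lambda>z. deriv h z = 0) (cosparse UNIV)" using mero_cases[OF dm] by blast
    show ?thesis
    proof (rule Sm_mono[OF Sm_const[of 0]])
      show "\<forall>\<^sub>F r in nevF. proxim (\<lambda>z. (deriv ^^ Suc j) g z / g z) r \<le> 0"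
        using eventually_conj[OF nevF_cosparse[OF ev] nevF_ge[of 1]]
      proof (rule eventually_mono)
        fix r assume r: "(\<forall>z. cmod z = r \<longrightarrow> deriv h z = 0) \<and> 1 \<le> r"
        then have "proxim (\<lambda>z. (deriv ^^ Suc j) g z / g z) r = proxim (\<lambda>_. 0) r"
          by (intro proxim_cong) (auto simp: h_def)
        then show "proxim (\<lambda>z. (deriv ^^ Suc j) g z / g z) r \<le> 0" by (simp add: proxim_const logplus_def)
      qed
    qed
  qed
qed

lemma KS_closed:
  "u \<in> KS \<Longrightarrow> v \<in> KS \<Longrightarrow> u + v \<in> KS" "u \<in> KS \<Longrightarrow> v \<in> KS \<Longrightarrow> u * v \<in> KS"
  "u \<in> KS \<Longrightarrow> inverse u \<in> KS" "u \<in> KS \<Longrightarrow> fls_deriv u \<in> KS" "fls_const c \<in> KS"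
proof -
  show "u + v \<in> KS" if uv: "u \<in> KS" "v \<in> KS"
  proof -
    obtain g h where gh: "s.cfun g" "u = laurent_expansion g 0" "s.cfun h" "v = laurent_expansion h 0"
      using uv by (auto simp: KS_def)
    then have "u + v = laurent_expansion (\<lambda>z. g z + h z) 0" by (simp add: le_add s.cfun_mero)
    then show ?thesis using s.cfun_add[OF gh(1,3)] by (auto simp: KS_def)
  qed
  show "u * v \<in> KS" if uv: "u \<in> KS" "v \<in> KS"
  proof -
    obtain g h where gh: "s.cfun g" "u = laurent_expansion g 0" "s.cfun h" "v = laurent_expansion h 0"
      using uv by (auto simp: KS_def)
    then have "u * v = laurent_expansion (\<lambda>z. g z * h z) 0" by (simp add: le_mult s.cfun_mero)
    then show ?thesis using s.cfun_mult[OF gh(1,3)] by (auto simp: KS_def)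
  qed
  show "inverse u \<in> KS" if u: "u \<in> KS"
  proof -
    obtain g where g: "s.cfun g" "u = laurent_expansion g 0" using u by (auto simp: KS_def)
    then have "inverse u = laurent_expansion (\<lambda>z. inverse (g z)) 0" by (simp add: le_inverse s.cfun_mero)
    then show ?thesis using s.cfun_inverse[OF g(1)] by (auto simp: KS_def)
  qed
  show "fls_deriv u \<in> KS" if u: "u \<in> KS"
  proof -
    obtain g where g: "s.cfun g" "u = laurent_expansion g 0" using u by (auto simp: KS_def)
    then have "fls_deriv u = laurent_expansion (deriv g) 0" by (simp add: le_deriv s.cfun_mero)
    then show ?thesis using s.cfun_deriv[OF g(1)] by (auto simp: KS_def)
  qed
  have "fls_const c = laurent_expansion (\<lambda>_. c) 0" by simp
  then show "fls_const c \<in> KS" using s.cfun_const[of c] unfolding KS_def by blast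
qed

text \<open>Otherwise \<open>f\<close> would be a root of \<open>X ^ n - f ^ n\<close>, a nonzero
  polynomial with small coefficients.\<close>

lemma power_not_small:
  assumes "n > 0"
  shows "\<not> s.cfun (\<lambda>z. f z ^ n)"
proof
  assume sm: "s.cfun (\<lambda>z. f z ^ n)"
  define x where "x = laurent_expansion f 0"
  have "laurent_expansion (\<lambda>z. f z ^ n) 0 = x ^ n" by (simp add: le_power f_mero x_def)
  then have xK: "x ^ n \<in> KS" using sm unfolding KS_def by (metis (mono_tags, lifting) mem_Collect_eq)
  have K01: "0 \<in> KS" "1 \<in> KS" "fls_const (-1) \<in> KS" using KS_closed(5)[of 0] KS_closed(5)[of 1] KS_closed(5)[of "-1"] by simp_all
  have nx: "- (x ^ n) \<in> KS" using KS_closed(2)[OF K01(3) xK] by (simp add: fls_const_uminus)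
  define p where "p = Polynomial.monom 1 n + [:- (x ^ n):]"
  have "\<forall>i. Polynomial.coeff p i \<in> KS"
    using assms K01 nx by (auto simp: p_def coeff_pCons split: nat.splits)
  moreover have "poly p x = 0" by (simp add: p_def poly_monom)
  ultimately have "p = 0" using f_transcendental_over_small unfolding x_def by blast
  moreover have "Polynomial.coeff p n = 1" using assms by (simp add: p_def coeff_pCons split: nat.splits)
  ultimately show False by simp
qed

end

lemma fls_deriv_zero_imp_const:
  fixes u :: "complex fls"
  assumes "fls_deriv u = 0"
  shows "u = fls_const (fls_nth u 0)"
proof (rule fls_eqI)
  fix j
  show "fls_nth u j = fls_nth (fls_const (fls_nth u 0)) j"
  proof (cases "j = 0")
    case False
    have "fls_nth (fls_deriv u) (j - 1) = fls_nth 0 (j - 1)" using assms by simp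
    then show ?thesis using False by simp
  qed simp
qed

subsection \<open>The differential monomial\<close>

text \<open>The last assumption negates the claim, so the locale is a proof by contradiction that is
  spread over several lemmas.\<close>

locale monomial_setup = transc +
  fixes k :: nat and l m :: "nat \<Rightarrow> nat" and \<omega> :: "complex \<Rightarrow> complex"
  assumes l0: "l 0 > 0" and lm: "\<forall>i\<in>{1..k}. l i \<ge> m i"
    and lsum: "(\<Sum>i=1..k. l i) > (\<Sum>i=1..k. m i)" and mpos: "(\<Sum>i=1..k. m i) > 0"
    and om: "s.cfun \<omega>" and omz: "mnz \<omega>"
    and finZ: "finite {z. isolated_zero (\<lambda>w. diff_monomial k l m f w - \<omega> w) z}"
begin

definition F where "F = diff_monomial k l m f"
definition L where "L = l 0 + (\<Sum>i=1..k. l i)"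
definition M where "M = (\<Sum>i=1..k. m i)"

lemma LM: "L \<ge> M + 2" using l0 lsum by (simp add: L_def M_def)

lemma Lpos: "L > 0" using LM by simp

lemma F_eq: "F = (\<lambda>z. f z ^ l 0 * (\<Prod>i=1..k. (deriv ^^ m i) (\<lambda>w. f w ^ l i) z))"
  by (rule ext) (simp add: F_def diff_monomial_def)

lemma F_big: "b.cfun F"
  unfolding F_eq by (intro b.cfun_mult b.cfun_prod b.cfun_higher_deriv b.cfun_power big_f)

lemma F_mero: "F meromorphic_on UNIV" using F_big by (rule b.cfun_mero)

lemma om_mero: "\<omega> meromorphic_on UNIV" using om by (rule s.cfun_mero)

lemma le_F: "laurent_expansion F z = fls_monomial k l m (laurent_expansion f z)"
proof -
  have pm: "(\<lambda>w. f w ^ l i) meromorphic_on UNIV" for i by (intro meromorphic_intros f_mero)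
  have dm: "(deriv ^^ m i) (\<lambda>w. f w ^ l i) meromorphic_on UNIV" for i by (intro meromorphic_intros pm)
  have "laurent_expansion F z = laurent_expansion (\<lambda>z. f z ^ l 0) z
     * laurent_expansion (\<lambda>z. \<Prod>i=1..k. (deriv ^^ m i) (\<lambda>w. f w ^ l i) z) z"
    unfolding F_eq by (rule le_mult) (intro pm meromorphic_intros dm)+
  also have "laurent_expansion (\<lambda>z. \<Prod>i=1..k. (deriv ^^ m i) (\<lambda>w. f w ^ l i) z) z
     = (\<Prod>i=1..k. laurent_expansion ((deriv ^^ m i) (\<lambda>w. f w ^ l i)) z)"
    by (rule le_prod) (rule dm)
  also have "\<dots> = (\<Prod>i=1..k. (fls_deriv ^^ m i) (laurent_expansion f z ^ l i))"
    by (intro prod.cong refl) (simp only: le_higher_deriv[OF pm] le_power[OF f_mero])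
  finally show ?thesis by (simp only: fls_monomial_def le_power[OF f_mero])
qed

lemma F_order:
  "ordm f z \<noteq> 0 \<Longrightarrow> laurent_expansion F z \<noteq> 0 \<and> ordm F z = int L * ordm f z - int M"
  "ordm f z = 0 \<Longrightarrow> ordm F z \<ge> 0"
  unfolding ordm_def le_F L_def M_def
  using fls_monomial_subdegree[OF le_nonzero[OF f_mnz] lm] fls_monomial_subdegree_nonneg by auto

text \<open>The power \<open>f ^ L\<close> distributes over the factors: the undifferentiated one
  cancels, and each of the others becomes a higher logarithmic derivative of
  \<open>f ^ l i\<close>.\<close>

lemma Sm_proxim_F: "Sm f (proxim (\<lambda>z. F z / f z ^ L))"
proof -
  define q where "q i z = (deriv ^^ m i) (\<lambda>w. f w ^ l i) z / f z ^ l i" for i z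
  have qm: "q i meromorphic_on UNIV" for i unfolding q_def by (intro meromorphic_intros f_mero)
  have qs: "Sm f (proxim (q i))" for i
    unfolding q_def[abs_def] by (rule Sm_proxim_higher_deriv[OF mnz_power[OF f_mnz] b.cfun_power[OF big_f]])
  have "Sm f (\<lambda>r. \<Sum>i=1..k. proxim (q i) r)" by (intro Sm_sum qs) auto
  then show ?thesis
  proof (rule Sm_mono)
    have "\<forall>\<^sub>F r in nevF. goodrad f r \<and> (\<forall>i\<in>{1..k}. anrad (q i) r)"
      by (intro eventually_conj nevF_goodrad f_mnz eventually_ball_finite ballI nevF_anrad qm) auto
    then show "\<forall>\<^sub>F r in nevF. proxim (\<lambda>z. F z / f z ^ L) r \<le> (\<Sum>i=1..k. proxim (q i) r)"
    proof (rule eventually_mono)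
      fix r assume r: "goodrad f r \<and> (\<forall>i\<in>{1..k}. anrad (q i) r)"
      have "proxim (\<lambda>z. F z / f z ^ L) r = proxim (\<lambda>z. \<Prod>i=1..k. q i z) r"
      proof (rule proxim_cong)
        fix z assume "cmod z = r"
        then have fz: "f z \<noteq> 0" using r by (auto simp: goodrad_def goodpt_def)
        have "f z ^ L = f z ^ l 0 * (\<Prod>i=1..k. f z ^ l i)" by (simp add: L_def power_add power_sum)
        then show "F z / f z ^ L = (\<Prod>i=1..k. q i z)"
          using fz by (simp add: F_eq q_def prod_dividef)
      qed (use r in \<open>simp add: goodrad_def\<close>)
      also have "\<dots> \<le> (\<Sum>i=1..k. proxim (q i) r)"
        using proxim_prod[of "{1..k}" q r] r by (auto simp: goodrad_def)
      finally show "proxim (\<lambda>z. F z / f z ^ L) r \<le> (\<Sum>i=1..k. proxim (q i) r)" .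
    qed
  qed
qed

text \<open>If \<open>F\<close> vanished, some \<open>g = f ^ l i\<close> would have a derivative
  \<open>h\<close> equal to a nonzero constant \<open>c\<close>, the last one before zero. Then
  \<open>1 / g\<close> is \<open>h / g\<close> up to the factor \<open>c\<close> and has small
  proximity function. Moreover \<open>f\<close> has no zeros, since at a zero the derivative of
  order \<open>m i\<close> could not vanish identically. So \<open>1 / g\<close> would be small, and
  with it a power of \<open>f\<close>.\<close>

lemma F_mnz: "mnz F"
proof (rule ccontr)
  assume nF: "\<not> mnz F"
  define x where "x = laurent_expansion f 0"
  have x0: "x \<noteq> 0" unfolding x_def by (rule le_nonzero[OF f_mnz])
  have "fls_monomial k l m x = 0" using nF mnz_iff[OF F_mero, of 0] by (simp add: le_F x_def)
  then have "(\<Prod>i=1..k. (fls_deriv ^^ m i) (x ^ l i)) = 0"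
    unfolding fls_monomial_def using x0 by (simp only: mult_eq_0_iff power_eq_0_iff) auto
  then obtain i where i: "i \<in> {1..k}" "(fls_deriv ^^ m i) (x ^ l i) = 0" by auto
  define g where "g z = f z ^ l i" for z
  have gm: "g meromorphic_on UNIV" unfolding g_def by (intro meromorphic_intros f_mero)
  have gz: "mnz g" unfolding g_def by (rule mnz_power[OF f_mnz])
  have gb: "b.cfun g" unfolding g_def by (rule b.cfun_power[OF big_f])
  have gx: "laurent_expansion g z = laurent_expansion f z ^ l i" for z by (simp add: g_def[abs_def] le_power f_mero)
  define j where "j = (LEAST j. (fls_deriv ^^ j) (x ^ l i) = 0)"
  have j: "(fls_deriv ^^ j) (x ^ l i) = 0" unfolding j_def using i(2) by (rule LeastI)
  have jm: "j \<le> m i" unfolding j_def using i(2) by (rule Least_le)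
  have j0: "j \<noteq> 0" using j x0 by (cases j) auto
  then obtain j' where j': "j = Suc j'" by (cases j) auto
  have u0: "(fls_deriv ^^ j') (x ^ l i) \<noteq> 0" using not_less_Least[of j' "\<lambda>j. (fls_deriv ^^ j) (x ^ l i) = 0"] j'
    unfolding j_def[symmetric] by simp
  define h where "h = (deriv ^^ j') g"
  have hm: "h meromorphic_on UNIV" unfolding h_def by (intro meromorphic_intros gm)
  have hx: "laurent_expansion h 0 = (fls_deriv ^^ j') (x ^ l i)"
    unfolding h_def le_higher_deriv[OF gm] gx x_def ..
  define c where "c = fls_nth (laurent_expansion h 0) 0"
  have "fls_deriv (laurent_expansion h 0) = 0" using j unfolding hx j' by simp
  then have hc: "laurent_expansion h 0 = fls_const c" unfolding c_def by (rule fls_deriv_zero_imp_const)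
  have c0: "c \<noteq> 0" using hc u0 hx by auto
  have hcm: "(\<lambda>z. h z - c) meromorphic_on UNIV" using hm by (intro meromorphic_intros)
  have "laurent_expansion (\<lambda>z. h z - c) 0 = 0" using le_diff[OF hm, of "\<lambda>_. c" 0] hc by (simp add: meromorphic_intros)
  then have ev: "eventually (\<lambda>z. h z - c = 0) (cosparse UNIV)"
    using mero_cases[OF hcm] mnz_iff[OF hcm, of 0] by blast
  have li: "l i > 0" using jm j0 lm i(1) by (metis gr0I le_zero_eq)
  have dm: "(deriv ^^ m i) g meromorphic_on UNIV" by (intro meromorphic_intros gm)
  have "\<not> mnz ((deriv ^^ m i) g)"
    unfolding mnz_iff[OF dm, of 0] le_higher_deriv[OF gm] gx using i(2) by (simp add: x_def)
  then have dz: "(fls_deriv ^^ m i) (laurent_expansion f z ^ l i) = 0" for z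
    using mnz_iff[OF dm, of z] by (simp add: le_higher_deriv[OF gm] gx)
  have nozero: "ordm f z \<le> 0" for z
  proof (rule ccontr)
    assume "\<not> ordm f z \<le> 0"
    then have "int (l i) * 1 \<le> int (l i) * ordm f z" by (intro mult_left_mono) auto
    moreover have "m i \<le> l i" using lm i(1) by blast
    ultimately have "int (m i) \<le> fls_subdegree (laurent_expansion f z ^ l i)"
      by (simp add: fls_subdegree_pow ordm_def)
    then show False
      using fls_higher_deriv_subdegree[of "laurent_expansion f z ^ l i" "m i"] le_nonzero[OF f_mnz, of z] dz[of z] by auto
  qed
  have zg: "zerom g z = 0" for z
    using nozero[of z] by (simp add: zerom_def ordm_def gx fls_subdegree_pow mult_nonneg_nonpos)
  have pol: "polem (\<lambda>z. inverse (g z)) = (\<lambda>_. 0)" using zerom_inverse[OF gz] zg by auto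
  have "Sm f (proxim (\<lambda>z. inverse (g z)))"
  proof (rule Sm_mono)
    show "Sm f (\<lambda>r. proxim (\<lambda>z. h z / g z) r + logplus (cmod (inverse c)))"
      unfolding h_def by (intro Sm_add Sm_const Sm_proxim_higher_deriv gz gb)
    show "\<forall>\<^sub>F r in nevF. proxim (\<lambda>z. inverse (g z)) r \<le> proxim (\<lambda>z. h z / g z) r + logplus (cmod (inverse c))"
      using eventually_conj[OF nevF_goodrad[OF gz] eventually_conj[OF nevF_anrad[OF hm] nevF_cosparse[OF ev]]]
    proof (rule eventually_mono)
      fix r assume r: "goodrad g r \<and> anrad h r \<and> (\<forall>z. cmod z = r \<longrightarrow> h z - c = 0)"
      have r0: "r > 0" using r by (simp add: goodrad_def)
      have "proxim (\<lambda>z. inverse (g z)) r = proxim (\<lambda>z. (h z / g z) * inverse c) r"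
        using r r0 c0 by (intro proxim_cong) (auto simp: field_simps)
      also have "\<dots> \<le> proxim (\<lambda>z. h z / g z) r + proxim (\<lambda>_. inverse c) r"
      proof (rule proxim_mult)
        show "anrad (\<lambda>z. h z / g z) r"
          using r unfolding goodrad_def goodpt_def anrad_def by (auto intro!: analytic_on_divide)
      qed (rule anrad_const[OF r0])
      finally show "proxim (\<lambda>z. inverse (g z)) r \<le> proxim (\<lambda>z. h z / g z) r + logplus (cmod (inverse c))"
        by (simp add: proxim_const)
    qed
  qed
  moreover have "Sm f (cnt (polem (\<lambda>z. inverse (g z))))" unfolding pol by (simp add: cnt_def[abs_def] Sm_const)
  moreover have "(\<lambda>z. inverse (g z)) meromorphic_on UNIV" by (intro meromorphic_intros gm)
  ultimately have "s.cfun (\<lambda>z. inverse (g z))" by (intro small_cfunI)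
  from s.cfun_inverse[OF this] have "s.cfun g" by simp
  then show False using power_not_small[OF li] by (simp add: g_def[abs_def])
qed

definition G where "G z = F z / \<omega> z"

lemma G_big: "b.cfun G"
  unfolding G_def[abs_def] by (intro b.cfun_divide F_big small_imp_big om)

lemma G_mero: "G meromorphic_on UNIV" using G_big by (rule b.cfun_mero)

lemma G_mnz: "mnz G" unfolding G_def[abs_def] by (rule mnz_divide[OF F_mnz omz])

lemma le_G: "laurent_expansion G z = laurent_expansion F z / laurent_expansion \<omega> z"
  unfolding G_def[abs_def] by (rule le_divide[OF F_mero om_mero])

lemma proxim_inverse_f_le:
  "\<forall>\<^sub>F r in nevF. real L * proxim (\<lambda>z. inverse (f z)) r
     \<le> proxim (\<lambda>z. inverse (F z)) r + proxim (\<lambda>z. F z / f z ^ L) r"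
  using eventually_conj[OF nevF_goodrad[OF f_mnz] nevF_goodrad[OF F_mnz]]
proof (rule eventually_mono)
  fix r assume r: "goodrad f r \<and> goodrad F r"
  have "real L * proxim (\<lambda>z. inverse (f z)) r = proxim (\<lambda>z. inverse (f z) ^ L) r" by (simp only: proxim_power)
  also have "\<dots> = proxim (\<lambda>z. inverse (F z) * (F z / f z ^ L)) r"
    using r by (intro proxim_cong) (auto simp: goodrad_def goodpt_def field_simps)
  also have "\<dots> \<le> proxim (\<lambda>z. inverse (F z)) r + proxim (\<lambda>z. F z / f z ^ L) r"
  proof (rule proxim_mult)
    show "anrad (\<lambda>z. inverse (F z)) r" using r by (intro goodrad_anrad goodrad_inverse) simp
    show "anrad (\<lambda>z. F z / f z ^ L) r"
      using r unfolding goodrad_def goodpt_def anrad_def by (auto intro!: analytic_on_divide analytic_intros)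
  qed
  finally show "real L * proxim (\<lambda>z. inverse (f z)) r
     \<le> proxim (\<lambda>z. inverse (F z)) r + proxim (\<lambda>z. F z / f z ^ L) r" .
qed

text \<open>If \<open>G\<close> were constant, \<open>F\<close> would be a constant multiple of
  \<open>\<omega>\<close> and hence small. This makes the proximity function of
  \<open>1 / f ^ L\<close> small, and its poles are controlled by zeros of \<open>\<omega>\<close>;
  so a power of \<open>f\<close> would be small.\<close>

lemma deriv_G_nonzero: "fls_deriv (laurent_expansion G z) \<noteq> 0"
proof
  assume "fls_deriv (laurent_expansion G z) = 0"
  define c where "c = fls_nth (laurent_expansion G z) 0"
  have Gc: "laurent_expansion G z = fls_const c"
    unfolding c_def by (rule fls_deriv_zero_imp_const) fact
  have dm: "(\<lambda>w. G w - c) meromorphic_on UNIV" by (intro meromorphic_intros G_mero)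
  have "laurent_expansion (\<lambda>w. G w - c) z = 0" using le_diff[OF G_mero, of "\<lambda>_. c" z] Gc by (simp add: meromorphic_intros)
  then have "\<not> mnz (\<lambda>w. G w - c)" using mnz_iff[OF dm, of z] by blast
  then have "laurent_expansion (\<lambda>w. G w - c) y = 0" for y using mnz_iff[OF dm, of y] by blast
  then have Gy: "laurent_expansion G y = fls_const c" for y using le_diff[OF G_mero, of "\<lambda>_. c" y] by (simp add: meromorphic_intros)
  then have c0: "c \<noteq> 0" using le_nonzero[OF G_mnz, of 0] by auto
  have Fy: "laurent_expansion F y = fls_const c * laurent_expansion \<omega> y" for y
    using Gy[of y] le_nonzero[OF omz, of y] unfolding le_G by (simp add: field_simps)
  have cm: "(\<lambda>z. c * \<omega> z) meromorphic_on UNIV" by (intro meromorphic_intros om_mero)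
  have Fcm: "(\<lambda>z. F z - c * \<omega> z) meromorphic_on UNIV" by (intro meromorphic_intros F_mero om_mero)
  have "laurent_expansion (\<lambda>z. F z - c * \<omega> z) 0 = 0"
    using le_diff[OF F_mero cm, of 0] le_mult[OF _ om_mero, of "\<lambda>_. c" 0] Fy[of 0] by (simp add: meromorphic_intros)
  then have "eventually (\<lambda>z. F z - c * \<omega> z = 0) (cosparse UNIV)"
    using mero_cases[OF Fcm] mnz_iff[OF Fcm, of 0] by blast
  then have Fs: "s.cfun F"
    by (intro s.cfun_cong[OF s.cfun_mult[OF s.cfun_const om] _ F_mero]) (auto elim: eventually_mono)
  have "Sm f (\<lambda>r. proxim (\<lambda>z. inverse (F z)) r + proxim (\<lambda>z. F z / f z ^ L) r)"
    by (intro Sm_add Sm_proxim_F Sm_proxim s.cfun_inverse Fs)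
  then have "Sm f (\<lambda>r. real L * proxim (\<lambda>z. inverse (f z)) r)" by (rule Sm_mono[OF _ proxim_inverse_f_le])
  then have p: "Sm f (proxim (\<lambda>z. inverse (f z) ^ L))" by (simp add: proxim_power[abs_def])
  have fLz: "mnz (\<lambda>z. f z ^ L)" by (rule mnz_power[OF f_mnz])
  have pole: "polem (\<lambda>z. inverse (f z) ^ L) = zerom (\<lambda>z. f z ^ L)"
    using zerom_inverse[OF fLz] by (simp add: power_inverse)
  \<comment> \<open>At a zero of \<open>f\<close> of order \<open>p\<close> the order
    \<open>t\<close> of \<open>\<omega>\<close> is \<open>L * p - M\<close>, which is positive.
    Hence \<open>L * p = t + M\<close> is at most \<open>(M + 1) * t\<close>.\<close>
  have le: "zerom (\<lambda>z. f z ^ L) y \<le> real (M + 1) * zerom \<omega> y" for y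
  proof (cases "ordm f y > 0")
    case False
    then show ?thesis by (simp add: zerom_def ordm_def le_power[OF f_mero] fls_subdegree_pow mult_nonneg_nonpos)
  next
    case True
    have "ordm F y = ordm \<omega> y"
      unfolding ordm_def Fy using c0 le_nonzero[OF omz, of y] by (subst fls_subdegree_mult) auto
    then have w: "ordm \<omega> y = int L * ordm f y - int M" using F_order(1)[of y] True by simp
    define t where "t = ordm \<omega> y"
    have "int L * 1 \<le> int L * ordm f y" using True by (intro mult_left_mono) auto
    moreover have "int L \<ge> int M + 2" using LM by simp
    ultimately have t1: "t \<ge> 1" unfolding t_def using w by linarith
    then have "int M * 1 \<le> int M * t" by (intro mult_left_mono) auto
    then have "int L * ordm f y \<le> int (M + 1) * t" using w unfolding t_def[symmetric] by (simp add: distrib_right)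
    then have "real_of_int (int L * ordm f y) \<le> real_of_int (int (M + 1) * t)" by (simp only: of_int_le_iff)
    moreover have "zerom (\<lambda>z. f z ^ L) y = real_of_int (int L * ordm f y)"
      using True by (simp add: zerom_def ordm_def le_power[OF f_mero] fls_subdegree_pow)
    moreover have "zerom \<omega> y = real_of_int t" using t1 by (simp add: zerom_def t_def)
    ultimately show ?thesis by simp
  qed
  have "Sm f (\<lambda>r. real (M + 1) * cnt (zerom \<omega>) r)" by (intro Sm_cmult Sm_cnt_zerom om omz) auto
  then have "Sm f (cnt (zerom (\<lambda>z. f z ^ L)))"
  proof (rule Sm_mono)
    show "\<forall>\<^sub>F r in nevF. cnt (zerom (\<lambda>z. f z ^ L)) r \<le> real (M + 1) * cnt (zerom \<omega>) r"
      using nevF_ge[of 1]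
    proof (rule eventually_mono)
      fix r :: real assume r: "1 \<le> r"
      have "cnt (zerom (\<lambda>z. f z ^ L)) r \<le> cnt (\<lambda>z. real (M + 1) * zerom \<omega> z) r"
        by (intro cnt_mono locfin_cmult locfin_zerom fLz omz le r)
      then show "cnt (zerom (\<lambda>z. f z ^ L)) r \<le> real (M + 1) * cnt (zerom \<omega>) r" by (simp only: cnt_cmult)
    qed
  qed
  moreover have "(\<lambda>z. inverse (f z) ^ L) meromorphic_on UNIV" by (intro meromorphic_intros f_mero)
  ultimately have "s.cfun (\<lambda>z. inverse (f z) ^ L)"
    using p unfolding pole[symmetric] by (intro small_cfunI)
  from s.cfun_inverse[OF this] have "s.cfun (\<lambda>z. f z ^ L)" by (simp add: power_inverse)
  then show False using power_not_small[OF Lpos] by blast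
qed

end

subsection \<open>The Riccati equation\<close>

context transc
begin

lemma Sm_cnt_finite:
  assumes "finite Z"
  shows "Sm f (cnt (\<lambda>z. if z \<in> Z then 1 else 0))"
proof (rule Sm_mono)
  show "Sm f (\<lambda>r. (\<Sum>z\<in>Z. ln r + \<bar>ln (cmod z)\<bar>) + ln r)"
    by (intro Sm_add Sm_sum assms Sm_ln Sm_const)
  show "\<forall>\<^sub>F r in nevF. cnt (\<lambda>z. if z \<in> Z then 1 else 0) r \<le> (\<Sum>z\<in>Z. ln r + \<bar>ln (cmod z)\<bar>) + ln r"
    using nevF_ge[of 1]
  proof (rule eventually_mono)
    fix r :: real assume r: "1 \<le> r"
    define S where "S = {z \<in> Z. 0 < cmod z \<and> cmod z \<le> r}"
    have "cnt (\<lambda>z. if z \<in> Z then 1 else 0) r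
        = (\<Sum>z\<in>S. (if z \<in> Z then 1 else 0) * ln (r / cmod z)) + (if 0 \<in> Z then 1 else 0) * ln r"
      using assms by (intro cnt_superset) (auto simp: S_def split: if_splits)
    also have "(\<Sum>z\<in>S. (if z \<in> Z then 1 else 0) * ln (r / cmod z)) \<le> (\<Sum>z\<in>S. ln r + \<bar>ln (cmod z)\<bar>)"
      using r by (intro sum_mono) (auto simp: S_def ln_div)
    also have "\<dots> \<le> (\<Sum>z\<in>Z. ln r + \<bar>ln (cmod z)\<bar>)"
      using r assms by (intro sum_mono2) (auto simp: S_def)
    also have "(if 0 \<in> Z then 1 else 0) * ln r \<le> ln r" using r by simp
    finally show "cnt (\<lambda>z. if z \<in> Z then 1 else 0) r \<le> (\<Sum>z\<in>Z. ln r + \<bar>ln (cmod z)\<bar>) + ln r" by simp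
  qed
qed

end

context monomial_setup
begin

definition Z where "Z = {z. isolated_zero (\<lambda>w. diff_monomial k l m f w - \<omega> w) z}"

lemma finite_Z: "finite Z" using finZ by (simp add: Z_def)

lemma Z_iff: "z \<in> Z \<longleftrightarrow> fls_subdegree (laurent_expansion F z - laurent_expansion \<omega> z) > 0"
proof -
  have "(\<lambda>w. F w - \<omega> w) meromorphic_on UNIV" by (intro meromorphic_intros F_mero om_mero)
  from isolated_zero_fls_subdegree_iff[OF le_mero[OF this]] show ?thesis
    by (simp add: Z_def F_def[symmetric] le_diff[OF F_mero om_mero])
qed

lemma locfin_Z: "locfin (\<lambda>z. if z \<in> Z then 1 else 0)"
  unfolding locfin_def
proof
  fix r show "finite {z. cmod z \<le> r \<and> (if z \<in> Z then 1 else 0 :: real) \<noteq> 0}"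
    by (rule finite_subset[OF _ finite_Z]) (auto split: if_splits)
qed

definition G1 where "G1 z = G z - 1"

lemma G1_big: "b.cfun G1"
  unfolding G1_def[abs_def] by (intro b.cfun_diff G_big b.cfun_const)

lemma G1_mero: "G1 meromorphic_on UNIV" using G1_big by (rule b.cfun_mero)

lemma le_G1: "laurent_expansion G1 z = laurent_expansion G z - 1"
  using le_diff[OF G_mero, of "\<lambda>_. 1" z] by (simp add: G1_def[abs_def] meromorphic_intros)

lemma le_G1_nz: "laurent_expansion G z - 1 \<noteq> 0"
  using deriv_G_nonzero[of z] by auto

lemma G1_mnz: "mnz G1"
  using le_G1_nz[of 0] unfolding mnz_iff[OF G1_mero, of 0] le_G1 .

definition W where "W z = deriv G1 z / G1 z"

lemma W_mero: "W meromorphic_on UNIV"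
  unfolding W_def[abs_def] by (intro meromorphic_intros G1_mero)

lemma le_W: "laurent_expansion W z = fls_deriv (laurent_expansion G z) / (laurent_expansion G z - 1)"
proof -
  have "deriv G1 meromorphic_on UNIV" by (intro meromorphic_intros G1_mero)
  then show ?thesis
    unfolding W_def[abs_def] by (simp add: le_divide le_deriv G1_mero le_G1)
qed

lemma W_mnz: "mnz W"
  using le_G1_nz[of 0] deriv_G_nonzero[of 0] unfolding mnz_iff[OF W_mero, of 0] le_W by simp

lemma Sm_proxim_W: "Sm f (proxim W)"
  unfolding W_def[abs_def] using log_derivative_small[OF G1_mnz] G1_big by (simp add: b.cfun_def)

lemma ordm_W_ge:
  "ordm W z \<ge> int L * max (ordm f z) 0 - (if ordm f z > 0 then int M + 1 else 0)
     - (if ordm f z < 0 then 1 else 0) - \<bar>ordm \<omega> z\<bar> - (if z \<in> Z then 1 else 0)"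
  "ordm W z \<ge> -1"
proof -
  note * = log_derivative_order[OF le_nonzero[OF omz] le_G deriv_G_nonzero[of z], of "ordm f z" L M,
      OF F_order(1)[unfolded ordm_def[of F]] F_order(2)[unfolded ordm_def[of F]]]
  show "ordm W z \<ge> int L * max (ordm f z) 0 - (if ordm f z > 0 then int M + 1 else 0)
     - (if ordm f z < 0 then 1 else 0) - \<bar>ordm \<omega> z\<bar> - (if z \<in> Z then 1 else 0)"
    unfolding ordm_def[of W] le_W Z_iff ordm_def[of \<omega>] by (rule *(1))
  show "ordm W z \<ge> -1" unfolding ordm_def[of W] le_W by (rule *(2))
qed

lemma proxim_inverse_G_le:
  "\<forall>\<^sub>F r in nevF. proxim (\<lambda>z. inverse (G z)) r
     \<le> proxim (\<lambda>z. deriv G z / G z) r + proxim (\<lambda>z. inverse (W z)) r + ln 2"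
  using eventually_conj[OF nevF_goodrad[OF G_mnz] eventually_conj[OF nevF_goodrad[OF G1_mnz] nevF_goodrad[OF W_mnz]]]
proof (rule eventually_mono)
  fix r assume r: "goodrad G r \<and> goodrad G1 r \<and> goodrad W r"
  have a1: "anrad (\<lambda>z. deriv G z / G z) r" using r by (intro anrad_logderiv) simp
  have a2: "anrad (\<lambda>z. inverse (W z)) r" using r by (intro goodrad_anrad goodrad_inverse) simp
  have r0: "r > 0" using r by (simp add: goodrad_def)
  have a3: "anrad (\<lambda>z. - (deriv G z / G z * inverse (W z))) r"
    using anrad_mult[OF anrad_const[OF r0, of "-1"] anrad_mult[OF a1 a2]] by simp
  have "proxim (\<lambda>z. inverse (G z)) r = proxim (\<lambda>z. 1 + - (deriv G z / G z * inverse (W z))) r"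
  proof (rule proxim_cong)
    fix z assume z: "cmod z = r"
    have an: "G analytic_on {z}" and nz: "G z \<noteq> 0" "G1 z \<noteq> 0" "W z \<noteq> 0"
      using r z by (auto simp: goodrad_def goodpt_def)
    have "deriv G1 z = deriv G z"
      unfolding G1_def[abs_def] using analytic_on_imp_differentiable_at[OF an, of z] by simp
    then have W: "W z = deriv G z / G1 z" by (simp add: W_def)
    then have "deriv G z \<noteq> 0" using nz by auto
    then have "deriv G z / G z * inverse (W z) = G1 z / G z" unfolding W using nz by simp
    also have "\<dots> = 1 - inverse (G z)" using nz by (simp add: G1_def field_simps)
    finally show "inverse (G z) = 1 + - (deriv G z / G z * inverse (W z))" by simp
  qed (use r0 in simp)
  also have "\<dots> \<le> proxim (\<lambda>_. 1) r + proxim (\<lambda>z. - (deriv G z / G z * inverse (W z))) r + ln 2"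
    by (rule proxim_add[OF anrad_const[OF r0] a3])
  also have "\<dots> = proxim (\<lambda>z. deriv G z / G z * inverse (W z)) r + ln 2"
    by (simp only: proxim_uminus) (simp add: proxim_const logplus_def)
  also have "\<dots> \<le> proxim (\<lambda>z. deriv G z / G z) r + proxim (\<lambda>z. inverse (W z)) r + ln 2"
    using proxim_mult[OF a1 a2] by simp
  finally show "proxim (\<lambda>z. inverse (G z)) r
     \<le> proxim (\<lambda>z. deriv G z / G z) r + proxim (\<lambda>z. inverse (W z)) r + ln 2" .
qed

lemma proxim_inverse_F_le:
  "\<forall>\<^sub>F r in nevF. proxim (\<lambda>z. inverse (F z)) r
     \<le> proxim (\<lambda>z. inverse (G z)) r + proxim (\<lambda>z. inverse (\<omega> z)) r"
  using eventually_conj[OF nevF_goodrad[OF G_mnz] nevF_goodrad[OF omz]]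
proof (rule eventually_mono)
  fix r assume r: "goodrad G r \<and> goodrad \<omega> r"
  have "proxim (\<lambda>z. inverse (F z)) r = proxim (\<lambda>z. inverse (G z) * inverse (\<omega> z)) r"
    using r by (intro proxim_cong) (auto simp: goodrad_def goodpt_def G_def inverse_eq_divide)
  also have "\<dots> \<le> proxim (\<lambda>z. inverse (G z)) r + proxim (\<lambda>z. inverse (\<omega> z)) r"
    using r by (intro proxim_mult goodrad_anrad goodrad_inverse) auto
  finally show "proxim (\<lambda>z. inverse (F z)) r
     \<le> proxim (\<lambda>z. inverse (G z)) r + proxim (\<lambda>z. inverse (\<omega> z)) r" .
qed

text \<open>Up to small terms, \<open>L * proxim (1 / f)\<close> is bounded successively by the
  proximity functions of \<open>1 / F\<close>, \<open>1 / G\<close> and \<open>1 / W\<close>.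
  Jensen's formula converts the last one into the proximity function of \<open>W\<close> minus the
  count of its orders.\<close>

lemma proxim_f_ordm_W_small:
  "Sm f (\<lambda>r. real L * proxim (\<lambda>z. inverse (f z)) r + cnt (\<lambda>z. real_of_int (ordm W z)) r)"
proof (rule Sm_mono)
  have lG: "Sm f (proxim (\<lambda>z. deriv G z / G z))"
    using log_derivative_small[OF G_mnz] G_big by (simp add: b.cfun_def)
  show "Sm f (\<lambda>r. proxim (\<lambda>z. F z / f z ^ L) r + proxim (\<lambda>z. inverse (\<omega> z)) r
      + proxim (\<lambda>z. deriv G z / G z) r + ln 2 + proxim W r + (- ln (cmod (lcoef W))))"
    by (intro Sm_add Sm_const Sm_proxim_W Sm_proxim_F lG Sm_proxim[OF s.cfun_inverse[OF om]])
  show "\<forall>\<^sub>F r in nevF. real L * proxim (\<lambda>z. inverse (f z)) r + cnt (\<lambda>z. real_of_int (ordm W z)) r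
      \<le> proxim (\<lambda>z. F z / f z ^ L) r + proxim (\<lambda>z. inverse (\<omega> z)) r
      + proxim (\<lambda>z. deriv G z / G z) r + ln 2 + proxim W r + (- ln (cmod (lcoef W)))"
    using proxim_inverse_f_le proxim_inverse_F_le proxim_inverse_G_le nevF_goodrad[OF W_mnz]
  proof eventually_elim
    case (elim r)
    then show ?case using proxim_ln(1)[OF elim(4)] jensen[OF W_mnz elim(4)] by linarith
  qed
qed

lemma cnt_ordm_W_ge:
  assumes "r \<ge> 1"
  shows "(real L - real M - 1) * cnt (zerom f) r - cnt (polem f) r
    - (cnt (zerom \<omega>) r + cnt (polem \<omega>) r) - cnt (\<lambda>z. if z \<in> Z then 1 else 0) r
    \<le> cnt (\<lambda>z. real_of_int (ordm W z)) r"
proof -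
  define D where "D z = (real L - real M - 1) * zerom f z - polem f z
    - (zerom \<omega> z + polem \<omega> z) - (if z \<in> Z then 1 else 0)" for z
  have l1: "locfin (\<lambda>z. (real L - real M - 1) * zerom f z)" by (intro locfin_cmult locfin_zerom f_mnz)
  have l2: "locfin (polem f)" by (rule locfin_polem[OF f_mero])
  have l3: "locfin (\<lambda>z. zerom \<omega> z + polem \<omega> z)" by (intro locfin_add locfin_zerom omz locfin_polem om_mero)
  have minus: "locfin (\<lambda>z. D1 z - D2 z)" if "locfin D1" "locfin D2" for D1 D2
    using locfin_add[OF that(1) locfin_cmult[OF that(2), of "-1"]] by simp
  have lD: "locfin D" unfolding D_def[abs_def] by (intro minus l1 l2 l3 locfin_Z)
  have "cnt D r = (real L - real M - 1) * cnt (zerom f) r - cnt (polem f) r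
    - (cnt (zerom \<omega>) r + cnt (polem \<omega>) r) - cnt (\<lambda>z. if z \<in> Z then 1 else 0) r"
    unfolding D_def[abs_def]
    by (simp only: cnt_diff[OF minus[OF minus[OF l1 l2] l3] locfin_Z] cnt_diff[OF minus[OF l1 l2] l3]
      cnt_diff[OF l1 l2] cnt_cmult cnt_add[OF locfin_zerom[OF omz] locfin_polem[OF om_mero]])
  moreover have "cnt D r \<le> cnt (\<lambda>z. real_of_int (ordm W z)) r"
  proof (rule cnt_mono[OF lD locfin_ordm[OF W_mnz] _ assms])
    fix z
    define p where "p = ordm f z"
    have aw: "zerom \<omega> z + polem \<omega> z = real_of_int \<bar>ordm \<omega> z\<bar>" by (simp add: zerom_def polem_def)
    define i where "i = (int L - int M - 1) * max p 0 - max (- p) 0 - \<bar>ordm \<omega> z\<bar> - (if z \<in> Z then 1 else 0)"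
    have "i \<le> ordm W z"
    proof -
      \<comment> \<open>The fixed loss \<open>M + 1\<close> at a zero is charged to its
        multiplicity. This replaces counts of distinct points by counts with multiplicity, which the
        first main theorem can evaluate.\<close>
      have "(int M + 1) * (if p > 0 then 1 else 0) \<le> (int M + 1) * max p 0" by (intro mult_left_mono) auto
      then have "(if p > 0 then int M + 1 else 0) \<le> (int M + 1) * max p 0" by (simp split: if_splits)
      moreover have "(if p < 0 then 1 else 0) \<le> max (- p) 0" by simp
      moreover have "(int L - int M - 1) * max p 0 = int L * max p 0 - (int M + 1) * max p 0" by (simp add: algebra_simps)
      ultimately show ?thesis using ordm_W_ge(1)[of z] unfolding i_def p_def[symmetric] by linarith
    qed
    moreover have "D z = real_of_int i"
      unfolding D_def i_def aw by (simp add: zerom_def polem_def p_def[symmetric] max_def)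
    ultimately show "D z \<le> real_of_int (ordm W z)" by simp
  qed
  ultimately show ?thesis by simp
qed

text \<open>The zeros and poles of \<open>f\<close> are expressed through the characteristic by the
  first main theorem. The zeros contribute \<open>(L - M - 1) * (T - proxim (1 / f))\<close>, which
  lowers the coefficient of \<open>proxim (1 / f)\<close> from \<open>L\<close> to
  \<open>M + 1\<close>; the poles take one \<open>T\<close> away and add
  \<open>proxim f\<close>.\<close>

lemma proxim_f_main_estimate:
  "Sm f (\<lambda>r. (real M + 1) * proxim (\<lambda>z. inverse (f z)) r + proxim f r + (real L - real M - 2) * nev_T f r)"
proof (rule Sm_mono)
  show "Sm f (\<lambda>r. (real L * proxim (\<lambda>z. inverse (f z)) r + cnt (\<lambda>z. real_of_int (ordm W z)) r)
     + (cnt (zerom \<omega>) r + cnt (polem \<omega>) r) + cnt (\<lambda>z. if z \<in> Z then 1 else 0) r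
     + (real L - real M - 1) * ln (cmod (lcoef f)))"
    by (intro Sm_add proxim_f_ordm_W_small Sm_const Sm_cnt_zerom Sm_cnt_polem Sm_cnt_finite om omz finite_Z)
  show "\<forall>\<^sub>F r in nevF. (real M + 1) * proxim (\<lambda>z. inverse (f z)) r + proxim f r + (real L - real M - 2) * nev_T f r
    \<le> (real L * proxim (\<lambda>z. inverse (f z)) r + cnt (\<lambda>z. real_of_int (ordm W z)) r)
     + (cnt (zerom \<omega>) r + cnt (polem \<omega>) r) + cnt (\<lambda>z. if z \<in> Z then 1 else 0) r
     + (real L - real M - 1) * ln (cmod (lcoef f))"
    using nevF_ge[of 1] nevF_goodrad[OF f_mnz]
  proof eventually_elim
    case (elim r)
    define q where "q = proxim (\<lambda>z. inverse (f z)) r"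
    define t where "t = nev_T f r"
    define c where "c = ln (cmod (lcoef f))"
    have fi: "(\<lambda>z. inverse (f z)) meromorphic_on UNIV" by (intro meromorphic_intros f_mero)
    have nz: "cnt (zerom f) r = t - c - q"
      using first_main_theorem[OF f_mnz elim(2)] nev_T_eq[OF fi, of r] elim(1)
      by (simp add: zerom_inverse[OF f_mnz] q_def t_def c_def)
    have np: "cnt (polem f) r = t - proxim f r" using nev_T_eq[OF f_mero, of r] elim(1) by (simp add: t_def)
    show ?case
      using cnt_ordm_W_ge[OF elim(1)] unfolding nz np q_def[symmetric] t_def[symmetric] c_def[symmetric] by (simp add: algebra_simps)
  qed
qed

lemma L_eq: "L = M + 2"
proof (rule ccontr)
  assume "L \<noteq> M + 2"
  then have d: "real L - real M - 2 \<ge> 1" using LM by linarith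
  have "Sm f (nev_T f)"
  proof (rule Sm_mono[OF proxim_f_main_estimate])
    show "\<forall>\<^sub>F r in nevF. nev_T f r \<le> (real M + 1) * proxim (\<lambda>z. inverse (f z)) r + proxim f r + (real L - real M - 2) * nev_T f r"
      using nevF_ge[of 1]
    proof eventually_elim
      case (elim r)
      have "1 * nev_T f r \<le> (real L - real M - 2) * nev_T f r"
        using nev_T_nonneg[OF f_mero elim] d by (intro mult_right_mono)
      moreover have "(real M + 1) * proxim (\<lambda>z. inverse (f z)) r \<ge> 0" using elim by (intro mult_nonneg_nonneg proxim_nonneg) auto
      moreover have "proxim f r \<ge> 0" using elim by (intro proxim_nonneg) auto
      ultimately show ?case by linarith
    qed
  qed
  then show False using not_Sm_T by blast
qed

lemma l_eq: "l 0 = 1" "(\<Sum>i=1..k. l i) = Suc M"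
proof -
  have "l 0 + (\<Sum>i=1..k. l i) = M + 2" using L_eq by (simp only: L_def)
  moreover have "(\<Sum>i=1..k. l i) > M" using lsum by (simp only: M_def)
  ultimately show "l 0 = 1" "(\<Sum>i=1..k. l i) = Suc M" using l0 by linarith+
qed

lemma Sm_proxim_f: "Sm f (proxim f)" "Sm f (proxim (\<lambda>z. inverse (f z)))"
proof -
  have d: "real L - real M - 2 = 0" using L_eq by simp
  have *: "Sm f (\<lambda>r. (real M + 1) * proxim (\<lambda>z. inverse (f z)) r + proxim f r)"
    using proxim_f_main_estimate unfolding d by simp
  have e: "\<forall>\<^sub>F r in nevF. proxim f r \<ge> 0 \<and> proxim (\<lambda>z. inverse (f z)) r \<ge> 0 \<and> real M * proxim (\<lambda>z. inverse (f z)) r \<ge> 0"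
    using nevF_ge[of 1] by eventually_elim (auto intro!: proxim_nonneg mult_nonneg_nonneg)
  show "Sm f (proxim f)" "Sm f (proxim (\<lambda>z. inverse (f z)))"
    by (rule Sm_mono[OF *]; use e in \<open>eventually_elim; simp add: distrib_right\<close>)+
qed

definition \<phi> where "\<phi> z = W z / f z"

lemma \<phi>_mnz: "mnz \<phi>" unfolding \<phi>_def[abs_def] by (rule mnz_divide[OF W_mnz f_mnz])

lemma \<phi>_mero: "\<phi> meromorphic_on UNIV" using \<phi>_mnz by (rule mnz_mero)

lemma ordm_\<phi>: "ordm \<phi> z = ordm W z - ordm f z"
  unfolding \<phi>_def[abs_def] by (rule ordm_divide[OF W_mnz f_mnz])

text \<open>At a pole of \<open>f\<close> the division by \<open>f\<close> cancels the at most
  simple pole of \<open>W\<close>. At a zero of order \<open>p\<close> with \<open>\<omega>\<close>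
  of order 0, \<open>W\<close> vanishes to order \<open>(M + 2) * p - M - 1\<close>, which is at
  least \<open>p\<close>. Poles of \<open>\<phi>\<close> can therefore only sit over zeros and poles
  of \<open>\<omega>\<close> and over the finite set \<open>Z\<close>.\<close>

lemma \<phi>_small: "s.cfun \<phi>"
proof (rule small_cfunI[OF \<phi>_mero])
  have "\<phi> = (\<lambda>z. W z * inverse (f z))" by (simp add: \<phi>_def fun_eq_iff divide_inverse)
  moreover have "(\<lambda>z. inverse (f z)) meromorphic_on UNIV" by (intro meromorphic_intros f_mero)
  ultimately show "Sm f (proxim \<phi>)" using Sm_proxim_mult[OF W_mero _ Sm_proxim_W Sm_proxim_f(2)] by simp
  have le: "polem \<phi> z \<le> zerom \<omega> z + polem \<omega> z + (if z \<in> Z then 1 else 0)" for z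
  proof -
    define p where "p = ordm f z"
    have "- ordm \<phi> z \<le> \<bar>ordm \<omega> z\<bar> + (if z \<in> Z then 1 else 0)"
    proof -
      consider "p < 0" | "p = 0" | "p > 0" by linarith
      then show ?thesis
      proof cases
        case 1
        then have "- ordm \<phi> z \<le> 0" using ordm_W_ge(2)[of z] ordm_\<phi>[of z] unfolding p_def[symmetric] by simp
        also have "0 \<le> \<bar>ordm \<omega> z\<bar> + (if z \<in> Z then 1 else 0)" by simp
        finally show ?thesis .
      next
        case 2 then show ?thesis using ordm_W_ge(1)[of z] ordm_\<phi>[of z] unfolding p_def[symmetric] by simp
      next
        case 3
        define a where "a = \<bar>ordm \<omega> z\<bar>"
        define t :: int where "t = (if z \<in> Z then 1 else 0)"
        have p1: "(int M + 1) * 1 \<le> (int M + 1) * p" using 3 by (intro mult_left_mono) auto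
        have Lp: "int L * max p 0 = (int M + 1) * p + p" using 3 by (simp add: L_eq algebra_simps)
        have "(int M + 1) * p + p - (int M + 1) - a - t \<le> ordm W z"
          using ordm_W_ge(1)[of z] 3 unfolding p_def[symmetric] a_def t_def Lp by simp
        moreover have "p - v \<le> a + t" if "q + p - u - a - t \<le> v" "u \<le> q" for q u v :: int using that by linarith
        ultimately have "p - ordm W z \<le> a + t" using p1 unfolding mult_1_right by blast
        then show ?thesis unfolding ordm_\<phi> p_def[symmetric] a_def t_def by simp
      qed
    qed
    moreover have "zerom \<omega> z + polem \<omega> z = real_of_int \<bar>ordm \<omega> z\<bar>" by (simp add: zerom_def polem_def)
    ultimately show ?thesis by (auto simp: polem_def[of \<phi>] split: if_splits)
  qed
  show "Sm f (cnt (polem \<phi>))"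
  proof (rule Sm_mono)
    show "Sm f (\<lambda>r. cnt (zerom \<omega>) r + cnt (polem \<omega>) r + cnt (\<lambda>z. if z \<in> Z then 1 else 0) r)"
      by (intro Sm_add Sm_cnt_zerom Sm_cnt_polem Sm_cnt_finite om omz finite_Z)
    show "\<forall>\<^sub>F r in nevF. cnt (polem \<phi>) r \<le> cnt (zerom \<omega>) r + cnt (polem \<omega>) r + cnt (\<lambda>z. if z \<in> Z then 1 else 0) r"
      using nevF_ge[of 1]
    proof (rule eventually_mono)
      fix r :: real assume r: "1 \<le> r"
      note lf = locfin_zerom[OF omz] locfin_polem[OF om_mero] locfin_Z
      have "cnt (polem \<phi>) r \<le> cnt (\<lambda>z. zerom \<omega> z + polem \<omega> z + (if z \<in> Z then 1 else 0)) r"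
        by (intro cnt_mono locfin_polem \<phi>_mero locfin_add lf le r)
      then show "cnt (polem \<phi>) r \<le> cnt (zerom \<omega>) r + cnt (polem \<omega>) r + cnt (\<lambda>z. if z \<in> Z then 1 else 0) r"
        by (simp only: cnt_add[OF locfin_add[OF lf(1,2)] lf(3)] cnt_add[OF lf(1,2)])
    qed
  qed
qed

text \<open>The ratio of \<open>c0\<close> of the differential monomial to \<open>c0\<close> of
  \<open>f\<close> at a simple pole of \<open>f\<close>: each factor contributes its exponent,
  damped by every derivative taken.\<close>

definition \<kappa> :: complex where
  "\<kappa> = of_nat (l 0) + (\<Sum>i=1..k. of_nat (l i) * (\<Prod>j<m i. (of_nat (l i + j) - 1) / of_nat (l i + j)))"

lemma \<kappa>_nonzero: "\<kappa> + 2 * of_nat (Suc M) \<noteq> 0"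
proof -
  define \<kappa>r :: real where
    "\<kappa>r = of_nat (l 0) + (\<Sum>i=1..k. of_nat (l i) * (\<Prod>j<m i. (of_nat (l i + j) - 1) / of_nat (l i + j)))"
  have "(\<Sum>i=1..k. of_nat (l i) * (\<Prod>j<m i. (of_nat (l i + j) - 1) / of_nat (l i + j))) \<ge> (0 :: real)"
  proof (rule sum_nonneg)
    fix i
    show "of_nat (l i) * (\<Prod>j<m i. (of_nat (l i + j) - 1) / of_nat (l i + j)) \<ge> (0 :: real)"
    proof (cases "l i = 0")
      case False
      then show ?thesis by (intro mult_nonneg_nonneg prod_nonneg ballI divide_nonneg_nonneg) auto
    qed simp
  qed
  then have "\<kappa>r \<ge> 0" unfolding \<kappa>r_def by (intro add_nonneg_nonneg) auto
  then have "\<kappa>r + 2 * real (Suc M) > 0" by simp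
  moreover have "\<kappa> + 2 * of_nat (Suc M) = of_real (\<kappa>r + 2 * real (Suc M))"
    unfolding \<kappa>_def \<kappa>r_def by simp
  ultimately show ?thesis by (simp only: of_real_eq_0_iff)
qed

definition A where "A z = \<phi> z / of_nat (2 * Suc M)"

definition B where "B z = deriv \<phi> z / \<phi> z + 2 / (\<kappa> + 2 * of_nat (Suc M))
   * (deriv \<omega> z / \<omega> z - of_nat (2 * Suc M) * (deriv \<phi> z / \<phi> z))"

text \<open>Written with sums and factors -1 so that the estimates for sums and products apply
  without separate versions for differences.\<close>

definition R where "R z = deriv f z + ((-1) * (A z * (f z * f z)) + (-1) * (B z * f z))"

lemma A_small: "s.cfun A"
  unfolding A_def[abs_def] by (intro s.cfun_divide \<phi>_small s.cfun_const)

lemma B_small: "s.cfun B"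
  unfolding B_def[abs_def]
  by (intro s.cfun_add s.cfun_diff s.cfun_mult s.cfun_divide s.cfun_deriv \<phi>_small om s.cfun_const)

lemmas AB_mero = s.cfun_mero[OF A_small] s.cfun_mero[OF B_small]

lemma deriv_mero: "g meromorphic_on UNIV \<Longrightarrow> deriv g meromorphic_on UNIV"
  by (intro meromorphic_intros)

lemma le_\<phi>: "laurent_expansion \<phi> z
    = fls_deriv (laurent_expansion G z) / (laurent_expansion G z - 1) / laurent_expansion f z"
  unfolding \<phi>_def[abs_def] le_divide[OF W_mero f_mero] le_W ..

lemma le_A: "laurent_expansion A z = laurent_expansion \<phi> z / of_nat (2 * Suc M)"
proof -
  have c: "(\<lambda>_. of_nat (2 * Suc M) :: complex) meromorphic_on UNIV" by (intro meromorphic_intros)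
  show ?thesis unfolding A_def[abs_def] le_divide[OF \<phi>_mero c] by (simp only: le_const fls_of_nat)
qed

lemma le_B: "laurent_expansion B z = fls_deriv (laurent_expansion \<phi> z) / laurent_expansion \<phi> z
   + fls_const (2 / (\<kappa> + 2 * of_nat (Suc M))) * (fls_deriv (laurent_expansion \<omega> z) / laurent_expansion \<omega> z
     - of_nat (2 * Suc M) * (fls_deriv (laurent_expansion \<phi> z) / laurent_expansion \<phi> z))"
proof -
  define u where "u z = deriv \<phi> z / \<phi> z" for z
  define v where "v z = deriv \<omega> z / \<omega> z" for z
  have u: "u meromorphic_on UNIV" unfolding u_def[abs_def] by (intro meromorphic_intros \<phi>_mero)
  have v: "v meromorphic_on UNIV" unfolding v_def[abs_def] by (intro meromorphic_intros om_mero)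
  have c: "(\<lambda>_. c) meromorphic_on UNIV" for c :: complex by (intro meromorphic_intros)
  have m1: "(\<lambda>z. c * u z) meromorphic_on UNIV" for c by (intro meromorphic_intros u)
  have m2: "(\<lambda>z. v z - c * u z) meromorphic_on UNIV" for c by (intro meromorphic_intros u v)
  have m3: "(\<lambda>z. d * (v z - c * u z)) meromorphic_on UNIV" for c d by (intro meromorphic_intros u v)
  have "laurent_expansion B z = laurent_expansion u z + fls_const (2 / (\<kappa> + 2 * of_nat (Suc M))) *
    (laurent_expansion v z - of_nat (2 * Suc M) * laurent_expansion u z)"
    unfolding B_def[abs_def] u_def[symmetric] v_def[symmetric]
    by (simp only: le_add[OF u m3] le_mult[OF c m2] le_diff[OF v m1] le_mult[OF c u] le_const fls_of_nat)
  then show ?thesis unfolding u_def[abs_def] v_def[abs_def]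
    by (simp only: le_divide[OF deriv_mero[OF \<phi>_mero] \<phi>_mero] le_divide[OF deriv_mero[OF om_mero] om_mero]
      le_deriv[OF \<phi>_mero] le_deriv[OF om_mero])
qed

lemma R_parts_mero:
  "(\<lambda>z. A z * (f z * f z)) meromorphic_on UNIV" "(\<lambda>z. B z * f z) meromorphic_on UNIV"
  "(\<lambda>z. f z * f z) meromorphic_on UNIV" "(\<lambda>_. -1 :: complex) meromorphic_on UNIV"
  "(\<lambda>z. (-1) * (A z * (f z * f z))) meromorphic_on UNIV" "(\<lambda>z. (-1) * (B z * f z)) meromorphic_on UNIV"
  "(\<lambda>z. (-1) * (A z * (f z * f z)) + (-1) * (B z * f z)) meromorphic_on UNIV"
  by (intro meromorphic_intros AB_mero f_mero)+

lemma R_mero: "R meromorphic_on UNIV"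
  unfolding R_def[abs_def] by (intro meromorphic_intros AB_mero f_mero)

lemma le_R: "laurent_expansion R z = fls_deriv (laurent_expansion f z)
    - laurent_expansion A z * laurent_expansion f z ^ 2 - laurent_expansion B z * laurent_expansion f z"
proof -
  have c: "fls_const (-1 :: complex) = -1" by (simp add: fls_const_uminus)
  show ?thesis
    unfolding R_def[abs_def] le_add[OF deriv_mero[OF f_mero] R_parts_mero(7)] le_add[OF R_parts_mero(5,6)]
      le_mult[OF R_parts_mero(4,1)] le_mult[OF R_parts_mero(4,2)] le_mult[OF AB_mero(1) R_parts_mero(3)]
      le_mult[OF AB_mero(2) f_mero] le_mult[OF f_mero f_mero] le_deriv[OF f_mero] le_const c
    by (simp add: power2_eq_square)
qed

text \<open>In general the pole order is bounded by 5 times that of \<open>f\<close>: 2 for the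
  derivative, 2 for the square and 1 for the linear term. At a simple pole where
  \<open>\<omega>\<close> has order 0 there is no pole at all. At a pole of order
  \<open>p \<ge> 2\<close> the function \<open>\<phi>\<close> has a zero of order at least
  \<open>p - 1\<close>, so \<open>p\<close> is at most twice the order of that zero.\<close>

lemma polem_R:
  "polem R z \<le> polem A z + polem B z + 5 * (2 * zerom \<phi> z + (zerom \<omega> z + polem \<omega> z))"
proof -
  have "ordm (\<lambda>_. -1) z = 0" by (simp add: ordm_def)
  then have c: "polem (\<lambda>_. -1) z = 0" by (simp add: polem_def)
  have "polem R z \<le> polem (deriv f) z + polem (\<lambda>z. (-1) * (A z * (f z * f z)) + (-1) * (B z * f z)) z"
    unfolding R_def[abs_def] by (rule polem_add[OF deriv_mero[OF f_mero] R_parts_mero(7)])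
  also have "\<dots> \<le> 2 * polem f z + (polem (\<lambda>z. (-1) * (A z * (f z * f z))) z + polem (\<lambda>z. (-1) * (B z * f z)) z)"
    by (intro add_mono polem_deriv[OF f_mero] polem_add[OF R_parts_mero(5,6)])
  finally have 1: "polem R z \<le> polem A z + polem B z + 5 * polem f z"
    using polem_mult[OF R_parts_mero(4,1), of z] polem_mult[OF R_parts_mero(4,2), of z]
      polem_mult[OF AB_mero(1) R_parts_mero(3), of z] polem_mult[OF AB_mero(2) f_mero, of z]
      polem_mult[OF f_mero f_mero, of z] c by linarith
  have aw: "zerom \<omega> z + polem \<omega> z = real_of_int \<bar>ordm \<omega> z\<bar>" by (simp add: zerom_def polem_def)
  show ?thesis
  proof (cases "ordm f z = -1 \<and> ordm \<omega> z = 0")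
    case True
    have n: "int (2 * Suc M) = int (l 0 + (\<Sum>i=1..k. l i)) + int (\<Sum>i=1..k. m i)"
      using L_eq by (simp only: L_def[symmetric] M_def[symmetric]) simp
    have "fls_subdegree (laurent_expansion R z) \<ge> 0"
      unfolding le_R
      by (rule riccati_at_simple_pole[OF _ le_nonzero[OF omz] _ lm _ n \<kappa>_def \<kappa>_nonzero _ le_\<phi> le_A le_B])
        (use True in \<open>simp_all add: ordm_def le_G le_F\<close>)
    then have "polem R z = 0" by (simp add: polem_def ordm_def)
    then show ?thesis by simp
  next
    case False
    have "polem f z \<le> 2 * zerom \<phi> z + (zerom \<omega> z + polem \<omega> z)"
    proof -
      consider "ordm f z \<ge> 0" | "ordm f z \<le> -2" | "ordm f z = -1" "ordm \<omega> z \<noteq> 0" using False by linarith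
      then show ?thesis
      proof cases
        case 1 then show ?thesis by (simp add: polem_def[of f])
      next
        case 2
        then have "- ordm f z \<le> 2 * ordm \<phi> z" using ordm_\<phi>[of z] ordm_W_ge(2)[of z] by linarith
        then have "polem f z \<le> 2 * zerom \<phi> z" by (simp add: polem_def zerom_def)
        then show ?thesis unfolding aw by simp
      next
        case 3
        then have "polem f z = 1" by (simp add: polem_def)
        moreover have "real_of_int \<bar>ordm \<omega> z\<bar> \<ge> 1" using 3(2) by linarith
        moreover have "zerom \<phi> z \<ge> 0" by simp
        ultimately show ?thesis unfolding aw by linarith
      qed
    qed
    then have "5 * polem f z \<le> 5 * (2 * zerom \<phi> z + (zerom \<omega> z + polem \<omega> z))" by (rule mult_left_mono) simp
    then show ?thesis by (rule order_trans[OF 1 add_left_mono])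
  qed
qed

lemma R_small: "s.cfun R"
proof (rule small_cfunI[OF R_mero])
  have "Sm f (proxim (deriv f))"
    by (rule Sm_mono[OF Sm_add[OF log_derivative_small[OF f_mnz] Sm_proxim_f(1)] proxim_deriv_le[OF f_mnz]])
      (use big_f in \<open>simp add: b.cfun_def\<close>)
  then show "Sm f (proxim R)"
    unfolding R_def[abs_def]
    by (intro Sm_proxim_add Sm_proxim_mult Sm_proxim_f Sm_proxim[OF s.cfun_const] Sm_proxim[OF A_small] Sm_proxim[OF B_small]
      R_parts_mero AB_mero f_mero deriv_mero)
  show "Sm f (cnt (polem R))"
  proof (rule Sm_mono)
    show "Sm f (\<lambda>r. cnt (polem A) r + cnt (polem B) r + 5 * (2 * cnt (zerom \<phi>) r + (cnt (zerom \<omega>) r + cnt (polem \<omega>) r)))"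
      by (intro Sm_add Sm_cmult Sm_cnt_zerom Sm_cnt_polem om omz \<phi>_small \<phi>_mnz A_small B_small) auto
    show "\<forall>\<^sub>F r in nevF. cnt (polem R) r
       \<le> cnt (polem A) r + cnt (polem B) r + 5 * (2 * cnt (zerom \<phi>) r + (cnt (zerom \<omega>) r + cnt (polem \<omega>) r))"
      using nevF_ge[of 1]
    proof (rule eventually_mono)
      fix r :: real assume r: "1 \<le> r"
      note pA = locfin_polem[OF AB_mero(1)] and pB = locfin_polem[OF AB_mero(2)]
        and zp = locfin_cmult[OF locfin_zerom[OF \<phi>_mnz]] and zo = locfin_zerom[OF omz] and po = locfin_polem[OF om_mero]
      note s1 = locfin_add[OF zo po]
      note s2 = locfin_add[OF zp[of 2] s1]
      note s3 = locfin_cmult[OF s2, of 5]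
      have "cnt (polem R) r \<le> cnt (\<lambda>z. polem A z + polem B z + 5 * (2 * zerom \<phi> z + (zerom \<omega> z + polem \<omega> z))) r"
        by (rule cnt_mono[OF locfin_polem[OF R_mero] locfin_add[OF locfin_add[OF pA pB] s3] polem_R r])
      then show "cnt (polem R) r
       \<le> cnt (polem A) r + cnt (polem B) r + 5 * (2 * cnt (zerom \<phi>) r + (cnt (zerom \<omega>) r + cnt (polem \<omega>) r))"
        by (simp only: cnt_add[OF locfin_add[OF pA pB] s3] cnt_add[OF pA pB] cnt_cmult cnt_add[OF zp[of 2] s1] cnt_add[OF zo po])
    qed
  qed
qed

lemma contradiction: False
proof -
  \<comment> \<open>The algebra is carried out on germs at the origin, where the functions become
    Laurent series and the constants of the derivation are exactly the complex numbers.\<close>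
  interpret derivation "fls_deriv :: complex fls \<Rightarrow> complex fls"
    by standard (simp_all add: algebra_simps)
  define x where "x = laurent_expansion f 0"
  define w where "w = laurent_expansion \<omega> 0"
  have x0: "x \<noteq> 0" unfolding x_def by (rule le_nonzero[OF f_mnz])
  have w0: "w \<noteq> 0" unfolding w_def by (rule le_nonzero[OF omz])
  have inKS: "laurent_expansion g 0 \<in> KS" if "s.cfun g" for g using that by (auto simp: KS_def)
  have A0: "laurent_expansion A 0 \<noteq> 0"
    unfolding le_A using le_nonzero[OF \<phi>_mnz, of 0] by (simp del: of_nat_Suc of_nat_mult)
  have G: "x ^ l 0 * (\<Prod>i=1..k. (fls_deriv ^^ m i) (x ^ l i)) / w = laurent_expansion G 0"
    unfolding le_G le_F fls_monomial_def x_def w_def ..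
  have const: "u \<in> KS" if "fls_deriv u = 0" for u
    using fls_deriv_zero_imp_const[OF that] KS_closed(5)[of "fls_nth u 0"] by simp
  have x: "fls_deriv x = laurent_expansion A 0 * x ^ 2 + laurent_expansion B 0 * x + laurent_expansion R 0"
    unfolding le_R x_def by simp
  have dG: "fls_deriv (laurent_expansion G 0)
      = of_nat (2 * Suc M) * laurent_expansion A 0 * x * (laurent_expansion G 0 - 1)"
  proof -
    have "of_nat (2 * Suc M) * laurent_expansion A 0 = laurent_expansion \<phi> 0"
      unfolding le_A by (simp del: of_nat_Suc of_nat_mult)
    then show ?thesis unfolding le_\<phi> x_def[symmetric] using x0 le_G1_nz[of 0] by simp
  qed
  show False
  proof (rule riccati_monomial_contradiction[of KS x "laurent_expansion A 0" "laurent_expansion B 0" "laurent_expansion R 0" w l k m])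
    show "p = 0" if "\<forall>i. Polynomial.coeff p i \<in> KS" "poly p x = 0" for p
      using f_transcendental_over_small that unfolding x_def by blast
    show "fls_deriv (x ^ l 0 * (\<Prod>i=1..k. (fls_deriv ^^ m i) (x ^ l i)) / w) =
      of_nat (2 * Suc (\<Sum>i=1..k. m i)) * laurent_expansion A 0 * x *
      (x ^ l 0 * (\<Prod>i=1..k. (fls_deriv ^^ m i) (x ^ l i)) / w - 1)"
      unfolding G M_def[symmetric] by (rule dG)
    show "(\<Sum>i=1..k. l i) = Suc (\<Sum>i=1..k. m i)" using l_eq(2) unfolding M_def .
  qed (use KS_closed const inKS[OF A_small] inKS[OF B_small] inKS[OF R_small] inKS[OF om] A0 w0 x l_eq(1) lm mpos
      in \<open>auto simp: w_def\<close>)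
qed

end

theorem theorem2p1:
  fixes k :: nat and l m :: "nat \<Rightarrow> nat"
    and f \<omega> :: "complex \<Rightarrow> complex"
  assumes "k \<ge> 1"
    and "l 0 > 0"
    and "\<forall>i\<in>{1..k}. l i \<ge> m i"
    and "(\<Sum>i=1..k. l i) > (\<Sum>i=1..k. m i)"
    and "(\<Sum>i=1..k. m i) > 0"
    and "transcendental_mero f"
    and "small_function \<omega> f"
    and "\<not> (\<forall>z. \<forall>\<^sub>F w in at z. \<omega> w = 0)"
  shows "infinite {z. isolated_zero (\<lambda>w. diff_monomial k l m f w - \<omega> w) z}"
proof
  assume fin: "finite {z. isolated_zero (\<lambda>w. diff_monomial k l m f w - \<omega> w) z}"
  interpret transc f by standard fact
  have om: "\<omega> meromorphic_on UNIV" using assms(7) by (simp add: small_function_def)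
  have omz: "mnz \<omega>"
    using mero_cases[OF om] assms(8) eventually_cosparse_imp_eventually_at[of "\<lambda>w. \<omega> w = 0" UNIV _ UNIV] by auto
  obtain E where E: "E \<in> sets lebesgue" "emeasure lebesgue E < \<infinity>"
    "\<And>c. c > 0 \<Longrightarrow> \<exists>R. \<forall>r\<ge>R. r \<notin> E \<longrightarrow> \<bar>nev_T \<omega> r\<bar> \<le> c * nev_T f r"
    using assms(7) unfolding small_function_def by blast
  have Em: "E \<in> lmeasurable" using E(1,2) by (intro fmeasurableI)
  have "Sm f (nev_T \<omega>)"
  proof (rule SmI)
    fix c :: real assume "c > 0"
    from E(3)[OF this] obtain R where "\<forall>r\<ge>R. r \<notin> E \<longrightarrow> \<bar>nev_T \<omega> r\<bar> \<le> c * nev_T f r" by blast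
    then have "\<forall>r\<ge>R. r \<notin> E \<longrightarrow> nev_T \<omega> r \<le> c * nev_T f r" by force
    then show "\<forall>\<^sub>F r in nevF. nev_T \<omega> r \<le> c * nev_T f r" unfolding eventually_nevF using Em by blast
  qed
  then have oms: "s.cfun \<omega>" using om by (simp add: s.cfun_def)
  interpret monomial_setup f k l m \<omega>
    by standard (use assms(2-5) oms omz fin in auto)
  show False by (rule contradiction)
qed

end
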